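(* The Airy$_1$ process $\mathcal{A}_1$ and the Airy$_2$ process $\mathcal{A}_2$ have versions with Hölder continuous paths with exponent $\tfrac12-\delta$ for any $\delta>0$.
   Context: The processes are indexed by $t\in\mathbb{R}$, and Hölder continuity of paths is understood locally, i.e. on every bounded interval. $\mathrm{Ai}$ denotes the Airy function. The Airy$_1$ and Airy$_2$ processes are the stationary real-valued processes defined through their finite-dimensional distributions: for $k\in\{1,2\}$, $x_1,\dots,x_n\in\mathbb{R}$ and $t_1<\dots<t_n$ in $\mathbb{R}$, $$\mathbb{P}\left(\mathcal{A}_k(t_1)\le x_1,\dots,\mathcal{A}_k(t_n)\le x_n\right)=\det(I-\mathrm{f}^{1/2}K_k^{\mathrm{ext}}\mathrm{f}^{1/2})_{L^2(\{t_1,\dots,t_n\}\times\mathbb{R})},$$ with counting measure on $\{t_1,\dots,t_n\}$ and Lebesgue measure on $\mathbb{R}$, $\mathrm{f}(t_j,x)=\mathbf{1}_{x\in(x_j,\infty)}$, and $$K_1^{\mathrm{ext}}(t,x;t',x')=-\frac{1}{\sqrt{4\pi(t'-t)}}\exp\left(-\frac{(x'-x)^2}{4(t'-t)}\right)\mathbf{1}_{t'>t}+\mathrm{Ai}(x+x'+(t'-t)^2)\exp\left((t'-t)(x+x')+\tfrac23(t'-t)^3\right),$$ $$K_2^{\mathrm{ext}}(t,x;t',x')=\begin{cases}\int_0^\infty e^{-\lambda(t-t')}\mathrm{Ai}(x+\lambda)\mathrm{Ai}(x'+\lambda)\,d\lambda,&t\ge t',\\-\int_{-\infty}^0e^{-\lambda(t-t')}\mathrm{Ai}(x+\lambda)\mathrm{Ai}(x'+\lambda)\,d\lambda,&t<t'.\end{cases}$$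 The determinants are Fredholm determinants; for $k=1$ the operator is not trace class and the determinant is understood through its Fredholm expansion series, or equivalently as the Fredholm determinant of the trace class operator obtained by conjugating with the multiplication operator by $(t_i,x)\mapsto(1+x^2)^{-2i}$. *)

theory Defs
  imports "HOL-Probability.Probability" "Jordan_Normal_Form.Determinant"
begin

text \<open>The integrand is not absolutely integrable on the half-line. The Henstock-Kurzweil integral
  over an unbounded interval is the limit of the integrals over bounded ones, hence the
  conditionally convergent integral that defines the Airy function.\<close>

definition Ai :: "real \<Rightarrow> real" where
  "Ai x = integral {0..} (\<lambda>t. cos (t ^ 3 / 3 + x * t)) / pi"

definition airy1_ext_kernel :: "real \<times> real \<Rightarrow> real \<times> real \<Rightarrow> real" where
  "airy1_ext_kernel = (\<lambda>(t, x) (t', x').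
     - (if t' > t then 1 / sqrt (4 * pi * (t' - t)) * exp (- ((x' - x)\<^sup>2 / (4 * (t' - t)))) else 0)
     + Ai (x + x' + (t' - t)\<^sup>2) * exp ((t' - t) * (x + x') + 2 / 3 * (t' - t) ^ 3))"

definition airy2_ext_kernel :: "real \<times> real \<Rightarrow> real \<times> real \<Rightarrow> real" where
  "airy2_ext_kernel = (\<lambda>(t, x) (t', x').
     if t \<ge> t'
     then (LBINT l:{0..}. exp (- (l * (t - t'))) * Ai (x + l) * Ai (x' + l))
     else - (LBINT l:{..0}. exp (- (l * (t - t'))) * Ai (x + l) * Ai (x' + l)))"

text \<open>The Fredholm determinant \<open>det (I - K)\<close> on \<open>L\<^sup>2(M)\<close> of the integral operator with kernel \<open>K\<close>,
  given by its Fredholm expansion. The term \<open>n = 0\<close> is \<open>1\<close>. The expansion does not change when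
  \<open>K\<close> is conjugated by a multiplication operator, so that for the first kernel above no
  conjugation has to be fixed.\<close>

definition fredholm_det :: "'b measure \<Rightarrow> ('b \<Rightarrow> 'b \<Rightarrow> real) \<Rightarrow> real" where
  "fredholm_det M K =
     (\<Sum>n. (-1) ^ n / fact n *
       (\<integral>z. Determinant.det (Matrix.mat n n (\<lambda>(i, j). K (z i) (z j))) \<partial>(\<Pi>\<^sub>M i\<in>{..<n}. M)))"

text \<open>A choice of times \<open>t\<^sub>1 < \<dots> < t\<^sub>n\<close> is given by the finite set \<open>T\<close> of the times, and the levels
  \<open>x\<^sub>1, \<dots>, x\<^sub>n\<close> by a function on \<open>T\<close>, the level at time \<open>t\<close> being \<open>x t\<close>.\<close>

definition level_indicator :: "(real \<Rightarrow> real) \<Rightarrow> real \<times> real \<Rightarrow> real" where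
  "level_indicator x = (\<lambda>(t, u). indicator {x t<..} u)"

definition has_determinantal_fdd ::
  "(real \<times> real \<Rightarrow> real \<times> real \<Rightarrow> real) \<Rightarrow> 'a measure \<Rightarrow> (real \<Rightarrow> 'a \<Rightarrow> real) \<Rightarrow> bool" where
  "has_determinantal_fdd K M A \<longleftrightarrow>
     (\<forall>T x. finite T \<and> T \<noteq> {} \<longrightarrow>
        \<P>(\<omega> in M. \<forall>t\<in>T. A t \<omega> \<le> x t) =
        fredholm_det (count_space T \<Otimes>\<^sub>M lborel)
          (\<lambda>z z'. sqrt (level_indicator x z) * K z z' * sqrt (level_indicator x z')))"

definition real_process :: "'a measure \<Rightarrow> (real \<Rightarrow> 'a \<Rightarrow> real) \<Rightarrow> bool" where
  "real_process M A \<longleftrightarrow> prob_space M \<and> (\<forall>t. A t \<in> borel_measurable M)"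

definition airy1_process :: "'a measure \<Rightarrow> (real \<Rightarrow> 'a \<Rightarrow> real) \<Rightarrow> bool" where
  "airy1_process M A \<longleftrightarrow> real_process M A \<and> has_determinantal_fdd airy1_ext_kernel M A"

definition airy2_process :: "'a measure \<Rightarrow> (real \<Rightarrow> 'a \<Rightarrow> real) \<Rightarrow> bool" where
  "airy2_process M A \<longleftrightarrow> real_process M A \<and> has_determinantal_fdd airy2_ext_kernel M A"

definition is_version :: "'a measure \<Rightarrow> (real \<Rightarrow> 'a \<Rightarrow> real) \<Rightarrow> (real \<Rightarrow> 'a \<Rightarrow> real) \<Rightarrow> bool" where
  "is_version M A B \<longleftrightarrow> real_process M B \<and> (\<forall>t. AE \<omega> in M. B t \<omega> = A t \<omega>)"

definition locally_Hoelder :: "real \<Rightarrow> (real \<Rightarrow> real) \<Rightarrow> bool" where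
  "locally_Hoelder \<gamma> f \<longleftrightarrow>
     (\<forall>a b. \<exists>C. \<forall>s\<in>{a..b}. \<forall>t\<in>{a..b}. \<bar>f t - f s\<bar> \<le> C * \<bar>t - s\<bar> powr \<gamma>)"

end

theory Submission
  imports Defs "HOL-Complex_Analysis.Cauchy_Integral_Theorem" "HOL-Real_Asymp.Real_Asymp"
begin

text \<open>
Both processes are treated through one estimate on their laws at two times. Let \<open>h\<close> be the distance of the
times \<open>s\<close> and \<open>t\<close>. On the two lines over \<open>s\<close> and \<open>t\<close>, the extended kernel is \<open>R - N\<close>, where \<open>R\<close> is smooth and
decays, and where \<open>N\<close> lives in the block from \<open>s\<close> to \<open>t\<close> and is there the heat kernel \<open>p\<close> of time \<open>h\<close>, for
Airy\<open>\<^sub>2\<close> tilted by exponentials of the positions. The heat flow moves the smooth part from \<open>s\<close> to \<open>t\<close>: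
\<open>\<integral> R z (s, w) * p w v dw = R z (t, v)\<close>. Since \<open>N\<close> squares to zero, one has formally
\<open>det (I - R + N) = det ((I - R + N) (I - N)) = det (I - R + R N)\<close>. With levels \<open>x\<close> at \<open>s\<close> and \<open>y\<close> at \<open>t\<close>, the
product \<open>R N\<close> integrates over \<open>w > x\<close>, so that by the flow property the columns of \<open>R - R N\<close> at time \<open>t\<close> are the
integrals of \<open>R z (s, w) * p w v\<close> over \<open>w \<le> x\<close>. If \<open>v > y > x\<close>, then \<open>p\<close> has to bridge the gap between \<open>x\<close> and
\<open>v\<close>, and these columns carry a factor \<open>exp (- (v - x)\<^sup>2 / (8 h))\<close>. Without them the determinant is the probability
of \<open>A s \<le> x\<close>. Hence the probability of \<open>A s \<le> x \<and> y < A t\<close> is the difference of two determinants that differ in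
tiny columns only. The lemmas \<open>fredholm_det_nilpotent\<close>, \<open>fredholm_det_crossing_reduction\<close> and
\<open>crossing_probability_bound\<close> make this rigorous on the level of the Fredholm series, and \<open>airy1_crossings\<close> and
\<open>airy2_crossings\<close> conclude that the probability is at most
\<open>C * exp (C * L\<^sup>2) * exp (- (y - x)\<^sup>2 / (16 h))\<close> for all \<open>- L \<le> x < y\<close>, where \<open>L \<ge> 1\<close>.

Such a bound follows from the kernels alone. A moment criterion for continuity would also need the tails of the
one-point laws. Instead, the passage to paths works on the event that the path starts in
\<open>[- L, L]\<close> and has small increments along the dyadic points of a cell as long as it stays in \<open>[- 2 L, 2 L]\<close>, the
increments of level \<open>n\<close> being compared with \<open>\<kappa> * L * 2 powr (- \<gamma> * n)\<close>. On this event all increments add up to at most \<open>L\<close>,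
so the path never leaves \<open>[- 2 L, 2 L]\<close>, and it is Hoelder continuous with exponent \<open>\<gamma>\<close> on the dyadic points
(\<open>dyadic_cell_increments\<close>). An increment exceeds its threshold with probability at most
\<open>exp (C * L\<^sup>2 - c * L\<^sup>2 * 2 powr ((1 - 2 * \<gamma>) * n))\<close> up to factors growing geometrically in \<open>n\<close>. For \<open>\<gamma> < 1 / 2\<close> the second
term wins from a level on that does not depend on \<open>L\<close>. So the cells can be fixed before \<open>L\<close> tends to infinity, and
in the limit the event has probability one, because a single random variable lies in \<open>[- L, L]\<close> with probability tending to one. The version is
the limit of the values at the dyadic points to the left (\<open>dyadic_extension\<close>, \<open>Hoelder_version\<close>).

The argument needs the growth \<open>exp (C * L\<^sup>2)\<close> and no worse, and this dictates how the determinants are estimated. For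
Airy\<open>\<^sub>1\<close>, the bound of Hadamard by the entries gives \<open>exp (24 m\<^sup>2)\<close> with a mass \<open>m\<close> of order \<open>L\<close>, provided that
\<open>Ai\<close> is bounded on the negative axis (\<open>Ai_bound\<close>). For Airy\<open>\<^sub>2\<close>, the mass is of order \<open>L\<^sup>2\<close>, but the entries are
inner products, and the bound for Gram determinants (\<open>gram_det_bound\<close>) gives \<open>exp (2 m)\<close>.
\<close>

section \<open>Bounds of Hadamard for determinants\<close>

abbreviation matrix_det :: "nat \<Rightarrow> (nat \<Rightarrow> nat \<Rightarrow> real) \<Rightarrow> real" where
  "matrix_det n f \<equiv> Determinant.det (Matrix.mat n n (\<lambda>(i, j). f i j))"

definition square_integrable :: "'b measure \<Rightarrow> ('b \<Rightarrow> real) \<Rightarrow> bool" where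
  "square_integrable M f \<longleftrightarrow> f \<in> borel_measurable M \<and> integrable M (\<lambda>x. (f x)\<^sup>2)"

text \<open>Functions that agree almost everywhere are not identified, so this is only semi-definite.\<close>

definition l2_inner :: "'b measure \<Rightarrow> ('b \<Rightarrow> real) \<Rightarrow> ('b \<Rightarrow> real) \<Rightarrow> real" where
  "l2_inner M f g = (\<integral>x. f x * g x \<partial>M)"

lemma l2_inner_commute: "l2_inner M f g = l2_inner M g f"
  by (simp add: l2_inner_def mult.commute)

lemma l2_inner_self_nonneg: "l2_inner M f f \<ge> 0"
  unfolding l2_inner_def by (rule Bochner_Integration.integral_nonneg) simp

lemma square_integrable_mult:
  assumes "square_integrable M f" "square_integrable M g"
  shows "integrable M (\<lambda>x. f x * g x)"
proof (rule Bochner_Integration.integrable_bound)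
  show "integrable M (\<lambda>x. (f x)\<^sup>2 + (g x)\<^sup>2)" using assms by (simp add: square_integrable_def)
  show "(\<lambda>x. f x * g x) \<in> borel_measurable M" using assms by (auto simp: square_integrable_def)
  show "AE x in M. norm (f x * g x) \<le> norm ((f x)\<^sup>2 + (g x)\<^sup>2)"
  proof (rule AE_I2)
    fix x
    show "norm (f x * g x) \<le> norm ((f x)\<^sup>2 + (g x)\<^sup>2)"
      using abs_ge_self[of "(f x)\<^sup>2 + (g x)\<^sup>2"] sum_squares_bound[of "\<bar>f x\<bar>" "\<bar>g x\<bar>"] mult_nonneg_nonneg[OF abs_ge_zero[of "f x"] abs_ge_zero[of "g x"]]
      unfolding real_norm_def abs_mult power2_abs by linarith
  qed
qed

lemma square_integrable_add_scaled:
  assumes "square_integrable M f" "square_integrable M g"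
  shows "square_integrable M (\<lambda>x. f x + c * g x)"
proof -
  have "(f x + c * g x)\<^sup>2 = (f x)\<^sup>2 + 2 * c * (f x * g x) + c\<^sup>2 * (g x)\<^sup>2" for x
    by (simp add: power2_eq_square algebra_simps)
  thus ?thesis using assms square_integrable_mult[OF assms] by (auto simp: square_integrable_def)
qed

lemma square_integrable_zero: "square_integrable M (\<lambda>x. 0)"
  by (simp add: square_integrable_def)

lemma square_integrable_sum:
  assumes "\<And>j. j < (n::nat) \<Longrightarrow> square_integrable M (w j)"
  shows "square_integrable M (\<lambda>x. \<Sum>j<n. c j * w j x)"
  using assms by (induction n) (auto intro: square_integrable_zero square_integrable_add_scaled)

lemma l2_inner_add_scaled:
  assumes "square_integrable M f" "square_integrable M g" "square_integrable M k"
  shows "l2_inner M (\<lambda>x. f x + c * g x) k = l2_inner M f k + c * l2_inner M g k"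
proof -
  have "(f x + c * g x) * k x = f x * k x + c * (g x * k x)" for x by (simp add: algebra_simps)
  thus ?thesis unfolding l2_inner_def
    using square_integrable_mult[OF assms(1,3)] square_integrable_mult[OF assms(2,3)] by simp
qed

lemma l2_inner_sum:
  assumes "\<And>j. j < (n::nat) \<Longrightarrow> square_integrable M (w j)" "square_integrable M k"
  shows "l2_inner M (\<lambda>x. \<Sum>j<n. c j * w j x) k = (\<Sum>j<n. c j * l2_inner M (w j) k)"
  using assms(1)
proof (induction n)
  case 0
  show ?case by (simp add: l2_inner_def)
next
  case (Suc n)
  show ?case using l2_inner_add_scaled[OF square_integrable_sum[of n M w c] Suc.prems[of n] assms(2), of "c n"] Suc by simp
qed

text \<open>Covers the vectors of norm zero in the Gram-Schmidt process, where the projection coefficient is the default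
value \<open>0 / 0 = 0\<close>.\<close>

lemma l2_inner_null:
  assumes "square_integrable M v" "square_integrable M w" "l2_inner M w w = 0"
  shows "l2_inner M v w = 0"
proof -
  have "AE x in M. w x * w x = 0"
    using assms square_integrable_mult[OF assms(2,2)] unfolding l2_inner_def
    by (subst (asm) integral_nonneg_eq_0_iff_AE) auto
  hence "AE x in M. v x * w x = 0" by eventually_elim simp
  thus ?thesis unfolding l2_inner_def by (rule integral_eq_zero_AE)
qed

text \<open>The residual of a projection, with the Bessel identity.\<close>

lemma l2_orthogonal_residual:
  assumes v: "square_integrable M v" and w: "\<And>j. j < n \<Longrightarrow> square_integrable M (w j)"
    and orth: "\<And>i j. i < n \<Longrightarrow> j < n \<Longrightarrow> i \<noteq> j \<Longrightarrow> l2_inner M (w i) (w j) = 0"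
  defines "c \<equiv> \<lambda>j. l2_inner M v (w j) / l2_inner M (w j) (w j)"
  defines "r \<equiv> \<lambda>x. v x - (\<Sum>j<n::nat. c j * w j x)"
  shows "square_integrable M r"
    and "\<And>i. i < n \<Longrightarrow> l2_inner M r (w i) = 0"
    and "l2_inner M v v = l2_inner M r r + (\<Sum>j<n. (l2_inner M v (w j))\<^sup>2 / l2_inner M (w j) (w j))"
proof -
  have r: "r = (\<lambda>x. v x + (- 1) * (\<Sum>j<n. c j * w j x))" by (simp add: r_def)
  show sr: "square_integrable M r" unfolding r by (intro square_integrable_add_scaled v square_integrable_sum w)
  have ip: "l2_inner M r k = l2_inner M v k - (\<Sum>j<n. c j * l2_inner M (w j) k)" if "square_integrable M k" for k
    unfolding r by (subst l2_inner_add_scaled[OF v square_integrable_sum[OF w] that]) (simp_all add: l2_inner_sum[OF w that])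
  have cw: "c i * l2_inner M (w i) (w i) = l2_inner M v (w i)" if "i < n" for i
    using l2_inner_null[OF v w[OF that]] by (simp add: c_def)
  show 0: "l2_inner M r (w i) = 0" if "i < n" for i
  proof -
    have "(\<Sum>j<n. c j * l2_inner M (w j) (w i)) = (\<Sum>j<n. if j = i then c i * l2_inner M (w i) (w i) else 0)"
      by (intro sum.cong) (auto simp: orth that)
    thus ?thesis using ip[OF w[OF that]] cw[OF that] that by simp
  qed
  have "l2_inner M r r = l2_inner M v r - (\<Sum>j<n. c j * l2_inner M (w j) r)" by (rule ip[OF sr])
  also have "(\<Sum>j<n. c j * l2_inner M (w j) r) = 0"
    by (intro sum.neutral) (simp add: l2_inner_commute[of M _ r] 0)
  also have "l2_inner M v r = l2_inner M v v - (\<Sum>j<n. c j * l2_inner M (w j) v)"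
    unfolding l2_inner_commute[of M v r] by (rule ip[OF v])
  also have "(\<Sum>j<n. c j * l2_inner M (w j) v) = (\<Sum>j<n. (l2_inner M v (w j))\<^sup>2 / l2_inner M (w j) (w j))"
    by (intro sum.cong) (auto simp: c_def l2_inner_commute[of M _ v] power2_eq_square)
  finally show "l2_inner M v v = l2_inner M r r + (\<Sum>j<n. (l2_inner M v (w j))\<^sup>2 / l2_inner M (w j) (w j))" by simp
qed

text \<open>The outcome of the Gram-Schmidt process without normalization. As the coefficients are unitriangular, passing from
\<open>v\<close> to \<open>w\<close> does not change determinants.\<close>

definition l2_orthogonalization :: "'b measure \<Rightarrow> nat \<Rightarrow> (nat \<Rightarrow> 'b \<Rightarrow> real) \<Rightarrow> (nat \<Rightarrow> 'b \<Rightarrow> real) \<Rightarrow> (nat \<Rightarrow> nat \<Rightarrow> real) \<Rightarrow> bool" where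
  "l2_orthogonalization M n v w c \<longleftrightarrow>
     (\<forall>i<n. square_integrable M (w i)) \<and> (\<forall>i<n. \<forall>x. v i x = w i x + (\<Sum>j<i. c i j * w j x)) \<and>
     (\<forall>i<n. \<forall>j<n. i \<noteq> j \<longrightarrow> l2_inner M (w i) (w j) = 0) \<and>
     (\<forall>i<n. l2_inner M (w i) (w i) \<le> l2_inner M (v i) (v i))"

lemma l2_orthogonalizationD:
  assumes "l2_orthogonalization M n v w c"
  shows "i < n \<Longrightarrow> square_integrable M (w i)"
    and "i < n \<Longrightarrow> v i x = w i x + (\<Sum>j<i. c i j * w j x)"
    and "i < n \<Longrightarrow> j < n \<Longrightarrow> i \<noteq> j \<Longrightarrow> l2_inner M (w i) (w j) = 0"
    and "i < n \<Longrightarrow> l2_inner M (w i) (w i) \<le> l2_inner M (v i) (v i)"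
  using assms unfolding l2_orthogonalization_def by simp_all

lemma l2_gram_schmidt:
  fixes v :: "nat \<Rightarrow> 'b \<Rightarrow> real"
  assumes "\<And>i. i < n \<Longrightarrow> square_integrable M (v i)"
  shows "\<exists>w c. l2_orthogonalization M n v w c"
  using assms
proof (induction n)
  case 0
  show ?case by (simp add: l2_orthogonalization_def)
next
  case (Suc n)
  have "\<And>i. i < n \<Longrightarrow> square_integrable M (v i)" using Suc.prems by simp
  hence "\<exists>w c. l2_orthogonalization M n v w c"
    by (rule Suc.IH)
  then obtain w c where ih: "l2_orthogonalization M n v w c" by blast
  note w = l2_orthogonalizationD(1)[OF ih] and eq = l2_orthogonalizationD(2)[OF ih]
    and orth = l2_orthogonalizationD(3)[OF ih] and le = l2_orthogonalizationD(4)[OF ih]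
  define d where "d = (\<lambda>j. l2_inner M (v n) (w j) / l2_inner M (w j) (w j))"
  define r where "r = (\<lambda>x. v n x - (\<Sum>j<n. d j * w j x))"
  have v: "square_integrable M (v n)" using Suc.prems by simp
  have res: "square_integrable M r" "\<And>i. i < n \<Longrightarrow> l2_inner M r (w i) = 0"
    "l2_inner M (v n) (v n) = l2_inner M r r + (\<Sum>j<n. (l2_inner M (v n) (w j))\<^sup>2 / l2_inner M (w j) (w j))"
    unfolding r_def d_def using l2_orthogonal_residual[where w = w and n = n and v = "v n" and M = M, OF v w orth] by simp_all
  have "(\<Sum>j<n. (l2_inner M (v n) (w j))\<^sup>2 / l2_inner M (w j) (w j)) \<ge> 0"
    by (intro sum_nonneg) (simp add: l2_inner_self_nonneg)
  hence "l2_inner M r r \<le> l2_inner M (v n) (v n)" using res(3) by simp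
  have s: "(\<Sum>j<i. (c(n := d)) i j * (w(n := r)) j x) = (\<Sum>j<i. (if i = n then d j else c i j) * w j x)" if "i \<le> n" for i x
    using that by (intro sum.cong) auto
  have "l2_orthogonalization M (Suc n) v (w(n := r)) (c(n := d))"
    unfolding l2_orthogonalization_def
  proof (intro conjI allI impI)
    fix i x assume "i < Suc n"
    hence "i \<le> n" by simp
    show "v i x = (w(n := r)) i x + (\<Sum>j<i. (c(n := d)) i j * (w(n := r)) j x)"
      unfolding s[OF \<open>i \<le> n\<close>] using eq[of i x] \<open>i \<le> n\<close> by (cases "i = n") (auto simp: r_def)
  next
    fix i assume "i < Suc n"
    show "square_integrable M ((w(n := r)) i)"
        using w[of i] res(1) \<open>i < Suc n\<close> by (cases "i = n") simp_all
      show "l2_inner M ((w(n := r)) i) ((w(n := r)) i) \<le> l2_inner M (v i) (v i)"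
        using le[of i] \<open>l2_inner M r r \<le> l2_inner M (v n) (v n)\<close> \<open>i < Suc n\<close> by (cases "i = n") simp_all
      fix j assume "j < Suc n" "i \<noteq> j"
      show "l2_inner M ((w(n := r)) i) ((w(n := r)) j) = 0"
        using orth[of i j] res(2)[of i] res(2)[of j] \<open>i < Suc n\<close> \<open>j < Suc n\<close> \<open>i \<noteq> j\<close> l2_inner_commute[of M "w i" r]
        by (cases "i = n"; cases "j = n") simp_all
  qed
  thus ?case by blast
qed

text \<open>Orthogonalizing the rows writes the matrix as a unitriangular matrix times one with orthogonal rows, whose Gram matrix is
diagonal; the norms of the rows can only have decreased.\<close>

lemma hadamard_det_bound:
  fixes A :: "real mat"
  assumes A: "A \<in> carrier_mat n n"
  shows "\<bar>Determinant.det A\<bar> \<le> (\<Prod>i<n. sqrt (\<Sum>j<n. (A $$ (i, j))\<^sup>2))"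
proof -
  define M where "M = count_space {..<n}"
  have sq: "square_integrable M f" for f unfolding M_def square_integrable_def
    by (simp add: integrable_count_space)
  have ip: "l2_inner M f g = (\<Sum>k<n. f k * g k)" for f g
    unfolding M_def l2_inner_def by (simp add: lebesgue_integral_count_space_finite)
  have "\<exists>w c. l2_orthogonalization M n (\<lambda>i x. A $$ (i, x)) w c"
    by (rule l2_gram_schmidt) (rule sq)
  then obtain w c where gs: "l2_orthogonalization M n (\<lambda>i x. A $$ (i, x)) w c" by blast
  note eq = l2_orthogonalizationD(2)[OF gs] and orth = l2_orthogonalizationD(3)[OF gs] and le = l2_orthogonalizationD(4)[OF gs]
  define W where "W = Matrix.mat n n (\<lambda>(i, k). w i k)"
  define L where "L = Matrix.mat n n (\<lambda>(i, j). if j < i then c i j else if j = i then 1 else 0)"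
  have car: "W \<in> carrier_mat n n" "L \<in> carrier_mat n n" by (auto simp: W_def L_def)
  have "A = L * W"
  proof (rule eq_matI)
    fix i k assume "i < dim_row (L * W)" "k < dim_col (L * W)"
    hence ik: "i < n" "k < n" by (auto simp: W_def L_def)
    have "(L * W) $$ (i, k) = (\<Sum>j<n. (if j < i then c i j else if j = i then 1 else 0) * w j k)"
      using ik by (simp add: W_def L_def scalar_prod_def atLeast0LessThan)
    also have "\<dots> = (\<Sum>j<n. (if j < i then c i j * w j k else 0) + (if j = i then w i k else 0))"
      by (intro sum.cong) auto
    also have "\<dots> = (\<Sum>j<n. if j < i then c i j * w j k else 0) + w i k"
      using ik by (simp add: sum.distrib)
    also have "(\<Sum>j<n. if j < i then c i j * w j k else 0) = (\<Sum>j<i. c i j * w j k)"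
      using ik by (intro sum.mono_neutral_cong_right) auto
    finally show "A $$ (i, k) = (L * W) $$ (i, k)" using eq[OF ik(1), of k] by simp
  qed (use A in \<open>auto simp: W_def L_def\<close>)
  moreover have "Determinant.det L = 1"
  proof -
    have "Determinant.det L = (\<Prod>i<n. L $$ (i, i))"
      by (subst det_lower_triangular[OF _ car(2)])
        (auto simp: L_def diag_mat_def prod.distinct_set_conv_list[symmetric] atLeast0LessThan)
    also have "\<dots> = 1" by (intro prod.neutral) (auto simp: L_def)
    finally show ?thesis .
  qed
  ultimately have "Determinant.det A = Determinant.det W" using det_mult[OF car(2,1)] by simp
  have diag: "W * transpose_mat W = Matrix.mat n n (\<lambda>(i, j). if i = j then l2_inner M (w i) (w i) else 0)"
  proof (rule eq_matI)
    fix i j assume "i < dim_row (Matrix.mat n n (\<lambda>(i, j). if i = j then l2_inner M (w i) (w i) else 0))"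
       "j < dim_col (Matrix.mat n n (\<lambda>(i, j). if i = j then l2_inner M (w i) (w i) else 0))"
    hence ij: "i < n" "j < n" by auto
    hence "(W * transpose_mat W) $$ (i, j) = l2_inner M (w i) (w j)"
      by (simp add: W_def scalar_prod_def ip atLeast0LessThan)
    thus "(W * transpose_mat W) $$ (i, j) = Matrix.mat n n (\<lambda>(i, j). if i = j then l2_inner M (w i) (w i) else 0) $$ (i, j)"
      using ij orth by simp
  qed (auto simp: W_def)
  have "(Determinant.det W)\<^sup>2 = Determinant.det (W * transpose_mat W)"
    using det_mult[OF car(1), of "transpose_mat W"] car(1) det_transpose[OF car(1)] by (simp add: power2_eq_square)
  also have "\<dots> = (\<Prod>i<n. l2_inner M (w i) (w i))"
    unfolding diag
    by (subst det_upper_triangular[of _ n]) (auto simp: diag_mat_def upper_triangular_def prod.distinct_set_conv_list[symmetric] atLeast0LessThan intro!: prod.cong)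
  also have "\<dots> \<le> (\<Prod>i<n. \<Sum>j<n. (A $$ (i, j))\<^sup>2)"
  proof (rule prod_mono)
    fix i assume "i \<in> {..<n}"
    hence "l2_inner M (w i) (w i) \<le> (\<Sum>j<n. A $$ (i, j) * A $$ (i, j))" using le[of i] unfolding ip[of "\<lambda>x. A $$ (i, x)"] by simp
    thus "0 \<le> l2_inner M (w i) (w i) \<and> l2_inner M (w i) (w i) \<le> (\<Sum>j<n. (A $$ (i, j))\<^sup>2)"
      using l2_inner_self_nonneg[of M "w i"] by (simp add: power2_eq_square)
  qed
  finally have "(Determinant.det A)\<^sup>2 \<le> (\<Prod>i<n. \<Sum>j<n. (A $$ (i, j))\<^sup>2)" using \<open>Determinant.det A = Determinant.det W\<close> by simp
  hence "sqrt ((Determinant.det A)\<^sup>2) \<le> sqrt (\<Prod>i<n. \<Sum>j<n. (A $$ (i, j))\<^sup>2)" by (rule real_sqrt_le_mono)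
  moreover have "sqrt (\<Prod>i<m. f i) = (\<Prod>i<m. sqrt (f i))" for m :: nat and f :: "nat \<Rightarrow> real"
    by (induction m) (simp_all add: real_sqrt_mult)
  ultimately show ?thesis by simp
qed

lemma det_scale_columns:
  fixes f :: "nat \<Rightarrow> nat \<Rightarrow> real"
  shows "matrix_det n (\<lambda>i j. f i j * d j) = matrix_det n (\<lambda>i j. f i j) * (\<Prod>j<n. d j)"
proof -
  have "p permutes {0..<n} \<Longrightarrow> (\<Prod>i = 0..<n. d (p i)) = (\<Prod>j<n. d j)" for p
    using prod.permute[of p "{0..<n}" d] by (simp add: o_def atLeast0LessThan)
  hence *: "p permutes {0..<n} \<Longrightarrow> (\<Prod>i = 0..<n. f i (p i) * d (p i)) = (\<Prod>i = 0..<n. f i (p i)) * (\<Prod>j<n. d j)" for p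
    by (simp add: prod.distrib)
  have p_lt: "p permutes {0..<n} \<Longrightarrow> i < n \<Longrightarrow> p i < n" for p i
    using permutes_in_image[of p "{0..<n}" i] by simp
  show ?thesis
    unfolding Determinant.det_def'[of _ n, OF mat_carrier] sum_distrib_right
    by (intro sum.cong refl) (simp add: * p_lt mult.assoc)
qed

text \<open>Orthogonalize the \<open>\<psi> j\<close> only and normalize them. The rows are then the coefficients of \<open>\<phi> i\<close> in an orthonormal system,
of norm at most that of \<open>\<phi> i\<close>, and the bound by the norms of the rows applies.\<close>

lemma gram_det_bound:
  fixes \<phi> \<psi> :: "nat \<Rightarrow> 'b \<Rightarrow> real"
  assumes \<phi>: "\<And>i. i < n \<Longrightarrow> square_integrable M (\<phi> i)" and \<psi>: "\<And>i. i < n \<Longrightarrow> square_integrable M (\<psi> i)"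
  shows "\<bar>matrix_det n (\<lambda>i j. l2_inner M (\<phi> i) (\<psi> j))\<bar>
    \<le> (\<Prod>i<n. sqrt (l2_inner M (\<phi> i) (\<phi> i)) * sqrt (l2_inner M (\<psi> i) (\<psi> i)))"
proof -
  have "\<exists>w c. l2_orthogonalization M n \<psi> w c"
    by (rule l2_gram_schmidt) (rule \<psi>)
  then obtain w c where gs: "l2_orthogonalization M n \<psi> w c" by blast
  note w = l2_orthogonalizationD(1)[OF gs] and eq = l2_orthogonalizationD(2)[OF gs]
    and orth = l2_orthogonalizationD(3)[OF gs] and le = l2_orthogonalizationD(4)[OF gs]
  define C where "C = Matrix.mat n n (\<lambda>(i, j). l2_inner M (\<phi> i) (\<psi> j))"
  define W where "W = Matrix.mat n n (\<lambda>(i, k). l2_inner M (\<phi> i) (w k))"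
  define U where "U = Matrix.mat n n (\<lambda>(k, j). if k < j then c j k else if k = j then 1 else 0)"
  define d where "d = (\<lambda>j. sqrt (l2_inner M (w j) (w j)))"
  define H where "H = Matrix.mat n n (\<lambda>(i, j). l2_inner M (\<phi> i) (w j) / d j)"
  have car: "W \<in> carrier_mat n n" "U \<in> carrier_mat n n" "H \<in> carrier_mat n n" by (auto simp: W_def U_def H_def)
  have "C = W * U"
  proof (rule eq_matI)
    fix i j assume "i < dim_row (W * U)" "j < dim_col (W * U)"
    hence ij: "i < n" "j < n" by (auto simp: W_def U_def)
    have "(W * U) $$ (i, j) = (\<Sum>k<n. l2_inner M (\<phi> i) (w k) * (if k < j then c j k else if k = j then 1 else 0))"
      using ij by (simp add: W_def U_def scalar_prod_def atLeast0LessThan)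
    also have "\<dots> = (\<Sum>k<n. (if k < j then c j k * l2_inner M (w k) (\<phi> i) else 0) + (if k = j then l2_inner M (w j) (\<phi> i) else 0))"
      by (intro sum.cong) (auto simp: l2_inner_commute)
    also have "\<dots> = (\<Sum>k<n. if k < j then c j k * l2_inner M (w k) (\<phi> i) else 0) + l2_inner M (w j) (\<phi> i)"
      using ij by (simp add: sum.distrib)
    also have "(\<Sum>k<n. if k < j then c j k * l2_inner M (w k) (\<phi> i) else 0) = (\<Sum>k<j. c j k * l2_inner M (w k) (\<phi> i))"
      using ij by (intro sum.mono_neutral_cong_right) auto
    also have "\<dots> + l2_inner M (w j) (\<phi> i) = l2_inner M (\<phi> i) (\<psi> j)"
    proof -
      have sw: "square_integrable M (w k)" if "k < j" for k using w that ij by simp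
      have "l2_inner M (\<lambda>x. w j x + 1 * (\<Sum>k<j. c j k * w k x)) (\<phi> i) = l2_inner M (w j) (\<phi> i) + 1 * l2_inner M (\<lambda>x. \<Sum>k<j. c j k * w k x) (\<phi> i)"
        by (rule l2_inner_add_scaled[OF w[OF ij(2)] square_integrable_sum \<phi>[OF ij(1)]]) (rule sw)
      moreover have "\<psi> j = (\<lambda>x. w j x + 1 * (\<Sum>k<j. c j k * w k x))" using eq[OF ij(2)] by auto
      ultimately show ?thesis using l2_inner_sum[of j M w "\<phi> i" "c j", OF sw \<phi>[OF ij(1)]] l2_inner_commute[of M "\<phi> i" "\<psi> j"] by simp
    qed
    finally show "C $$ (i, j) = (W * U) $$ (i, j)" using ij by (simp add: C_def)
  qed (auto simp: C_def W_def U_def)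
  moreover have "Determinant.det U = 1"
  proof -
    have "Determinant.det U = (\<Prod>i<n. U $$ (i, i))"
      by (subst det_upper_triangular[OF _ car(2)])
        (auto simp: U_def diag_mat_def upper_triangular_def prod.distinct_set_conv_list[symmetric] atLeast0LessThan)
    also have "\<dots> = 1" by (intro prod.neutral) (auto simp: U_def)
    finally show ?thesis .
  qed
  ultimately have "Determinant.det C = Determinant.det W" using det_mult[OF car(1,2)] by simp
  also have "W = Matrix.mat n n (\<lambda>(i, j). (l2_inner M (\<phi> i) (w j) / d j) * d j)"
    unfolding W_def by (intro cong_mat refl) (auto simp: d_def l2_inner_null[OF \<phi> w])
  also have "Determinant.det \<dots> = Determinant.det H * (\<Prod>j<n. d j)"
    unfolding H_def by (rule det_scale_columns)
  finally have "\<bar>Determinant.det C\<bar> = \<bar>Determinant.det H\<bar> * (\<Prod>j<n. d j)"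
    by (simp add: abs_mult abs_prod d_def l2_inner_self_nonneg)
  also have "\<dots> \<le> (\<Prod>i<n. sqrt (l2_inner M (\<phi> i) (\<phi> i))) * (\<Prod>j<n. sqrt (l2_inner M (\<psi> j) (\<psi> j)))"
  proof (rule mult_mono)
    have "\<bar>Determinant.det H\<bar> \<le> (\<Prod>i<n. sqrt (\<Sum>j<n. (H $$ (i, j))\<^sup>2))" by (rule hadamard_det_bound[OF car(3)])
    also have "\<dots> \<le> (\<Prod>i<n. sqrt (l2_inner M (\<phi> i) (\<phi> i)))"
    proof (rule prod_mono)
      fix i assume "i \<in> {..<n}"
      hence i: "i < n" by simp
      have "(\<Sum>j<n. (H $$ (i, j))\<^sup>2) = (\<Sum>j<n. (l2_inner M (\<phi> i) (w j))\<^sup>2 / l2_inner M (w j) (w j))"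
        using i by (intro sum.cong) (auto simp: H_def d_def power_divide l2_inner_self_nonneg)
      also have "\<dots> \<le> l2_inner M (\<phi> i) (\<phi> i)"
        using l2_orthogonal_residual(3)[OF \<phi>[OF i] w orth] l2_inner_self_nonneg by simp
      finally show "0 \<le> sqrt (\<Sum>j<n. (H $$ (i, j))\<^sup>2) \<and> sqrt (\<Sum>j<n. (H $$ (i, j))\<^sup>2) \<le> sqrt (l2_inner M (\<phi> i) (\<phi> i))"
        by (simp add: sum_nonneg)
    qed
    finally show "\<bar>Determinant.det H\<bar> \<le> (\<Prod>i<n. sqrt (l2_inner M (\<phi> i) (\<phi> i)))" .
    show "(\<Prod>j<n. d j) \<le> (\<Prod>j<n. sqrt (l2_inner M (\<psi> j) (\<psi> j)))"
      unfolding d_def by (intro prod_mono) (auto simp: le l2_inner_self_nonneg)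
  qed (auto intro!: prod_nonneg simp: d_def l2_inner_self_nonneg)
  finally show ?thesis unfolding C_def prod.distrib .
qed

text \<open>The factors \<open>\<rho> i\<close> and \<open>\<kappa> j\<close> are taken out of the rows and columns, which leaves a matrix with entries in \<open>[- 1, 1]\<close>.\<close>

lemma det_bound_of_entries:
  fixes K :: "nat \<Rightarrow> nat \<Rightarrow> real"
  assumes le: "\<And>i j. i < n \<Longrightarrow> j < n \<Longrightarrow> \<bar>K i j\<bar> \<le> \<rho> i * \<kappa> j" and pos: "\<And>i. i < n \<Longrightarrow> 0 \<le> \<rho> i" "\<And>j. j < n \<Longrightarrow> 0 < \<kappa> j"
  shows "\<bar>matrix_det n (\<lambda>i j. K i j)\<bar> \<le> sqrt (real n ^ n) * (\<Prod>i<n. \<rho> i * \<kappa> i)"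
proof -
  define A where "A = Matrix.mat n n (\<lambda>(i, j). K i j / \<kappa> j)"
  have "Matrix.mat n n (\<lambda>(i, j). K i j) = Matrix.mat n n (\<lambda>(i, j). (K i j / \<kappa> j) * \<kappa> j)"
    by (intro cong_mat refl) (auto dest!: pos(2))
  hence det_eq: "matrix_det n (\<lambda>i j. K i j) = Determinant.det A * (\<Prod>j<n. \<kappa> j)"
    unfolding A_def det_scale_columns[symmetric] by (rule arg_cong)
  have \<kappa>_nonneg: "0 \<le> (\<Prod>j<n. \<kappa> j)" using pos(2) by (intro prod_nonneg) (simp add: less_imp_le)
  with det_eq have abs_eq: "\<bar>matrix_det n (\<lambda>i j. K i j)\<bar> = \<bar>Determinant.det A\<bar> * (\<Prod>j<n. \<kappa> j)"
    by (simp add: abs_mult)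
  have "\<bar>Determinant.det A\<bar> \<le> (\<Prod>i<n. sqrt (\<Sum>j<n. (A $$ (i, j))\<^sup>2))"
    by (rule hadamard_det_bound) (simp add: A_def)
  also have "\<dots> \<le> (\<Prod>i<n. sqrt (real n) * \<rho> i)"
  proof (rule prod_mono)
    fix i assume "i \<in> {..<n}"
    hence i: "i < n" by simp
    have "(\<Sum>j<n. (A $$ (i, j))\<^sup>2) \<le> (\<Sum>j<n. (\<rho> i)\<^sup>2)"
    proof (rule sum_mono)
      fix j assume "j \<in> {..<n}"
      hence j: "j < n" by simp
      have "\<bar>A $$ (i, j)\<bar> \<le> \<rho> i" using le[OF i j] pos(2)[OF j] i j by (simp add: A_def abs_divide divide_le_eq)
      thus "(A $$ (i, j))\<^sup>2 \<le> (\<rho> i)\<^sup>2" using power_mono[of "\<bar>A $$ (i, j)\<bar>" "\<rho> i" 2] by simp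
    qed
    also have "\<dots> = real n * (\<rho> i)\<^sup>2" by simp
    finally have "sqrt (\<Sum>j<n. (A $$ (i, j))\<^sup>2) \<le> sqrt (real n * (\<rho> i)\<^sup>2)" by (rule real_sqrt_le_mono)
    thus "0 \<le> sqrt (\<Sum>j<n. (A $$ (i, j))\<^sup>2) \<and> sqrt (\<Sum>j<n. (A $$ (i, j))\<^sup>2) \<le> sqrt (real n) * \<rho> i"
      using pos(1)[OF i] by (simp add: sum_nonneg real_sqrt_mult)
  qed
  also have "(\<Prod>i<n. sqrt (real n) * \<rho> i) = sqrt (real n ^ n) * (\<Prod>i<n. \<rho> i)"
    by (simp add: prod.distrib real_sqrt_power)
  finally have "\<bar>Determinant.det A\<bar> \<le> sqrt (real n ^ n) * (\<Prod>i<n. \<rho> i)" .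
  from mult_right_mono[OF this \<kappa>_nonneg] show ?thesis
    unfolding abs_eq by (simp add: prod.distrib mult.assoc)
qed

section \<open>Determinants as functions of their columns\<close>

lemma det_mat_transpose:
  "matrix_det n (\<lambda>i j. f i j) = matrix_det n (\<lambda>i j. f j i :: real)"
proof -
  have "Matrix.mat n n (\<lambda>(i, j). f i j) = transpose_mat (Matrix.mat n n (\<lambda>(i, j). f j i))"
    by (intro eq_matI) auto
  thus ?thesis using det_transpose[of "Matrix.mat n n (\<lambda>(i, j). f j i)" n] by simp
qed

lemma det_permute_simultaneous:
  fixes f :: "nat \<Rightarrow> nat \<Rightarrow> real"
  assumes "p permutes {..<n}"
  shows "matrix_det n (\<lambda>i j. f (p i) (p j)) = matrix_det n (\<lambda>i j. f i j)"
proof -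
  have p: "p permutes {0..<n}" using assms by (simp add: atLeast0LessThan)
  have lt: "p i < n" if "i < n" for i using permutes_in_image[OF p, of i] that by simp
  have rows: "matrix_det n (\<lambda>i j. g (p i) j) = signof p * matrix_det n (\<lambda>i j. g i j)"
    for g :: "nat \<Rightarrow> nat \<Rightarrow> real"
  proof -
    have "Matrix.mat n n (\<lambda>(i, j). g (p i) j) = Matrix.mat n n (\<lambda>(i, j). Matrix.mat n n (\<lambda>(i, j). g i j) $$ (p i, j))"
      by (intro eq_matI) (auto simp: lt)
    thus ?thesis using det_permute_rows[OF _ p, of "Matrix.mat n n (\<lambda>(i, j). g i j)"] by simp
  qed
  have "matrix_det n (\<lambda>i j. f (p i) (p j)) = signof p * matrix_det n (\<lambda>i j. f i (p j))"
    by (rule rows)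
  also have "matrix_det n (\<lambda>i j. f i (p j)) = matrix_det n (\<lambda>i j. f j (p i))"
    by (rule det_mat_transpose)
  also have "\<dots> = signof p * matrix_det n (\<lambda>i j. f j i)"
    by (rule rows)
  also have "matrix_det n (\<lambda>i j. f j i) = matrix_det n (\<lambda>i j. f i j)"
    by (rule det_mat_transpose)
  finally show ?thesis by (simp add: sign_def)
qed

text \<open>Multilinearity in the columns, where \<open>S\<close> collects the columns from which \<open>g\<close> is taken.\<close>

lemma det_diff_columns_expand:
  fixes f g :: "nat \<Rightarrow> nat \<Rightarrow> real"
  shows "matrix_det n (\<lambda>i j. f i j - g i j) =
    (\<Sum>S\<in>Pow {..<n}. (- 1) ^ card S * matrix_det n (\<lambda>i j. if j \<in> S then g i j else f i j))"
proof -
  have leib: "matrix_det n (\<lambda>i j. h i j) = (\<Sum>p\<in>{p. p permutes {..<n}}. signof p * (\<Prod>i<n. h (p i) i))"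
    for h :: "nat \<Rightarrow> nat \<Rightarrow> real"
  proof -
    have lt: "p permutes {0..<n} \<Longrightarrow> i < n \<Longrightarrow> p i < n" for p i using permutes_in_image[of p "{0..<n}" i] by simp
    show ?thesis
      by (rule trans[OF det_mat_transpose], subst Determinant.det_def'[OF mat_carrier]) (simp add: atLeast0LessThan[symmetric] lt)
  qed
  have pr: "(\<Prod>i<n. f (p i) i - g (p i) i) = (\<Sum>S\<in>Pow {..<n}. (- 1) ^ card S * (\<Prod>i<n. if i \<in> S then g (p i) i else f (p i) i))" for p
  proof -
    have "(\<Prod>i<n. f (p i) i - g (p i) i) = (\<Prod>i<n. - g (p i) i + f (p i) i)" by simp
    also have "\<dots> = (\<Sum>S\<in>Pow {..<n}. (\<Prod>i\<in>S. - g (p i) i) * (\<Prod>i\<in>{..<n} - S. f (p i) i))"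
      by (rule prod_add) simp
    also have "\<dots> = (\<Sum>S\<in>Pow {..<n}. (- 1) ^ card S * (\<Prod>i<n. if i \<in> S then g (p i) i else f (p i) i))"
    proof (rule sum.cong[OF refl])
      fix S assume "S \<in> Pow {..<n}"
      hence S: "S \<subseteq> {..<n}" by simp
      have "(\<Prod>i\<in>S. - g (p i) i) = (- 1) ^ card S * (\<Prod>i\<in>S. g (p i) i)"
        by (simp add: prod_uminus)
      moreover have "(\<Prod>i<n. if i \<in> S then g (p i) i else f (p i) i) = (\<Prod>i\<in>S. g (p i) i) * (\<Prod>i\<in>{..<n} - S. f (p i) i)"
      proof -
        have "{..<n} \<inter> {i. i \<in> S} = S" "{..<n} \<inter> - {i. i \<in> S} = {..<n} - S" using S by auto
        thus ?thesis by (simp only: prod.If_cases[OF finite_lessThan])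
      qed
      ultimately show "(\<Prod>i\<in>S. - g (p i) i) * (\<Prod>i\<in>{..<n} - S. f (p i) i) = (- 1) ^ card S * (\<Prod>i<n. if i \<in> S then g (p i) i else f (p i) i)"
        by simp
    qed
    finally show ?thesis .
  qed
  have "matrix_det n (\<lambda>i j. f i j - g i j) =
     (\<Sum>p\<in>{p. p permutes {..<n}}. \<Sum>S\<in>Pow {..<n}. (- 1) ^ card S * (signof p * (\<Prod>i<n. if i \<in> S then g (p i) i else f (p i) i)))"
    unfolding leib pr sum_distrib_left by (simp add: mult_ac)
  also have "\<dots> = (\<Sum>S\<in>Pow {..<n}. (- 1) ^ card S * (\<Sum>p\<in>{p. p permutes {..<n}}. signof p * (\<Prod>i<n. if i \<in> S then g (p i) i else f (p i) i)))"
    by (subst sum.swap) (simp add: sum_distrib_left)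
  finally show ?thesis unfolding leib .
qed

lemma det_last_column_single:
  fixes f :: "nat \<Rightarrow> nat \<Rightarrow> real"
  shows "matrix_det (Suc m) (\<lambda>i j. if j = m then (if i = m then c else 0) else f i j) =
    c * matrix_det m (\<lambda>i j. f i j)"
proof -
  let ?A = "Matrix.mat (Suc m) (Suc m) (\<lambda>(i, j). if j = m then (if i = m then c else 0) else f i j)"
  have del: "mat_delete ?A m m = Matrix.mat m m (\<lambda>(i, j). f i j)"
    by (intro eq_matI) (auto simp: mat_delete_def)
  have "Determinant.det ?A = (\<Sum>i<Suc m. ?A $$ (i, m) * cofactor ?A i m)"
    by (rule laplace_expansion_column) auto
  also have "\<dots> = c * cofactor ?A m m" by (simp add: lessThan_Suc)
  also have "cofactor ?A m m = matrix_det m (\<lambda>i j. f i j)"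
    unfolding cofactor_def del by simp
  finally show ?thesis .
qed

text \<open>Exchanging the columns \<open>q\<close> and \<open>m\<close> moves the single entry into the corner and accounts for the sign.\<close>

lemma det_single_entry_column:
  fixes f :: "nat \<Rightarrow> nat \<Rightarrow> real"
  assumes "q < m"
  shows "matrix_det (Suc m) (\<lambda>i j. if j = q then (if i = m then c else 0) else f i j) =
    - c * matrix_det m (\<lambda>i j. if j = q then f i m else f i j)"
proof -
  let ?A = "Matrix.mat (Suc m) (Suc m) (\<lambda>(i, j). if j = q then (if i = m then c else 0) else f i j)"
  have "swapcols q m ?A = Matrix.mat (Suc m) (Suc m) (\<lambda>(i, j). if j = m then (if i = m then c else 0) else (if j = q then f i m else f i j))"
    using assms by (intro eq_matI) (auto simp: mat_swapcols_def)
  moreover have "Determinant.det (swapcols q m ?A) = - Determinant.det ?A"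
    by (rule det_swapcols[of q "Suc m" m]) (use assms in auto)
  ultimately show ?thesis using det_last_column_single[of m c "\<lambda>i j. if j = q then f i m else f i j"] by simp
qed

lemma det_column_expand:
  fixes f :: "nat \<Rightarrow> nat \<Rightarrow> real"
  assumes "q < n"
  shows "matrix_det n (\<lambda>i j. if j = q then h i else f i j) =
     (\<Sum>i<n. h i * cofactor (Matrix.mat n n (\<lambda>(i, j). if j = q then 0 else f i j)) i q)"
proof -
  let ?B = "Matrix.mat n n (\<lambda>(i, j). if j = q then h i else f i j)"
  have "Determinant.det ?B = (\<Sum>i<n. ?B $$ (i, q) * cofactor ?B i q)"
    using assms by (intro laplace_expansion_column) auto
  also have "\<dots> = (\<Sum>i<n. h i * cofactor (Matrix.mat n n (\<lambda>(i, j). if j = q then 0 else f i j)) i q)"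
  proof (rule sum.cong[OF refl])
    fix i assume "i \<in> {..<n}"
    have "mat_delete ?B i q = mat_delete (Matrix.mat n n (\<lambda>(i, j). if j = q then 0 else f i j)) i q"
      by (intro eq_matI) (auto simp: mat_delete_def)
    thus "?B $$ (i, q) * cofactor ?B i q = h i * cofactor (Matrix.mat n n (\<lambda>(i, j). if j = q then 0 else f i j)) i q"
      using \<open>i \<in> {..<n}\<close> assms by (simp add: cofactor_def)
  qed
  finally show ?thesis .
qed

lemma det_column_sum:
  fixes f :: "nat \<Rightarrow> nat \<Rightarrow> real"
  assumes "q < n"
  shows "matrix_det n (\<lambda>i j. if j = q then g i else f i j) =
    (\<Sum>l<n. matrix_det n (\<lambda>i j. if j = q then (if i = l then g l else 0) else f i j))"
proof -
  define C where "C = (\<lambda>i. cofactor (Matrix.mat n n (\<lambda>(i, j). if j = q then 0 else f i j)) i q)"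
  have "(\<Sum>i<n. (if i = l then g l else 0) * C i) = g l * C l" if "l < n" for l
  proof -
    have "(\<Sum>i<n. (if i = l then g l else 0) * C i) = (\<Sum>i<n. if i = l then g l * C l else 0)"
      by (intro sum.cong) auto
    thus ?thesis using that by simp
  qed
  thus ?thesis unfolding det_column_expand[OF assms] C_def by simp
qed

text \<open>The determinant is linear in the column \<open>q\<close>.\<close>

lemma det_column_integral:
  fixes f :: "nat \<Rightarrow> nat \<Rightarrow> real" and g :: "nat \<Rightarrow> 'b \<Rightarrow> real"
  assumes "q < n" and "\<And>i. i < n \<Longrightarrow> integrable M (g i)"
  shows "matrix_det n (\<lambda>i j. if j = q then (\<integral>y. g i y \<partial>M) else f i j) =
    (\<integral>y. matrix_det n (\<lambda>i j. if j = q then g i y else f i j) \<partial>M)"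
  unfolding det_column_expand[OF assms(1)] using assms(2) by (subst Bochner_Integration.integral_sum) auto

lemma det_zero_column:
  fixes f :: "nat \<Rightarrow> nat \<Rightarrow> real"
  assumes "q < n" "\<And>i. i < n \<Longrightarrow> f i q = 0"
  shows "matrix_det n (\<lambda>i j. f i j) = 0"
proof -
  have "matrix_det n (\<lambda>i j. f i j) = (\<Sum>i<n. Matrix.mat n n (\<lambda>(i, j). f i j) $$ (i, q) * cofactor (Matrix.mat n n (\<lambda>(i, j). f i j)) i q)"
    using assms by (intro laplace_expansion_column) auto
  also have "\<dots> = 0" using assms by (intro sum.neutral) auto
  finally show ?thesis .
qed

section \<open>Integrals of determinants of dominated kernels\<close>

abbreviation tuples :: "'b measure \<Rightarrow> nat \<Rightarrow> (nat \<Rightarrow> 'b) measure" where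
  "tuples M n \<equiv> PiM {..<n} (\<lambda>_. M)"

lemma distr_PiM_permute:
  fixes n :: nat
  assumes "sigma_finite_measure M" "p permutes {..<n}"
  shows "distr (tuples M n) (tuples M n) (\<lambda>z. \<lambda>i\<in>{..<n}. z (p i)) = tuples M n"
proof -
  interpret product_sigma_finite "\<lambda>_::nat. M" using assms(1) by (simp add: product_sigma_finite_def)
  have pin: "p i < n" if "i < n" for i using permutes_in_image[OF assms(2), of i] that by simp
  have ipin: "Hilbert_Choice.inv p i < n" if "i < n" for i using permutes_in_image[OF permutes_inv[OF assms(2)], of i] that by simp
  have [measurable]: "(\<lambda>z. \<lambda>i\<in>{..<n}. z (p i)) \<in> measurable (tuples M n) (tuples M n)"
    using pin by (intro measurable_restrict measurable_component_singleton) auto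
  show ?thesis
  proof (rule product_sigma_finite.PiM_eqI)
    show "product_sigma_finite (\<lambda>_::nat. M)" by unfold_locales
    fix A assume A: "\<And>i. i \<in> {..<n} \<Longrightarrow> A i \<in> sets M"
    have "(\<lambda>z. \<lambda>i\<in>{..<n}. z (p i)) -` Pi\<^sub>E {..<n} A \<inter> space (tuples M n) = Pi\<^sub>E {..<n} (\<lambda>i. A (Hilbert_Choice.inv p i))" (is "?L = ?R")
    proof (intro equalityI subsetI)
      fix z assume z: "z \<in> ?L"
      have "z i \<in> A (Hilbert_Choice.inv p i)" if "i < n" for i
      proof -
        have "(\<lambda>i\<in>{..<n}. z (p i)) (Hilbert_Choice.inv p i) \<in> A (Hilbert_Choice.inv p i)" using z ipin[OF that] by auto
        thus ?thesis using ipin[OF that] permutes_inverses(1)[OF assms(2)] by simp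
      qed
      thus "z \<in> ?R" using z by (auto simp: space_PiM PiE_iff)
    next
      fix z assume z: "z \<in> ?R"
      have "z (p i) \<in> A i" if "i < n" for i
        using PiE_mem[OF z, of "p i"] pin[OF that] permutes_inverses(2)[OF assms(2)] by simp
      moreover have "z i \<in> space M" if "i < n" for i
        using PiE_mem[OF z, of i] A[of "Hilbert_Choice.inv p i"] ipin[OF that] that sets.sets_into_space by fastforce
      ultimately show "z \<in> ?L" using z by (auto simp: space_PiM PiE_iff)
    qed
    hence "emeasure (distr (tuples M n) (tuples M n) (\<lambda>z. \<lambda>i\<in>{..<n}. z (p i))) (Pi\<^sub>E {..<n} A)
        = emeasure (tuples M n) (Pi\<^sub>E {..<n} (\<lambda>i. A (Hilbert_Choice.inv p i)))"
      using A by (subst emeasure_distr) (auto intro!: sets_PiM_I_finite)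
    also have "\<dots> = (\<Prod>i<n. emeasure M (A (Hilbert_Choice.inv p i)))"
      using A ipin by (intro emeasure_PiM) auto
    also have "\<dots> = (\<Prod>i<n. emeasure M (A i))"
      using prod.permute[OF permutes_inv[OF assms(2)], of "\<lambda>i. emeasure M (A i)"] by (simp add: o_def)
    finally show "emeasure (distr (tuples M n) (tuples M n) (\<lambda>z. \<lambda>i\<in>{..<n}. z (p i))) (Pi\<^sub>E {..<n} A) = (\<Prod>i<n. emeasure M (A i))" .
  qed simp_all
qed

text \<open>Each column has a kernel of its own. This is what the expansion of the determinant of \<open>R - F\<close> along the columns leads to.\<close>

definition col_det :: "nat \<Rightarrow> (nat \<Rightarrow> 'b \<Rightarrow> 'b \<Rightarrow> real) \<Rightarrow> (nat \<Rightarrow> 'b) \<Rightarrow> real" where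
  "col_det n W z = matrix_det n (\<lambda>i j. W j (z i) (z j))"

lemma col_det_measurable:
  assumes "\<And>j. j < n \<Longrightarrow> case_prod (W j) \<in> borel_measurable (M \<Otimes>\<^sub>M M)"
  shows "col_det n W \<in> borel_measurable (tuples M n)"
proof -
  have lt: "p i < n" if "p permutes {0..<n}" "i < n" for p i
    using permutes_in_image[OF that(1), of i] that(2) by simp
  have "(\<lambda>z. W j (z i) (z j)) \<in> borel_measurable (tuples M n)" if "i < n" "j < n" for i j
  proof -
    have "(\<lambda>z. (z i, z j)) \<in> measurable (tuples M n) (M \<Otimes>\<^sub>M M)"
      using that by (intro measurable_Pair measurable_component_singleton) auto
    from measurable_compose[OF this assms[OF that(2)]] show ?thesis by simp
  qed
  hence "(\<lambda>z. \<Sum>p\<in>{p. p permutes {0..<n}}. signof p * (\<Prod>i = 0..<n. W (p i) (z i) (z (p i)))) \<in> borel_measurable (tuples M n)"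
    by (intro borel_measurable_sum borel_measurable_times borel_measurable_const borel_measurable_prod) (auto simp: lt)
  also have "(\<lambda>z. \<Sum>p\<in>{p. p permutes {0..<n}}. signof p * (\<Prod>i = 0..<n. W (p i) (z i) (z (p i)))) = col_det n W"
    unfolding col_det_def by (subst Determinant.det_def'[OF mat_carrier]) (auto simp: lt intro!: ext sum.cong)
  finally show ?thesis .
qed

text \<open>A kernel is controlled by a product \<open>\<rho> z * \<kappa> z'\<close>. As only \<open>\<rho> z * \<kappa> z\<close> has to be integrable, the two factors may grow
separately. This takes the place of conjugating the operator by a multiplication operator.\<close>

locale kernel_majorant = sigma_finite_measure M for M :: "'b measure" +
  fixes \<rho> \<kappa> :: "'b \<Rightarrow> real"
  assumes majorant_pos: "\<And>z. z \<in> space M \<Longrightarrow> 0 \<le> \<rho> z" "\<And>z. z \<in> space M \<Longrightarrow> 0 < \<kappa> z"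
    and majorant_integrable: "integrable M (\<lambda>z. \<rho> z * \<kappa> z)"
begin

definition dominated :: "('b \<Rightarrow> 'b \<Rightarrow> real) \<Rightarrow> bool" where
  "dominated K \<longleftrightarrow> case_prod K \<in> borel_measurable (M \<Otimes>\<^sub>M M) \<and>
     (\<forall>z\<in>space M. \<forall>z'\<in>space M. \<bar>K z z'\<bar> \<le> \<rho> z * \<kappa> z')"

definition mass :: real where "mass = (\<integral>z. \<rho> z * \<kappa> z \<partial>M)"

sublocale PM: product_sigma_finite "\<lambda>_::nat. M"
  using sigma_finite_measure_axioms by (simp add: product_sigma_finite_def)

lemma mass_nonneg: "0 \<le> mass"
  unfolding mass_def using majorant_pos by (intro Bochner_Integration.integral_nonneg) (simp add: less_imp_le)

lemma col_det_bound:
  assumes "\<And>j. j < n \<Longrightarrow> dominated (W j)" "z \<in> space (tuples M n)"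
  shows "\<bar>col_det n W z\<bar> \<le> sqrt (real n ^ n) * (\<Prod>i<n. \<rho> (z i) * \<kappa> (z i))"
proof -
  have "z i \<in> space M" if "i < n" for i using assms(2) that by (auto simp: space_PiM PiE_iff)
  thus ?thesis unfolding col_det_def using assms(1) majorant_pos
    by (intro det_bound_of_entries) (auto simp: dominated_def)
qed

lemma prod_majorant_integrable: "integrable (tuples M n) (\<lambda>z. \<Prod>i<n. \<rho> (z i) * \<kappa> (z i))"
  using majorant_integrable by (intro PM.product_integrable_prod) auto

lemma prod_majorant_integral: "(\<integral>z. (\<Prod>i<n. \<rho> (z i) * \<kappa> (z i)) \<partial>(tuples M n)) = mass ^ n"
  using majorant_integrable by (subst PM.product_integral_prod) (auto simp: mass_def)

lemma col_det_integrable: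
  assumes "\<And>j. j < n \<Longrightarrow> dominated (W j)"
  shows "integrable (tuples M n) (col_det n W)"
proof (rule Bochner_Integration.integrable_bound)
  show "integrable (tuples M n) (\<lambda>z. sqrt (real n ^ n) * (\<Prod>i<n. \<rho> (z i) * \<kappa> (z i)))"
    by (intro integrable_mult_right prod_majorant_integrable)
  show "col_det n W \<in> borel_measurable (tuples M n)"
    using assms by (intro col_det_measurable) (auto simp: dominated_def)
  show "AE z in tuples M n. norm (col_det n W z) \<le> norm (sqrt (real n ^ n) * (\<Prod>i<n. \<rho> (z i) * \<kappa> (z i)))"
    unfolding real_norm_def by (intro AE_I2 order_trans[OF col_det_bound[OF assms] abs_ge_self])
qed

lemma col_det_integral_bound:
  assumes "\<And>j. j < n \<Longrightarrow> dominated (W j)"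
  shows "\<bar>\<integral>z. col_det n W z \<partial>(tuples M n)\<bar> \<le> sqrt (real n ^ n) * mass ^ n"
proof -
  have "\<bar>\<integral>z. col_det n W z \<partial>(tuples M n)\<bar> \<le> (\<integral>z. \<bar>col_det n W z\<bar> \<partial>(tuples M n))"
    by (rule integral_abs_bound)
  also have "\<dots> \<le> (\<integral>z. sqrt (real n ^ n) * (\<Prod>i<n. \<rho> (z i) * \<kappa> (z i)) \<partial>(tuples M n))"
    using assms by (intro integral_mono integrable_mult_right prod_majorant_integrable integrable_abs col_det_integrable col_det_bound)
  also have "\<dots> = sqrt (real n ^ n) * mass ^ n"
    by (simp add: prod_majorant_integral)
  finally show ?thesis .
qed

text \<open>The variables of an \<open>n\<close>-fold integral may be renamed.\<close>

lemma integral_PiM_permute: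
  fixes f :: "(nat \<Rightarrow> 'b) \<Rightarrow> real"
  assumes f: "f \<in> borel_measurable (tuples M n)" and p: "p permutes {..<n}"
  shows "(\<integral>z. f (\<lambda>i\<in>{..<n}. z (p i)) \<partial>(tuples M n)) = (\<integral>z. f z \<partial>(tuples M n))"
proof -
  let ?P = "tuples M n"
  have pin': "p i < n" if "i < n" for i using permutes_in_image[OF p, of i] that by simp
  have m: "(\<lambda>z. \<lambda>i\<in>{..<n}. z (p i)) \<in> measurable ?P ?P"
    using pin' by (intro measurable_restrict measurable_component_singleton) auto
  have "(\<integral>z. f z \<partial>?P) = (\<integral>z. f z \<partial>(distr ?P ?P (\<lambda>z. \<lambda>i\<in>{..<n}. z (p i))))"
    unfolding distr_PiM_permute[OF sigma_finite_measure_axioms p] ..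
  also have "\<dots> = (\<integral>z. f (\<lambda>i\<in>{..<n}. z (p i)) \<partial>?P)"
    by (intro integral_distr m f)
  finally show ?thesis ..
qed

text \<open>A permutation of the variables permutes rows and columns simultaneously, so only the number of columns of each kind
matters.\<close>

lemma col_det_integral_permute:
  assumes dom: "\<And>j. j < n \<Longrightarrow> dominated (W j)" and p: "p permutes {..<n}"
  shows "(\<integral>z. col_det n (\<lambda>j. W (p j)) z \<partial>(tuples M n)) = (\<integral>z. col_det n W z \<partial>(tuples M n))"
proof -
  let ?P = "tuples M n"
  have pin': "p i < n" if "i < n" for i using permutes_in_image[OF p, of i] that by simp
  have "(\<integral>z. col_det n (\<lambda>j. W (p j)) z \<partial>?P) = (\<integral>z. col_det n (\<lambda>j. W (p j)) (\<lambda>i\<in>{..<n}. z (p i)) \<partial>?P)"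
    using dom pin' by (intro integral_PiM_permute[symmetric] col_det_measurable p) (auto simp: dominated_def)
  also have "\<dots> = (\<integral>z. col_det n W z \<partial>?P)"
  proof (rule Bochner_Integration.integral_cong[OF refl])
    fix z
    have "col_det n (\<lambda>j. W (p j)) (\<lambda>i\<in>{..<n}. z (p i)) = matrix_det n (\<lambda>i j. W (p j) (z (p i)) (z (p j)))"
      unfolding col_det_def by (intro arg_cong[where f = Determinant.det] cong_mat) auto
    also have "\<dots> = col_det n W z"
      unfolding col_det_def using det_permute_simultaneous[OF p, of "\<lambda>i j. W j (z i) (z j)"] .
    finally show "col_det n (\<lambda>j. W (p j)) (\<lambda>i\<in>{..<n}. z (p i)) = col_det n W z" .
  qed
  finally show ?thesis .
qed

end

text \<open>\<open>n\<^sup>n / n!\<close> is a term of the exponential series of \<open>n\<close>.\<close>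

lemma power_self_le_exp_fact: "real n ^ n \<le> exp 1 ^ n * fact n"
proof -
  have "real n ^ n / fact n \<le> exp (real n)"
    using sum_le_suminf[OF summable_exp_generic[of "real n"], of "{n}"] by (simp add: exp_def divide_inverse mult.commute)
  thus ?thesis by (simp add: field_simps exp_of_nat_mult[symmetric])
qed

text \<open>The square of a term is at most \<open>(e * x\<^sup>2)\<^sup>n / n!\<close>. Splitting it as \<open>(2 * e * x\<^sup>2)\<^sup>n / n!\<close> times \<open>2\<^sup>-\<^sup>n\<close>, the inequality
between the means bounds the series by an exponential and a geometric one.\<close>

lemma hadamard_series:
  fixes x :: real
  assumes "x \<ge> 0"
  shows "summable (\<lambda>n. sqrt (real n ^ n) * x ^ n / fact n)"
    and "(\<Sum>n. sqrt (real n ^ n) * x ^ n / fact n) \<le> exp (6 * x\<^sup>2) + 1"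
proof -
  define u where "u = (\<lambda>n. (2 * exp 1 * x\<^sup>2) ^ n / fact n)"
  define v where "v = (\<lambda>n. (1 / 2 :: real) ^ n)"
  have u: "u sums exp (2 * exp 1 * x\<^sup>2)"
    unfolding u_def using exp_converges[of "2 * exp 1 * x\<^sup>2"] by (simp add: divide_inverse mult.commute)
  have v: "v sums 2" unfolding v_def using geometric_sums[of "1 / 2 :: real"] by simp
  have w: "(\<lambda>n. u n / 2 + v n / 2) sums (exp (2 * exp 1 * x\<^sup>2) / 2 + 2 / 2)"
    by (intro sums_add sums_divide u v)
  have le: "sqrt (real n ^ n) * x ^ n / fact n \<le> u n / 2 + v n / 2" for n
  proof -
    have "(sqrt (real n ^ n) * x ^ n / fact n)\<^sup>2 = real n ^ n * (x\<^sup>2) ^ n / (fact n * fact n)"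
      by (simp add: power_mult_distrib power_divide power2_eq_square)
    also have "\<dots> \<le> (exp 1 ^ n * fact n) * (x\<^sup>2) ^ n / (fact n * fact n)"
      by (intro divide_right_mono mult_right_mono power_self_le_exp_fact) auto
    also have "\<dots> = u n * v n" by (simp add: u_def v_def power_mult_distrib power_divide)
    finally have "sqrt (real n ^ n) * x ^ n / fact n \<le> sqrt (u n * v n)"
      by (rule real_le_rsqrt)
    also have "\<dots> \<le> (u n + v n) / 2"
      using assms by (intro arith_geo_mean_sqrt) (auto simp: u_def v_def)
    finally show ?thesis by (simp add: add_divide_distrib)
  qed
  show sm: "summable (\<lambda>n. sqrt (real n ^ n) * x ^ n / fact n)"
    by (rule summable_comparison_test'[OF sums_summable[OF w], of 0]) (use le assms in auto)
  have "(\<Sum>n. sqrt (real n ^ n) * x ^ n / fact n) \<le> exp (2 * exp 1 * x\<^sup>2) / 2 + 2 / 2"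
    by (rule sums_le[OF le summable_sums[OF sm] w])
  also have "exp (2 * exp 1 * x\<^sup>2) \<le> exp (6 * x\<^sup>2)"
    using exp_le by (auto intro!: mult_right_mono)
  finally show "(\<Sum>n. sqrt (real n ^ n) * x ^ n / fact n) \<le> exp (6 * x\<^sup>2) + 1"
    using exp_gt_zero[of "6 * x\<^sup>2"] by linarith
qed

lemma ex_permutes_onto:
  assumes S: "S \<subseteq> {..<n::nat}"
  shows "\<exists>p. p permutes {..<n} \<and> (\<forall>j<n. p j \<in> S \<longleftrightarrow> j < card S)"
proof -
  have fin: "finite S" using S by (rule finite_subset) simp
  have cS: "card S \<le> n" using card_mono[OF _ S] by simp
  obtain f where f: "bij_betw f {..<card S} S"
    using finite_same_card_bij[of "{..<card S}" S] fin by auto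
  have "card ({..<n} - S) = n - card S" using S fin by (simp add: card_Diff_subset)
  then obtain g where g: "bij_betw g {card S..<n} ({..<n} - S)"
    using finite_same_card_bij[of "{card S..<n}" "{..<n} - S"] by auto
  define p where "p = (\<lambda>j. if j < card S then f j else if j < n then g j else j)"
  have "bij_betw p {..<card S} S" using f by (rule bij_betw_cong[THEN iffD1, rotated]) (simp add: p_def)
  moreover have "bij_betw p {card S..<n} ({..<n} - S)" using g by (rule bij_betw_cong[THEN iffD1, rotated]) (simp add: p_def)
  ultimately have "bij_betw p ({..<card S} \<union> {card S..<n}) (S \<union> ({..<n} - S))"
    by (rule bij_betw_combine) auto
  moreover have "{..<card S} \<union> {card S..<n} = {..<n}" "S \<union> ({..<n} - S) = {..<n}" using S cS by auto
  ultimately have "p permutes {..<n}" by (intro bij_imp_permutes) (auto simp: p_def)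
  moreover have "p j \<in> S \<longleftrightarrow> j < card S" if "j < n" for j
    using bij_betwE[OF f] bij_betwE[OF g] that by (auto simp: p_def)
  ultimately show ?thesis by blast
qed

lemma sum_Pow_card:
  fixes h :: "nat \<Rightarrow> real"
  shows "(\<Sum>S\<in>Pow {..<n}. h (card S)) = (\<Sum>k\<le>n. real (n choose k) * h k)"
proof -
  have "(\<Sum>S\<in>Pow {..<n}. h (card S)) = (\<Sum>k\<le>n. \<Sum>S\<in>{S \<in> Pow {..<n}. card S = k}. h (card S))"
    using card_mono[of "{..<n}"] by (subst sum.group) auto
  also have "\<dots> = (\<Sum>k\<le>n. real (n choose k) * h k)"
  proof (rule sum.cong[OF refl])
    fix k
    have "{S \<in> Pow {..<n}. card S = k} = {S. S \<subseteq> {..<n} \<and> card S = k}" by auto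
    moreover have "(\<Sum>S\<in>{S \<in> Pow {..<n}. card S = k}. h (card S)) = real (card {S \<in> Pow {..<n}. card S = k}) * h k" by simp
    ultimately show "(\<Sum>S\<in>{S \<in> Pow {..<n}. card S = k}. h (card S)) = real (n choose k) * h k"
      by (simp add: n_subsets)
  qed
  finally show ?thesis .
qed

context kernel_majorant
begin

text \<open>All subsets of columns of the same size contribute equally, so that the \<open>k\<close> columns with kernel \<open>F\<close> may be put first.\<close>

lemma integral_col_det_diff:
  assumes R: "dominated R" and F: "dominated F"
  shows "(\<integral>z. col_det n (\<lambda>_ z z'. R z z' - F z z') z \<partial>(tuples M n)) =
    (\<Sum>k\<le>n. real (n choose k) * ((- 1) ^ k * (\<integral>z. col_det n (\<lambda>j. if j < k then F else R) z \<partial>(tuples M n))))"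
proof -
  let ?P = "tuples M n"
  have exp: "col_det n (\<lambda>_ z z'. R z z' - F z z') z = (\<Sum>S\<in>Pow {..<n}. (- 1) ^ card S * col_det n (\<lambda>j. if j \<in> S then F else R) z)" for z
    unfolding col_det_def
    by (subst det_diff_columns_expand) (auto intro!: sum.cong arg_cong[where f = Determinant.det] cong_mat)
  have "(\<integral>z. col_det n (\<lambda>_ z z'. R z z' - F z z') z \<partial>?P) = (\<Sum>S\<in>Pow {..<n}. (- 1) ^ card S * (\<integral>z. col_det n (\<lambda>j. if j \<in> S then F else R) z \<partial>?P))"
    unfolding exp using R F by (subst Bochner_Integration.integral_sum) (auto intro!: integrable_mult_right col_det_integrable)
  also have "\<dots> = (\<Sum>S\<in>Pow {..<n}. (- 1) ^ card S * (\<integral>z. col_det n (\<lambda>j. if j < card S then F else R) z \<partial>?P))"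
  proof (rule sum.cong[OF refl])
    fix S assume "S \<in> Pow {..<n}"
    then obtain p where p: "p permutes {..<n}" "\<And>j. j < n \<Longrightarrow> p j \<in> S \<longleftrightarrow> j < card S"
      using ex_permutes_onto[of S n] by auto
    have "(\<integral>z. col_det n (\<lambda>j. if j \<in> S then F else R) z \<partial>?P) = (\<integral>z. col_det n (\<lambda>j. if p j \<in> S then F else R) z \<partial>?P)"
      using col_det_integral_permute[OF _ p(1), of "\<lambda>j. if j \<in> S then F else R"] R F by simp
    also have "\<dots> = (\<integral>z. col_det n (\<lambda>j. if j < card S then F else R) z \<partial>?P)"
      unfolding col_det_def using p(2)
      by (intro Bochner_Integration.integral_cong refl arg_cong[where f = Determinant.det] cong_mat) auto
    finally show "(- 1) ^ card S * (\<integral>z. col_det n (\<lambda>j. if j \<in> S then F else R) z \<partial>?P) = (- 1) ^ card S * (\<integral>z. col_det n (\<lambda>j. if j < card S then F else R) z \<partial>?P)" by simp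
  qed
  finally show ?thesis by (simp only: sum_Pow_card[of "\<lambda>k. (- 1) ^ k * (\<integral>z. col_det n (\<lambda>j. if j < k then F else R) z \<partial>?P)"])
qed

lemma det_entries_integrable:
  fixes e :: "nat \<Rightarrow> nat \<Rightarrow> (nat \<Rightarrow> 'b) \<Rightarrow> real"
  assumes meas: "\<And>i j. i < n \<Longrightarrow> j < n \<Longrightarrow> e i j \<in> borel_measurable (tuples M n)"
    and le: "\<And>i j z. i < n \<Longrightarrow> j < n \<Longrightarrow> z \<in> space (tuples M n) \<Longrightarrow> \<bar>e i j z\<bar> \<le> \<rho> (z i) * \<kappa> (z j)"
  shows "(\<lambda>z. matrix_det n (\<lambda>i j. e i j z)) \<in> borel_measurable (tuples M n)"
    and "integrable (tuples M n) (\<lambda>z. matrix_det n (\<lambda>i j. e i j z))"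
proof -
  have lt: "p i < n" if "p permutes {0..<n}" "i < n" for p i
    using permutes_in_image[OF that(1), of i] that(2) by simp
  have "(\<lambda>z. \<Sum>p\<in>{p. p permutes {0..<n}}. signof p * (\<Prod>i = 0..<n. e i (p i) z)) \<in> borel_measurable (tuples M n)"
    using meas by (intro borel_measurable_sum borel_measurable_times borel_measurable_const borel_measurable_prod) (auto simp: lt)
  also have "(\<lambda>z. \<Sum>p\<in>{p. p permutes {0..<n}}. signof p * (\<Prod>i = 0..<n. e i (p i) z)) = (\<lambda>z. matrix_det n (\<lambda>i j. e i j z))"
    by (subst Determinant.det_def'[OF mat_carrier]) (auto simp: lt intro!: ext sum.cong)
  finally show m: "(\<lambda>z. matrix_det n (\<lambda>i j. e i j z)) \<in> borel_measurable (tuples M n)" .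
  show "integrable (tuples M n) (\<lambda>z. matrix_det n (\<lambda>i j. e i j z))"
  proof (rule Bochner_Integration.integrable_bound[OF _ m])
    show "integrable (tuples M n) (\<lambda>z. sqrt (real n ^ n) * (\<Prod>i<n. \<rho> (z i) * \<kappa> (z i)))"
      by (intro integrable_mult_right prod_majorant_integrable)
    show "AE z in tuples M n. norm (matrix_det n (\<lambda>i j. e i j z)) \<le> norm (sqrt (real n ^ n) * (\<Prod>i<n. \<rho> (z i) * \<kappa> (z i)))"
      unfolding real_norm_def
    proof (intro AE_I2 order_trans[OF det_bound_of_entries abs_ge_self])
      fix z i j assume z: "z \<in> space (tuples M n)" and ij: "i < n"
      hence "z i \<in> space M" by (auto simp: space_PiM PiE_iff)
      thus "0 \<le> \<rho> (z i)" "0 < \<kappa> (z i)" by (auto intro: majorant_pos)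
      show "\<bar>e i j z\<bar> \<le> \<rho> (z i) * \<kappa> (z j)" if "j < n" using le[OF ij that z] .
    qed
  qed
qed

end

section \<open>Removal of a nilpotent block from a Fredholm determinant\<close>

context kernel_majorant
begin

lemma dominated_product_integrable:
  assumes K: "dominated K" and L: "dominated L" and z: "z \<in> space M" "z' \<in> space M"
  shows "integrable M (\<lambda>y. K z y * L y z')"
proof (rule Bochner_Integration.integrable_bound)
  have "case_prod K \<in> borel_measurable (M \<Otimes>\<^sub>M M)" "case_prod L \<in> borel_measurable (M \<Otimes>\<^sub>M M)"
    using K L by (auto simp: dominated_def)
  hence "(\<lambda>y. K z y) \<in> borel_measurable M" "(\<lambda>y. L y z') \<in> borel_measurable M"
    using measurable_Pair2[of "case_prod K" M M borel z] measurable_Pair1[of "case_prod L" M M borel z'] z by auto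
  thus "(\<lambda>y. K z y * L y z') \<in> borel_measurable M" by measurable
  show "integrable M (\<lambda>y. (\<rho> z * \<kappa> z') * (\<rho> y * \<kappa> y))"
    by (intro integrable_mult_right majorant_integrable)
  show "AE y in M. norm (K z y * L y z') \<le> norm ((\<rho> z * \<kappa> z') * (\<rho> y * \<kappa> y))"
  proof (rule AE_I2)
    fix y assume y: "y \<in> space M"
    have k: "\<bar>K z y\<bar> \<le> \<rho> z * \<kappa> y" and l: "\<bar>L y z'\<bar> \<le> \<rho> y * \<kappa> z'"
      using K L z y by (auto simp: dominated_def)
    have "\<bar>K z y\<bar> * \<bar>L y z'\<bar> \<le> (\<rho> z * \<kappa> y) * (\<rho> y * \<kappa> z')"
      using k l order_trans[OF abs_ge_zero k] by (intro mult_mono) auto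
    also have "\<dots> = (\<rho> z * \<kappa> z') * (\<rho> y * \<kappa> y)" by (simp only: mult_ac)
    also have "\<dots> \<le> norm ((\<rho> z * \<kappa> z') * (\<rho> y * \<kappa> y))" by simp
    finally show "norm (K z y * L y z') \<le> norm ((\<rho> z * \<kappa> z') * (\<rho> y * \<kappa> y))" by (simp add: abs_mult)
  qed
qed

end

text \<open>\<open>N\<close> maps the functions on the complement of \<open>X\<close> to functions on \<open>X\<close>, hence \<open>N\<^sup>2 = 0\<close>. \<open>Q\<close> is the operator product of \<open>R\<close>
and \<open>N\<close>.\<close>

locale nilpotent_perturbation = kernel_majorant M \<rho> \<kappa> for M :: "'b measure" and \<rho> \<kappa> +
  fixes R N Q :: "'b \<Rightarrow> 'b \<Rightarrow> real" and X :: "'b set"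
  assumes R: "dominated R" and N: "dominated N" and Q: "dominated Q"
    and supp: "\<And>z z'. N z z' \<noteq> 0 \<Longrightarrow> z \<in> X \<and> z' \<notin> X"
    and Q_eq: "\<And>z z'. z \<in> space M \<Longrightarrow> z' \<in> space M \<Longrightarrow> Q z z' = (\<integral>w. R z w * N w z' \<partial>M)"
begin

text \<open>The first \<open>q\<close> columns carry \<open>Q\<close>, the next \<open>a\<close> carry \<open>N\<close> and the others \<open>R\<close>.\<close>

definition coltype :: "nat \<Rightarrow> nat \<Rightarrow> nat \<Rightarrow> 'b \<Rightarrow> 'b \<Rightarrow> real" where
  "coltype q a = (\<lambda>j. if j < q then Q else if j < q + a then N else R)"

definition mixed :: "nat \<Rightarrow> nat \<Rightarrow> nat \<Rightarrow> real" where
  "mixed q a r = (\<integral>z. col_det (q + a + r) (coltype q a) z \<partial>(tuples M (q + a + r)))"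

lemma coltype_dominated: "dominated (coltype q a j)"
  using R N Q by (simp add: coltype_def)

lemma entry_measurable:
  assumes "dominated K" "i < n" "j < n"
  shows "(\<lambda>z. K (z i) (z j)) \<in> borel_measurable (tuples M n)"
proof -
  have "(\<lambda>z. (z i, z j)) \<in> measurable (tuples M n) (M \<Otimes>\<^sub>M M)"
    using assms by (intro measurable_Pair measurable_component_singleton) auto
  from measurable_compose[OF this, of "case_prod K" borel] assms(1) show ?thesis by (simp add: dominated_def)
qed

lemma mixed_bound: "\<bar>mixed q a r\<bar> \<le> sqrt (real (q + a + r) ^ (q + a + r)) * mass ^ (q + a + r)"
  unfolding mixed_def by (rule col_det_integral_bound) (rule coltype_dominated)

text \<open>The column \<open>q\<close> carries \<open>N\<close>. Expand it along its entries \<open>N (z l) (z q)\<close>. If the column \<open>l\<close> carries \<open>Q\<close> or \<open>N\<close>, the term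
vanishes: a nonzero entry puts \<open>z l\<close> into \<open>X\<close>, where \<open>N w (z l)\<close> and hence \<open>Q w (z l)\<close> are zero for every \<open>w\<close>. The \<open>r\<close> terms
with a column \<open>R\<close> agree by symmetry. For the last of them, deleting the row and column of the variable \<open>z l\<close> and integrating
over it turns \<open>R (z i) (z l) * N (z l) (z q)\<close> into the entry \<open>Q (z i) (z q)\<close> of the column \<open>q\<close>.\<close>

lemma mixed_eliminate_column:
  "mixed q (Suc a) r = - real r * mixed (Suc q) a (r - 1)"
proof -
  define n where "n = q + Suc a + r"
  let ?P = "tuples M n"
  define W where "W = coltype q (Suc a)"
  define e where "e = (\<lambda>l i j z. if j = q then (if i = l then N (z l) (z q) else 0) else W j (z i) (z j))"
  define T where "T = (\<lambda>l z. matrix_det n (\<lambda>i j. e l i j z))"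
  have qn: "q < n" by (simp add: n_def)
  have Wdom: "dominated (W j)" for j unfolding W_def by (rule coltype_dominated)
  have e_meas: "e l i j \<in> borel_measurable ?P" if "i < n" "j < n" "l < n" for l i j
    unfolding e_def using entry_measurable[OF Wdom that(1,2)] entry_measurable[OF N that(3) qn] by simp
  have sp: "z i \<in> space M" if "z \<in> space ?P" "i < n" for z i using that by (auto simp: space_PiM PiE_iff)
  have e_le: "\<bar>e l i j z\<bar> \<le> \<rho> (z i) * \<kappa> (z j)" if "i < n" "j < n" "z \<in> space ?P" for l i j z
    using Wdom[of j] N sp[OF that(3)] that qn majorant_pos[of "z i"] majorant_pos[of "z j"] unfolding e_def dominated_def
    by (auto simp: less_imp_le)
  have T_meas: "T l \<in> borel_measurable ?P" if "l < n" for l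
    unfolding T_def using e_meas e_le that by (intro det_entries_integrable(1)) auto
  have T_int: "integrable ?P (T l)" if "l < n" for l
    unfolding T_def using e_meas e_le that by (intro det_entries_integrable(2)) auto
  have expand: "col_det n W z = (\<Sum>l<n. T l z)" for z
  proof -
    have "col_det n W z = matrix_det n (\<lambda>i j. if j = q then N (z i) (z q) else W j (z i) (z j))"
      unfolding col_det_def by (intro arg_cong[where f = Determinant.det] cong_mat) (auto simp: W_def coltype_def)
    also have "\<dots> = (\<Sum>l<n. T l z)"
      unfolding T_def e_def by (rule det_column_sum[OF qn, of "\<lambda>i. N (z i) (z q)"])
    finally show ?thesis .
  qed
  have T0: "T l z = 0" if l: "l < q + Suc a" "l < n" and z: "z \<in> space ?P" for l z
  proof (cases "N (z l) (z q) = 0")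
    case True
    thus ?thesis unfolding T_def e_def by (intro det_zero_column[OF qn]) auto
  next
    case False
    hence lX: "z l \<in> X" "z q \<notin> X" "l \<noteq> q" using supp by auto
    have N0: "N w (z l) = 0" for w using supp lX(1) by blast
    hence "Q (z i) (z l) = 0" if "i < n" for i using Q_eq[OF sp[OF z that] sp[OF z l(2)]] by simp
    hence "W l (z i) (z l) = 0" if "i < n" for i using N0 l that by (simp add: W_def coltype_def)
    thus ?thesis unfolding T_def e_def using lX(3) by (intro det_zero_column[OF l(2)]) auto
  qed
  have T_last: "(\<integral>z. T l z \<partial>?P) = (\<integral>z. T (n - 1) z \<partial>?P)" if l: "q + Suc a \<le> l" "l < n" for l
  proof -
    define p where "p = Transposition.transpose l (n - 1)"
    have p: "p permutes {..<n}" unfolding p_def using l by (intro permutes_swap_id) auto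
    have pin: "p i < n" if "i < n" for i using permutes_in_image[OF p, of i] that by simp
    have pq: "p j = q \<longleftrightarrow> j = q" for j using l by (auto simp: p_def Transposition.transpose_def)
    define m where "m = n - 1"
    have pl: "p i = m \<longleftrightarrow> i = l" for i unfolding m_def using l by (auto simp: p_def Transposition.transpose_def)
    have pW: "W (p j) = W j" for j using l by (auto simp: p_def Transposition.transpose_def W_def coltype_def)
    have "(\<integral>z. T l z \<partial>?P) = (\<integral>z. T l (\<lambda>i\<in>{..<n}. z (p i)) \<partial>?P)"
      by (rule integral_PiM_permute[OF T_meas[OF l(2)] p, symmetric])
    also have "\<dots> = (\<integral>z. T (n - 1) z \<partial>?P)"
    proof (rule Bochner_Integration.integral_cong[OF refl])
      fix z
      define f where "f = (\<lambda>i j. e m i j z)"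
      have "T l (\<lambda>i\<in>{..<n}. z (p i)) = matrix_det n (\<lambda>i j. f (p i) (p j))"
        unfolding T_def
      proof (intro arg_cong[where f = Determinant.det] cong_mat refl)
        fix i j assume "i < n" "j < n"
        have pqq: "p q = q" "p l = m" using pq pl by blast+
        thus "(case (i, j) of (i, j) \<Rightarrow> e l i j (\<lambda>i\<in>{..<n}. z (p i))) = (case (i, j) of (i, j) \<Rightarrow> f (p i) (p j))"
          using \<open>i < n\<close> \<open>j < n\<close> qn l(2) by (simp add: f_def e_def pq pl pW pqq)
      qed
      also have "\<dots> = T (n - 1) z" unfolding T_def f_def m_def by (rule det_permute_simultaneous[OF p])
      finally show "T l (\<lambda>i\<in>{..<n}. z (p i)) = T (n - 1) z" .
    qed
    finally show ?thesis .
  qed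
  have T_val: "(\<integral>z. T (n - 1) z \<partial>?P) = - mixed (Suc q) a (r - 1)" if r: "r > 0"
  proof -
    define m where "m = n - 1"
    have m: "n = Suc m" "q < m" "m = Suc q + a + (r - 1)" using r by (auto simp: m_def n_def)
    have Wm: "W m = R" using m r by (simp add: W_def coltype_def n_def)
    let ?S = "tuples M m"
    have ins: "{..<n} = insert m {..<m}" unfolding m(1) by (rule lessThan_Suc)
    have "(\<integral>z. T m z \<partial>?P) = (\<integral>x. \<integral>y. T m (x(m := y)) \<partial>M \<partial>?S)"
    proof -
      have "m < n" using m(1) by simp
      from T_int[OF this, unfolded ins] show ?thesis
        unfolding ins by (intro PM.product_integral_insert) auto
    qed
    also have "\<dots> = (\<integral>x. - col_det m (coltype (Suc q) a) x \<partial>?S)"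
    proof (rule Bochner_Integration.integral_cong[OF refl])
      fix x assume x: "x \<in> space ?S"
      have spx: "x i \<in> space M" if "i < m" for i using x that by (auto simp: space_PiM PiE_iff)
      define f where "f = (\<lambda>i j. W j (x i) (x j))"
      have "T m (x(m := y)) = - (matrix_det m (\<lambda>i j. if j = q then R (x i) y * N y (x q) else f i j))" for y
      proof -
        define f' where "f' = (\<lambda>i j. W j ((x(m := y)) i) ((x(m := y)) j))"
        have "T m (x(m := y)) = matrix_det (Suc m) (\<lambda>i j. if j = q then (if i = m then N y (x q) else 0) else f' i j)"
          unfolding T_def e_def m(1) using m(2) by (intro arg_cong[where f = Determinant.det] cong_mat) (auto simp: f'_def)
        also have "\<dots> = - N y (x q) * matrix_det m (\<lambda>i j. if j = q then f' i m else f' i j)"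
          by (rule det_single_entry_column[OF m(2)])
        also have "Matrix.mat m m (\<lambda>(i, j). if j = q then f' i m else f' i j) = Matrix.mat m m (\<lambda>(i, j). if j = q then R (x i) y else f i j)"
          by (intro cong_mat) (auto simp: f'_def f_def Wm)
        also have "- N y (x q) * matrix_det m (\<lambda>i j. if j = q then R (x i) y else f i j)
          = - matrix_det m (\<lambda>i j. if j = q then R (x i) y * N y (x q) else f i j)"
          unfolding det_column_expand[OF m(2)] by (simp add: sum_distrib_left sum_negf mult_ac)
        finally show ?thesis .
      qed
      hence "(\<integral>y. T m (x(m := y)) \<partial>M) = - (\<integral>y. matrix_det m (\<lambda>i j. if j = q then R (x i) y * N y (x q) else f i j) \<partial>M)"
        by simp
      also have "(\<integral>y. matrix_det m (\<lambda>i j. if j = q then R (x i) y * N y (x q) else f i j) \<partial>M)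
        = matrix_det m (\<lambda>i j. if j = q then (\<integral>y. R (x i) y * N y (x q) \<partial>M) else f i j)"
      proof (rule det_column_integral[OF m(2), symmetric])
        fix i assume i: "i < m"
        show "integrable M (\<lambda>y. R (x i) y * N y (x q))"
          using R N spx i m(2) by (intro dominated_product_integrable) auto
      qed
      also have "\<dots> = col_det m (coltype (Suc q) a) x"
        unfolding col_det_def using Q_eq spx m(2)
        by (intro arg_cong[where f = Determinant.det] cong_mat refl) (auto simp: f_def W_def coltype_def)
      finally show "(\<integral>y. T m (x(m := y)) \<partial>M) = - col_det m (coltype (Suc q) a) x" .
    qed
    also have "\<dots> = - mixed (Suc q) a (r - 1)" unfolding mixed_def m(3)[symmetric] by simp
    finally show ?thesis by (simp add: m_def)
  qed
  have "mixed q (Suc a) r = (\<integral>z. (\<Sum>l<n. T l z) \<partial>?P)"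
    unfolding mixed_def n_def[symmetric] W_def[symmetric] expand ..
  also have "\<dots> = (\<Sum>l<n. \<integral>z. T l z \<partial>?P)"
    using T_int by (intro Bochner_Integration.integral_sum) auto
  also have "\<dots> = (\<Sum>l<n. if q + Suc a \<le> l then (\<integral>z. T (n - 1) z \<partial>?P) else 0)"
  proof (rule sum.cong[OF refl])
    fix l assume "l \<in> {..<n}"
    hence l: "l < n" by simp
    show "(\<integral>z. T l z \<partial>?P) = (if q + Suc a \<le> l then (\<integral>z. T (n - 1) z \<partial>?P) else 0)"
    proof (cases "q + Suc a \<le> l")
      case True
      thus ?thesis using T_last[OF True l] by (simp only: if_True)
    next
      case False
      hence "l < q + Suc a" by linarith
      hence "(\<integral>z. T l z \<partial>?P) = (\<integral>z. 0 \<partial>?P)"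
        by (intro Bochner_Integration.integral_cong refl T0 l)
      thus ?thesis using False by (simp only: if_False Bochner_Integration.integral_zero)
    qed
  qed
  also have "\<dots> = (\<Sum>l\<in>{q + Suc a..<n}. (\<integral>z. T (n - 1) z \<partial>?P))"
    by (rule sum.mono_neutral_cong_right) auto
  also have "\<dots> = real r * (\<integral>z. T (n - 1) z \<partial>?P)" by (simp add: n_def)
  finally show ?thesis using T_val by (cases "r = 0") simp_all
qed

lemma mixed_closed_form:
  "mixed q a r = (if a \<le> r then (- 1) ^ a * (fact r / fact (r - a)) * mixed (q + a) 0 (r - a) else 0)"
proof (induction a arbitrary: q r)
  case 0
  show ?case by simp
next
  case (Suc a)
  show ?case
  proof (cases r)
    case 0
    thus ?thesis by (simp add: mixed_eliminate_column)
  next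
    case (Suc r')
    have "- real (Suc r') = - 1 - real r'" by simp
    thus ?thesis unfolding mixed_eliminate_column[of q a r] Suc.IH using Suc by (simp add: field_simps)
  qed
qed

lemma coltype_0: "coltype k 0 = (\<lambda>j. if j < k then Q else R)"
  by (auto simp: coltype_def)

lemma coltype_left_0: "coltype 0 k = (\<lambda>j. if j < k then N else R)"
  by (auto simp: coltype_def)

text \<open>The contribution of \<open>k\<close> columns with kernel \<open>Q\<close> and \<open>c\<close> columns with kernel \<open>R\<close>. Both Fredholm series are rearrangements of the
same absolutely convergent double series of these numbers.\<close>

definition reduced_term :: "nat \<times> nat \<Rightarrow> real" where
  "reduced_term = (\<lambda>(k, c). (- 1) ^ c / (fact k * fact c) * mixed k 0 c)"

lemma reduced_term_bound: "\<bar>reduced_term (k, c)\<bar> \<le> sqrt (real (k + c) ^ (k + c)) * mass ^ (k + c) / (fact k * fact c)"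
  using mixed_bound[of k 0 c] by (simp add: reduced_term_def abs_mult abs_divide divide_right_mono power_abs)

text \<open>Each of the \<open>k\<close> columns with kernel \<open>N\<close> consumes one column with kernel \<open>R\<close>, and turns into a column with kernel \<open>Q\<close>.\<close>

lemma expansion_RN:
  "(- 1) ^ n / fact n * (\<integral>z. col_det n (\<lambda>_ z z'. R z z' - N z z') z \<partial>(tuples M n)) = (\<Sum>k\<in>{k. 2 * k \<le> n}. reduced_term (k, n - 2 * k))"
proof -
  have "(\<integral>z. col_det n (\<lambda>_ z z'. R z z' - N z z') z \<partial>(tuples M n)) = (\<Sum>k\<le>n. real (n choose k) * ((- 1) ^ k * mixed 0 k (n - k)))"
    unfolding integral_col_det_diff[OF R N] mixed_def coltype_left_0 by (intro sum.cong) auto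
  hence "(- 1) ^ n / fact n * (\<integral>z. col_det n (\<lambda>_ z z'. R z z' - N z z') z \<partial>(tuples M n))
     = (\<Sum>k\<le>n. (- 1) ^ n / fact n * (real (n choose k) * ((- 1) ^ k * mixed 0 k (n - k))))" by (simp only: sum_distrib_left)
  also have "\<dots> = (\<Sum>k\<le>n. if 2 * k \<le> n then reduced_term (k, n - 2 * k) else 0)"
  proof (rule sum.cong[OF refl])
    fix k assume "k \<in> {..n}"
    hence k: "k \<le> n" by simp
    show "(- 1) ^ n / fact n * (real (n choose k) * ((- 1) ^ k * mixed 0 k (n - k))) = (if 2 * k \<le> n then reduced_term (k, n - 2 * k) else 0)"
    proof (cases "2 * k \<le> n")
      case True
      have elim: "mixed 0 k (n - k) = (- 1) ^ k * (fact (n - k) / fact (n - 2 * k)) * mixed k 0 (n - 2 * k)"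
        unfolding mixed_closed_form[of 0 k "n - k"] using True by (simp add: mult_2)
      have s: "(- 1 :: real) ^ n = (- 1) ^ (n - 2 * k)"
      proof -
        have "n = n - 2 * k + 2 * k" using True by simp
        hence "(- 1 :: real) ^ n = (- 1) ^ (n - 2 * k + 2 * k)" by simp
        thus ?thesis by (simp add: power_add power_mult)
      qed
      have kk: "(- 1 :: real) ^ k * (- 1) ^ k = 1" by (simp flip: power_mult_distrib)
      have "(- 1) ^ n / fact n * (real (n choose k) * ((- 1) ^ k * mixed 0 k (n - k)))
        = ((- 1) ^ k * (- 1) ^ k) * ((- 1) ^ (n - 2 * k) * (1 / (fact k * fact (n - 2 * k))) * mixed k 0 (n - 2 * k))"
        unfolding elim binomial_fact[OF k, where 'a = real] s by (simp add: field_simps)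
      thus ?thesis using True unfolding kk by (simp add: reduced_term_def)
    next
      case False
      hence "\<not> k \<le> n - k" using k by linarith
      thus ?thesis using False unfolding mixed_closed_form[of 0 k "n - k"] by simp
    qed
  qed
  also have "\<dots> = (\<Sum>k\<in>{k. 2 * k \<le> n}. reduced_term (k, n - 2 * k))"
    by (rule sum.mono_neutral_cong_right) auto
  finally show ?thesis .
qed

lemma expansion_RQ:
  "(- 1) ^ n / fact n * (\<integral>z. col_det n (\<lambda>_ z z'. R z z' - Q z z') z \<partial>(tuples M n)) = (\<Sum>k\<le>n. reduced_term (k, n - k))"
proof -
  have "(\<integral>z. col_det n (\<lambda>_ z z'. R z z' - Q z z') z \<partial>(tuples M n)) = (\<Sum>k\<le>n. real (n choose k) * ((- 1) ^ k * mixed k 0 (n - k)))"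
    unfolding integral_col_det_diff[OF R Q] mixed_def coltype_0 by (intro sum.cong) auto
  hence "(- 1) ^ n / fact n * (\<integral>z. col_det n (\<lambda>_ z z'. R z z' - Q z z') z \<partial>(tuples M n))
     = (\<Sum>k\<le>n. (- 1) ^ n / fact n * (real (n choose k) * ((- 1) ^ k * mixed k 0 (n - k))))" by (simp only: sum_distrib_left)
  also have "\<dots> = (\<Sum>k\<le>n. reduced_term (k, n - k))"
  proof (rule sum.cong[OF refl])
    fix k assume "k \<in> {..n}"
    hence k: "k \<le> n" by simp
    have s: "(- 1 :: real) ^ n * (- 1) ^ k = (- 1) ^ (n - k)"
    proof -
      have "(- 1 :: real) ^ n = (- 1) ^ (n - k) * (- 1) ^ k" using k by (simp flip: power_add)
      moreover have "(- 1 :: real) ^ k * (- 1) ^ k = 1" by (simp flip: power_mult_distrib)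
      ultimately show ?thesis by (simp add: mult.assoc)
    qed
    have "(- 1) ^ n / fact n * (real (n choose k) * ((- 1) ^ k * mixed k 0 (n - k)))
      = ((- 1) ^ n * (- 1) ^ k) * (1 / (fact k * fact (n - k))) * mixed k 0 (n - k)"
      unfolding binomial_fact[OF k, where 'a = real] by (simp add: field_simps)
    thus "(- 1) ^ n / fact n * (real (n choose k) * ((- 1) ^ k * mixed k 0 (n - k))) = reduced_term (k, n - k)"
      unfolding s by (simp add: reduced_term_def)
  qed
  finally show ?thesis .
qed

lemma reduced_term_summable: "reduced_term summable_on UNIV"
proof (rule abs_summable_summable)
  define g where "g = (\<lambda>n. \<Sum>k\<le>n. \<bar>reduced_term (k, n - k)\<bar>)"
  have g_le: "g n \<le> sqrt (real n ^ n) * (2 * mass) ^ n / fact n" for n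
  proof -
    have "g n \<le> (\<Sum>k\<le>n. sqrt (real n ^ n) * mass ^ n / fact n * real (n choose k))"
      unfolding g_def
    proof (rule sum_mono)
      fix k assume "k \<in> {..n}"
      hence k: "k \<le> n" by simp
      thus "\<bar>reduced_term (k, n - k)\<bar> \<le> sqrt (real n ^ n) * mass ^ n / fact n * real (n choose k)"
        using reduced_term_bound[of k "n - k"] by (simp add: binomial_fact[OF k, where 'a = real])
    qed
    also have "\<dots> = sqrt (real n ^ n) * mass ^ n / fact n * 2 ^ n"
      unfolding sum_distrib_left[symmetric] by (simp only: of_nat_sum[symmetric] choose_row_sum of_nat_power of_nat_numeral)
    finally show ?thesis by (simp add: power_mult_distrib mult_ac)
  qed
  have "summable g"
    by (rule summable_comparison_test'[OF hadamard_series(1)[of "2 * mass"], of 0])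
      (use g_le mass_nonneg in \<open>auto simp: g_def sum_nonneg\<close>)
  moreover have "g n \<ge> 0" for n by (simp add: g_def sum_nonneg)
  ultimately have "g summable_on UNIV" by (subst summable_on_UNIV_nonneg_real_iff)
  hence "(\<lambda>(n, k). \<bar>reduced_term (k, n - k)\<bar>) summable_on (SIGMA n:UNIV. {..n})"
    by (intro summable_on_SigmaI[where g = g]) (auto simp: g_def intro!: has_sum_finite)
  moreover have "bij_betw (\<lambda>(n, k). (k, n - k)) (SIGMA n:UNIV. {..n}) (UNIV :: (nat \<times> nat) set)"
    by (rule bij_betwI[where g = "\<lambda>(k, c). (k + c, k)"]) auto
  ultimately show "(\<lambda>x. norm (reduced_term x)) summable_on UNIV"
    using summable_on_reindex_bij_betw[of "\<lambda>(n, k). (k, n - k)" "SIGMA n:UNIV. {..n}" UNIV "\<lambda>x. norm (reduced_term x)"]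
    by (simp add: case_prod_unfold)
qed

text \<open>This is \<open>det (I - R + N) = det (I - R + R N)\<close>, which for trace class operators follows from multiplicativity and
\<open>det (I - N) = 1\<close>. Here \<open>N\<close> is only dominated, and the identity is obtained by rearranging the Fredholm series.\<close>

theorem fredholm_det_nilpotent:
  "fredholm_det M (\<lambda>z z'. R z z' - N z z') = fredholm_det M (\<lambda>z z'. R z z' - Q z z')"
proof -
  define S where "S = infsum reduced_term UNIV"
  have S: "(reduced_term has_sum S) UNIV" unfolding S_def by (rule has_sum_infsum[OF reduced_term_summable])
  have "((\<lambda>(n, k). reduced_term (k, n - k)) has_sum S) (SIGMA n:UNIV. {..n})"
  proof -
    have "bij_betw (\<lambda>(n, k). (k, n - k)) (SIGMA n:UNIV. {..n}) (UNIV :: (nat \<times> nat) set)"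
      by (rule bij_betwI[where g = "\<lambda>(k, c). (k + c, k)"]) auto
    from has_sum_reindex_bij_betw[OF this, of reduced_term S] S show ?thesis by (simp add: case_prod_unfold)
  qed
  hence "((\<lambda>n. \<Sum>k\<le>n. reduced_term (k, n - k)) has_sum S) UNIV"
    by (rule has_sum_SigmaD) (auto intro!: has_sum_finite)
  hence RQ: "(\<lambda>n. \<Sum>k\<le>n. reduced_term (k, n - k)) sums S" by (rule has_sum_imp_sums)
  have fin: "finite {k. 2 * k \<le> n}" for n :: nat by (rule finite_subset[of _ "{..n}"]) auto
  have "((\<lambda>(n, k). reduced_term (k, n - 2 * k)) has_sum S) (SIGMA n:UNIV. {k. 2 * k \<le> n})"
  proof -
    have "bij_betw (\<lambda>(n, k). (k, n - 2 * k)) (SIGMA n:UNIV. {k. 2 * k \<le> n}) (UNIV :: (nat \<times> nat) set)"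
      by (rule bij_betwI[where g = "\<lambda>(k, c). (c + 2 * k, k)"]) auto
    from has_sum_reindex_bij_betw[OF this, of reduced_term S] S show ?thesis by (simp add: case_prod_unfold)
  qed
  hence "((\<lambda>n. \<Sum>k\<in>{k. 2 * k \<le> n}. reduced_term (k, n - 2 * k)) has_sum S) UNIV"
    by (rule has_sum_SigmaD) (auto intro!: has_sum_finite fin)
  hence RN: "(\<lambda>n. \<Sum>k\<in>{k. 2 * k \<le> n}. reduced_term (k, n - 2 * k)) sums S" by (rule has_sum_imp_sums)
  have "fredholm_det M (\<lambda>z z'. R z z' - N z z') = S"
    unfolding fredholm_det_def by (rule sums_unique[OF RN[folded expansion_RN, unfolded col_det_def], symmetric])
  moreover have "fredholm_det M (\<lambda>z z'. R z z' - Q z z') = S"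
    unfolding fredholm_det_def by (rule sums_unique[OF RQ[folded expansion_RQ, unfolded col_det_def], symmetric])
  ultimately show ?thesis by simp
qed

end

section \<open>Fredholm determinants without the columns of a set\<close>

text \<open>The integrands of the two series differ only where one of the variables lies in \<open>Y\<close>, which costs one factor
\<open>\<integral> g\<close> over \<open>Y\<close>. The number \<open>n\<close> of choices of this variable is absorbed by passing from \<open>m\<close> to \<open>2 * m\<close>.\<close>

lemma fredholm_det_kill_columns:
  fixes K :: "'b \<Rightarrow> 'b \<Rightarrow> real" and g :: "'b \<Rightarrow> real" and b :: "nat \<Rightarrow> real"
  assumes sf: "sigma_finite_measure M"
    and K: "case_prod K \<in> borel_measurable (M \<Otimes>\<^sub>M M)" and Y: "Y \<in> sets M"
    and g: "integrable M g" "\<And>z. z \<in> space M \<Longrightarrow> 0 \<le> g z" and m: "(\<integral>z. g z \<partial>M) \<le> m" "1 \<le> m"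
    and b: "\<And>n. 0 \<le> b n" "summable (\<lambda>n. b n * (2 * m) ^ n / fact n)"
    and le: "\<And>n z. z \<in> space (tuples M n) \<Longrightarrow>
      \<bar>matrix_det n (\<lambda>i j. K (z i) (z j))\<bar> \<le> b n * (\<Prod>i<n. g (z i))"
  shows "\<bar>fredholm_det M K - fredholm_det M (\<lambda>z z'. if z' \<in> Y then 0 else K z z')\<bar>
    \<le> (\<integral>z. indicator Y z * g z \<partial>M) * (\<Sum>n. b n * (2 * m) ^ n / fact n)"
proof -
  interpret PM: product_sigma_finite "\<lambda>_::nat. M" using sf by (simp add: product_sigma_finite_def)
  define K0 where "K0 = (\<lambda>z z'. if z' \<in> Y then 0 else K z z')"
  define G mY where "G = (\<integral>z. g z \<partial>M)" and "mY = (\<integral>z. indicator Y z * g z \<partial>M)"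
  have G0: "0 \<le> G" unfolding G_def using g(2) by (intro Bochner_Integration.integral_nonneg) auto
  have mY0: "0 \<le> mY" unfolding mY_def using g(2) by (intro Bochner_Integration.integral_nonneg) auto
  have gY: "integrable M (\<lambda>z. indicator Y z * g z)"
    using integrable_mult_indicator[OF Y g(1)] by simp
  have K0_meas: "case_prod K0 \<in> borel_measurable (M \<Otimes>\<^sub>M M)"
  proof -
    have "(\<lambda>w. if snd w \<in> Y then 0 else case_prod K w) \<in> borel_measurable (M \<Otimes>\<^sub>M M)"
      using K Y by measurable
    also have "(\<lambda>w. if snd w \<in> Y then 0 else case_prod K w) = case_prod K0"
      by (auto simp: K0_def)
    finally show ?thesis .
  qed
  define d where "d = (\<lambda>L n z. matrix_det n (\<lambda>i j. (L :: 'b \<Rightarrow> 'b \<Rightarrow> real) (z i) (z j)))"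
  have d_meas: "d L n \<in> borel_measurable (tuples M n)" if "case_prod L \<in> borel_measurable (M \<Otimes>\<^sub>M M)" for L n
    using col_det_measurable[of n "\<lambda>_. L" M] that unfolding d_def col_det_def by simp
  have prod_int: "integrable (tuples M n) (\<lambda>z. \<Prod>i<n. g (z i))" for n :: nat
    using g(1) by (intro PM.product_integrable_prod) auto
  have prod_val: "(\<integral>z. (\<Prod>i<n. g (z i)) \<partial>(tuples M n)) = G ^ n" for n :: nat
    using g(1) by (subst PM.product_integral_prod) (auto simp: G_def)
  have sp: "z i \<in> space M" if "z \<in> space (tuples M n)" "i < n" for z :: "nat \<Rightarrow> 'b" and i n
    using that by (auto simp: space_PiM PiE_iff)
  have gprod_nonneg: "0 \<le> (\<Prod>i<n. g (z i))" if "z \<in> space (tuples M n)" for z :: "nat \<Rightarrow> 'b" and n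
    using sp[OF that] g(2) by (intro prod_nonneg) auto
  have d0: "d K0 n z = (if \<exists>i<n. z i \<in> Y then 0 else d K n z)" for n z
  proof (cases "\<exists>i<n. z i \<in> Y")
    case True
    then obtain q where "q < n" "z q \<in> Y" by blast
    thus ?thesis using True unfolding d_def by (simp add: K0_def det_zero_column)
  next
    case False
    thus ?thesis unfolding d_def by (auto simp: K0_def intro!: arg_cong[where f = Determinant.det] cong_mat)
  qed
  have le0: "\<bar>d K0 n z\<bar> \<le> b n * (\<Prod>i<n. g (z i))" if "z \<in> space (tuples M n)" for n z
    unfolding d0 using le[OF that] mult_nonneg_nonneg[OF b(1) gprod_nonneg[OF that]] by (simp add: d_def)
  have int: "integrable (tuples M n) (d L n)"
    and bound: "\<bar>\<integral>z. d L n z \<partial>(tuples M n)\<bar> \<le> b n * G ^ n"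
    if "case_prod L \<in> borel_measurable (M \<Otimes>\<^sub>M M)" and dle: "\<And>z. z \<in> space (tuples M n) \<Longrightarrow> \<bar>d L n z\<bar> \<le> b n * (\<Prod>i<n. g (z i))"
    for L n
  proof -
    show i: "integrable (tuples M n) (d L n)"
    proof (rule Bochner_Integration.integrable_bound)
      show "integrable (tuples M n) (\<lambda>z. b n * (\<Prod>i<n. g (z i)))" by (intro integrable_mult_right prod_int)
      show "d L n \<in> borel_measurable (tuples M n)" by (rule d_meas[OF that(1)])
      show "AE z in tuples M n. norm (d L n z) \<le> norm (b n * (\<Prod>i<n. g (z i)))"
        unfolding real_norm_def by (intro AE_I2 order_trans[OF dle abs_ge_self])
    qed
    have "\<bar>\<integral>z. d L n z \<partial>(tuples M n)\<bar> \<le> (\<integral>z. \<bar>d L n z\<bar> \<partial>(tuples M n))"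
      by (rule integral_abs_bound)
    also have "\<dots> \<le> (\<integral>z. b n * (\<Prod>i<n. g (z i)) \<partial>(tuples M n))"
      using i by (intro integral_mono integrable_mult_right prod_int integrable_abs dle)
    finally show "\<bar>\<integral>z. d L n z \<partial>(tuples M n)\<bar> \<le> b n * G ^ n" by (simp add: prod_val)
  qed
  have Gm: "G ^ n \<le> (2 * m) ^ n" for n
    using G0 m by (intro power_mono) (auto simp: G_def)
  have term_summable: "summable (\<lambda>n. (- 1) ^ n / fact n * (\<integral>z. d L n z \<partial>(tuples M n)))"
    if "case_prod L \<in> borel_measurable (M \<Otimes>\<^sub>M M)" and dle: "\<And>n z. z \<in> space (tuples M n) \<Longrightarrow> \<bar>d L n z\<bar> \<le> b n * (\<Prod>i<n. g (z i))"
    for L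
  proof (rule summable_comparison_test'[OF b(2), of 0])
    fix n
    have "\<bar>\<integral>z. d L n z \<partial>(tuples M n)\<bar> \<le> b n * (2 * m) ^ n"
      using bound[OF that(1) dle, of n] mult_left_mono[OF Gm b(1)] by (rule order_trans)
    thus "norm ((- 1) ^ n / fact n * (\<integral>z. d L n z \<partial>(tuples M n))) \<le> b n * (2 * m) ^ n / fact n"
      by (simp add: abs_mult divide_right_mono power_abs)
  qed
  have dK: "\<bar>d K n z\<bar> \<le> b n * (\<Prod>i<n. g (z i))" if "z \<in> space (tuples M n)" for n z
    using le[OF that] by (simp add: d_def)
  note sumK = term_summable[OF K dK] and sumK0 = term_summable[OF K0_meas le0]
  have diff: "\<bar>(\<integral>z. d K n z \<partial>(tuples M n)) - (\<integral>z. d K0 n z \<partial>(tuples M n))\<bar> \<le> mY * (b n * (2 * m) ^ n)" for n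
  proof -
    let ?P = "tuples M n"
    define h where "h = (\<lambda>(l::nat) (i::nat). if i = l then (\<lambda>z. indicator Y z * g z) else g)"
    have h_int: "integrable ?P (\<lambda>z. \<Prod>i<n. h l i (z i))" for l
      using g(1) gY by (intro PM.product_integrable_prod) (auto simp: h_def)
    have h_val: "(\<integral>z. (\<Prod>i<n. h l i (z i)) \<partial>?P) = mY * G ^ (n - 1)" if "l < n" for l
    proof -
      have "(\<integral>z. (\<Prod>i<n. h l i (z i)) \<partial>?P) = (\<Prod>i<n. integral\<^sup>L M (h l i))"
        using g(1) gY by (intro PM.product_integral_prod) (auto simp: h_def)
      also have "\<dots> = (\<Prod>i<n. if i = l then mY else G)" by (intro prod.cong) (auto simp: h_def mY_def G_def)
      also have "\<dots> = mY * (\<Prod>i\<in>{..<n} - {l}. if i = l then mY else G)"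
        using that by (subst prod.remove[of _ l]) auto
      also have "(\<Prod>i\<in>{..<n} - {l}. if i = l then mY else G) = (\<Prod>i\<in>{..<n} - {l}. G)" by (intro prod.cong) auto
      finally show ?thesis using that by simp
    qed
    have pt: "\<bar>d K n z - d K0 n z\<bar> \<le> b n * (\<Sum>l<n. \<Prod>i<n. h l i (z i))" if z: "z \<in> space ?P" for z
    proof (cases "\<exists>i<n. z i \<in> Y")
      case True
      then obtain l where l: "l < n" "z l \<in> Y" by blast
      have h0: "0 \<le> h l i (z i)" if "i < n" for l i using sp[OF z that] g(2) by (auto simp: h_def)
      have "(\<Prod>i<n. g (z i)) = (\<Prod>i<n. h l i (z i))" using l by (intro prod.cong) (auto simp: h_def)
      also have "\<dots> \<le> (\<Sum>l<n. \<Prod>i<n. h l i (z i))"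
        using l h0 by (intro member_le_sum[of l "{..<n}" "\<lambda>l. \<Prod>i<n. h l i (z i)"]) (auto intro!: prod_nonneg)
      finally have "b n * (\<Prod>i<n. g (z i)) \<le> b n * (\<Sum>l<n. \<Prod>i<n. h l i (z i))" using b(1) by (rule mult_left_mono)
      thus ?thesis using dK[OF z] True d0[of n z] by simp
    next
      case False
      have "d K0 n z = d K n z" unfolding d0[of n z] using False by (simp only: if_False)
      moreover have "0 \<le> h l i (z i)" if "i < n" for l i using sp[OF z that] g(2) by (auto simp: h_def)
      hence "0 \<le> (\<Sum>l<n. \<Prod>i<n. h l i (z i))" by (intro sum_nonneg prod_nonneg) auto
      ultimately show ?thesis using b(1)[of n] by simp
    qed
    have intK: "integrable ?P (d K n)" by (rule int[OF K]) (rule dK)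
    have intK0: "integrable ?P (d K0 n)" by (rule int[OF K0_meas]) (rule le0)
    have "\<bar>(\<integral>z. d K n z \<partial>?P) - (\<integral>z. d K0 n z \<partial>?P)\<bar> = \<bar>\<integral>z. d K n z - d K0 n z \<partial>?P\<bar>"
      using intK intK0 by simp
    also have "\<dots> \<le> (\<integral>z. \<bar>d K n z - d K0 n z\<bar> \<partial>?P)" by (rule integral_abs_bound)
    also have "\<dots> \<le> (\<integral>z. b n * (\<Sum>l<n. \<Prod>i<n. h l i (z i)) \<partial>?P)"
      using intK intK0 h_int by (intro integral_mono pt) auto
    also have "\<dots> = b n * (\<Sum>l<n. mY * G ^ (n - 1))"
      using h_int by (simp add: h_val)
    also have "\<dots> = mY * (b n * (real n * G ^ (n - 1)))" by simp
    also have "\<dots> \<le> mY * (b n * (2 * m) ^ n)"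
    proof (intro mult_left_mono mY0 b(1))
      have "G ^ (n - 1) \<le> m ^ (n - 1)" using G0 m(1) by (intro power_mono) (auto simp: G_def)
      also have "\<dots> \<le> m ^ n" using m(2) by (intro power_increasing) auto
      finally have "real n * G ^ (n - 1) \<le> 2 ^ n * m ^ n"
        using G0 by (intro mult_mono) (auto simp: less_imp_le[OF of_nat_less_two_power])
      thus "real n * G ^ (n - 1) \<le> (2 * m) ^ n" by (simp add: power_mult_distrib)
    qed
    finally show ?thesis .
  qed
  have sum_b: "summable (\<lambda>n. mY * (b n * (2 * m) ^ n / fact n))" using b(2) by (rule summable_mult)
  have fd: "fredholm_det M L = (\<Sum>n. (- 1) ^ n / fact n * (\<integral>z. d L n z \<partial>(tuples M n)))" for L
    unfolding fredholm_det_def d_def ..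
  have "fredholm_det M K - fredholm_det M K0 = (\<Sum>n. (- 1) ^ n / fact n * (\<integral>z. d K n z \<partial>(tuples M n)) - (- 1) ^ n / fact n * (\<integral>z. d K0 n z \<partial>(tuples M n)))"
    unfolding fd by (rule suminf_diff[OF sumK sumK0])
  also have "norm \<dots> \<le> (\<Sum>n. mY * (b n * (2 * m) ^ n / fact n))"
  proof (rule norm_suminf_le[OF _ sum_b])
    fix n
    have "norm ((- 1) ^ n / fact n * (\<integral>z. d K n z \<partial>(tuples M n)) - (- 1) ^ n / fact n * (\<integral>z. d K0 n z \<partial>(tuples M n)))
      = \<bar>(\<integral>z. d K n z \<partial>(tuples M n)) - (\<integral>z. d K0 n z \<partial>(tuples M n))\<bar> / fact n"
      unfolding right_diff_distrib[symmetric] by (simp add: abs_mult power_abs)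
    also have "\<dots> \<le> mY * (b n * (2 * m) ^ n) / fact n" by (rule divide_right_mono[OF diff]) simp
    finally show "norm ((- 1) ^ n / fact n * (\<integral>z. d K n z \<partial>(tuples M n)) - (- 1) ^ n / fact n * (\<integral>z. d K0 n z \<partial>(tuples M n))) \<le> mY * (b n * (2 * m) ^ n / fact n)"
      by simp
  qed
  also have "\<dots> = mY * (\<Sum>n. b n * (2 * m) ^ n / fact n)" by (rule suminf_mult[OF b(2)])
  finally show ?thesis unfolding K0_def mY_def by simp
qed

lemma two_times_sigma_finite: "sigma_finite_measure (count_space {s, t :: real} \<Otimes>\<^sub>M lborel)"
  by (intro sigma_finite_pair_measure sigma_finite_measure_count_space_finite lborel.sigma_finite_measure_axioms) simp

lemma two_times_integral:
  fixes f :: "real \<times> real \<Rightarrow> real"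
  assumes st: "s \<noteq> t" and f: "f \<in> borel_measurable (count_space {s, t} \<Otimes>\<^sub>M lborel)"
    and i: "integrable lborel (\<lambda>u. f (s, u))" "integrable lborel (\<lambda>u. f (t, u))"
  shows "integrable (count_space {s, t} \<Otimes>\<^sub>M lborel) f"
    and "(\<integral>z. f z \<partial>(count_space {s, t} \<Otimes>\<^sub>M lborel)) = (\<integral>u. f (s, u) \<partial>lborel) + (\<integral>u. f (t, u) \<partial>lborel)"
proof -
  interpret C: sigma_finite_measure "count_space {s, t}" by (simp add: sigma_finite_measure_count_space_finite)
  interpret pair_sigma_finite "count_space {s, t}" "lborel :: real measure" ..
  show int: "integrable (count_space {s, t} \<Otimes>\<^sub>M lborel) f"
    by (rule Fubini_integrable[OF f]) (use i in \<open>auto simp: integrable_count_space AE_count_space\<close>)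
  have "(\<integral>z. f z \<partial>(count_space {s, t} \<Otimes>\<^sub>M lborel)) = (\<integral>r. \<integral>u. f (r, u) \<partial>lborel \<partial>(count_space {s, t}))"
    by (rule integral_fst'[OF int, symmetric])
  also have "\<dots> = (\<integral>u. f (s, u) \<partial>lborel) + (\<integral>u. f (t, u) \<partial>lborel)"
    using st by (subst lebesgue_integral_count_space_finite) auto
  finally show "(\<integral>z. f z \<partial>(count_space {s, t} \<Otimes>\<^sub>M lborel)) = (\<integral>u. f (s, u) \<partial>lborel) + (\<integral>u. f (t, u) \<partial>lborel)" .
qed

section \<open>The Airy function\<close>

text \<open>Covers conditionally convergent integrals such as the one that defines \<open>Ai\<close>.\<close>

lemma has_integral_atLeast_0_limit:
  fixes f :: "real \<Rightarrow> real"
  assumes int: "\<And>b. f integrable_on {0..b}"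
    and lim: "((\<lambda>b. integral {0..b} f) \<longlongrightarrow> l) at_top"
  shows "(f has_integral l) {0..}"
proof (subst has_integral_alt', intro conjI allI impI)
  have cut: "{0..} \<inter> {a..b} = {max 0 a..b}" for a b :: real by auto
  fix a b :: real
  show "(\<lambda>x. if x \<in> {0..} then f x else 0) integrable_on cbox a b"
    using integrable_on_subinterval[OF int[of b], of "max 0 a" b]
    by (simp add: integrable_restrict_Int cut del: atLeast_iff)
next
  fix e :: real assume "e > 0"
  with lim obtain N where N: "\<And>b. b \<ge> N \<Longrightarrow> \<bar>integral {0..b} f - l\<bar> < e"
    by (auto simp: tendsto_iff eventually_at_top_linorder dist_real_def)
  show "\<exists>B>0. \<forall>a b. ball 0 B \<subseteq> cbox a b \<longrightarrow>
     norm (integral (cbox a b) (\<lambda>x. if x \<in> {0..} then f x else 0) - l) < e"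
  proof (intro exI[of _ "\<bar>N\<bar> + 1"] conjI allI impI)
    fix a b :: real assume sub: "ball 0 (\<bar>N\<bar> + 1) \<subseteq> cbox a b"
    have "0 \<in> ball (0::real) (\<bar>N\<bar>+1)" "\<bar>N\<bar> \<in> ball (0::real) (\<bar>N\<bar>+1)" by (auto simp: dist_real_def)
    with sub have "0 \<in> cbox a b" "\<bar>N\<bar> \<in> cbox a b" by blast+
    hence "a \<le> 0" "N \<le> b" by auto
    have "integral (cbox a b) (\<lambda>x. if x \<in> {0..} then f x else 0) = integral ({0..} \<inter> {a..b}) f"
      by (simp add: integral_restrict_Int del: atLeast_iff)
    also have "{0..} \<inter> {a..b} = {0..b}" using \<open>a \<le> 0\<close> by auto
    finally show "norm (integral (cbox a b) (\<lambda>x. if x \<in> {0..} then f x else 0) - l) < e"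
      using N[OF \<open>N \<le> b\<close>] by simp
  qed auto
qed

text \<open>On the real axis this has modulus one, and the Airy integral is half the integral of its real part; in the upper half-plane
it decays like a Gaussian along horizontal lines.\<close>

definition airy_wave :: "real \<Rightarrow> complex \<Rightarrow> complex" where
  "airy_wave X z = exp (\<i> * (z ^ 3 / 3 + of_real X * z))"

lemma norm_airy_wave:
  "norm (airy_wave X (Complex k s)) = exp (s ^ 3 / 3 - s * X - s * k\<^sup>2)"
  by (simp add: airy_wave_def power3_eq_cube power2_eq_square field_simps)

lemma airy_wave_primitive: "\<exists>F. \<forall>z. (F has_field_derivative airy_wave X z) (at z)"
proof -
  have "airy_wave X holomorphic_on UNIV" unfolding airy_wave_def by (intro holomorphic_intros) auto
  from holomorphic_convex_primitive'[OF convex_UNIV open_UNIV this] show ?thesis by (metis UNIV_I)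
qed

lemma gaussian_lborel_integrable:
  fixes s :: real assumes "s > 0"
  shows "integrable lborel (\<lambda>k. exp (- s * k\<^sup>2))"
    and "(\<integral>k. exp (- s * k\<^sup>2) \<partial>lborel) = sqrt (pi / s)"
proof -
  define d where "d = sqrt (1 / (2 * s))"
  have d: "d > 0" "d\<^sup>2 = 1 / (2 * s)" using assms by (auto simp: d_def)
  have eq: "exp (- s * k\<^sup>2) = sqrt (pi / s) * normal_density 0 d k" for k :: real
    using assms by (simp add: normal_density_def d field_simps)
  show "integrable lborel (\<lambda>k. exp (- s * k\<^sup>2))"
    unfolding eq using d by (intro integrable_mult_right integrable_normal_density) auto
  show "(\<integral>k. exp (- s * k\<^sup>2) \<partial>lborel) = sqrt (pi / s)"
    unfolding eq using d assms integral_normal_density[of d 0] by simp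
qed

lemma airy_wave_integrable:
  assumes "s > 0"
  shows "integrable lborel (\<lambda>k. airy_wave X (Complex k s))"
proof (rule Bochner_Integration.integrable_bound)
  show "integrable lborel (\<lambda>k. exp (s ^ 3 / 3 - s * X) * exp (- s * k\<^sup>2))"
    using gaussian_lborel_integrable(1)[OF assms] by simp
  have "continuous_on UNIV (\<lambda>k. airy_wave X (Complex k s))"
    unfolding airy_wave_def by (intro continuous_intros) auto
  thus "(\<lambda>k. airy_wave X (Complex k s)) \<in> borel_measurable lborel"
    by (simp add: borel_measurable_continuous_onI)
  show "AE k in lborel. norm (airy_wave X (Complex k s)) \<le> norm (exp (s ^ 3 / 3 - s * X) * exp (- s * k\<^sup>2))"
    by (simp add: norm_airy_wave flip: exp_add)
qed

text \<open>The contour is shifted from the real axis to height \<open>s\<close>. A primitive \<open>F\<close> of the wave reduces the contour integrals to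
differences of values of \<open>F\<close>; along the vertical sides at \<open>\<plusminus> b\<close> the wave is at most \<open>exp (- \<sigma> * (b\<^sup>2 - \<bar>X\<bar> - s\<^sup>2))\<close> at height \<open>\<sigma>\<close>,
so their contribution vanishes as \<open>b\<close> tends to infinity.\<close>

lemma Ai_has_integral:
  fixes X s :: real
  assumes "s > 0"
  defines "J \<equiv> (\<integral>k. airy_wave X (Complex k s) \<partial>lborel)"
  shows "((\<lambda>t. cos (t ^ 3 / 3 + X * t)) has_integral (Re J / 2)) {0..}"
    and "complex_of_real (Re J) = J"
    and "((\<lambda>b. integral {0..b} (\<lambda>t. cos (t ^ 3 / 3 + X * t))) \<longlongrightarrow> Re J / 2) at_top"
proof -
  obtain F where F: "\<And>z. (F has_field_derivative airy_wave X z) (at z)"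
    using airy_wave_primitive[of X] by blast
  define c where "c = (\<lambda>t. cos (t ^ 3 / 3 + X * t))"
  define G where "G = (\<lambda>t::real. F (of_real t) - F (of_real (- t)))"
  have line: "((\<lambda>t. F (a + of_real t * d)) has_vector_derivative airy_wave X (a + of_real t * d) * d) (at t within S)"
    for a d :: complex and t S
  proof -
    have "((\<lambda>t. a + of_real t * d) has_vector_derivative d) (at t within S)"
      by (auto intro!: derivative_eq_intros simp: has_vector_derivative_def scaleR_conv_of_real)
    from field_vector_diff_chain_within[OF this has_field_derivative_at_within[OF F]]
    show ?thesis by (simp add: o_def mult.commute)
  qed
  have wave: "airy_wave X (of_real t) + airy_wave X (of_real (- t)) = of_real (2 * c t)" for t
  proof -
    have *: "airy_wave X (of_real t) = cis (t ^ 3 / 3 + X * t)" for t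
      by (simp add: airy_wave_def cis_conv_exp)
    have m: "(- t) ^ 3 / 3 + X * (- t) = - (t ^ 3 / 3 + X * t)" by simp
    show ?thesis unfolding * m c_def by (simp add: complex_eq_iff del: minus_add_distrib)
  qed
  have "((\<lambda>t. G t) has_vector_derivative of_real (2 * c t)) (at t within S)" for t S
    using has_vector_derivative_diff[OF line[of 0 1 t S] line[of 0 "- 1" t S]] wave[of t]
    by (simp add: G_def)
  hence "((\<lambda>t. complex_of_real (2 * c t)) has_integral G b - G 0) {0..b}" if "b \<ge> 0" for b
    using that by (rule fundamental_theorem_of_calculus[rotated])
  hence c: "((\<lambda>t. complex_of_real (2 * c t)) has_integral G b) {0..b}" if "b \<ge> 0" for b
    using that by (simp add: G_def)
  have cont: "continuous_on {0..b} c" for b unfolding c_def by (intro continuous_intros) auto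
  hence cint: "c integrable_on {0..b}" for b by (intro integrable_continuous_interval)
  have G: "G b = of_real (2 * integral {0..b} c)" if "b \<ge> 0" for b
  proof -
    have "((\<lambda>t. complex_of_real (2 * c t)) has_integral of_real (2 * integral {0..b} c)) {0..b}"
      using cint by (intro has_integral_of_real has_integral_mult_right integrable_integral)
    thus ?thesis using c[OF that] has_integral_unique by blast
  qed
  \<comment> \<open>the vertical sides, at \<open>b\<close> and at \<open>- b\<close>\<close>
  have side: "((\<lambda>b. F (of_real (e * b) + \<i> * s) - F (of_real (e * b))) \<longlongrightarrow> 0) at_top"
    if e: "e = 1 \<or> e = (-1 :: real)" for e
  proof (rule Lim_null_comparison)
    define m where "m = (\<lambda>b::real. b\<^sup>2 - \<bar>X\<bar> - s\<^sup>2)"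
    have mlim: "filterlim m at_top at_top"
      unfolding m_def by real_asymp
    show "\<forall>\<^sub>F b in at_top. norm (F (of_real (e * b) + \<i> * s) - F (of_real (e * b))) \<le> 1 / m b"
      using filterlim_at_top_dense[THEN iffD1, rule_format, OF mlim, of 0]
    proof eventually_elim
      case (elim b)
      have "norm (F (of_real (e * b) + of_real s * \<i>) - F (of_real (e * b) + of_real 0 * \<i>))
           \<le> - exp (- s * m b) / m b - (- exp (- 0 * m b) / m b)"
      proof (rule differentiable_bound_general[OF assms(1), where \<phi>' = "\<lambda>\<sigma>. exp (- \<sigma> * m b)"
            and f' = "\<lambda>\<sigma>. airy_wave X (of_real (e * b) + of_real \<sigma> * \<i>) * \<i>"])
        show "continuous_on {0..s} (\<lambda>x. - exp (- x * m b) / m b)" by (intro continuous_intros)  (use elim in auto)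
        show "continuous_on {0..s} (\<lambda>x. F (complex_of_real (e * b) + complex_of_real x * \<i>))"
          by (rule continuous_on_vector_derivative[OF line])
        fix \<sigma> assume \<sigma>: "0 < \<sigma>" "\<sigma> < s"
        show "((\<lambda>x. - exp (- x * m b) / m b) has_vector_derivative exp (- \<sigma> * m b)) (at \<sigma>)"
          unfolding has_real_derivative_iff_has_vector_derivative[symmetric]
          using elim by (auto intro!: derivative_eq_intros)
        show "((\<lambda>x. F (complex_of_real (e * b) + complex_of_real x * \<i>)) has_vector_derivative airy_wave X (of_real (e * b) + of_real \<sigma> * \<i>) * \<i>) (at \<sigma>)"
          by (rule line)
        have *: "of_real (e * b) + of_real \<sigma> * \<i> = Complex (e * b) \<sigma>" by (simp add: complex_eq_iff)
        have "\<sigma> ^ 3 \<le> \<sigma> * s\<^sup>2"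
          using \<sigma> mult_left_mono[of "\<sigma>\<^sup>2" "s\<^sup>2" \<sigma>] power_mono[of \<sigma> s 2] by (simp add: power3_eq_cube power2_eq_square)
        hence "\<sigma> ^ 3 / 3 \<le> \<sigma> * s\<^sup>2" using \<sigma> zero_less_power[of \<sigma> 3] by linarith
        moreover have "- (\<sigma> * X) \<le> \<sigma> * \<bar>X\<bar>" using \<sigma> by (simp add: abs_if)
        moreover have e2: "(e * b)\<^sup>2 = b\<^sup>2" using e by (elim disjE) simp_all
        ultimately show "norm (airy_wave X (of_real (e * b) + of_real \<sigma> * \<i>) * \<i>) \<le> exp (- \<sigma> * m b)"
          unfolding * norm_mult norm_airy_wave e2 by (simp add: m_def algebra_simps)
      qed
      also have "\<dots> \<le> 1 / m b" using elim by (simp add: field_simps)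
      finally show ?case by (simp add: mult.commute)
    qed
    show "((\<lambda>b. 1 / m b) \<longlongrightarrow> 0) at_top"
      by (intro tendsto_divide_0[OF tendsto_const] filterlim_at_top_imp_at_infinity mlim)
  qed
  \<comment> \<open>the horizontal side at height \<open>s\<close>\<close>
  have mid: "((\<lambda>b. F (of_real b + \<i> * s) - F (of_real (- b) + \<i> * s)) \<longlongrightarrow> J) at_top"
  proof -
    have pt: "airy_wave X (\<i> * of_real s + of_real k * 1) = airy_wave X (Complex k s)" for k
      by (rule arg_cong[where f = "airy_wave X"]) (simp add: complex_eq_iff)
    have eq: "(LINT k|lborel. indicator {-b..b} k *\<^sub>R airy_wave X (Complex k s)) = F (of_real b + \<i> * s) - F (of_real (- b) + \<i> * s)"
      if "b \<ge> 0" for b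
    proof -
      have "has_bochner_integral lborel (\<lambda>k. indicator {-b..b} k *\<^sub>R airy_wave X (\<i> * of_real s + of_real k * 1))
         (F (\<i> * of_real s + of_real b * 1) - F (\<i> * of_real s + of_real (-b) * 1))"
      proof (rule has_bochner_integral_FTC_Icc)
        show "- b \<le> b" using that by simp
        show "continuous_on {-b..b} (\<lambda>k. airy_wave X (\<i> * of_real s + of_real k * 1))"
          unfolding airy_wave_def by (intro continuous_intros) auto
      qed (use line[of "\<i> * of_real s" 1] in simp)
      thus ?thesis unfolding pt has_bochner_integral_iff by (simp add: add.commute)
    qed
    have lim:  "((\<lambda>b. LINT k|lborel. indicator {-b..b} k *\<^sub>R airy_wave X (Complex k s)) \<longlongrightarrow> J) at_top"
      unfolding J_def
    proof (rule integral_dominated_convergence_at_top[where w = "\<lambda>k. norm (airy_wave X (Complex k s))"])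
      show "integrable lborel (\<lambda>k. norm (airy_wave X (Complex k s)))"
        using airy_wave_integrable[OF assms(1)] by (rule integrable_norm)
      show m: "(\<lambda>k. airy_wave X (Complex k s)) \<in> borel_measurable lborel"
        using airy_wave_integrable[OF assms(1)] by auto
      show "(\<lambda>k. indicator {-b..b} k *\<^sub>R airy_wave X (Complex k s)) \<in> borel_measurable lborel" for b
        using m by measurable
      show "AE k in lborel. ((\<lambda>b. indicator {-b..b} k *\<^sub>R airy_wave X (Complex k s)) \<longlongrightarrow> airy_wave X (Complex k s)) at_top"
      proof (rule AE_I2)
        fix k :: real
        have "eventually (\<lambda>b. indicator {-b..b} k *\<^sub>R airy_wave X (Complex k s) = airy_wave X (Complex k s)) at_top"
          using eventually_ge_at_top[of "\<bar>k\<bar>"] by eventually_elim (auto simp: indicator_def)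
        thus "((\<lambda>b. indicator {-b..b} k *\<^sub>R airy_wave X (Complex k s)) \<longlongrightarrow> airy_wave X (Complex k s)) at_top"
          by (rule tendsto_eventually)
      qed
    qed (auto simp: indicator_def)
    show ?thesis
      by (rule Lim_transform_eventually[OF lim])
        (rule eventually_mono[OF eventually_ge_at_top[of 0]], rule eq)
  qed
  have "((\<lambda>b. (F (of_real b + \<i> * s) - F (of_real (- b) + \<i> * s))
      - (F (of_real (1 * b) + \<i> * s) - F (of_real (1 * b)))
      + (F (of_real (- 1 * b) + \<i> * s) - F (of_real (- 1 * b)))) \<longlongrightarrow> J - 0 + 0) at_top"
    by (rule tendsto_add[OF tendsto_diff[OF mid side[of 1]] side[of "- 1"]]) simp_all
  hence "(G \<longlongrightarrow> J) at_top" by (simp add: G_def)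
  hence lim: "((\<lambda>b. complex_of_real (2 * integral {0..b} c)) \<longlongrightarrow> J) at_top"
    by (rule Lim_transform_eventually) (rule eventually_mono[OF eventually_ge_at_top[of 0]], rule G)
  from tendsto_Im[OF this] have "((\<lambda>b::real. 0) \<longlongrightarrow> Im J) at_top" by simp
  hence "Im J = 0" by (simp add: tendsto_const_iff)
  thus "complex_of_real (Re J) = J" by (simp add: complex_eq_iff)
  from tendsto_Re[OF lim] have "((\<lambda>b. (2 * integral {0..b} c) / 2) \<longlongrightarrow> Re J / 2) at_top"
    by (intro tendsto_intros) auto
  thus "((\<lambda>b. integral {0..b} (\<lambda>t. cos (t ^ 3 / 3 + X * t))) \<longlongrightarrow> Re J / 2) at_top" by (simp add: c_def)
  with cint show "((\<lambda>t. cos (t ^ 3 / 3 + X * t)) has_integral (Re J / 2)) {0..}"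
    unfolding c_def by (intro has_integral_atLeast_0_limit)
qed

lemma Ai_contour:
  assumes "s > 0"
  shows "complex_of_real (Ai X) = (\<integral>k. airy_wave X (Complex k s) \<partial>lborel) / (2 * pi)"
proof -
  have "Ai X = Re (\<integral>k. airy_wave X (Complex k s) \<partial>lborel) / 2 / pi"
    unfolding Ai_def integral_unique[OF Ai_has_integral(1)[OF assms]] ..
  with Ai_has_integral(2)[OF assms, of X] show ?thesis by (simp add: mult.commute)
qed

lemma Ai_exp_bound:
  assumes "s > 0"
  shows "\<bar>Ai X\<bar> \<le> exp (s ^ 3 / 3) * sqrt (pi / s) / (2 * pi) * exp (- s * X)"
proof -
  have "\<bar>Ai X\<bar> = norm (complex_of_real (Ai X))" by simp
  also have "\<dots> = norm (\<integral>k. airy_wave X (Complex k s) \<partial>lborel) / (2 * pi)"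
    unfolding Ai_contour[OF assms] by (simp add: norm_divide)
  also have "norm (\<integral>k. airy_wave X (Complex k s) \<partial>lborel) \<le> (\<integral>k. norm (airy_wave X (Complex k s)) \<partial>lborel)"
    by (rule integral_norm_bound)
  also have "\<dots> = (\<integral>k. exp (s ^ 3 / 3 - s * X) * exp (- s * k\<^sup>2) \<partial>lborel)"
    by (simp add: norm_airy_wave flip: exp_add)
  also have "\<dots> = exp (s ^ 3 / 3 - s * X) * sqrt (pi / s)"
    using gaussian_lborel_integrable[OF assms] by simp
  also have "exp (s ^ 3 / 3 - s * X) = exp (s ^ 3 / 3) * exp (- s * X)"
    unfolding mult_exp_exp by simp
  finally show ?thesis by (simp add: divide_right_mono mult_ac)
qed

lemma Ai_measurable [measurable]: "Ai \<in> borel_measurable borel"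
proof -
  have "(\<lambda>X. Re ((\<integral>k. airy_wave X (Complex k 1) \<partial>lborel) / (2 * pi))) \<in> borel_measurable borel"
    unfolding airy_wave_def Complex_eq by measurable
  moreover have "Ai = (\<lambda>X. Re ((\<integral>k. airy_wave X (Complex k 1) \<partial>lborel) / (2 * pi)))"
    using arg_cong[OF Ai_contour[of 1], of Re] by (intro ext) simp
  ultimately show ?thesis by simp
qed

text \<open>Van der Corput: where the phase has a monotone derivative \<open>q\<close> of modulus at least \<open>1\<close>, integrate by parts against \<open>sin p / q\<close>. The
remainder is dominated by the derivative of \<open>- 1 / q\<close>.\<close>

lemma integral_cos_stretch_bound:
  fixes y a b :: real
  assumes "0 \<le> a" "a \<le> b" and away: "(\<forall>k\<in>{a..b}. k\<^sup>2 - y \<ge> 1) \<or> (\<forall>k\<in>{a..b}. k\<^sup>2 - y \<le> - 1)"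
  shows "\<bar>integral {a..b} (\<lambda>k. cos (k ^ 3 / 3 - y * k))\<bar> \<le> 3"
proof -
  define p where "p = (\<lambda>k::real. k ^ 3 / 3 - y * k)"
  define q where "q = (\<lambda>k::real. k\<^sup>2 - y)"
  have nz: "q k \<noteq> 0" if "k \<in> {a..b}" for k using away that by (force simp: q_def)
  have inv: "\<bar>1 / q k\<bar> \<le> 1" if "k \<in> {a..b}" for k using away that by (force simp: q_def abs_if field_simps)
  have dp: "(p has_real_derivative q k) (at k within S)" for k S
    unfolding p_def q_def by (auto intro!: derivative_eq_intros)
  have dq: "(q has_real_derivative 2 * k) (at k within S)" for k S
    unfolding q_def by (auto intro!: derivative_eq_intros)
  have i1: "((\<lambda>k. cos (p k) - sin (p k) * (2 * k) / (q k)\<^sup>2) has_integral (sin (p b) / q b - sin (p a) / q a)) {a..b}"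
  proof (rule fundamental_theorem_of_calculus[OF \<open>a \<le> b\<close>])
    fix k assume k: "k \<in> {a..b}"
    have "((\<lambda>k. sin (p k) / q k) has_real_derivative
        (cos (p k) * q k * q k - sin (p k) * (2 * k)) / (q k * q k)) (at k within {a..b})"
      by (intro DERIV_divide DERIV_chain2[OF DERIV_sin dp] dq nz k)
    also have "(cos (p k) * q k * q k - sin (p k) * (2 * k)) / (q k * q k) = cos (p k) - sin (p k) * (2 * k) / (q k)\<^sup>2"
      using nz[OF k] by (simp add: diff_divide_distrib power2_eq_square)
    finally show "((\<lambda>k. sin (p k) / q k) has_vector_derivative cos (p k) - sin (p k) * (2 * k) / (q k)\<^sup>2) (at k within {a..b})"
      unfolding has_real_derivative_iff_has_vector_derivative[symmetric] .
  qed
  have i2: "((\<lambda>k. 2 * k / (q k)\<^sup>2) has_integral (- 1 / q b - (- 1 / q a))) {a..b}"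
  proof (rule fundamental_theorem_of_calculus[OF \<open>a \<le> b\<close>])
    fix k assume k: "k \<in> {a..b}"
    have "((\<lambda>k. - 1 / q k) has_real_derivative (0 * q k - (- 1) * (2 * k)) / (q k * q k)) (at k within {a..b})"
      by (intro DERIV_divide DERIV_const dq nz k)
    thus "((\<lambda>k. - 1 / q k) has_vector_derivative 2 * k / (q k)\<^sup>2) (at k within {a..b})"
      unfolding has_real_derivative_iff_has_vector_derivative[symmetric] by (simp add: power2_eq_square)
  qed
  have i3: "((\<lambda>k. cos (p k)) has_integral (integral {a..b} (\<lambda>k. cos (p k)))) {a..b}"
    unfolding p_def by (intro integrable_integral integrable_continuous_interval continuous_intros) auto
  have i4: "((\<lambda>k. sin (p k) * (2 * k) / (q k)\<^sup>2) has_integral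
      (integral {a..b} (\<lambda>k. cos (p k)) - (sin (p b) / q b - sin (p a) / q a))) {a..b}"
    using has_integral_diff[OF i3 i1] by simp
  have pt: "\<bar>sin (p k) * (2 * k) / (q k)\<^sup>2\<bar> \<le> 2 * k / (q k)\<^sup>2" if "k \<in> {a..b}" for k
    using that assms(1) mult_right_mono[OF abs_sin_le_one[of "p k"], of "2 * k"]
    by (simp add: abs_mult divide_right_mono)
  have "integral {a..b} (\<lambda>k. cos (p k)) - (sin (p b) / q b - sin (p a) / q a) \<le> - 1 / q b - (- 1 / q a)"
    by (rule has_integral_le[OF i4 i2]) (rule abs_le_D1[OF pt])
  moreover have "- (integral {a..b} (\<lambda>k. cos (p k)) - (sin (p b) / q b - sin (p a) / q a)) \<le> - 1 / q b - (- 1 / q a)"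
    by (rule has_integral_le[OF has_integral_neg[OF i4] i2]) (rule abs_le_D2[OF pt])
  moreover have quot: "\<bar>sin (p k) / q k\<bar> \<le> 1" if "k \<in> {a..b}" for k
  proof -
    have "\<bar>sin (p k) / q k\<bar> = \<bar>sin (p k)\<bar> * \<bar>1 / q k\<bar>" by (simp add: abs_mult abs_divide)
    also have "\<dots> \<le> 1 * 1" by (intro mult_mono abs_sin_le_one inv that) auto
    finally show ?thesis by simp
  qed
  have "\<bar>sin (p a) / q a\<bar> \<le> 1" by (rule quot) (use assms(2) in simp)
  moreover have "\<bar>sin (p b) / q b\<bar> \<le> 1" by (rule quot) (use assms(2) in simp)
  moreover have "- 1 / q b - (- 1 / q a) \<le> 1"
  proof -
    have ab: "a \<in> {a..b}" "b \<in> {a..b}" using assms(2) by auto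
    show ?thesis using away
    proof
      assume "\<forall>k\<in>{a..b}. k\<^sup>2 - y \<ge> 1"
      hence "q a \<ge> 1" "q b \<ge> 1" using ab by (auto simp: q_def)
      hence "- 1 / q b \<le> 0" "1 / q a \<le> 1" by simp_all
      thus ?thesis by linarith
    next
      assume "\<forall>k\<in>{a..b}. k\<^sup>2 - y \<le> - 1"
      hence "q a \<le> - 1" "q b \<le> - 1" using ab by (auto simp: q_def)
      hence "- 1 / q b \<le> 1" "1 / q a \<le> 0" using inv[OF ab(2)] by (simp_all add: abs_le_iff)
      thus ?thesis by linarith
    qed
  qed
  ultimately show ?thesis unfolding p_def by linarith
qed

text \<open>The stationary point \<open>sqrt y\<close> is isolated in the interval from \<open>sqrt (y - 1)\<close> to \<open>sqrt (y + 1)\<close>, of length at most \<open>2\<close>.\<close>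

lemma integral_cos_bound:
  fixes y b :: real
  assumes "y \<ge> 0" "b \<ge> 0"
  shows "\<bar>integral {0..b} (\<lambda>k. cos (k ^ 3 / 3 - y * k))\<bar> \<le> 8"
proof -
  define f where "f = (\<lambda>k::real. cos (k ^ 3 / 3 - y * k))"
  define l u where "l = min b (sqrt (max 0 (y - 1)))" and "u = min b (sqrt (y + 1))"
  have lu: "0 \<le> l" "l \<le> u" "u \<le> b" using assms by (auto simp: l_def u_def intro: min.coboundedI2)
  have int: "f integrable_on {c..d}" for c d
    unfolding f_def by (intro integrable_continuous_interval continuous_intros) auto
  have split: "integral {0..b} f = integral {0..l} f + integral {l..u} f + integral {u..b} f"
    using Henstock_Kurzweil_Integration.integral_combine[of 0 l b f] Henstock_Kurzweil_Integration.integral_combine[of l u b f] lu int by simp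
  have "\<bar>integral {0..l} f\<bar> \<le> 3"
  proof (cases "y \<le> 1")
    case True
    hence "l = 0" using assms by (simp add: l_def)
    thus ?thesis by simp
  next
    case False
    have "k\<^sup>2 - y \<le> - 1" if "k \<in> {0..l}" for k
    proof -
      have "k \<le> sqrt (y - 1)" using that False by (auto simp: l_def)
      hence "k\<^sup>2 \<le> (sqrt (y - 1))\<^sup>2" using that by (intro power_mono) auto
      thus ?thesis using False by simp
    qed
    thus ?thesis unfolding f_def using lu by (intro integral_cos_stretch_bound) auto
  qed
  moreover have "\<bar>integral {u..b} f\<bar> \<le> 3"
  proof (cases "b \<le> sqrt (y + 1)")
    case True
    hence "u = b" by (simp add: u_def)
    thus ?thesis by simp
  next
    case False
    have "k\<^sup>2 - y \<ge> 1" if "k \<in> {u..b}" for k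
    proof -
      have "sqrt (y + 1) \<le> k" using that False by (auto simp: u_def)
      hence "(sqrt (y + 1))\<^sup>2 \<le> k\<^sup>2" using assms by (intro power_mono) auto
      thus ?thesis using assms by simp
    qed
    thus ?thesis unfolding f_def using lu by (intro integral_cos_stretch_bound) auto
  qed
  moreover have "\<bar>integral {l..u} f\<bar> \<le> 2"
  proof -
    have "u - l \<le> 2"
    proof (cases "y \<le> 3")
      case True
      have "sqrt (y + 1) \<le> sqrt 4" using True by (intro real_sqrt_le_mono) auto
      thus ?thesis using lu by (auto simp: u_def)
    next
      case False
      have "sqrt (y + 1) - sqrt (y - 1) \<le> 2"
      proof -
        have "sqrt (y + 1) \<le> sqrt ((sqrt (y - 1) + 2)\<^sup>2)"
          using False by (intro real_sqrt_le_mono) (simp add: power2_eq_square algebra_simps)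
        thus ?thesis using False by simp
      qed
      thus ?thesis using False by (auto simp: l_def u_def min_def)
    qed
    moreover have "norm (integral {l..u} f) \<le> 1 * (u - l)"
      unfolding f_def using lu by (intro integral_bound) (auto intro!: continuous_intros)
    ultimately show ?thesis by simp
  qed
  ultimately show ?thesis using split unfolding f_def by linarith
qed

text \<open>For positive \<open>X\<close> the contour at height \<open>4\<close> gives the decay; for negative \<open>X\<close> the oscillation of the integral bounds \<open>Ai\<close>
uniformly.\<close>

lemma Ai_bound:
  obtains C where "C > 0" "\<And>r X. 0 \<le> r \<Longrightarrow> r \<le> 4 \<Longrightarrow> \<bar>Ai X\<bar> \<le> C * exp (- r * X)"
proof -
  have "0 < (4::real)" by simp
  from Ai_exp_bound[OF this] obtain D where D: "\<And>X. \<bar>Ai X\<bar> \<le> D * exp (- 4 * X)" by blast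
  define C where "C = max 8 D"
  have neg: "\<bar>Ai X\<bar> \<le> C" if "X \<le> 0" for X
  proof -
    define I where "I = Re (\<integral>k. airy_wave X (Complex k 1) \<partial>lborel) / 2"
    have "((\<lambda>b. \<bar>integral {0..b} (\<lambda>t. cos (t ^ 3 / 3 + X * t))\<bar>) \<longlongrightarrow> \<bar>I\<bar>) at_top"
      unfolding I_def by (intro tendsto_rabs Ai_has_integral(3)) auto
    hence "\<bar>I\<bar> \<le> 8"
    proof (rule tendsto_upperbound)
      show "\<forall>\<^sub>F b in at_top. \<bar>integral {0..b} (\<lambda>t. cos (t ^ 3 / 3 + X * t))\<bar> \<le> 8"
        using eventually_ge_at_top[of 0] by eventually_elim (use integral_cos_bound[of "- X"] that in simp)
    qed auto
    moreover have "Ai X = I / pi"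
      unfolding Ai_def I_def by (subst integral_unique[OF Ai_has_integral(1)[of 1]]) simp_all
    moreover have "\<bar>I / pi\<bar> \<le> \<bar>I\<bar> / 1"
      unfolding abs_divide by (rule divide_left_mono) (use pi_gt3 in simp_all)
    ultimately have "\<bar>Ai X\<bar> \<le> 8" by linarith
    thus ?thesis by (simp add: C_def)
  qed
  have pos: "\<bar>Ai X\<bar> \<le> C * exp (- 4 * X)" for X
    by (rule order_trans[OF D]) (simp add: C_def)
  show ?thesis
  proof (rule that)
    show "C > 0" by (simp add: C_def)
    fix r X :: real assume r: "0 \<le> r" "r \<le> 4"
    show "\<bar>Ai X\<bar> \<le> C * exp (- r * X)"
    proof (cases "X \<le> 0")
      case True
      hence "1 \<le> exp (- r * X)" using r by (simp add: mult_nonneg_nonpos)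
      hence "C * 1 \<le> C * exp (- r * X)" by (intro mult_left_mono) (auto simp: C_def)
      thus ?thesis using neg[OF True] by linarith
    next
      case False
      hence "exp (- 4 * X) \<le> exp (- r * X)" using r by simp
      hence "C * exp (- 4 * X) \<le> C * exp (- r * X)" by (intro mult_left_mono) (auto simp: C_def)
      thus ?thesis using pos[of X] by linarith
    qed
  qed
qed

section \<open>Heat kernel and Airy function\<close>

lemma integrable_pair_dominated:
  fixes f :: "'b \<Rightarrow> 'c \<Rightarrow> 'd::{banach, second_countable_topology}"
  assumes "sigma_finite_measure M1" "sigma_finite_measure M2"
    and f: "case_prod f \<in> borel_measurable (M1 \<Otimes>\<^sub>M M2)"
    and a: "integrable M1 a" and b: "integrable M2 (b :: _ \<Rightarrow> real)"
    and le: "\<And>x y. x \<in> space M1 \<Longrightarrow> y \<in> space M2 \<Longrightarrow> norm (f x y) \<le> a x * b y"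
  shows "integrable (M1 \<Otimes>\<^sub>M M2) (case_prod f)"
    and "(\<integral>x. \<integral>y. f x y \<partial>M2 \<partial>M1) = (\<integral>y. \<integral>x. f x y \<partial>M1 \<partial>M2)"
    and "integrable M1 (\<lambda>x. \<integral>y. f x y \<partial>M2)"
proof -
  interpret pair_sigma_finite M1 M2 using assms(1,2) by (simp add: pair_sigma_finite_def)
  have "integrable (M1 \<Otimes>\<^sub>M M2) (\<lambda>(x, y). a x * b y)"
  proof (rule Fubini_integrable)
    show "(\<lambda>(x, y). a x * b y) \<in> borel_measurable (M1 \<Otimes>\<^sub>M M2)"
      using a b by measurable
    show "integrable M1 (\<lambda>x. \<integral>y. norm (case (x, y) of (x, y) \<Rightarrow> a x * b y) \<partial>M2)"
      using a b by (simp add: abs_mult)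
    show "AE x in M1. integrable M2 (\<lambda>y. case (x, y) of (x, y) \<Rightarrow> a x * b y)"
      using b by simp
  qed
  thus *: "integrable (M1 \<Otimes>\<^sub>M M2) (case_prod f)"
    by (rule Bochner_Integration.integrable_bound[OF _ f])
      (auto simp: space_pair_measure intro!: AE_I2 order_trans[OF le abs_ge_self])
  show "(\<integral>x. \<integral>y. f x y \<partial>M2 \<partial>M1) = (\<integral>y. \<integral>x. f x y \<partial>M1 \<partial>M2)"
    by (rule Fubini_integral[OF *, symmetric])
  show "integrable M1 (\<lambda>x. \<integral>y. f x y \<partial>M2)"
    using integrable_fst[OF *] by simp
qed

definition heat_kernel :: "real \<Rightarrow> real \<Rightarrow> real" where
  "heat_kernel h w = 1 / sqrt (4 * pi * h) * exp (- (w\<^sup>2 / (4 * h)))"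

lemma heat_kernel_measurable [measurable]: "heat_kernel h \<in> borel_measurable borel"
  unfolding heat_kernel_def by measurable

lemma heat_kernel_nonneg: "h > 0 \<Longrightarrow> heat_kernel h w \<ge> 0"
  unfolding heat_kernel_def by simp

lemma heat_kernel_affine:
  assumes "h > 0"
  shows "sqrt (2 * h) * (heat_kernel h (2 * h * \<alpha> + sqrt (2 * h) * x) * exp (\<alpha> * (2 * h * \<alpha> + sqrt (2 * h) * x)))
    = exp (h * \<alpha>\<^sup>2) * std_normal_density x"
proof -
  define d where "d = sqrt (2 * h)"
  have d: "d > 0" "d * d = 2 * h" using assms by (auto simp: d_def)
  have d2: "2 * h = d * d" "h = d * d / 2" using d by auto
  have "sqrt (4 * pi * h) = d * sqrt (2 * pi)"
    using assms by (simp add: d_def real_sqrt_mult[symmetric])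
  moreover have "- ((2 * h * \<alpha> + d * x)\<^sup>2 / (4 * h)) + \<alpha> * (2 * h * \<alpha> + d * x) = h * \<alpha>\<^sup>2 - x\<^sup>2 / 2"
    using d(1) unfolding d2 by (simp add: field_simps power2_eq_square)
  hence "exp (- ((2 * h * \<alpha> + d * x)\<^sup>2 / (4 * h))) * exp (\<alpha> * (2 * h * \<alpha> + d * x)) = exp (h * \<alpha>\<^sup>2) * exp (- x\<^sup>2 / 2)"
    by (simp add: mult_exp_exp)
  ultimately show ?thesis
    using d(1) unfolding heat_kernel_def d_def[symmetric] std_normal_density_def by simp
qed

text \<open>The exponentials, also with complex frequency, are eigenfunctions of the heat flow.\<close>

lemma heat_kernel_exp:
  fixes p :: complex
  assumes "h > 0"
  shows "integrable lborel (\<lambda>u. heat_kernel h (u - v) * exp (p * of_real u))"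
    and "(\<integral>u. heat_kernel h (u - v) * exp (p * of_real u) \<partial>lborel) = exp (p * v + h * p\<^sup>2)"
proof -
  define d where "d = sqrt (2 * h)"
  have d: "d > 0" "d * d = 2 * h" using assms by (auto simp: d_def)
  obtain \<alpha> k where p: "p = of_real \<alpha> + \<i> * of_real k" by (metis complex_eq)
  define c where "c = v + 2 * h * \<alpha>"
  let ?f = "\<lambda>u. heat_kernel h (u - v) * exp (p * of_real u)"
  have eq: "d *\<^sub>R ?f (c + d * x) = exp (p * v + h * \<alpha>\<^sup>2 + \<i> * (2 * h * \<alpha> * k)) * (std_normal_density x *\<^sub>R iexp (k * d * x))" for x
  proof -
    have "exp (p * of_real (c + d * x)) = exp (p * v) * exp (\<alpha> * (2 * h * \<alpha> + d * x)) * exp (\<i> * (2 * h * \<alpha> * k)) * iexp (k * d * x)"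
      unfolding exp_of_real[symmetric] mult_exp_exp p c_def by (simp add: algebra_simps)
    hence "d *\<^sub>R ?f (c + d * x) = exp (p * v) * exp (\<i> * (2 * h * \<alpha> * k)) * iexp (k * d * x)
        * of_real (d * (heat_kernel h (2 * h * \<alpha> + d * x) * exp (\<alpha> * (2 * h * \<alpha> + d * x))))"
      by (simp add: scaleR_conv_of_real c_def mult_ac)
    also have "d * (heat_kernel h (2 * h * \<alpha> + d * x) * exp (\<alpha> * (2 * h * \<alpha> + d * x))) = exp (h * \<alpha>\<^sup>2) * std_normal_density x"
      unfolding d_def by (rule heat_kernel_affine[OF assms])
    finally show ?thesis
      by (simp add: exp_add scaleR_conv_of_real exp_of_real[symmetric] mult_ac)
  qed
  have int: "integrable lborel (\<lambda>x. std_normal_density x *\<^sub>R iexp (k * d * x))"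
    by (rule Bochner_Integration.integrable_bound[OF integrable_normal_density[of 1 0]]) (auto simp: normal_density_nonneg)
  have "(\<integral>x. std_normal_density x *\<^sub>R iexp (k * d * x) \<partial>lborel) = char std_normal_distribution (k * d)"
    unfolding char_def by (subst integral_density) (auto simp: normal_density_nonneg)
  also have "\<dots> = complex_of_real (exp (- (h * k\<^sup>2)))"
  proof -
    have "(k * d)\<^sup>2 / 2 = h * k\<^sup>2" using d(2) by (simp add: power2_eq_square mult_ac)
    thus ?thesis unfolding char_std_normal_distribution by simp
  qed
  finally have val: "(\<integral>x. std_normal_density x *\<^sub>R iexp (k * d * x) \<partial>lborel) = complex_of_real (exp (- (h * k\<^sup>2)))" .
  have "integrable lborel (\<lambda>x. (1 / d) *\<^sub>R (d *\<^sub>R ?f (c + d * x)))"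
    unfolding eq by (intro integrable_scaleR_right integrable_mult_right int)
  hence "integrable lborel (\<lambda>x. ?f (c + d * x))"
    using d(1) unfolding scaleR_scaleR by simp
  thus "integrable lborel ?f"
    using lborel_integrable_real_affine_iff[of d ?f c] d(1) by simp
  have "(\<integral>u. ?f u \<partial>lborel) = (\<integral>x. d *\<^sub>R ?f (c + d * x) \<partial>lborel)"
    using lborel_integral_real_affine[of d ?f c] d(1) unfolding integral_scaleR_right by simp
  also have "\<dots> = exp (p * v + h * \<alpha>\<^sup>2 + \<i> * (2 * h * \<alpha> * k)) * complex_of_real (exp (- (h * k\<^sup>2)))"
    unfolding eq integral_mult_right_zero val ..
  also have "\<dots> = exp (p * v + h * p\<^sup>2)"
    unfolding exp_of_real[symmetric] mult_exp_exp p
    by (rule arg_cong[where f = exp]) (simp add: algebra_simps power2_eq_square)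
  finally show "(\<integral>u. ?f u \<partial>lborel) = exp (p * v + h * p\<^sup>2)" .
qed

lemma heat_kernel_exp_real:
  fixes p :: real
  assumes "h > 0"
  shows "integrable lborel (\<lambda>u. heat_kernel h (u - v) * exp (p * u))"
    and "(\<integral>u. heat_kernel h (u - v) * exp (p * u) \<partial>lborel) = exp (p * v + h * p\<^sup>2)"
proof -
  have eq: "complex_of_real (heat_kernel h (u - v)) * exp (complex_of_real p * complex_of_real u) = complex_of_real (heat_kernel h (u - v) * exp (p * u))" for u
    by (simp add: exp_of_real[symmetric])
  have eq2: "exp (complex_of_real p * complex_of_real v + complex_of_real h * (complex_of_real p)\<^sup>2) = complex_of_real (exp (p * v + h * p\<^sup>2))"
    by (simp add: exp_of_real[symmetric])
  show "integrable lborel (\<lambda>u. heat_kernel h (u - v) * exp (p * u))"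
    using heat_kernel_exp(1)[OF assms, of v "of_real p"] unfolding eq by (simp only: complex_of_real_integrable_eq)
  show "(\<integral>u. heat_kernel h (u - v) * exp (p * u) \<partial>lborel) = exp (p * v + h * p\<^sup>2)"
    using heat_kernel_exp(2)[OF assms, of v "of_real p"] unfolding eq eq2 by (simp only: integral_complex_of_real of_real_eq_iff)
qed

text \<open>The solution at time \<open>\<tau>\<close> of the heat equation that starts from \<open>Ai\<close>, also for negative times. In these terms, the second
summand of the kernel of Airy\<open>\<^sub>1\<close> from \<open>(t, x)\<close> to \<open>(t', x')\<close> is \<open>airy_flow (t' - t) (x + x')\<close>.\<close>

definition airy_flow :: "real \<Rightarrow> real \<Rightarrow> real" where
  "airy_flow \<tau> x = Ai (x + \<tau>\<^sup>2) * exp (\<tau> * x + 2 / 3 * \<tau> ^ 3)"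

lemma airy_flow_measurable [measurable]: "airy_flow \<tau> \<in> borel_measurable borel"
  unfolding airy_flow_def by measurable

text \<open>Shifting the contour of \<open>Ai\<close> by \<open>\<i> * \<tau>\<close> completes the cube: in the frequency variable, the flow is the multiplication by
\<open>exp (- \<tau> * k\<^sup>2)\<close>.\<close>

lemma airy_flow_contour:
  assumes "s + \<tau> > 0"
  shows "complex_of_real (airy_flow \<tau> x) =
    (\<integral>k. exp (\<i> * (Complex k s ^ 3 / 3) - \<tau> * (Complex k s)\<^sup>2) * exp (\<i> * Complex k s * x) \<partial>lborel) / (2 * pi)"
proof -
  have "airy_wave (x + \<tau>\<^sup>2) (Complex k (s + \<tau>)) * exp (\<tau> * x + 2 / 3 * \<tau> ^ 3)
      = exp (\<i> * (Complex k s ^ 3 / 3) - \<tau> * (Complex k s)\<^sup>2) * exp (\<i> * Complex k s * x)" for k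
  proof -
    define z where "z = Complex k s"
    have z: "Complex k (s + \<tau>) = z + \<i> * \<tau>" by (simp add: z_def complex_eq_iff)
    have "\<i> * ((z + \<i> * \<tau>) ^ 3 / 3 + of_real (x + \<tau>\<^sup>2) * (z + \<i> * \<tau>)) + of_real (\<tau> * x + 2 / 3 * \<tau> ^ 3)
       = (\<i> * (z ^ 3 / 3) - \<tau> * z\<^sup>2) + \<i> * z * x"
      by (simp add: field_simps power2_eq_square power3_eq_cube)
    thus ?thesis
      unfolding airy_wave_def z z_def[symmetric] mult_exp_exp exp_of_real[symmetric] by simp
  qed
  hence "(\<integral>k. airy_wave (x + \<tau>\<^sup>2) (Complex k (s + \<tau>)) \<partial>lborel) * exp (\<tau> * x + 2 / 3 * \<tau> ^ 3)
     = (\<integral>k. exp (\<i> * (Complex k s ^ 3 / 3) - \<tau> * (Complex k s)\<^sup>2) * exp (\<i> * Complex k s * x) \<partial>lborel)"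
    unfolding integral_mult_left_zero[symmetric] by simp
  thus ?thesis
    unfolding airy_flow_def of_real_mult Ai_contour[OF assms] by simp
qed

lemma airy_flow_contour_integrable:
  fixes s \<tau> :: real
  assumes "s + \<tau> > 0"
  shows "integrable lborel (\<lambda>k. exp (\<i> * (Complex k s ^ 3 / 3) - \<tau> * (Complex k s)\<^sup>2))"
proof (rule Bochner_Integration.integrable_bound)
  show "integrable lborel (\<lambda>k. exp (s ^ 3 / 3 + \<tau> * s\<^sup>2) * exp (- (s + \<tau>) * k\<^sup>2))"
    using gaussian_lborel_integrable(1)[OF assms] by (rule integrable_mult_right)
  have "continuous_on UNIV (\<lambda>k. exp (\<i> * (Complex k s ^ 3 / 3) - \<tau> * (Complex k s)\<^sup>2))"
    by (intro continuous_intros) auto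
  thus "(\<lambda>k. exp (\<i> * (Complex k s ^ 3 / 3) - \<tau> * (Complex k s)\<^sup>2)) \<in> borel_measurable lborel"
    by (simp add: borel_measurable_continuous_onI)
  show "AE k in lborel. norm (exp (\<i> * (Complex k s ^ 3 / 3) - \<tau> * (Complex k s)\<^sup>2))
     \<le> norm (exp (s ^ 3 / 3 + \<tau> * s\<^sup>2) * exp (- (s + \<tau>) * k\<^sup>2))"
    by (simp add: mult_exp_exp power2_eq_square power3_eq_cube field_simps)
qed

lemma airy_flow_heat:
  assumes "h > 0"
  shows "integrable lborel (\<lambda>u. airy_flow \<tau> (c + u) * heat_kernel h (u - v))"
    and "(\<integral>u. airy_flow \<tau> (c + u) * heat_kernel h (u - v) \<partial>lborel) = airy_flow (\<tau> + h) (c + v)"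
proof -
  define s where "s = \<bar>\<tau>\<bar> + 1"
  have s: "s + \<tau> > 0" "s + (\<tau> + h) > 0" using assms by (auto simp: s_def)
  define a where "a = (\<lambda>k. exp (\<i> * (Complex k s ^ 3 / 3) - \<tau> * (Complex k s)\<^sup>2))"
  define f where "f = (\<lambda>k u. a k * exp (\<i> * Complex k s * of_real (c + u)) * of_real (heat_kernel h (u - v)))"
  note a_int = airy_flow_contour_integrable[OF s(1), folded a_def]
  have m: "case_prod f \<in> borel_measurable (lborel \<Otimes>\<^sub>M lborel)"
    unfolding f_def a_def Complex_eq by measurable
  have b_int: "integrable lborel (\<lambda>u. exp (- s * c) * (heat_kernel h (u - v) * exp (- s * u)))"
    by (intro integrable_mult_right heat_kernel_exp_real assms)
  have le: "norm (f k u) \<le> norm (a k) * (exp (- s * c) * (heat_kernel h (u - v) * exp (- s * u)))" for k u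
    unfolding f_def by (simp add: norm_mult heat_kernel_nonneg[OF assms] mult_exp_exp algebra_simps)
  note F = integrable_pair_dominated[of lborel lborel f, OF lborel.sigma_finite_measure_axioms lborel.sigma_finite_measure_axioms m
      integrable_norm[OF a_int] b_int le]
  have in1: "(\<integral>k. f k u \<partial>lborel) = complex_of_real (2 * pi) * complex_of_real (airy_flow \<tau> (c + u) * heat_kernel h (u - v))" for u
  proof -
    have e: "(\<integral>k. a k * exp (\<i> * Complex k s * of_real (c + u)) \<partial>lborel) = complex_of_real (2 * pi) * complex_of_real (airy_flow \<tau> (c + u))"
      unfolding airy_flow_contour[OF s(1)] a_def by simp
    have "(\<integral>k. f k u \<partial>lborel) = (\<integral>k. a k * exp (\<i> * Complex k s * of_real (c + u)) \<partial>lborel) * of_real (heat_kernel h (u - v))"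
      unfolding f_def by (rule integral_mult_left_zero)
    thus ?thesis unfolding e by simp
  qed
  have in2: "(\<integral>u. f k u \<partial>lborel) = exp (\<i> * (Complex k s ^ 3 / 3) - (\<tau> + h) * (Complex k s)\<^sup>2) * exp (\<i> * Complex k s * of_real (c + v))" for k
  proof -
    define z where "z = Complex k s"
    have "f k u = a k * exp (\<i> * z * c) * (heat_kernel h (u - v) * exp ((\<i> * z) * of_real u))" for u
      by (simp add: f_def z_def[symmetric] algebra_simps exp_add)
    hence "(\<integral>u. f k u \<partial>lborel) = a k * exp (\<i> * z * c) * exp (\<i> * z * v + h * (\<i> * z)\<^sup>2)"
      by (simp only: integral_mult_right_zero heat_kernel_exp[OF assms])
    also have "\<dots> = exp (\<i> * (z ^ 3 / 3) - (\<tau> + h) * z\<^sup>2) * exp (\<i> * z * of_real (c + v))"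
      unfolding a_def z_def[symmetric] mult_exp_exp by (rule arg_cong[where f = exp]) (simp add: algebra_simps power2_eq_square)
    finally show ?thesis by (simp add: z_def)
  qed
  have "integrable lborel (\<lambda>u. \<integral>k. f k u \<partial>lborel)"
    using lborel_pair.integrable_snd[OF F(1)] by simp
  hence "integrable lborel (\<lambda>u. of_real (1 / (2 * pi)) * (complex_of_real (2 * pi) * complex_of_real (airy_flow \<tau> (c + u) * heat_kernel h (u - v))))"
    unfolding in1 by (rule integrable_mult_right)
  hence "integrable lborel (\<lambda>u. complex_of_real (airy_flow \<tau> (c + u) * heat_kernel h (u - v)))"
    by (simp add: field_simps)
  thus i: "integrable lborel (\<lambda>u. airy_flow \<tau> (c + u) * heat_kernel h (u - v))"
    by (simp only: complex_of_real_integrable_eq)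
  have "complex_of_real (2 * pi) * complex_of_real (\<integral>u. airy_flow \<tau> (c + u) * heat_kernel h (u - v) \<partial>lborel)
     = (\<integral>u. \<integral>k. f k u \<partial>lborel \<partial>lborel)"
    unfolding in1 integral_mult_right_zero integral_complex_of_real ..
  also have "\<dots> = (\<integral>k. \<integral>u. f k u \<partial>lborel \<partial>lborel)" by (rule F(2)[symmetric])
  also have "\<dots> = complex_of_real (2 * pi) * complex_of_real (airy_flow (\<tau> + h) (c + v))"
    unfolding in2 airy_flow_contour[OF s(2)] by simp
  finally have "complex_of_real (\<integral>u. airy_flow \<tau> (c + u) * heat_kernel h (u - v) \<partial>lborel) = complex_of_real (airy_flow (\<tau> + h) (c + v))"
    by (subst (asm) mult_left_cancel) simp_all
  thus "(\<integral>u. airy_flow \<tau> (c + u) * heat_kernel h (u - v) \<partial>lborel) = airy_flow (\<tau> + h) (c + v)"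
    by (simp only: of_real_eq_iff)
qed

text \<open>The kernel of \<open>exp (- h * H)\<close> for the Airy operator \<open>H f = - f'' + x * f\<close>.\<close>

definition tilted_heat_kernel :: "real \<Rightarrow> real \<Rightarrow> real \<Rightarrow> real" where
  "tilted_heat_kernel h u v = heat_kernel h (u - v) * exp (- h * (u + v) / 2 + h ^ 3 / 12)"

text \<open>\<open>Ai (u + l)\<close> is an eigenfunction of the Airy operator for the eigenvalue \<open>- l\<close>. The identity is reduced to the heat flow of
\<open>Ai\<close> from time \<open>- h / 2\<close> to time \<open>h / 2\<close>.\<close>

lemma Ai_tilted_heat:
  assumes "h > 0"
  shows "integrable lborel (\<lambda>u. Ai (u + l) * tilted_heat_kernel h u v)"
    and "(\<integral>u. Ai (u + l) * tilted_heat_kernel h u v \<partial>lborel) = exp (h * l) * Ai (v + l)"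
proof -
  define c where "c = l - h\<^sup>2 / 4"
  define D where "D = exp (h * (l - v) / 2 + h ^ 3 / 24)"
  have sq: "(h / 2)\<^sup>2 = h\<^sup>2 / 4" "(- h / 2)\<^sup>2 = h\<^sup>2 / 4" by (simp_all add: power_divide)
  have eq: "Ai (u + l) * tilted_heat_kernel h u v = D * (airy_flow (- h / 2) (c + u) * heat_kernel h (u - v))" for u
  proof -
    have "- h * (u + v) / 2 + h ^ 3 / 12 = h * (l - v) / 2 + h ^ 3 / 24 + ((- h / 2) * (c + u) + 2 / 3 * (- h / 2) ^ 3)"
      by (simp add: c_def field_simps power2_eq_square power3_eq_cube)
    hence "exp (- h * (u + v) / 2 + h ^ 3 / 12) = D * exp ((- h / 2) * (c + u) + 2 / 3 * (- h / 2) ^ 3)"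
      unfolding D_def mult_exp_exp by simp
    moreover have "c + u + (- h / 2)\<^sup>2 = u + l" unfolding sq c_def by simp
    ultimately show ?thesis unfolding tilted_heat_kernel_def airy_flow_def by (simp only: mult_ac)
  qed
  show "integrable lborel (\<lambda>u. Ai (u + l) * tilted_heat_kernel h u v)"
    unfolding eq by (intro integrable_mult_right airy_flow_heat assms)
  have "(\<integral>u. Ai (u + l) * tilted_heat_kernel h u v \<partial>lborel) = D * airy_flow (h / 2) (c + v)"
    unfolding eq integral_mult_right_zero airy_flow_heat(2)[OF assms] by simp
  also have "\<dots> = exp (h * l) * Ai (v + l)"
  proof -
    have "D * exp ((h / 2) * (c + v) + 2 / 3 * (h / 2) ^ 3) = exp (h * l)"
      unfolding D_def mult_exp_exp by (rule arg_cong[where f = exp]) (simp add: c_def field_simps power2_eq_square power3_eq_cube)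
    moreover have "c + v + (h / 2)\<^sup>2 = v + l" unfolding sq c_def by simp
    ultimately show ?thesis unfolding airy_flow_def by (metis mult.assoc mult.commute)
  qed
  finally show "(\<integral>u. Ai (u + l) * tilted_heat_kernel h u v \<partial>lborel) = exp (h * l) * Ai (v + l)" .
qed

text \<open>Gaussian kernels are an approximation of the identity, here on bounded continuous functions.\<close>

lemma integral_std_normal_scaled_tendsto:
  fixes q :: "real \<Rightarrow> complex"
  assumes cont: "continuous_on UNIV q" and B: "\<And>k. norm (q k) \<le> B" and e: "e \<longlonglongrightarrow> 0"
  shows "(\<lambda>n. \<integral>x. std_normal_density x *\<^sub>R q (k + e n * x) \<partial>lborel) \<longlonglongrightarrow> q k"
proof -
  have "(\<lambda>n. \<integral>x. std_normal_density x *\<^sub>R q (k + e n * x) \<partial>lborel) \<longlonglongrightarrow> (\<integral>x. std_normal_density x *\<^sub>R q k \<partial>lborel)"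
  proof (rule integral_dominated_convergence[where w = "\<lambda>x. std_normal_density x * B"])
    show "integrable lborel (\<lambda>x. std_normal_density x * B)"
      using integrable_normal_density[of 1 0] by simp
    have [measurable]: "q \<in> borel_measurable borel" using cont by (rule borel_measurable_continuous_onI)
    show "(\<lambda>x. std_normal_density x *\<^sub>R q (k + e n * x)) \<in> borel_measurable lborel" for n by measurable
    show "(\<lambda>x. std_normal_density x *\<^sub>R q k) \<in> borel_measurable lborel" by measurable
    show "AE x in lborel. (\<lambda>n. std_normal_density x *\<^sub>R q (k + e n * x)) \<longlonglongrightarrow> std_normal_density x *\<^sub>R q k"
    proof (rule AE_I2)
      fix x :: real
      have "(\<lambda>n. k + e n * x) \<longlonglongrightarrow> k + 0 * x" by (intro tendsto_intros e)
      hence "(\<lambda>n. q (k + e n * x)) \<longlonglongrightarrow> q k"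
        using continuous_on_tendsto_compose[OF cont] by simp
      thus "(\<lambda>n. std_normal_density x *\<^sub>R q (k + e n * x)) \<longlonglongrightarrow> std_normal_density x *\<^sub>R q k"
        by (intro tendsto_intros)
    qed
    show "AE x in lborel. norm (std_normal_density x *\<^sub>R q (k + e n * x)) \<le> std_normal_density x * B" for n
      using B by (auto simp: normal_density_nonneg intro!: mult_left_mono)
  qed
  thus ?thesis using integral_normal_density[of 1 0] by simp
qed

text \<open>The double integral does not converge absolutely in \<open>l\<close>. A Gaussian factor \<open>exp (- \<eta> * l\<^sup>2)\<close> makes it so; its transform is a
heat kernel that concentrates at \<open>0\<close> as \<open>\<eta>\<close> tends to zero.\<close>

lemma parseval_integrable:
  fixes q1 q2 :: "real \<Rightarrow> complex"
  defines "\<Phi> \<equiv> \<lambda>q l. \<integral>k. q k * iexp (k * l) \<partial>lborel"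
  assumes q1: "integrable lborel q1" and q2: "integrable lborel q2"
    and cont: "continuous_on UNIV q2" and B: "\<And>k. norm (q2 k) \<le> B"
    and prod: "integrable lborel (\<lambda>l. \<Phi> q1 l * \<Phi> q2 l)"
  shows "(\<integral>l. \<Phi> q1 l * \<Phi> q2 l \<partial>lborel) = 2 * pi * (\<integral>k. q1 k * q2 (- k) \<partial>lborel)"
proof -
  have [measurable]: "q1 \<in> borel_measurable borel" "q2 \<in> borel_measurable borel" using q1 q2 by auto
  have \<Phi>_meas [measurable]: "\<Phi> q1 \<in> borel_measurable borel" "\<Phi> q2 \<in> borel_measurable borel"
    unfolding \<Phi>_def by measurable
  have \<Phi>_bound: "norm (\<Phi> q2 l) \<le> (\<integral>k. norm (q2 k) \<partial>lborel)" for l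
    unfolding \<Phi>_def using integral_norm_bound[of lborel "\<lambda>k. q2 k * iexp (k * l)"] by (simp add: norm_mult)
  note sf = lborel.sigma_finite_measure_axioms
  define N where "N = (\<integral>k. norm (q2 k) \<partial>lborel)"
  define \<eta> where "\<eta> = (\<lambda>n. 1 / real (Suc n))"
  have \<eta>: "\<eta> n > 0" for n by (simp add: \<eta>_def)
  define g where "g = (\<lambda>n l. exp (- \<eta> n * l\<^sup>2))"
  have g_int: "integrable lborel (g n)" for n unfolding g_def by (rule gaussian_lborel_integrable(1)[OF \<eta>])
  have [measurable]: "g n \<in> borel_measurable borel" for n unfolding g_def by measurable
  have g_le: "0 \<le> g n l" "g n l \<le> 1" for n l using \<eta>[of n] by (auto simp: g_def)
  \<comment> \<open>the transform of the Gaussian factor is a heat kernel of time \<open>\<eta> n\<close>\<close>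
  have g_hat: "(\<integral>l. g n l * iexp (y * l) \<partial>lborel) = 2 * pi * heat_kernel (\<eta> n) y" for n y
  proof -
    define h where "h = 1 / (4 * \<eta> n)"
    have h: "h > 0" using \<eta> by (simp add: h_def)
    have "g n l = sqrt (pi / \<eta> n) * heat_kernel h (l - 0)" for l
      using \<eta>[of n] by (simp add: g_def heat_kernel_def h_def real_sqrt_divide)
    hence "g n l * iexp (y * l) = complex_of_real (sqrt (pi / \<eta> n)) * (heat_kernel h (l - 0) * exp ((\<i> * y) * of_real l))" for l
      by (simp add: mult_ac)
    hence "(\<integral>l. g n l * iexp (y * l) \<partial>lborel) = sqrt (pi / \<eta> n) * exp ((\<i> * y) * of_real 0 + h * (\<i> * y)\<^sup>2)"
      by (simp only: integral_mult_right_zero heat_kernel_exp[OF h])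
    also have "exp ((\<i> * y) * of_real 0 + h * (\<i> * y)\<^sup>2) = complex_of_real (exp (- (y\<^sup>2 / (4 * \<eta> n))))"
      using \<eta>[of n] by (simp add: exp_of_real[symmetric] h_def power_mult_distrib)
    also have "complex_of_real (sqrt (pi / \<eta> n)) * complex_of_real (exp (- (y\<^sup>2 / (4 * \<eta> n)))) = 2 * pi * heat_kernel (\<eta> n) y"
    proof -
      have "sqrt (pi / \<eta> n) = 2 * pi / sqrt (4 * pi * \<eta> n)"
        using \<eta>[of n] by (simp add: real_sqrt_divide real_sqrt_mult field_simps)
      thus ?thesis by (simp add: heat_kernel_def)
    qed
    finally show ?thesis .
  qed
  define S where "S = (\<lambda>n k. \<integral>x. std_normal_density x *\<^sub>R q2 (- k + sqrt (2 * \<eta> n) * x) \<partial>lborel)"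
  have inner: "(\<integral>l. (g n l * iexp (k * l)) * \<Phi> q2 l \<partial>lborel) = 2 * pi * S n k" for n k
  proof -
    define f where "f = (\<lambda>l m. (g n l * iexp (k * l)) * (q2 m * iexp (m * l)))"
    have "(\<integral>l. (g n l * iexp (k * l)) * \<Phi> q2 l \<partial>lborel) = (\<integral>l. \<integral>m. f l m \<partial>lborel \<partial>lborel)"
      unfolding f_def \<Phi>_def integral_mult_right_zero ..
    also have "\<dots> = (\<integral>m. \<integral>l. f l m \<partial>lborel \<partial>lborel)"
      by (rule integrable_pair_dominated(2)[OF sf sf _ g_int integrable_norm[OF q2]])
        (use g_le[of n] in \<open>auto simp: f_def norm_mult\<close>)
    also have "(\<lambda>m. \<integral>l. f l m \<partial>lborel) = (\<lambda>m. q2 m * (2 * pi * heat_kernel (\<eta> n) (k + m)))"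
    proof
      fix m
      have "f l m = q2 m * (g n l * iexp ((k + m) * l))" for l
        by (simp add: f_def mult_exp_exp algebra_simps)
      thus "(\<integral>l. f l m \<partial>lborel) = q2 m * (2 * pi * heat_kernel (\<eta> n) (k + m))"
        by (simp only: integral_mult_right_zero g_hat)
    qed
    also have "(\<integral>m. q2 m * (2 * pi * heat_kernel (\<eta> n) (k + m)) \<partial>lborel) =
        \<bar>sqrt (2 * \<eta> n)\<bar> *\<^sub>R (\<integral>x. q2 (- k + sqrt (2 * \<eta> n) * x) * (2 * pi * heat_kernel (\<eta> n) (k + (- k + sqrt (2 * \<eta> n) * x))) \<partial>lborel)"
      using \<eta>[of n] by (intro lborel_integral_real_affine) simp
    also have "\<dots> = (\<integral>x. 2 * pi * (std_normal_density x *\<^sub>R q2 (- k + sqrt (2 * \<eta> n) * x)) \<partial>lborel)"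
    proof -
      have "sqrt (2 * \<eta> n) *\<^sub>R (q2 w * (2 * pi * heat_kernel (\<eta> n) (k + (- k + sqrt (2 * \<eta> n) * x))))
        = 2 * pi * (std_normal_density x *\<^sub>R q2 w)" for x w
        using heat_kernel_affine[OF \<eta>[of n], of 0 x]
        by (simp add: scaleR_conv_of_real mult_ac flip: of_real_mult)
      thus ?thesis using \<eta>[of n] by (subst integral_scaleR_right[symmetric]) simp
    qed
    finally show ?thesis unfolding S_def integral_mult_right_zero .
  qed
  \<comment> \<open>insert the transform of \<open>q1\<close> and exchange the integrals; the Gaussian factor dominates in \<open>l\<close>\<close>
  have outer: "(\<integral>l. \<Phi> q1 l * (g n l * \<Phi> q2 l) \<partial>lborel) = 2 * pi * (\<integral>k. q1 k * S n k \<partial>lborel)" for n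
  proof -
    define f where "f = (\<lambda>l k. (q1 k * iexp (k * l)) * (g n l * \<Phi> q2 l))"
    have "(\<integral>l. \<Phi> q1 l * (g n l * \<Phi> q2 l) \<partial>lborel) = (\<integral>l. \<integral>k. f l k \<partial>lborel \<partial>lborel)"
      unfolding f_def by (subst integral_mult_left_zero) (simp add: \<Phi>_def)
    also have "\<dots> = (\<integral>k. \<integral>l. f l k \<partial>lborel \<partial>lborel)"
    proof (rule integrable_pair_dominated(2)[OF sf sf _ _ integrable_norm[OF q1]])
      show "(\<lambda>(l, k). f l k) \<in> borel_measurable (lborel \<Otimes>\<^sub>M lborel)" unfolding f_def by measurable
      show "integrable lborel (\<lambda>l. g n l * N)" using g_int by simp
      show "norm (f l k) \<le> g n l * N * norm (q1 k)" for l k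
        unfolding f_def N_def using mult_left_mono[OF \<Phi>_bound[of l], of "norm (q1 k) * g n l"] g_le[of n l]
        by (simp add: norm_mult mult_ac)
    qed
    also have "(\<lambda>k. \<integral>l. f l k \<partial>lborel) = (\<lambda>k. 2 * pi * (q1 k * S n k))"
    proof
      fix k
      have "f l k = q1 k * ((g n l * iexp (k * l)) * \<Phi> q2 l)" for l by (simp add: f_def)
      thus "(\<integral>l. f l k \<partial>lborel) = 2 * pi * (q1 k * S n k)"
        by (simp only: integral_mult_right_zero inner) simp
    qed
    finally show ?thesis by simp
  qed
  have \<eta>0: "(\<lambda>n. sqrt (2 * \<eta> n)) \<longlonglongrightarrow> 0"
  proof -
    have "\<eta> \<longlonglongrightarrow> 0" unfolding \<eta>_def using LIMSEQ_inverse_real_of_nat by (simp add: inverse_eq_divide)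
    from tendsto_real_sqrt[OF tendsto_mult_right_zero[OF this, of 2]] show ?thesis by simp
  qed
  have "(\<lambda>n. \<integral>l. \<Phi> q1 l * (g n l * \<Phi> q2 l) \<partial>lborel) \<longlonglongrightarrow> (\<integral>l. \<Phi> q1 l * \<Phi> q2 l \<partial>lborel)"
  proof (rule integral_dominated_convergence[where w = "\<lambda>l. norm (\<Phi> q1 l * \<Phi> q2 l)"])
    show "integrable lborel (\<lambda>l. norm (\<Phi> q1 l * \<Phi> q2 l))" using prod by (rule integrable_norm)
    show "AE l in lborel. (\<lambda>n. \<Phi> q1 l * (g n l * \<Phi> q2 l)) \<longlonglongrightarrow> \<Phi> q1 l * \<Phi> q2 l"
    proof (rule AE_I2)
      fix l :: real
      have "\<eta> \<longlonglongrightarrow> 0" unfolding \<eta>_def using LIMSEQ_inverse_real_of_nat by (simp add: inverse_eq_divide)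
      hence "(\<lambda>n. \<Phi> q1 l * (g n l * \<Phi> q2 l)) \<longlonglongrightarrow> \<Phi> q1 l * (complex_of_real (exp (- 0 * l\<^sup>2)) * \<Phi> q2 l)"
        unfolding g_def by (intro tendsto_intros)
      thus "(\<lambda>n. \<Phi> q1 l * (g n l * \<Phi> q2 l)) \<longlonglongrightarrow> \<Phi> q1 l * \<Phi> q2 l" by simp
    qed
    show "AE l in lborel. norm (\<Phi> q1 l * (g n l * \<Phi> q2 l)) \<le> norm (\<Phi> q1 l * \<Phi> q2 l)" for n
    proof (rule AE_I2)
      fix l
      show "norm (\<Phi> q1 l * (g n l * \<Phi> q2 l)) \<le> norm (\<Phi> q1 l * \<Phi> q2 l)"
        using mult_left_mono[OF g_le(2)[of n l], of "norm (\<Phi> q1 l) * norm (\<Phi> q2 l)"] g_le[of n l] by (simp add: norm_mult mult_ac)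
    qed
  qed measurable
  moreover have "(\<lambda>n. \<integral>k. q1 k * S n k \<partial>lborel) \<longlonglongrightarrow> (\<integral>k. q1 k * q2 (- k) \<partial>lborel)"
  proof (rule integral_dominated_convergence[where w = "\<lambda>k. norm (q1 k) * B"])
    show "integrable lborel (\<lambda>k. norm (q1 k) * B)" using q1 by simp
    show "(\<lambda>k. q1 k * S n k) \<in> borel_measurable lborel" for n unfolding S_def by measurable
    show "AE k in lborel. (\<lambda>n. q1 k * S n k) \<longlonglongrightarrow> q1 k * q2 (- k)"
      unfolding S_def by (intro AE_I2 tendsto_intros integral_std_normal_scaled_tendsto[OF cont B \<eta>0])
    show "AE k in lborel. norm (q1 k * S n k) \<le> norm (q1 k) * B" for n
    proof (rule AE_I2)
      fix k
      have "norm (S n k) \<le> (\<integral>x. std_normal_density x * B \<partial>lborel)"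
        unfolding S_def
      proof (rule order_trans[OF integral_norm_bound integral_mono'])
        show "integrable lborel (\<lambda>x. std_normal_density x * B)" using integrable_normal_density[of 1 0] by simp
        show "norm (std_normal_density x *\<^sub>R q2 (- k + sqrt (2 * \<eta> n) * x)) \<le> std_normal_density x * B" for x
          using B by (auto simp: normal_density_nonneg intro!: mult_left_mono)
        show "0 \<le> std_normal_density x * B" for x
          using order_trans[OF norm_ge_zero B[of 0]] by (simp add: normal_density_nonneg)
      qed
      also have "\<dots> = B" using integral_normal_density[of 1 0] by simp
      finally show "norm (q1 k * S n k) \<le> norm (q1 k) * B" by (simp add: norm_mult mult_left_mono)
    qed
  qed measurable
  ultimately show ?thesis
    unfolding outer by (rule LIMSEQ_unique[OF _ tendsto_mult_left])
qed

section \<open>Products of Airy functions\<close>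

lemma exp_tail_integral:
  fixes c a :: real
  assumes "c > 0"
  shows "has_bochner_integral lborel (\<lambda>x. indicator {a..} x * exp (- c * x)) (exp (- c * a) / c)"
proof (rule has_bochner_integral_nn_integral)
  have "(\<integral>\<^sup>+x. ennreal (exp (- c * x)) * indicator {a..} x \<partial>lborel) = ennreal (0 - - exp (- c * a) / c)"
  proof (rule nn_integral_FTC_atLeast)
    show "((\<lambda>x. - exp (- c * x) / c) has_real_derivative exp (- c * x)) (at x)" for x
      using assms by (auto intro!: derivative_eq_intros)
    show "((\<lambda>x. - exp (- c * x) / c) \<longlongrightarrow> 0) at_top"
      using assms by real_asymp
  qed auto
  moreover have "(\<integral>\<^sup>+x. ennreal (exp (- c * x)) * indicator {a..} x \<partial>lborel) = (\<integral>\<^sup>+x. ennreal (indicator {a..} x * exp (- c * x)) \<partial>lborel)"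
    by (intro nn_integral_cong) (auto simp: indicator_def)
  ultimately show "(\<integral>\<^sup>+x. ennreal (indicator {a..} x * exp (- c * x)) \<partial>lborel) = ennreal (exp (- c * a) / c)"
    by simp
qed (use assms in auto)

lemma exp_abs_integrable:
  fixes c :: real
  assumes "c > 0"
  shows "integrable lborel (\<lambda>x. exp (- c * \<bar>x\<bar>))"
proof (rule Bochner_Integration.integrable_bound)
  have i: "integrable lborel (\<lambda>x. indicator {0..} x * exp (- c * x))"
    using exp_tail_integral[OF assms, of 0] by (simp add: has_bochner_integral_iff)
  have "integrable lborel (\<lambda>x. indicator {0..} (- x) * exp (- c * - x))"
    using lborel_integrable_real_affine[OF i, of "- 1" 0] by simp
  from Bochner_Integration.integrable_add[OF i this]
  show "integrable lborel (\<lambda>x. indicator {0..} x * exp (- c * x) + indicator {0..} (- x) * exp (- c * - x))" .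
  show "AE x in lborel. norm (exp (- c * \<bar>x\<bar>)) \<le> norm (indicator {0..} x * exp (- c * x) + indicator {0..} (- x) * exp (- c * - x))"
    by (auto simp: indicator_def abs_if)
qed simp

text \<open>The spectral decomposition of the tilted heat kernel. Write \<open>exp (h * l / 2) * Ai (x + l)\<close> as the Fourier transform of the
wave at height \<open>h / 2\<close>; by Parseval the integral becomes a Gaussian one, because the cubes of the frequencies \<open>k\<close> and \<open>- k\<close>
cancel.\<close>

lemma Ai_product_integral:
  assumes "0 < h" "h \<le> 1"
  shows "integrable lborel (\<lambda>l. exp (h * l) * Ai (x + l) * Ai (y + l))"
    and "(\<integral>l. exp (h * l) * Ai (x + l) * Ai (y + l) \<partial>lborel) = tilted_heat_kernel h x y"
proof -
  define s where "s = h / 2"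
  have s: "s > 0" using assms by (simp add: s_def)
  define Q where "Q = (\<lambda>x k. airy_wave x (Complex k s))"
  define \<Phi> where "\<Phi> = (\<lambda>q l. \<integral>k. q k * iexp (k * l) \<partial>lborel)"
  have Q_int: "integrable lborel (Q x)" for x unfolding Q_def by (rule airy_wave_integrable[OF s])
  have Q_cont: "continuous_on UNIV (Q x)" for x
    unfolding Q_def airy_wave_def by (intro continuous_intros) auto
  have Q_bound: "norm (Q x k) \<le> exp (s ^ 3 / 3 - s * x)" for x k
    using s by (simp add: Q_def norm_airy_wave)
  have \<Phi>: "\<Phi> (Q x) l = complex_of_real (2 * pi * (exp (s * l) * Ai (x + l)))" for x l
  proof -
    have "Q x k * iexp (k * l) = complex_of_real (exp (s * l)) * airy_wave (x + l) (Complex k s)" for k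
    proof -
      have k: "Complex k s = of_real k + \<i> * of_real s" by (simp add: complex_eq_iff)
      show ?thesis unfolding Q_def airy_wave_def exp_of_real[symmetric] mult_exp_exp k
        by (rule arg_cong[where f = exp]) (simp add: algebra_simps)
    qed
    hence "\<Phi> (Q x) l = complex_of_real (exp (s * l)) * (\<integral>k. airy_wave (x + l) (Complex k s) \<partial>lborel)"
      unfolding \<Phi>_def by (simp only: integral_mult_right_zero)
    thus ?thesis using Ai_contour[OF s, of "x + l"] by simp
  qed
  obtain C where C: "C > 0" "\<And>r X. 0 \<le> r \<Longrightarrow> r \<le> 4 \<Longrightarrow> \<bar>Ai X\<bar> \<le> C * exp (- r * X)"
    using Ai_bound by blast
  show int: "integrable lborel (\<lambda>l. exp (h * l) * Ai (x + l) * Ai (y + l))"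
  proof (rule Bochner_Integration.integrable_bound)
    define D where "D = C * C * (1 + exp (- (x + y)))"
    show "integrable lborel (\<lambda>l. D * exp (- h * \<bar>l\<bar>))"
      using assms by (intro integrable_mult_right exp_abs_integrable)
    show "AE l in lborel. norm (exp (h * l) * Ai (x + l) * Ai (y + l)) \<le> norm (D * exp (- h * \<bar>l\<bar>))"
    proof (rule AE_I2)
      fix l :: real
      have "\<bar>exp (h * l) * Ai (x + l) * Ai (y + l)\<bar> \<le> D * exp (- h * \<bar>l\<bar>)"
      proof (cases "l \<le> 0")
        case True
        have "\<bar>Ai (x + l)\<bar> * \<bar>Ai (y + l)\<bar> \<le> C * C"
          using C(2)[of 0] C(1) by (intro mult_mono) auto
        also have "\<dots> \<le> D" using C(1) by (simp add: D_def)
        finally have "exp (h * l) * (\<bar>Ai (x + l)\<bar> * \<bar>Ai (y + l)\<bar>) \<le> exp (h * l) * D" by (rule mult_left_mono) simp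
        thus ?thesis using True by (simp add: abs_mult mult_ac)
      next
        case False
        have "\<bar>Ai (x + l)\<bar> * \<bar>Ai (y + l)\<bar> \<le> (C * exp (- 1 * (x + l))) * (C * exp (- 1 * (y + l)))"
          using C(1) by (intro mult_mono C(2)) auto
        also have "\<dots> = C * C * exp (- (x + y)) * exp (- 2 * l)"
          by (simp add: mult_ac mult_exp_exp)
        also have "\<dots> \<le> D * exp (- 2 * l)" using C(1) by (simp add: D_def)
        finally have "exp (h * l) * (\<bar>Ai (x + l)\<bar> * \<bar>Ai (y + l)\<bar>) \<le> exp (h * l) * (D * exp (- 2 * l))"
          by (rule mult_left_mono) simp
        also have "\<dots> = D * exp (h * l - 2 * l)" by (simp add: mult_ac mult_exp_exp)
        also have "h * l - 2 * l \<le> - h * \<bar>l\<bar>"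
          using False assms mult_right_mono[of h 1 l] by simp
        hence "D * exp (h * l - 2 * l) \<le> D * exp (- h * \<bar>l\<bar>)"
          using C(1) by (intro mult_left_mono) (auto simp: D_def intro!: mult_nonneg_nonneg add_nonneg_nonneg)
        finally show ?thesis by (simp add: abs_mult mult_ac)
      qed
      thus "norm (exp (h * l) * Ai (x + l) * Ai (y + l)) \<le> norm (D * exp (- h * \<bar>l\<bar>))" by simp
    qed
  qed simp
  have prod: "\<Phi> (Q x) l * \<Phi> (Q y) l = complex_of_real ((2 * pi)\<^sup>2) * complex_of_real (exp (h * l) * Ai (x + l) * Ai (y + l))" for l
  proof -
    have "exp (h * l) = exp (s * l) * exp (s * l)" by (simp add: s_def mult_exp_exp)
    thus ?thesis unfolding \<Phi> by (simp add: power2_eq_square mult_ac)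
  qed
  have "integrable lborel (\<lambda>l. \<Phi> (Q x) l * \<Phi> (Q y) l)"
    unfolding prod using int by (intro integrable_mult_right) (simp only: complex_of_real_integrable_eq)
  from parseval_integrable[OF Q_int Q_int Q_cont Q_bound this[unfolded \<Phi>_def]]
  have "(\<integral>l. \<Phi> (Q x) l * \<Phi> (Q y) l \<partial>lborel) = 2 * pi * (\<integral>k. Q x k * Q y (- k) \<partial>lborel)"
    unfolding \<Phi>_def .
  also have "(\<integral>k. Q x k * Q y (- k) \<partial>lborel) = complex_of_real (2 * pi * tilted_heat_kernel h x y)"
  proof -
    define h' where "h' = 1 / (4 * h)"
    have h': "h' > 0" using assms by (simp add: h'_def)
    define e where "e = exp (h ^ 3 / 12 - h * (x + y) / 2)"
    have gauss: "sqrt (pi / h) * heat_kernel h' k = exp (- h * k\<^sup>2)" for k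
      using assms by (simp add: heat_kernel_def h'_def real_sqrt_divide)
    have "Q x k * Q y (- k) = complex_of_real (e * sqrt (pi / h)) * (heat_kernel h' (k - 0) * exp ((\<i> * (x - y)) * of_real k))" for k
    proof -
      have k: "Complex k s = of_real k + \<i> * of_real s" "Complex (- k) s = - of_real k + \<i> * of_real s" by (simp_all add: complex_eq_iff)
      have "Q x k * Q y (- k) = exp (of_real (h ^ 3 / 12 - h * (x + y) / 2) + of_real (- h * k\<^sup>2) + (\<i> * (x - y)) * of_real k)"
        unfolding Q_def airy_wave_def mult_exp_exp k
        by (rule arg_cong[where f = exp]) (simp add: s_def field_simps power2_eq_square power3_eq_cube)
      also have "\<dots> = complex_of_real e * complex_of_real (sqrt (pi / h) * heat_kernel h' k) * exp ((\<i> * (x - y)) * of_real k)"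
        unfolding gauss e_def exp_of_real[symmetric] mult_exp_exp ..
      finally show ?thesis by (simp add: mult_ac)
    qed
    hence "(\<integral>k. Q x k * Q y (- k) \<partial>lborel) = complex_of_real (e * sqrt (pi / h)) * exp ((\<i> * (x - y)) * of_real 0 + h' * (\<i> * (x - y))\<^sup>2)"
      by (simp only: integral_mult_right_zero heat_kernel_exp[OF h'])
    also have "(\<i> * (x - y)) * of_real 0 + h' * (\<i> * (x - y))\<^sup>2 = complex_of_real (- ((x - y)\<^sup>2 / (4 * h)))"
      by (simp add: h'_def power_mult_distrib)
    also have "complex_of_real (e * sqrt (pi / h)) * exp (complex_of_real (- ((x - y)\<^sup>2 / (4 * h))))
      = complex_of_real (2 * pi * tilted_heat_kernel h x y)"
    proof -
      have "sqrt (pi / h) = 2 * pi / sqrt (4 * pi * h)"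
        using assms by (simp add: real_sqrt_divide real_sqrt_mult field_simps)
      moreover have "e = exp (- h * (x + y) / 2 + h ^ 3 / 12)" unfolding e_def by (rule arg_cong[where f = exp]) simp
      ultimately show ?thesis unfolding exp_of_real of_real_mult[symmetric] of_real_eq_iff tilted_heat_kernel_def heat_kernel_def by simp
    qed
    finally show ?thesis .
  qed
  finally have "complex_of_real ((2 * pi)\<^sup>2) * complex_of_real (\<integral>l. exp (h * l) * Ai (x + l) * Ai (y + l) \<partial>lborel)
      = complex_of_real ((2 * pi)\<^sup>2) * complex_of_real (tilted_heat_kernel h x y)"
    unfolding prod integral_mult_right_zero integral_complex_of_real by (simp add: power2_eq_square)
  hence "complex_of_real (\<integral>l. exp (h * l) * Ai (x + l) * Ai (y + l) \<partial>lborel) = complex_of_real (tilted_heat_kernel h x y)"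
    by (subst (asm) mult_left_cancel) simp_all
  thus "(\<integral>l. exp (h * l) * Ai (x + l) * Ai (y + l) \<partial>lborel) = tilted_heat_kernel h x y"
    by (simp only: of_real_eq_iff)
qed

section \<open>The Fredholm determinant at two times\<close>

definition time_space :: "real \<Rightarrow> real \<Rightarrow> (real \<times> real) measure" where
  "time_space s t = count_space {s, t} \<Otimes>\<^sub>M lborel"

text \<open>The kernel \<open>R - R N\<close> after the flow property has been used: in the columns of the later time, only the mass below the level
\<open>x\<close> is left of \<open>R z (t, v) = \<integral> R z (s, w) * p w v dw\<close>.\<close>

definition crossing_kernel ::
  "(real \<times> real \<Rightarrow> real \<times> real \<Rightarrow> real) \<Rightarrow> (real \<Rightarrow> real \<Rightarrow> real) \<Rightarrow> real \<Rightarrow> real \<Rightarrow> real \<times> real \<Rightarrow> real \<times> real \<Rightarrow> real" where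
  "crossing_kernel R p s x z z' =
     (if fst z' = s then R z z' else (\<integral>u. indicator {..x} u * (R z (s, u) * p u (snd z')) \<partial>lborel))"

lemma time_space_measurable_fst [measurable]: "fst \<in> borel_measurable (time_space s t)"
  unfolding time_space_def by (rule measurable_compose[OF measurable_fst]) simp

lemma time_space_measurable_snd [measurable]: "snd \<in> borel_measurable (time_space s t)"
  unfolding time_space_def by (rule measurable_compose[OF measurable_snd]) simp

lemma time_space_measurable_Pair [measurable]:
  "Pair r \<in> measurable borel (time_space s t)" if "r \<in> {s, t}"
  unfolding time_space_def using that by (intro measurable_Pair) auto

lemma space_time_space: "space (time_space s t) = {s, t} \<times> UNIV"
  by (simp add: time_space_def space_pair_measure)

lemma level_indicator_measurable [measurable]: "level_indicator lv \<in> borel_measurable (time_space s t)"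
proof -
  have "(\<lambda>z. lv (fst z)) \<in> borel_measurable (time_space s t)"
    unfolding time_space_def by (rule measurable_compose[OF measurable_fst]) simp
  hence "(\<lambda>z. if lv (fst z) < snd z then 1 else (0::real)) \<in> borel_measurable (time_space s t)" by measurable
  moreover have "(\<lambda>z. if lv (fst z) < snd z then 1 else (0::real)) = level_indicator lv"
    by (auto simp: level_indicator_def indicator_def)
  ultimately show ?thesis by simp
qed

lemma level_indicator_01: "level_indicator lv z = 0 \<or> level_indicator lv z = 1"
  by (cases z) (auto simp: level_indicator_def indicator_def)

lemma sqrt_level_indicator: "sqrt (level_indicator lv z) = level_indicator lv z"
  using level_indicator_01[of lv z] by auto

lemma fredholm_det_cong:
  assumes "\<And>z z'. z \<in> space M \<Longrightarrow> z' \<in> space M \<Longrightarrow> K z z' = L z z'"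
  shows "fredholm_det M K = fredholm_det M L"
proof -
  have "(\<integral>z. matrix_det n (\<lambda>i j. K (z i) (z j)) \<partial>(tuples M n))
      = (\<integral>z. matrix_det n (\<lambda>i j. L (z i) (z j)) \<partial>(tuples M n))" for n :: nat
    using assms by (intro Bochner_Integration.integral_cong refl arg_cong[where f = Determinant.det] cong_mat)
      (auto simp: space_PiM PiE_iff)
  thus ?thesis unfolding fredholm_det_def by simp
qed

text \<open>Apply the removal of a nilpotent block to the kernels cut off at the levels. The bound \<open>C * exp (u - v)\<close> on \<open>p\<close> lets one pair
of weights, growing like \<open>exp u\<close> in the rows of time \<open>s\<close>, dominate both \<open>R\<close> and \<open>p\<close>.\<close>

lemma fredholm_det_crossing_reduction:
  fixes R K :: "real \<times> real \<Rightarrow> real \<times> real \<Rightarrow> real" and p :: "real \<Rightarrow> real \<Rightarrow> real"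
  assumes st: "s \<noteq> t"
    and R_meas: "case_prod R \<in> borel_measurable (time_space s t \<Otimes>\<^sub>M time_space s t)"
    and p_meas: "case_prod p \<in> borel_measurable (borel \<Otimes>\<^sub>M borel)"
    and K: "\<And>r r' u u'. r \<in> {s, t} \<Longrightarrow> r' \<in> {s, t} \<Longrightarrow>
        K (r, u) (r', u') = R (r, u) (r', u') - (if r = s \<and> r' = t then p u u' else 0)"
    and R_le: "\<And>r r' u u'. r \<in> {s, t} \<Longrightarrow> r' \<in> {s, t} \<Longrightarrow> \<bar>R (r, u) (r', u')\<bar> \<le> C * exp (- 2 * (u + u'))"
    and p_le: "\<And>u v. lv s < u \<Longrightarrow> lv t < v \<Longrightarrow> \<bar>p u v\<bar> \<le> C * exp (u - v)"
    and semigroup: "\<And>r u v. r \<in> {s, t} \<Longrightarrow> integrable lborel (\<lambda>w. R (r, u) (s, w) * p w v)"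
      "\<And>r u v. r \<in> {s, t} \<Longrightarrow> (\<integral>w. R (r, u) (s, w) * p w v \<partial>lborel) = R (r, u) (t, v)"
  shows "fredholm_det (time_space s t) (\<lambda>z z'. sqrt (level_indicator lv z) * K z z' * sqrt (level_indicator lv z'))
    = fredholm_det (time_space s t) (\<lambda>z z'. level_indicator lv z * crossing_kernel R p s (lv s) z z' * level_indicator lv z')"
    (is "?L = ?Rhs")
proof -
  let ?M = "time_space s t"
  let ?i = "level_indicator lv"
  interpret M: sigma_finite_measure ?M unfolding time_space_def by (rule two_times_sigma_finite)
  have C0: "0 \<le> C" using R_le[of s s 0 0] by simp
  define x y where "x = lv s" and "y = lv t"
  have i_s: "?i (s, u) = indicator {x<..} u" and i_t: "?i (t, u) = indicator {y<..} u" for u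
    by (simp_all add: level_indicator_def x_def y_def)
  have i01: "0 \<le> ?i z" "?i z \<le> 1" "?i z * ?i z = ?i z" for z using level_indicator_01[of lv z] by auto
  define R' where "R' = (\<lambda>z z'. ?i z * R z z' * ?i z')"
  define N where "N = (\<lambda>z z'. if fst z = s \<and> fst z' = t then ?i z * p (snd z) (snd z') * ?i z' else 0)"
  define Q where "Q = (\<lambda>z z'. \<integral>w. R' z w * N w z' \<partial>?M)"
  define D where "D = (C + 1) * exp (3 * \<bar>x\<bar> + 3 * \<bar>y\<bar>)"
  \<comment> \<open>\<open>\<rho> (s, u) * \<kappa>0 (t, v) = exp (u - v)\<close> matches the bound on \<open>p\<close>, and \<open>\<rho> * \<kappa>0\<close> decays like \<open>exp (- u)\<close> at both times\<close>
  define \<rho> where "\<rho> = (\<lambda>z. ?i z * (if fst z = s then exp (snd z) else 1))"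
  define \<kappa>0 where "\<kappa>0 = (\<lambda>z :: real \<times> real. if fst z = s then exp (- 2 * snd z) else exp (- snd z))"
  have D0: "0 < D" using C0 by (simp add: D_def)
  have \<rho>0: "0 \<le> \<rho> z" for z using i01 by (simp add: \<rho>_def)
  have \<kappa>00: "0 < \<kappa>0 z" for z by (simp add: \<kappa>0_def)
  have [measurable]: "(\<lambda>w. fst (fst w)) \<in> borel_measurable (?M \<Otimes>\<^sub>M ?M)" "(\<lambda>w. fst (snd w)) \<in> borel_measurable (?M \<Otimes>\<^sub>M ?M)"
    "(\<lambda>w. snd (fst w)) \<in> borel_measurable (?M \<Otimes>\<^sub>M ?M)" "(\<lambda>w. snd (snd w)) \<in> borel_measurable (?M \<Otimes>\<^sub>M ?M)"
    "(\<lambda>w. ?i (fst w)) \<in> borel_measurable (?M \<Otimes>\<^sub>M ?M)" "(\<lambda>w. ?i (snd w)) \<in> borel_measurable (?M \<Otimes>\<^sub>M ?M)"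
    by (rule measurable_compose[OF measurable_fst] measurable_compose[OF measurable_snd], measurable)+
  have R'_meas: "case_prod R' \<in> borel_measurable (?M \<Otimes>\<^sub>M ?M)"
  proof -
    have "(\<lambda>w. ?i (fst w) * case_prod R w * ?i (snd w)) \<in> borel_measurable (?M \<Otimes>\<^sub>M ?M)" using R_meas by measurable
    also have "(\<lambda>w. ?i (fst w) * case_prod R w * ?i (snd w)) = case_prod R'" by (auto simp: R'_def)
    finally show ?thesis .
  qed
  have N_meas: "case_prod N \<in> borel_measurable (?M \<Otimes>\<^sub>M ?M)"
  proof -
    have "(\<lambda>w. (snd (fst w), snd (snd w))) \<in> measurable (?M \<Otimes>\<^sub>M ?M) (borel \<Otimes>\<^sub>M borel)" by (rule measurable_Pair; measurable)
    from measurable_compose[OF this p_meas]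
    have [measurable]: "(\<lambda>w. p (snd (fst w)) (snd (snd w))) \<in> borel_measurable (?M \<Otimes>\<^sub>M ?M)" by simp
    have "(\<lambda>w. if fst (fst w) = s \<and> fst (snd w) = t then ?i (fst w) * p (snd (fst w)) (snd (snd w)) * ?i (snd w) else 0) \<in> borel_measurable (?M \<Otimes>\<^sub>M ?M)"
      by measurable
    also have "(\<lambda>w. if fst (fst w) = s \<and> fst (snd w) = t then ?i (fst w) * p (snd (fst w)) (snd (snd w)) * ?i (snd w) else 0) = case_prod N"
      by (auto simp: N_def)
    finally show ?thesis .
  qed
  have R'_le: "\<bar>R' z z'\<bar> \<le> \<rho> z * (D * \<kappa>0 z')" if zz: "z \<in> space ?M" "z' \<in> space ?M" for z z'
  proof (cases "?i z = 0 \<or> ?i z' = 0")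
    case True
    thus ?thesis using \<rho>0[of z] D0 \<kappa>00[of z'] by (auto simp: R'_def less_imp_le)
  next
    case False
    hence one: "?i z = 1" "?i z' = 1" using level_indicator_01 by blast+
    obtain r u r' u' where z: "z = (r, u)" "z' = (r', u')" "r \<in> {s, t}" "r' \<in> {s, t}"
      using zz by (cases z; cases z') (auto simp: space_time_space)
    have gt: "r = s \<longrightarrow> x < u" "r = t \<longrightarrow> y < u" "r' = t \<longrightarrow> y < u'"
      using one z(1,2) by (auto simp: i_s i_t indicator_eq_1_iff)
    have u: "exp (- 2 * u) \<le> (if r = s then exp u else 1) * exp (3 * \<bar>x\<bar> + 2 * \<bar>y\<bar>)"
    proof (cases "r = s")
      case True
      hence "- 2 * u \<le> u + (3 * \<bar>x\<bar> + 2 * \<bar>y\<bar>)" using gt(1) by linarith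
      thus ?thesis using True by (simp add: mult_exp_exp)
    next
      case False
      hence "- 2 * u \<le> 3 * \<bar>x\<bar> + 2 * \<bar>y\<bar>" using gt(2) z(3) by (auto simp: abs_if)
      thus ?thesis using False by simp
    qed
    have u': "exp (- 2 * u') \<le> \<kappa>0 (r', u') * exp \<bar>y\<bar>"
    proof (cases "r' = s")
      case True
      thus ?thesis by (simp add: \<kappa>0_def mult_exp_exp)
    next
      case False
      hence "- 2 * u' \<le> - u' + \<bar>y\<bar>" using gt(3) z(4) by (auto simp: abs_if)
      thus ?thesis using False by (simp add: \<kappa>0_def mult_exp_exp)
    qed
    have "\<bar>R' z z'\<bar> \<le> C * (exp (- 2 * u) * exp (- 2 * u'))"
      using R_le[OF z(3,4), of u u'] one by (simp add: R'_def z(1,2) mult_exp_exp algebra_simps)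
    also have "\<dots> \<le> (C + 1) * (((if r = s then exp u else 1) * exp (3 * \<bar>x\<bar> + 2 * \<bar>y\<bar>)) * (\<kappa>0 (r', u') * exp \<bar>y\<bar>))"
      using C0 by (intro mult_mono u u') auto
    also have "\<dots> = \<rho> z * (D * \<kappa>0 z')"
    proof -
      have "exp (3 * \<bar>x\<bar> + 3 * \<bar>y\<bar>) = exp (3 * \<bar>x\<bar> + 2 * \<bar>y\<bar>) * exp \<bar>y\<bar>" by (simp add: mult_exp_exp)
      thus ?thesis using one by (simp add: D_def \<rho>_def z(1,2))
    qed
    finally show ?thesis .
  qed
  have N_le: "\<bar>N z z'\<bar> \<le> \<rho> z * (D * \<kappa>0 z')" for z z'
  proof (cases "fst z = s \<and> fst z' = t \<and> ?i z = 1 \<and> ?i z' = 1")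
    case False
    hence "N z z' = 0" using level_indicator_01[of lv z] level_indicator_01[of lv z'] by (auto simp: N_def)
    thus ?thesis using \<rho>0[of z] D0 \<kappa>00[of z'] by (auto simp: less_imp_le)
  next
    case True
    then obtain u v where z: "z = (s, u)" "z' = (t, v)" by (cases z; cases z') auto
    have uv: "x < u" "y < v" using True by (auto simp: z i_s i_t indicator_def split: if_splits)
    have "\<bar>N z z'\<bar> \<le> C * exp (u - v)" using p_le[of u v] uv True by (simp add: N_def z x_def y_def)
    also have "\<dots> \<le> D * exp (u - v)"
    proof (rule mult_right_mono)
      have "C * 1 \<le> (C + 1) * exp (3 * \<bar>x\<bar> + 3 * \<bar>y\<bar>)" using C0 by (intro mult_mono) auto
      thus "C \<le> D" by (simp add: D_def)
    qed simp
    also have "\<dots> = \<rho> z * (D * \<kappa>0 z')" using True st by (simp add: \<rho>_def \<kappa>0_def z exp_diff exp_minus field_simps)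
    finally show ?thesis .
  qed
  have \<rho>\<kappa>: "integrable ?M (\<lambda>z. \<rho> z * \<kappa>0 z)"
  proof -
    have tail: "integrable lborel (\<lambda>u. indicator {a<..} u * exp (- u))" for a :: real
    proof (rule Bochner_Integration.integrable_bound)
      show "integrable lborel (\<lambda>u. indicator {a..} u * exp (- 1 * u))"
        using exp_tail_integral[of 1 a] by (simp add: has_bochner_integral_iff)
    qed (auto simp: indicator_def)
    have "(\<lambda>z. \<rho> z * \<kappa>0 z) \<in> borel_measurable ?M" unfolding \<rho>_def \<kappa>0_def by measurable
    moreover have "\<rho> (s, u) * \<kappa>0 (s, u) = indicator {x<..} u * exp (- u)" "\<rho> (t, u) * \<kappa>0 (t, u) = indicator {y<..} u * exp (- u)" for u
      using st by (auto simp: \<rho>_def \<kappa>0_def i_s i_t mult_exp_exp)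
    ultimately show "integrable ?M (\<lambda>z. \<rho> z * \<kappa>0 z)"
      unfolding time_space_def using st tail by (intro two_times_integral(1)) (auto simp: time_space_def)
  qed
  define m where "m = (\<integral>z. \<rho> z * \<kappa>0 z \<partial>?M)"
  have m0: "0 \<le> m" unfolding m_def using \<rho>0 \<kappa>00 by (intro Bochner_Integration.integral_nonneg mult_nonneg_nonneg) (auto simp: less_imp_le)
  \<comment> \<open>a common constant for \<open>R'\<close>, \<open>N\<close> and their product\<close>
  define E where "E = D + D * D * m"
  have DE: "D \<le> E" using D0 m0 by (simp add: E_def)
  interpret A: kernel_majorant ?M \<rho> "\<lambda>z. D * \<kappa>0 z"
    using \<rho>0 D0 \<kappa>00 \<rho>\<kappa> by unfold_locales (auto simp: mult.left_commute)
  have domA: "A.dominated R'" "A.dominated N"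
    unfolding A.dominated_def using R'_meas N_meas R'_le N_le by auto
  have Q_le: "\<bar>Q z z'\<bar> \<le> \<rho> z * (E * \<kappa>0 z')" if zz: "z \<in> space ?M" "z' \<in> space ?M" for z z'
  proof -
    have "\<bar>Q z z'\<bar> \<le> (\<integral>w. \<bar>R' z w * N w z'\<bar> \<partial>?M)" unfolding Q_def by (rule integral_abs_bound)
    also have "\<dots> \<le> (\<integral>w. (\<rho> z * (D * D * \<kappa>0 z')) * (\<rho> w * \<kappa>0 w) \<partial>?M)"
    proof (rule integral_mono)
      show "integrable ?M (\<lambda>w. \<bar>R' z w * N w z'\<bar>)" by (intro integrable_abs A.dominated_product_integrable domA zz)
      show "integrable ?M (\<lambda>w. (\<rho> z * (D * D * \<kappa>0 z')) * (\<rho> w * \<kappa>0 w))" by (intro integrable_mult_right \<rho>\<kappa>)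
      fix w assume w: "w \<in> space ?M"
      have "\<bar>R' z w\<bar> * \<bar>N w z'\<bar> \<le> (\<rho> z * (D * \<kappa>0 w)) * (\<rho> w * (D * \<kappa>0 z'))"
        using R'_le[OF zz(1) w] N_le[of w z'] order_trans[OF abs_ge_zero R'_le[OF zz(1) w]] by (intro mult_mono) auto
      thus "\<bar>R' z w * N w z'\<bar> \<le> (\<rho> z * (D * D * \<kappa>0 z')) * (\<rho> w * \<kappa>0 w)" by (simp add: abs_mult mult_ac)
    qed
    also have "\<dots> = \<rho> z * (D * D * m * \<kappa>0 z')" by (simp add: m_def)
    also have "\<dots> \<le> \<rho> z * (E * \<kappa>0 z')" using \<rho>0 \<kappa>00[of z'] D0 by (intro mult_left_mono mult_right_mono) (auto simp: E_def less_imp_le)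
    finally show ?thesis .
  qed
  have Q_meas: "case_prod Q \<in> borel_measurable (?M \<Otimes>\<^sub>M ?M)"
  proof -
    have "(\<lambda>v. (fst (fst v), snd v)) \<in> measurable ((?M \<Otimes>\<^sub>M ?M) \<Otimes>\<^sub>M ?M) (?M \<Otimes>\<^sub>M ?M)" by measurable
    note m1 = measurable_compose[OF this R'_meas]
    have "(\<lambda>v. (snd v, snd (fst v))) \<in> measurable ((?M \<Otimes>\<^sub>M ?M) \<Otimes>\<^sub>M ?M) (?M \<Otimes>\<^sub>M ?M)" by measurable
    note m2 = measurable_compose[OF this N_meas]
    have "(\<lambda>(zz, w). R' (fst zz) w * N w (snd zz)) \<in> borel_measurable ((?M \<Otimes>\<^sub>M ?M) \<Otimes>\<^sub>M ?M)"
      using borel_measurable_times[OF m1 m2] by (simp add: case_prod_unfold)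
    from M.borel_measurable_lebesgue_integral[OF this] show ?thesis
      by (simp add: Q_def case_prod_unfold)
  qed
  interpret B: kernel_majorant ?M \<rho> "\<lambda>z. E * \<kappa>0 z"
    using \<rho>0 D0 DE \<kappa>00 \<rho>\<kappa> by unfold_locales (auto simp: mult.left_commute)
  have up: "\<rho> z * (D * \<kappa>0 z') \<le> \<rho> z * (E * \<kappa>0 z')" for z z'
    using \<rho>0 \<kappa>00[of z'] DE by (intro mult_left_mono mult_right_mono) (auto simp: less_imp_le)
  interpret B: nilpotent_perturbation ?M \<rho> "\<lambda>z. E * \<kappa>0 z" R' N Q "{z. fst z = s}"
  proof unfold_locales
    show "B.dominated R'" unfolding B.dominated_def using R'_meas order_trans[OF R'_le up] by blast
    show "B.dominated N" unfolding B.dominated_def using N_meas order_trans[OF N_le up] by blast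
    show "B.dominated Q" unfolding B.dominated_def using Q_meas Q_le by blast
    show "z \<in> {z. fst z = s} \<and> z' \<notin> {z. fst z = s}" if "N z z' \<noteq> 0" for z z'
      using that st by (auto simp: N_def split: if_splits)
    show "Q z z' = (\<integral>w. R' z w * N w z' \<partial>?M)" for z z' by (simp add: Q_def)
  qed
  have L: "sqrt (?i z) * K z z' * sqrt (?i z') = R' z z' - N z z'" if zz: "z \<in> space ?M" "z' \<in> space ?M" for z z'
  proof -
    obtain r u r' v where z: "z = (r, u)" "z' = (r', v)" "r \<in> {s, t}" "r' \<in> {s, t}"
      using zz by (cases z; cases z') (auto simp: space_time_space)
    define c where "c = (if r = s \<and> r' = t then p u v else 0)"
    have "N z z' = ?i z * c * ?i z'" by (simp add: N_def z(1,2) c_def)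
    moreover have "?i z * K z z' * ?i z' = ?i z * R z z' * ?i z' - ?i z * c * ?i z'"
      using K[OF z(3,4), of u v] unfolding z(1,2) c_def[symmetric] by (simp only: left_diff_distrib right_diff_distrib)
    ultimately show ?thesis unfolding sqrt_level_indicator R'_def by simp
  qed
  have Rhs: "R' z z' - Q z z' = ?i z * crossing_kernel R p s (lv s) z z' * ?i z'" if zz: "z \<in> space ?M" "z' \<in> space ?M" for z z'
  proof -
    obtain r u r' v where z: "z = (r, u)" "z' = (r', v)" "r \<in> {s, t}" "r' \<in> {s, t}"
      using zz by (cases z; cases z') (auto simp: space_time_space)
    show ?thesis
    proof (cases "r' = s")
      case True
      hence "N w z' = 0" for w using st by (simp add: N_def z(2))
      hence "Q z z' = 0" by (simp add: Q_def)
      thus ?thesis using True by (simp add: R'_def crossing_kernel_def z(2))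
    next
      case False
      hence r': "r' = t" using z(4) by auto
      define F where "F = (\<lambda>w. R (r, u) (s, w) * p w v)"
      have F: "integrable lborel F" "(\<integral>w. F w \<partial>lborel) = R (r, u) (t, v)" using semigroup[OF z(3)] by (auto simp: F_def)
      have F1: "integrable lborel (\<lambda>w. indicator {x<..} w * F w)" and F2: "integrable lborel (\<lambda>w. indicator {..x} w * F w)"
        using integrable_mult_indicator[OF _ F(1), of "{x<..}"] integrable_mult_indicator[OF _ F(1), of "{..x}"] by simp_all
      have slice: "R' z (s, w) * N (s, w) z' = (?i z * ?i z') * (indicator {x<..} w * F w)" for w
        using i01(3)[of "(s, w)"] st by (auto simp: R'_def N_def z(1,2) r' i_s F_def indicator_def)
      have "Q z z' = (\<integral>w. R' z (s, w) * N (s, w) z' \<partial>lborel) + (\<integral>w. R' z (t, w) * N (t, w) z' \<partial>lborel)"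
        unfolding Q_def time_space_def
      proof (rule two_times_integral(2)[OF st])
        have "integrable ?M (\<lambda>w. R' z w * N w z')" by (intro A.dominated_product_integrable domA zz)
        thus "(\<lambda>w. R' z w * N w z') \<in> borel_measurable (count_space {s, t} \<Otimes>\<^sub>M lborel)" by (auto simp: time_space_def)
        show "integrable lborel (\<lambda>w. R' z (s, w) * N (s, w) z')" unfolding slice using F1 by (rule integrable_mult_right)
        show "integrable lborel (\<lambda>w. R' z (t, w) * N (t, w) z')" using st by (simp add: N_def)
      qed
      also have "(\<integral>w. R' z (t, w) * N (t, w) z' \<partial>lborel) = 0" using st by (simp add: N_def)
      also have "(\<integral>w. R' z (s, w) * N (s, w) z' \<partial>lborel) = (?i z * ?i z') * (\<integral>w. indicator {x<..} w * F w \<partial>lborel)"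
        unfolding slice by (rule integral_mult_right_zero)
      finally have Q: "Q z z' = (?i z * ?i z') * (\<integral>w. indicator {x<..} w * F w \<partial>lborel)" by simp
      have "(\<integral>w. F w \<partial>lborel) = (\<integral>w. indicator {x<..} w * F w + indicator {..x} w * F w \<partial>lborel)"
        by (intro Bochner_Integration.integral_cong) (auto simp: indicator_def)
      also have "\<dots> = (\<integral>w. indicator {x<..} w * F w \<partial>lborel) + (\<integral>w. indicator {..x} w * F w \<partial>lborel)"
        by (rule Bochner_Integration.integral_add[OF F1 F2])
      finally have "R (r, u) (t, v) - (\<integral>w. indicator {x<..} w * F w \<partial>lborel) = (\<integral>w. indicator {..x} w * F w \<partial>lborel)"
        using F(2) by simp
      moreover have "R' z z' - Q z z' = (?i z * ?i z') * (R (r, u) (t, v) - (\<integral>w. indicator {x<..} w * F w \<partial>lborel))"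
        unfolding Q by (simp add: R'_def z(1,2) r' algebra_simps)
      ultimately show ?thesis using st by (simp add: crossing_kernel_def z(1,2) r' F_def x_def)
    qed
  qed
  have "?L = fredholm_det ?M (\<lambda>z z'. R' z z' - N z z')" by (rule fredholm_det_cong) (rule L)
  also have "\<dots> = fredholm_det ?M (\<lambda>z z'. R' z z' - Q z z')" by (rule B.fredholm_det_nilpotent)
  also have "\<dots> = ?Rhs" by (rule fredholm_det_cong) (rule Rhs)
  finally show ?thesis .
qed

lemma fredholm_det_transpose: "fredholm_det M K = fredholm_det M (\<lambda>z z'. K z' z)"
proof -
  have "matrix_det n (\<lambda>i j. K (z i) (z j)) = matrix_det n (\<lambda>i j. K (z j) (z i))" for n :: nat and z
    by (rule det_mat_transpose)
  thus ?thesis unfolding fredholm_det_def by presburger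
qed

text \<open>Both kernels have their heat part in the block from the earlier to the later time. Transposing the kernel, which does not change
the determinants, puts it into the block from \<open>s\<close> to \<open>t\<close> also if \<open>t < s\<close>. The laws at \<open>s\<close> and \<open>t\<close> can then be treated
without regard to their order.\<close>

definition oriented :: "real \<Rightarrow> real \<Rightarrow> ('b \<Rightarrow> 'b \<Rightarrow> real) \<Rightarrow> 'b \<Rightarrow> 'b \<Rightarrow> real" where
  "oriented s t K = (if s < t then K else (\<lambda>z z'. K z' z))"

lemma two_time_fdd:
  assumes fdd: "has_determinantal_fdd K P A"
  shows "\<P>(\<omega> in P. A s \<omega> \<le> lv s \<and> A t \<omega> \<le> lv t) =
      fredholm_det (time_space s t) (\<lambda>z z'. sqrt (level_indicator lv z) * oriented s t K z z' * sqrt (level_indicator lv z'))"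
proof -
  have "\<P>(\<omega> in P. A s \<omega> \<le> lv s \<and> A t \<omega> \<le> lv t) = \<P>(\<omega> in P. \<forall>r\<in>{s, t}. A r \<omega> \<le> lv r)" by simp
  also have "\<dots> = fredholm_det (time_space s t) (\<lambda>z z'. sqrt (level_indicator lv z) * K z z' * sqrt (level_indicator lv z'))"
    using fdd[unfolded has_determinantal_fdd_def, rule_format, of "{s, t}" lv] by (simp add: time_space_def)
  also have "\<dots> = fredholm_det (time_space s t) (\<lambda>z z'. sqrt (level_indicator lv z) * oriented s t K z z' * sqrt (level_indicator lv z'))"
  proof (cases "s < t")
    case True
    thus ?thesis by (simp add: oriented_def)
  next
    case False
    thus ?thesis by (subst fredholm_det_transpose) (simp add: oriented_def mult_ac)
  qed
  finally show ?thesis .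
qed

section \<open>Probability of crossing a gap\<close>

text \<open>For levels \<open>y' \<ge> y\<close> the two determinants, with and without the columns of time \<open>t\<close>, differ by at most the mass of these
columns above \<open>y'\<close>. Without these columns the determinant does not depend on \<open>y'\<close>, since it does not see the rows of time \<open>t\<close>
either. Letting \<open>y'\<close> tend to infinity identifies it with the probability of \<open>A s \<le> x\<close>.\<close>

lemma crossing_probability_bound:
  fixes A :: "real \<Rightarrow> 'a \<Rightarrow> real" and K R :: "real \<times> real \<Rightarrow> real \<times> real \<Rightarrow> real" and p :: "real \<Rightarrow> real \<Rightarrow> real"
    and w :: "real \<times> real \<Rightarrow> real"
  assumes proc: "real_process P A" and st: "s \<noteq> t"
    and fdd: "\<And>lv. \<P>(\<omega> in P. A s \<omega> \<le> lv s \<and> A t \<omega> \<le> lv t) =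
      fredholm_det (time_space s t) (\<lambda>z z'. sqrt (level_indicator lv z) * K z z' * sqrt (level_indicator lv z'))"
    and R_meas: "case_prod R \<in> borel_measurable (time_space s t \<Otimes>\<^sub>M time_space s t)"
    and p_meas: "case_prod p \<in> borel_measurable (borel \<Otimes>\<^sub>M borel)"
    and K: "\<And>r r' u u'. r \<in> {s, t} \<Longrightarrow> r' \<in> {s, t} \<Longrightarrow>
        K (r, u) (r', u') = R (r, u) (r', u') - (if r = s \<and> r' = t then p u u' else 0)"
    and R_le: "\<And>r r' u u'. r \<in> {s, t} \<Longrightarrow> r' \<in> {s, t} \<Longrightarrow> \<bar>R (r, u) (r', u')\<bar> \<le> C * exp (- 2 * (u + u'))"
    and p_le: "\<And>u v. x < u \<Longrightarrow> y < v \<Longrightarrow> \<bar>p u v\<bar> \<le> C * exp (u - v)"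
    and semigroup: "\<And>r u v. r \<in> {s, t} \<Longrightarrow> integrable lborel (\<lambda>w. R (r, u) (s, w) * p w v)"
      "\<And>r u v. r \<in> {s, t} \<Longrightarrow> (\<integral>w. R (r, u) (s, w) * p w v \<partial>lborel) = R (r, u) (t, v)"
    and w_meas: "w \<in> borel_measurable (time_space s t)" and w_nonneg: "\<And>z. 0 \<le> w z"
    and w_int: "integrable lborel (\<lambda>u. indicator {x<..} u * w (s, u))" "integrable lborel (\<lambda>v. indicator {y<..} v * w (t, v))"
    and m: "(\<integral>u. indicator {x<..} u * w (s, u) \<partial>lborel) + (\<integral>v. indicator {y<..} v * w (t, v) \<partial>lborel) \<le> m" "1 \<le> m"
    and b: "\<And>n. 0 \<le> b n" "summable (\<lambda>n. b n * (2 * m) ^ n / fact n)"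
    and det_le: "\<And>n z. (\<And>i. i < n \<Longrightarrow> fst (z i) = s \<and> x < snd (z i) \<or> fst (z i) = t \<and> y < snd (z i)) \<Longrightarrow>
      \<bar>matrix_det n (\<lambda>i j. crossing_kernel R p s x (z i) (z j))\<bar> \<le> b n * (\<Prod>i<n. w (z i))"
  shows "\<P>(\<omega> in P. A s \<omega> \<le> x \<and> y < A t \<omega>) \<le> (\<integral>v. indicator {y<..} v * w (t, v) \<partial>lborel) * (\<Sum>n. b n * (2 * m) ^ n / fact n)"
proof -
  interpret P: prob_space P using proc by (simp add: real_process_def)
  have [measurable]: "A r \<in> borel_measurable P" for r using proc by (simp add: real_process_def)
  let ?M = "time_space s t"
  have sf: "sigma_finite_measure ?M" unfolding time_space_def by (rule two_times_sigma_finite)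
  define lv where "lv = (\<lambda>y' r. if r = s then x else y' :: real)"
  have lv: "lv y' s = x" "lv y' t = y'" for y' using st by (auto simp: lv_def)
  define Q where "Q = (\<lambda>y' z z'. level_indicator (lv y') z * crossing_kernel R p s x z z' * level_indicator (lv y') z')"
  define Y where "Y = {z \<in> space ?M. fst z = t}"
  define S where "S = (\<Sum>n. b n * (2 * m) ^ n / fact n)"
  define D0 where "D0 = (\<lambda>y'. fredholm_det ?M (\<lambda>z z'. if z' \<in> Y then 0 else Q y' z z'))"
  define T where "T = (\<lambda>y'. \<integral>v. indicator {y'<..} v * w (t, v) \<partial>lborel)"
  have i_s: "level_indicator (lv y') (s, u) = indicator {x<..} u" and i_t: "level_indicator (lv y') (t, u) = indicator {y'<..} u" for y' u
    by (simp_all add: level_indicator_def lv)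
  have D: "\<P>(\<omega> in P. A s \<omega> \<le> x \<and> A t \<omega> \<le> y') = fredholm_det ?M (Q y')" if "y \<le> y'" for y'
  proof -
    have "\<P>(\<omega> in P. A s \<omega> \<le> x \<and> A t \<omega> \<le> y') =
      fredholm_det ?M (\<lambda>z z'. sqrt (level_indicator (lv y') z) * K z z' * sqrt (level_indicator (lv y') z'))"
      using fdd[of "lv y'"] by (simp add: lv)
    also have "\<dots> = fredholm_det ?M (\<lambda>z z'. level_indicator (lv y') z * crossing_kernel R p s (lv y' s) z z' * level_indicator (lv y') z')"
      by (rule fredholm_det_crossing_reduction[OF st R_meas p_meas K R_le _ semigroup]) (use p_le that in \<open>auto simp: lv\<close>)
    finally show ?thesis by (simp add: Q_def lv)
  qed
  have Y_sets: "Y \<in> sets ?M"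
  proof -
    have "{z \<in> space ?M. fst z = t} \<in> sets ?M" by measurable
    thus ?thesis by (simp add: Y_def)
  qed
  have c_meas: "(\<lambda>z. crossing_kernel R p s x (fst z) (snd z)) \<in> borel_measurable (?M \<Otimes>\<^sub>M ?M)"
  proof -
    have [measurable]: "(\<lambda>w. fst (snd w)) \<in> borel_measurable (?M \<Otimes>\<^sub>M ?M)" "(\<lambda>w. snd (snd w)) \<in> borel_measurable (?M \<Otimes>\<^sub>M ?M)"
      by (rule measurable_compose[OF measurable_snd], measurable)+
    have lb: "borel_measurable (X \<Otimes>\<^sub>M lborel) = borel_measurable (X \<Otimes>\<^sub>M borel)" for X :: "'x measure"
      by (intro measurable_cong_sets sets_pair_measure_cong) auto
    have [measurable]: "(\<lambda>q. R (fst (fst q)) (s, snd q)) \<in> borel_measurable ((?M \<Otimes>\<^sub>M ?M) \<Otimes>\<^sub>M borel)"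
    proof -
      have "Pair s \<in> measurable borel ?M" by (rule time_space_measurable_Pair) simp
      hence "(\<lambda>q. (fst (fst q), (s, snd q))) \<in> measurable ((?M \<Otimes>\<^sub>M ?M) \<Otimes>\<^sub>M borel) (?M \<Otimes>\<^sub>M ?M)"
        by (intro measurable_Pair measurable_compose[OF measurable_snd]) auto
      from measurable_compose[OF this R_meas] show ?thesis by simp
    qed
    have [measurable]: "(\<lambda>q. p (snd q) (snd (snd (fst q)))) \<in> borel_measurable ((?M \<Otimes>\<^sub>M ?M) \<Otimes>\<^sub>M borel)"
    proof -
      have "(\<lambda>q. snd q) \<in> borel_measurable ((?M \<Otimes>\<^sub>M ?M) \<Otimes>\<^sub>M borel)" by measurable
      moreover have "(\<lambda>q. snd (snd (fst q))) \<in> borel_measurable ((?M \<Otimes>\<^sub>M ?M) \<Otimes>\<^sub>M borel)"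
        by (rule measurable_compose[OF measurable_fst]) measurable
      ultimately have "(\<lambda>q. (snd q, snd (snd (fst q)))) \<in> measurable ((?M \<Otimes>\<^sub>M ?M) \<Otimes>\<^sub>M borel) (borel \<Otimes>\<^sub>M borel)" by (rule measurable_Pair)
      from measurable_compose[OF this p_meas] show ?thesis by simp
    qed
    have [measurable]: "(\<lambda>q. R (fst q) (snd q)) \<in> borel_measurable (?M \<Otimes>\<^sub>M ?M)" using R_meas by (simp add: case_prod_unfold)
    have "(\<lambda>(q, u). indicator {..x} u * (R (fst q) (s, u) * p u (snd (snd q)))) \<in> borel_measurable ((?M \<Otimes>\<^sub>M ?M) \<Otimes>\<^sub>M lborel)"
      unfolding case_prod_unfold lb by measurable
    from lborel.borel_measurable_lebesgue_integral[OF this]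
    have [measurable]: "(\<lambda>q. \<integral>u. indicator {..x} u * (R (fst q) (s, u) * p u (snd (snd q))) \<partial>lborel) \<in> borel_measurable (?M \<Otimes>\<^sub>M ?M)" .
    show ?thesis unfolding crossing_kernel_def by measurable
  qed
  have Q_meas: "case_prod (Q y') \<in> borel_measurable (?M \<Otimes>\<^sub>M ?M)" for y'
  proof -
    have "(\<lambda>q. level_indicator (lv y') (fst q)) \<in> borel_measurable (?M \<Otimes>\<^sub>M ?M)" "(\<lambda>q. level_indicator (lv y') (snd q)) \<in> borel_measurable (?M \<Otimes>\<^sub>M ?M)"
      by measurable
    hence "(\<lambda>q. level_indicator (lv y') (fst q) * crossing_kernel R p s x (fst q) (snd q) * level_indicator (lv y') (snd q)) \<in> borel_measurable (?M \<Otimes>\<^sub>M ?M)"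
      using c_meas by measurable
    thus ?thesis by (simp add: Q_def case_prod_unfold)
  qed
  have shift: "integrable lborel (\<lambda>v. indicator {y'<..} v * w (t, v))" "T y' \<le> T y" if "y \<le> y'" for y'
  proof -
    have [measurable]: "(\<lambda>v. w (t, v)) \<in> borel_measurable borel"
      by (rule measurable_compose[OF time_space_measurable_Pair w_meas]) simp
    show i: "integrable lborel (\<lambda>v. indicator {y'<..} v * w (t, v))"
      by (rule Bochner_Integration.integrable_bound[OF w_int(2)]) (use that w_nonneg in \<open>auto simp: indicator_def\<close>)
    show "T y' \<le> T y" unfolding T_def
      by (rule integral_mono[OF i w_int(2)]) (use that w_nonneg in \<open>auto simp: indicator_def\<close>)
  qed
  have close: "\<bar>fredholm_det ?M (Q y') - D0 y'\<bar> \<le> T y' * S" if y': "y \<le> y'" for y'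
  proof -
    define g where "g = (\<lambda>z. level_indicator (lv y') z * w z)"
    have g_meas: "g \<in> borel_measurable ?M" unfolding g_def using w_meas by measurable
    have g_i: "integrable lborel (\<lambda>u. g (s, u))" "integrable lborel (\<lambda>u. g (t, u))"
      unfolding g_def i_s i_t using w_int(1) shift(1)[OF y'] by auto
    note two = two_times_integral[OF st g_meas[unfolded time_space_def] g_i, folded time_space_def]
    have g_val: "(\<integral>z. g z \<partial>?M) \<le> m"
      unfolding two(2) using m(1) shift(2)[OF y'] by (simp add: g_def i_s i_t T_def)
    have "(\<lambda>z. indicator Y z * g z) \<in> borel_measurable ?M" using g_meas Y_sets by measurable
    moreover have Ys: "indicator Y (s, u) * g (s, u) = 0" and Yt: "indicator Y (t, u) * g (t, u) = indicator {y'<..} u * w (t, u)" for u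
      using st by (auto simp: Y_def space_time_space indicator_def g_def i_t)
    ultimately have gY: "(\<integral>z. indicator Y z * g z \<partial>?M) = T y'"
      unfolding time_space_def T_def
      by (subst two_times_integral(2)[OF st]) (use g_i(2) shift(1)[OF y'] in \<open>simp_all only: time_space_def Ys Yt integrable_zero Bochner_Integration.integral_zero add_0_left\<close>)
    have "\<bar>fredholm_det ?M (Q y') - fredholm_det ?M (\<lambda>z z'. if z' \<in> Y then 0 else Q y' z z')\<bar>
      \<le> (\<integral>z. indicator Y z * g z \<partial>?M) * (\<Sum>n. b n * (2 * m) ^ n / fact n)"
    proof (rule fredholm_det_kill_columns[OF sf Q_meas Y_sets two(1) _ g_val m(2) b])
      show "0 \<le> g z" for z using w_nonneg[of z] level_indicator_01[of "lv y'" z] by (auto simp: g_def)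
      fix n and z :: "nat \<Rightarrow> real \<times> real" assume z: "z \<in> space (tuples ?M n)"
      have zi: "fst (z i) \<in> {s, t}" if "i < n" for i
        using z that by (auto simp: space_PiM PiE_iff space_time_space mem_Times_iff)
      show "\<bar>matrix_det n (\<lambda>i j. Q y' (z i) (z j))\<bar> \<le> b n * (\<Prod>i<n. g (z i))"
      proof (cases "\<forall>i<n. level_indicator (lv y') (z i) = 1")
        case True
        have "matrix_det n (\<lambda>i j. Q y' (z i) (z j)) = matrix_det n (\<lambda>i j. crossing_kernel R p s x (z i) (z j))"
          using True by (intro arg_cong[where f = Determinant.det] cong_mat) (auto simp: Q_def)
        moreover have "(\<Prod>i<n. g (z i)) = (\<Prod>i<n. w (z i))" using True by (intro prod.cong) (auto simp: g_def)
        moreover have "fst (z i) = s \<and> x < snd (z i) \<or> fst (z i) = t \<and> y < snd (z i)" if "i < n" for i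
        proof -
          obtain r u where ru: "z i = (r, u)" by (cases "z i")
          have "level_indicator (lv y') (r, u) = 1" using True that ru by auto
          thus ?thesis using zi[OF that] y' ru by (auto simp: i_s i_t indicator_eq_1_iff)
        qed
        ultimately show ?thesis using det_le[of n z] by simp
      next
        case False
        then obtain q where q: "q < n" "level_indicator (lv y') (z q) = 0" using level_indicator_01 by blast
        have "matrix_det n (\<lambda>i j. Q y' (z i) (z j)) = 0"
          using q by (intro det_zero_column[OF q(1)]) (simp add: Q_def)
        moreover have "(\<Prod>i<n. g (z i)) = 0" using q by (intro prod_zero) (auto simp: g_def)
        ultimately show ?thesis by (simp only: abs_zero mult_zero_right order_refl)
      qed
    qed
    thus ?thesis unfolding gY D0_def S_def .
  qed
  \<comment> \<open>a determinant with a variable at time \<open>t\<close> has a zero column, and the others do not involve the level at \<open>t\<close>\<close>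
  have D0_const: "D0 y' = D0 y" for y'
    unfolding D0_def
  proof -
    have "(\<integral>z. matrix_det n (\<lambda>i j. if z j \<in> Y then 0 else Q y' (z i) (z j)) \<partial>(tuples ?M n))
      = (\<integral>z. matrix_det n (\<lambda>i j. if z j \<in> Y then 0 else Q y (z i) (z j)) \<partial>(tuples ?M n))" for n :: nat
    proof (rule Bochner_Integration.integral_cong[OF refl])
      fix z assume z: "z \<in> space (tuples ?M n)"
      show "matrix_det n (\<lambda>i j. if z j \<in> Y then 0 else Q y' (z i) (z j))
        = matrix_det n (\<lambda>i j. if z j \<in> Y then 0 else Q y (z i) (z j))"
      proof (cases "\<exists>q<n. z q \<in> Y")
        case True
        then obtain q where "q < n" "z q \<in> Y" by blast
        thus ?thesis by (simp add: det_zero_column)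
      next
        case False
        have "level_indicator (lv y') (z i) = level_indicator (lv y) (z i)" if "i < n" for i
        proof -
          have "z i \<in> space ?M" using z that by (auto simp: space_PiM PiE_iff)
          moreover have "z i \<notin> Y" using False that by blast
          ultimately obtain u where "z i = (s, u)" by (cases "z i") (auto simp: Y_def space_time_space)
          thus ?thesis by (simp add: i_s)
        qed
        thus ?thesis by (intro arg_cong[where f = Determinant.det] cong_mat) (auto simp: Q_def)
      qed
    qed
    thus "fredholm_det ?M (\<lambda>z z'. if z' \<in> Y then 0 else Q y' z z') = fredholm_det ?M (\<lambda>z z'. if z' \<in> Y then 0 else Q y z z')"
      unfolding fredholm_det_def by simp
  qed
  \<comment> \<open>let the upper level tend to infinity\<close>
  have T_lim: "(\<lambda>k. T (y + real k)) \<longlonglongrightarrow> 0"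
  proof -
    have [measurable]: "(\<lambda>v. w (t, v)) \<in> borel_measurable borel"
      by (rule measurable_compose[OF time_space_measurable_Pair w_meas]) simp
    have "(\<lambda>k. \<integral>v. indicator {y + real k<..} v * w (t, v) \<partial>lborel) \<longlonglongrightarrow> (\<integral>v. 0 \<partial>(lborel :: real measure))"
    proof (rule integral_dominated_convergence[where w = "\<lambda>v. indicator {y<..} v * w (t, v)"])
      show "integrable lborel (\<lambda>v. indicator {y<..} v * w (t, v))" by (rule w_int(2))
      show "AE v in lborel. (\<lambda>k. indicator {y + real k<..} v * w (t, v)) \<longlonglongrightarrow> 0"
      proof (rule AE_I2)
        fix v :: real
        obtain N where N: "v - y \<le> real N" using real_arch_simple[of "v - y"] by blast
        have "eventually (\<lambda>k. indicator {y + real k<..} v * w (t, v) = 0) sequentially"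
          using eventually_ge_at_top[of N]
        proof eventually_elim
          case (elim k)
          hence "real N \<le> real k" by simp
          hence "v \<le> y + real k" using N by linarith
          thus ?case by (simp add: indicator_def)
        qed
        thus "(\<lambda>k. indicator {y + real k<..} v * w (t, v)) \<longlonglongrightarrow> 0" by (rule tendsto_eventually)
      qed
      show "AE v in lborel. norm (indicator {y + real k<..} v * w (t, v)) \<le> indicator {y<..} v * w (t, v)" for k
        using w_nonneg by (auto simp: indicator_def)
    qed measurable
    thus ?thesis by (simp add: T_def)
  qed
  have lim1: "(\<lambda>k. fredholm_det ?M (Q (y + real k))) \<longlonglongrightarrow> D0 y"
  proof (rule LIM_zero_cancel, rule Lim_null_comparison)
    show "\<forall>\<^sub>F k in sequentially. norm (fredholm_det ?M (Q (y + real k)) - D0 y) \<le> T (y + real k) * S"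
    proof (rule always_eventually, rule allI)
      fix k
      show "norm (fredholm_det ?M (Q (y + real k)) - D0 y) \<le> T (y + real k) * S"
        using close[of "y + real k"] unfolding D0_const[of "y + real k"] by simp
    qed
    show "(\<lambda>k. T (y + real k) * S) \<longlonglongrightarrow> 0" using T_lim by (rule tendsto_mult_left_zero)
  qed
  have lim2: "(\<lambda>k. \<P>(\<omega> in P. A s \<omega> \<le> x \<and> A t \<omega> \<le> y + real k)) \<longlonglongrightarrow> \<P>(\<omega> in P. A s \<omega> \<le> x)"
  proof -
    have inc: "incseq (\<lambda>k. {\<omega> \<in> space P. A s \<omega> \<le> x \<and> A t \<omega> \<le> y + real k})"
      by (rule incseq_SucI) auto
    have un: "(\<Union>k. {\<omega> \<in> space P. A s \<omega> \<le> x \<and> A t \<omega> \<le> y + real k}) = {\<omega> \<in> space P. A s \<omega> \<le> x}"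
    proof (intro equalityI subsetI)
      fix \<omega> assume \<omega>: "\<omega> \<in> {\<omega> \<in> space P. A s \<omega> \<le> x}"
      obtain N where "A t \<omega> - y \<le> real N" using real_arch_simple[of "A t \<omega> - y"] by blast
      hence "A t \<omega> \<le> y + real N" by linarith
      thus "\<omega> \<in> (\<Union>k. {\<omega> \<in> space P. A s \<omega> \<le> x \<and> A t \<omega> \<le> y + real k})" using \<omega> by (auto intro!: exI[of _ N])
    qed auto
    have "(\<lambda>k. measure P {\<omega> \<in> space P. A s \<omega> \<le> x \<and> A t \<omega> \<le> y + real k}) \<longlonglongrightarrow> measure P (\<Union>k. {\<omega> \<in> space P. A s \<omega> \<le> x \<and> A t \<omega> \<le> y + real k})"
      by (rule P.finite_Lim_measure_incseq[OF _ inc]) auto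
    thus ?thesis unfolding un .
  qed
  have "(\<lambda>k. \<P>(\<omega> in P. A s \<omega> \<le> x \<and> A t \<omega> \<le> y + real k)) \<longlonglongrightarrow> D0 y"
    using lim1 by (subst D) auto
  hence D0: "\<P>(\<omega> in P. A s \<omega> \<le> x) = D0 y" using lim2 LIMSEQ_unique by blast
  have "{\<omega> \<in> space P. A s \<omega> \<le> x} = {\<omega> \<in> space P. A s \<omega> \<le> x \<and> A t \<omega> \<le> y} \<union> {\<omega> \<in> space P. A s \<omega> \<le> x \<and> y < A t \<omega>}" by auto
  hence "\<P>(\<omega> in P. A s \<omega> \<le> x) = \<P>(\<omega> in P. A s \<omega> \<le> x \<and> A t \<omega> \<le> y) + \<P>(\<omega> in P. A s \<omega> \<le> x \<and> y < A t \<omega>)"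
    by (simp only:, intro P.finite_measure_Union) auto
  hence "\<P>(\<omega> in P. A s \<omega> \<le> x \<and> y < A t \<omega>) = D0 y - fredholm_det ?M (Q y)"
    using D0 D[of y] by simp
  also have "\<dots> \<le> T y * S" using close[of y] by simp
  finally show ?thesis by (simp add: T_def S_def)
qed

section \<open>Gaussian and exponential tails\<close>

lemma exp_window_le:
  assumes "0 \<le> c" "c * L \<le> b" "- L \<le> (u::real)"
  shows "exp (- c * u) \<le> exp b"
  using mult_left_mono[OF assms(3,1)] assms(2) by simp

text \<open>A parabola lies above its tangents.\<close>

lemma heat_kernel_le_exp:
  assumes "h > 0"
  shows "heat_kernel h w \<le> exp h / sqrt (4 * pi * h) * exp w"
proof -
  have "0 \<le> (w / 2 + h)\<^sup>2 / h" using assms by simp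
  also have "\<dots> = w\<^sup>2 / (4 * h) + w + h" using assms by (simp add: field_simps power2_eq_square)
  finally have "exp (- (w\<^sup>2 / (4 * h))) \<le> exp (h + w)" by simp
  hence "1 / sqrt (4 * pi * h) * exp (- (w\<^sup>2 / (4 * h))) \<le> 1 / sqrt (4 * pi * h) * exp (h + w)"
    using assms by (intro mult_left_mono) auto
  thus ?thesis unfolding heat_kernel_def by (simp add: exp_add)
qed

text \<open>Half of the exponent is spent on crossing the gap from \<open>x\<close> to \<open>v\<close>, the other half is kept as a heat kernel of twice the time.\<close>

lemma heat_kernel_far:
  assumes h: "h > 0" and wx: "w \<le> x" "x \<le> v"
  shows "heat_kernel h (w - v) \<le> 2 * exp (- ((v - x)\<^sup>2 / (8 * h))) * heat_kernel (2 * h) (w - v)"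
proof -
  have sq: "(v - x)\<^sup>2 \<le> (w - v)\<^sup>2" using wx power_mono[of "v - x" "v - w" 2] by (simp add: power2_commute[of w])
  have "exp (- ((w - v)\<^sup>2 / (4 * h))) = exp (- ((w - v)\<^sup>2 / (8 * h))) * exp (- ((w - v)\<^sup>2 / (4 * (2 * h))))"
    using h by (simp add: mult_exp_exp field_simps)
  also have "\<dots> \<le> exp (- ((v - x)\<^sup>2 / (8 * h))) * exp (- ((w - v)\<^sup>2 / (4 * (2 * h))))"
    using sq h by (intro mult_right_mono) (auto intro!: divide_right_mono)
  finally have e: "exp (- ((w - v)\<^sup>2 / (4 * h))) \<le> exp (- ((v - x)\<^sup>2 / (8 * h))) * exp (- ((w - v)\<^sup>2 / (4 * (2 * h))))" .
  have "sqrt (4 * pi * (2 * h)) \<le> sqrt (4 * (4 * pi * h))" using h by (intro real_sqrt_le_mono) simp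
  also have "\<dots> = 2 * sqrt (4 * pi * h)" by (subst real_sqrt_mult) simp
  finally have "sqrt (4 * pi * (2 * h)) \<le> 2 * sqrt (4 * pi * h)" .
  hence c: "1 / sqrt (4 * pi * h) \<le> 2 * (1 / sqrt (4 * pi * (2 * h)))"
    using h by (simp add: divide_simps mult_ac del: real_sqrt_mult)
  have "heat_kernel h (w - v) \<le> (2 * (1 / sqrt (4 * pi * (2 * h)))) * (exp (- ((v - x)\<^sup>2 / (8 * h))) * exp (- ((w - v)\<^sup>2 / (4 * (2 * h)))))"
    unfolding heat_kernel_def using h by (intro mult_mono c e) auto
  thus ?thesis unfolding heat_kernel_def by (simp add: mult_ac)
qed

lemma heat_kernel_far_integral:
  fixes q :: real
  assumes h: "h > 0" and xv: "x \<le> v"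
  shows "integrable lborel (\<lambda>w. indicator {..x} w * (exp (- q * w) * heat_kernel h (w - v)))"
    and "(\<integral>w. indicator {..x} w * (exp (- q * w) * heat_kernel h (w - v)) \<partial>lborel)
      \<le> 2 * exp (- ((v - x)\<^sup>2 / (8 * h))) * exp (- q * v + 2 * h * q\<^sup>2)"
proof -
  have "integrable lborel (\<lambda>w. heat_kernel h (w - v) * exp ((- q) * w))" by (rule heat_kernel_exp_real[OF h])
  from integrable_mult_indicator[OF _ this, of "{..x}"]
  show i: "integrable lborel (\<lambda>w. indicator {..x} w * (exp (- q * w) * heat_kernel h (w - v)))" by (simp add: mult.commute)
  have "(\<integral>w. indicator {..x} w * (exp (- q * w) * heat_kernel h (w - v)) \<partial>lborel)
     \<le> (\<integral>w. 2 * exp (- ((v - x)\<^sup>2 / (8 * h))) * (heat_kernel (2 * h) (w - v) * exp ((- q) * w)) \<partial>lborel)"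
  proof (rule integral_mono[OF i])
    show "integrable lborel (\<lambda>w. 2 * exp (- ((v - x)\<^sup>2 / (8 * h))) * (heat_kernel (2 * h) (w - v) * exp ((- q) * w)))"
      using h by (intro integrable_mult_right heat_kernel_exp_real) auto
    fix w
    show "indicator {..x} w * (exp (- q * w) * heat_kernel h (w - v)) \<le> 2 * exp (- ((v - x)\<^sup>2 / (8 * h))) * (heat_kernel (2 * h) (w - v) * exp ((- q) * w))"
    proof (cases "w \<le> x")
      case True
      have "exp (- q * w) * heat_kernel h (w - v) \<le> exp (- q * w) * (2 * exp (- ((v - x)\<^sup>2 / (8 * h))) * heat_kernel (2 * h) (w - v))"
        by (rule mult_left_mono[OF heat_kernel_far[OF h True xv]]) simp
      thus ?thesis using True by (simp add: mult_ac)
    next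
      case False
      thus ?thesis using h by (simp add: heat_kernel_nonneg)
    qed
  qed
  also have "\<dots> = 2 * exp (- ((v - x)\<^sup>2 / (8 * h))) * exp (- q * v + 2 * h * q\<^sup>2)"
    unfolding integral_mult_right_zero using heat_kernel_exp_real(2)[of "2 * h" v "- q"] h by simp
  finally show "(\<integral>w. indicator {..x} w * (exp (- q * w) * heat_kernel h (w - v)) \<partial>lborel)
      \<le> 2 * exp (- ((v - x)\<^sup>2 / (8 * h))) * exp (- q * v + 2 * h * q\<^sup>2)" .
qed

text \<open>Again half of the exponent is kept for integrability.\<close>

lemma gaussian_tail:
  fixes x y h D :: real
  assumes h: "0 < h" "h \<le> 1" and xy: "x \<le> y" and D: "0 \<le> D"
  shows "integrable lborel (\<lambda>v. indicator {y<..} v * (D * exp (- ((v - x)\<^sup>2 / (8 * h)))))"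
    and "(\<integral>v. indicator {y<..} v * (D * exp (- ((v - x)\<^sup>2 / (8 * h)))) \<partial>lborel) \<le> 8 * D * exp (- ((y - x)\<^sup>2 / (16 * h)))"
proof -
  have gi: "integrable lborel (\<lambda>v. exp (- ((v - x)\<^sup>2 / (16 * h))))"
    and gv: "(\<integral>v. exp (- ((v - x)\<^sup>2 / (16 * h))) \<partial>lborel) \<le> 8"
  proof -
    have eq: "exp (- ((v - x)\<^sup>2 / (16 * h))) = sqrt (4 * pi * (4 * h)) * (heat_kernel (4 * h) (v - x) * exp (0 * v))" for v
      using h by (simp add: heat_kernel_def)
    show "integrable lborel (\<lambda>v. exp (- ((v - x)\<^sup>2 / (16 * h))))"
      unfolding eq using h by (intro integrable_mult_right heat_kernel_exp_real) auto
    have "(\<integral>v. exp (- ((v - x)\<^sup>2 / (16 * h))) \<partial>lborel) = sqrt (4 * pi * (4 * h))"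
      unfolding eq integral_mult_right_zero using h by (subst heat_kernel_exp_real(2)) auto
    also have "\<dots> \<le> sqrt (8\<^sup>2)"
    proof (rule real_sqrt_le_mono)
      have "4 * pi * (4 * h) \<le> 4 * 4 * (4 * 1)" using h pi_less_4 by (intro mult_mono) auto
      thus "4 * pi * (4 * h) \<le> 8\<^sup>2" by simp
    qed
    finally show "(\<integral>v. exp (- ((v - x)\<^sup>2 / (16 * h))) \<partial>lborel) \<le> 8" by simp
  qed
  have le: "indicator {y<..} v * (D * exp (- ((v - x)\<^sup>2 / (8 * h)))) \<le> (D * exp (- ((y - x)\<^sup>2 / (16 * h)))) * exp (- ((v - x)\<^sup>2 / (16 * h)))" for v
  proof (cases "y < v")
    case True
    have "(y - x)\<^sup>2 \<le> (v - x)\<^sup>2" using True xy by (intro power_mono) auto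
    hence "(y - x)\<^sup>2 / (16 * h) + (v - x)\<^sup>2 / (16 * h) \<le> (v - x)\<^sup>2 / (8 * h)" using h by (simp add: field_simps)
    hence "exp (- ((v - x)\<^sup>2 / (8 * h))) \<le> exp (- ((y - x)\<^sup>2 / (16 * h))) * exp (- ((v - x)\<^sup>2 / (16 * h)))"
      by (simp add: mult_exp_exp)
    from mult_left_mono[OF this D] show ?thesis using True by (simp add: mult.assoc)
  next
    case False
    thus ?thesis using D by simp
  qed
  show i: "integrable lborel (\<lambda>v. indicator {y<..} v * (D * exp (- ((v - x)\<^sup>2 / (8 * h)))))"
  proof (rule Bochner_Integration.integrable_bound)
    show "integrable lborel (\<lambda>v. (D * exp (- ((y - x)\<^sup>2 / (16 * h)))) * exp (- ((v - x)\<^sup>2 / (16 * h))))"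
      by (intro integrable_mult_right gi)
    show "AE v in lborel. norm (indicator {y<..} v * (D * exp (- ((v - x)\<^sup>2 / (8 * h))))) \<le> norm ((D * exp (- ((y - x)\<^sup>2 / (16 * h)))) * exp (- ((v - x)\<^sup>2 / (16 * h))))"
    proof (rule AE_I2)
      fix v
      show "norm (indicator {y<..} v * (D * exp (- ((v - x)\<^sup>2 / (8 * h))))) \<le> norm ((D * exp (- ((y - x)\<^sup>2 / (16 * h)))) * exp (- ((v - x)\<^sup>2 / (16 * h))))"
        using le[of v] D by (simp add: abs_mult)
    qed
  qed measurable
  have "(\<integral>v. indicator {y<..} v * (D * exp (- ((v - x)\<^sup>2 / (8 * h)))) \<partial>lborel)
     \<le> (\<integral>v. (D * exp (- ((y - x)\<^sup>2 / (16 * h)))) * exp (- ((v - x)\<^sup>2 / (16 * h))) \<partial>lborel)"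
    by (rule integral_mono[OF i _ le]) (intro integrable_mult_right gi)
  also have "\<dots> \<le> (D * exp (- ((y - x)\<^sup>2 / (16 * h)))) * 8"
    unfolding integral_mult_right_zero using D by (intro mult_left_mono gv) auto
  finally show "(\<integral>v. indicator {y<..} v * (D * exp (- ((v - x)\<^sup>2 / (8 * h)))) \<partial>lborel) \<le> 8 * D * exp (- ((y - x)\<^sup>2 / (16 * h)))"
    by (simp add: mult_ac)
qed

text \<open>The decay rate \<open>2 / L\<close> is slow enough for the weight to be bounded on \<open>[- L, 0]\<close>, so that the integral is only of order \<open>L\<close>.\<close>

lemma exp_window_integral:
  fixes L x D :: real
  assumes L: "1 \<le> L" and x: "- L \<le> x" and D: "0 \<le> D"
  shows "integrable lborel (\<lambda>u. indicator {x<..} u * (D * exp (- (2 / L) * u)))"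
    and "(\<integral>u. indicator {x<..} u * (D * exp (- (2 / L) * u)) \<partial>lborel) \<le> D * (4 * L)"
proof -
  have c: "0 < 2 / L" using L by simp
  have hb: "has_bochner_integral lborel (\<lambda>u. indicator {- L..} u * exp (- (2 / L) * u)) (exp (- (2 / L) * - L) / (2 / L))"
    by (rule exp_tail_integral[OF c])
  have i1: "integrable lborel (\<lambda>u. D * (indicator {- L..} u * exp (- (2 / L) * u)))"
    using hb by (intro integrable_mult_right) (simp add: has_bochner_integral_iff)
  show i: "integrable lborel (\<lambda>u. indicator {x<..} u * (D * exp (- (2 / L) * u)))"
    by (rule Bochner_Integration.integrable_bound[OF i1]) (use x D in \<open>auto simp: indicator_def abs_mult\<close>)
  have "(\<integral>u. indicator {x<..} u * (D * exp (- (2 / L) * u)) \<partial>lborel) \<le> (\<integral>u. D * (indicator {- L..} u * exp (- (2 / L) * u)) \<partial>lborel)"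
    by (rule integral_mono[OF i i1]) (use x D in \<open>auto simp: indicator_def\<close>)
  also have "\<dots> = D * (exp 2 * (L / 2))"
    using hb L by (simp add: has_bochner_integral_iff)
  also have "\<dots> \<le> D * (4 * L)"
  proof (rule mult_left_mono[OF _ D])
    have "exp (2::real) \<le> 8"
    proof -
      have "exp (1::real) \<le> 272 / 100" using e_less_272 by simp
      hence "exp (1::real) * exp 1 \<le> 272 / 100 * (272 / 100)" by (intro mult_mono) auto
      thus ?thesis by (simp add: mult_exp_exp)
    qed
    thus "exp 2 * (L / 2) \<le> 4 * L" using L by simp
  qed
  finally show "(\<integral>u. indicator {x<..} u * (D * exp (- (2 / L) * u)) \<partial>lborel) \<le> D * (4 * L)" .
qed

section \<open>Crossings of the Airy\<open>\<^sub>1\<close> process\<close>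

text \<open>Common to both processes: weights of order one on \<open>[- L, \<infinity>)\<close> at time \<open>s\<close> and Gaussian weights at time \<open>t\<close>. If the latter have
mass more than \<open>1\<close>, then the claimed bound exceeds \<open>1\<close>; otherwise the total mass is of the order of the first one.\<close>

lemma crossing_probability_gaussian:
  fixes A :: "real \<Rightarrow> 'a \<Rightarrow> real" and Ker R :: "real \<times> real \<Rightarrow> real \<times> real \<Rightarrow> real" and p :: "real \<Rightarrow> real \<Rightarrow> real"
  assumes proc: "real_process P A" and fdd: "has_determinantal_fdd Ker P A"
    and h: "h = \<bar>t - s\<bar>" "0 < h" "h \<le> 1" and L: "1 \<le> L" "- L \<le> x" "x < y" and D: "0 \<le> D1" "0 \<le> D2"
    and R_meas: "case_prod R \<in> borel_measurable (time_space s t \<Otimes>\<^sub>M time_space s t)"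
    and p_meas: "case_prod p \<in> borel_measurable (borel \<Otimes>\<^sub>M borel)"
    and K: "\<And>r r' u u'. r \<in> {s, t} \<Longrightarrow> r' \<in> {s, t} \<Longrightarrow>
        oriented s t Ker (r, u) (r', u') = R (r, u) (r', u') - (if r = s \<and> r' = t then p u u' else 0)"
    and R_le: "\<And>r r' u u'. r \<in> {s, t} \<Longrightarrow> r' \<in> {s, t} \<Longrightarrow> \<bar>R (r, u) (r', u')\<bar> \<le> C * exp (- 2 * (u + u'))"
    and p_le: "\<And>u v. x < u \<Longrightarrow> y < v \<Longrightarrow> \<bar>p u v\<bar> \<le> C' * exp (u - v)"
    and semigroup: "\<And>r u v. r \<in> {s, t} \<Longrightarrow> integrable lborel (\<lambda>w. R (r, u) (s, w) * p w v)"
      "\<And>r u v. r \<in> {s, t} \<Longrightarrow> (\<integral>w. R (r, u) (s, w) * p w v \<partial>lborel) = R (r, u) (t, v)"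
    and b: "\<And>n. 0 \<le> b n" "summable (\<lambda>n. b n * (2 * (D1 * (4 * L) + 1)) ^ n / fact n)"
    and S: "(\<Sum>n. b n * (2 * (D1 * (4 * L) + 1)) ^ n / fact n) \<le> S" "1 \<le> S"
    and det_le: "\<And>n z. (\<And>i. i < n \<Longrightarrow> fst (z i) = s \<and> x < snd (z i) \<or> fst (z i) = t \<and> y < snd (z i)) \<Longrightarrow>
      \<bar>matrix_det n (\<lambda>i j. crossing_kernel R p s x (z i) (z j))\<bar>
        \<le> b n * (\<Prod>i<n. if fst (z i) = s then D1 * exp (- (2 / L) * snd (z i)) else D2 * exp (- ((snd (z i) - x)\<^sup>2 / (8 * h))))"
  shows "\<P>(\<omega> in P. A s \<omega> \<le> x \<and> y < A t \<omega>) \<le> 8 * D2 * S * exp (- ((y - x)\<^sup>2 / (16 * h)))"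
proof -
  interpret P: prob_space P using proc by (simp add: real_process_def)
  have st: "s \<noteq> t" using h by auto
  define w where "w = (\<lambda>z :: real \<times> real. if fst z = s then D1 * exp (- (2 / L) * snd z) else D2 * exp (- ((snd z - x)\<^sup>2 / (8 * h))))"
  have ws: "w (s, u) = D1 * exp (- (2 / L) * u)" and wt: "w (t, u) = D2 * exp (- ((u - x)\<^sup>2 / (8 * h)))" for u
    using st by (auto simp: w_def)
  define T where "T = (\<integral>v. indicator {y<..} v * w (t, v) \<partial>lborel)"
  have T_le: "T \<le> 8 * D2 * exp (- ((y - x)\<^sup>2 / (16 * h)))"
    unfolding T_def wt by (rule gaussian_tail) (use h L D in auto)
  have T_nonneg: "0 \<le> T" unfolding T_def wt using D by (intro Bochner_Integration.integral_nonneg) simp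
  have fin: ?thesis if "\<P>(\<omega> in P. A s \<omega> \<le> x \<and> y < A t \<omega>) \<le> T * S"
  proof -
    have "T * S \<le> (8 * D2 * exp (- ((y - x)\<^sup>2 / (16 * h)))) * S" by (rule mult_right_mono[OF T_le]) (use S in simp)
    thus ?thesis using that by (simp add: mult_ac)
  qed
  show ?thesis
  proof (cases "T \<le> 1")
    case False
    have "\<P>(\<omega> in P. A s \<omega> \<le> x \<and> y < A t \<omega>) \<le> 1 * 1" by simp
    also have "\<dots> \<le> T * S" using False S by (intro mult_mono) auto
    finally show ?thesis by (rule fin)
  next
    case True
    define m where "m = D1 * (4 * L) + 1"
    have "\<P>(\<omega> in P. A s \<omega> \<le> x \<and> y < A t \<omega>) \<le> T * (\<Sum>n. b n * (2 * m) ^ n / fact n)"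
      unfolding T_def
    proof (rule crossing_probability_bound[OF proc st two_time_fdd[OF fdd] R_meas p_meas K])
      fix r r' u u' assume "r \<in> {s, t}" "r' \<in> {s, t}"
      from R_le[OF this, of u u'] show "\<bar>R (r, u) (r', u')\<bar> \<le> max C C' * exp (- 2 * (u + u'))"
        by (rule order_trans) (intro mult_right_mono, auto)
    next
      fix u v assume "x < u" "y < v"
      from p_le[OF this] show "\<bar>p u v\<bar> \<le> max C C' * exp (u - v)"
        by (rule order_trans) (intro mult_right_mono, auto)
    next
      show "w \<in> borel_measurable (time_space s t)" unfolding w_def by measurable
      show "0 \<le> w z" for z using D by (simp add: w_def)
      show "integrable lborel (\<lambda>u. indicator {x<..} u * w (s, u))" unfolding ws by (rule exp_window_integral) (use L D in auto)
      show "integrable lborel (\<lambda>u. indicator {y<..} u * w (t, u))" unfolding wt by (rule gaussian_tail) (use L D h in auto)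
      have "(\<integral>u. indicator {x<..} u * w (s, u) \<partial>lborel) \<le> D1 * (4 * L)" unfolding ws by (rule exp_window_integral) (use L D in auto)
      thus "(\<integral>u. indicator {x<..} u * w (s, u) \<partial>lborel) + (\<integral>v. indicator {y<..} v * w (t, v) \<partial>lborel) \<le> m"
        using True by (simp add: m_def T_def)
      show "1 \<le> m" using D L by (simp add: m_def)
      show "summable (\<lambda>n. b n * (2 * m) ^ n / fact n)" using b(2) by (simp add: m_def)
    next
      fix n and z :: "nat \<Rightarrow> real \<times> real"
      assume "\<And>i. i < n \<Longrightarrow> fst (z i) = s \<and> x < snd (z i) \<or> fst (z i) = t \<and> y < snd (z i)"
      from det_le[OF this] show "\<bar>matrix_det n (\<lambda>i j. crossing_kernel R p s x (z i) (z j))\<bar> \<le> b n * (\<Prod>i<n. w (z i))"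
        by (simp add: w_def)
    qed (use semigroup b(1) in auto)
    also have "\<dots> \<le> T * S" using S(1) T_nonneg by (intro mult_left_mono) (simp_all add: m_def)
    finally show ?thesis by (rule fin)
  qed
qed

text \<open>The times are not ordered, so this bounds upward and downward crossings.\<close>

definition gaussian_crossings :: "'a measure \<Rightarrow> (real \<Rightarrow> 'a \<Rightarrow> real) \<Rightarrow> real \<Rightarrow> bool" where
  "gaussian_crossings P A C \<longleftrightarrow> (\<forall>s t L x y. s \<noteq> t \<and> \<bar>t - s\<bar> \<le> 1 \<and> 1 \<le> L \<and> - L \<le> x \<and> x < y \<longrightarrow>
     \<P>(\<omega> in P. A s \<omega> \<le> x \<and> y < A t \<omega>) \<le> C * exp (C * L\<^sup>2) * exp (- ((y - x)\<^sup>2 / (16 * \<bar>t - s\<bar>))))"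

text \<open>The bound for \<open>Ai\<close> with the rate \<open>q + \<tau>\<close>; the cubic terms are bounded.\<close>

lemma airy_flow_bound:
  obtains C where "C \<ge> 1" "\<And>\<tau> q X. \<bar>\<tau>\<bar> \<le> 1 \<Longrightarrow> 0 \<le> q \<Longrightarrow> 0 \<le> q + \<tau> \<Longrightarrow> q + \<tau> \<le> 4 \<Longrightarrow> \<bar>airy_flow \<tau> X\<bar> \<le> C * exp (- q * X)"
proof -
  obtain C where C: "C > 0" "\<And>r X. 0 \<le> r \<Longrightarrow> r \<le> 4 \<Longrightarrow> \<bar>Ai X\<bar> \<le> C * exp (- r * X)" by (rule Ai_bound) blast
  show thesis
  proof (rule that)
    show "1 \<le> C * exp 1 + 1" using C by simp
    fix \<tau> q X :: real assume a: "\<bar>\<tau>\<bar> \<le> 1" "0 \<le> q" "0 \<le> q + \<tau>" "q + \<tau> \<le> 4"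
    have "\<bar>airy_flow \<tau> X\<bar> \<le> C * exp (- (q + \<tau>) * (X + \<tau>\<^sup>2)) * exp (\<tau> * X + 2 / 3 * \<tau> ^ 3)"
      unfolding airy_flow_def abs_mult abs_exp_cancel by (intro mult_right_mono C(2) a) simp
    also have "\<dots> = C * exp (- q * X - q * \<tau>\<^sup>2 - \<tau> ^ 3 / 3)"
      unfolding mult.assoc mult_exp_exp by (simp add: algebra_simps power2_eq_square power3_eq_cube)
    also have "\<dots> \<le> C * exp (1 + - q * X)"
    proof -
      have "\<bar>\<tau>\<bar> ^ 3 \<le> 1" using a(1) by (intro power_le_one) auto
      hence "\<bar>\<tau> ^ 3\<bar> \<le> 1" by (simp add: power_abs)
      moreover have "0 \<le> q * \<tau>\<^sup>2" using a by simp
      ultimately have "- q * X - q * \<tau>\<^sup>2 - \<tau> ^ 3 / 3 \<le> 1 + - q * X" by linarith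
      thus ?thesis using C by simp
    qed
    also have "\<dots> = C * exp 1 * exp (- q * X)" by (simp only: exp_add mult.assoc)
    also have "\<dots> \<le> (C * exp 1 + 1) * exp (- q * X)" by (intro mult_right_mono) auto
    finally show "\<bar>airy_flow \<tau> X\<bar> \<le> (C * exp 1 + 1) * exp (- q * X)" .
  qed
qed

text \<open>The rate of decay is \<open>q = 1 / L\<close>, and \<open>q + h\<close> in the rows of time \<open>t\<close>, where the flow runs backwards by \<open>h\<close>. On \<open>[- L, \<infinity>)\<close> the
additional factors are at most \<open>exp L\<close> each. Together with the weights of order one at time \<open>s\<close>, the mass is of order \<open>L\<close>.\<close>

lemma airy1_crossings:
  assumes "airy1_process P A"
  obtains C where "gaussian_crossings P A C"
proof -
  have proc: "real_process P A" and fdd: "has_determinantal_fdd airy1_ext_kernel P A"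
    using assms by (auto simp: airy1_process_def)
  obtain C where C: "C \<ge> 1" "\<And>\<tau> q X. \<bar>\<tau>\<bar> \<le> 1 \<Longrightarrow> 0 \<le> q \<Longrightarrow> 0 \<le> q + \<tau> \<Longrightarrow> q + \<tau> \<le> 4 \<Longrightarrow> \<bar>airy_flow \<tau> X\<bar> \<le> C * exp (- q * X)"
    by (rule airy_flow_bound) blast
  define C' where "C' = 32 * exp 10 * C + 602 * C\<^sup>2"
  have "\<P>(\<omega> in P. A s \<omega> \<le> x \<and> y < A t \<omega>) \<le> C' * exp (C' * L\<^sup>2) * exp (- ((y - x)\<^sup>2 / (16 * \<bar>t - s\<bar>)))"
    if st: "s \<noteq> t" "\<bar>t - s\<bar> \<le> 1" and L: "1 \<le> L" "- L \<le> x" "x < y" for s t L x y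
  proof -
    define h where "h = \<bar>t - s\<bar>"
    have h: "0 < h" "h \<le> 1" using st by (auto simp: h_def)
    define \<tau> where "\<tau> = (\<lambda>r r'. sgn (t - s) * (r' - r))"
    have \<tau>: "\<tau> s s = 0" "\<tau> t t = 0" "\<tau> s t = h" "\<tau> t s = - h"
      using st by (auto simp: \<tau>_def h_def sgn_if)
    define R where "R = (\<lambda>z z' :: real \<times> real. airy_flow (\<tau> (fst z) (fst z')) (snd z + snd z'))"
    define p where "p = (\<lambda>u v. heat_kernel h (u - v))"
    define q where "q = 1 / L"
    have q: "0 < q" "q \<le> 1" "q * L = 1" using L by (auto simp: q_def)
    define g where "g = (\<lambda>v. exp (- ((v - x)\<^sup>2 / (8 * h))))"
    define \<rho> where "\<rho> = (\<lambda>z :: real \<times> real. if fst z = s then C * exp (- q * snd z) else C * exp (2 * L + 1))"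
    define \<kappa> where "\<kappa> = (\<lambda>z :: real \<times> real. if fst z = s then exp (- q * snd z) else 2 * exp 9 * g (snd z))"
    have row: "\<bar>R (r, u) (s, a)\<bar> \<le> C * exp (- (q + (if r = s then 0 else h)) * (u + a))" if "r \<in> {s, t}" for r u a
    proof (cases "r = s")
      case True
      show ?thesis using C(2)[of 0 q "u + a"] q True by (simp add: R_def \<tau>)
    next
      case False
      hence "r = t" using that by simp
      thus ?thesis using C(2)[of "- h" "q + h" "u + a"] q h st by (simp add: R_def \<tau>)
    qed
    have exph: "exp (- h * u) \<le> exp L" and expq: "exp (- q * u) \<le> exp 1" if "- L \<le> u" for u
      using exp_window_le[OF _ _ that, of h L] exp_window_le[OF _ _ that, of q 1] h q L mult_right_mono[of h 1 L] by auto
    have entry: "\<bar>crossing_kernel R p s x z z'\<bar> \<le> \<rho> z * \<kappa> z'"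
      if "fst z = s \<and> x < snd z \<or> fst z = t \<and> y < snd z" "fst z' = s \<and> x < snd z' \<or> fst z' = t \<and> y < snd z'" for z z'
    proof -
      obtain r u where z: "z = (r, u)" by (cases z)
      obtain r' v where z': "z' = (r', v)" by (cases z')
      have r: "r \<in> {s, t}" "r' \<in> {s, t}" and uv: "- L \<le> u" "- L \<le> v" using that L by (auto simp: z z')
      show ?thesis
      proof (cases "r' = s")
        case True
        show ?thesis
        proof (cases "r = s")
          case r_s: True
          show ?thesis using row[of s u v] True r_s
            by (simp add: z z' crossing_kernel_def \<rho>_def \<kappa>_def mult_exp_exp algebra_simps)
        next
          case r_t: False
          have "exp (- (q + h) * (u + v)) = (exp (- q * u) * exp (- h * u) * exp (- h * v)) * exp (- q * v)"
            by (simp add: mult_exp_exp algebra_simps)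
          also have "\<dots> \<le> (exp 1 * exp L * exp L) * exp (- q * v)"
            by (intro mult_mono expq exph uv) auto
          finally have "C * exp (- (q + h) * (u + v)) \<le> C * ((exp 1 * exp L * exp L) * exp (- q * v))"
            using C by (intro mult_left_mono) auto
          also have "\<dots> = \<rho> z * \<kappa> z'" using True r_t by (simp add: z z' \<rho>_def \<kappa>_def mult_exp_exp algebra_simps)
          finally show ?thesis using row[OF r(1), of u v] True r_t by (simp add: z z' crossing_kernel_def)
        qed
      next
        case False
        hence r': "r' = t" "y < v" using that by (auto simp: z')
        define Q where "Q = q + (if r = s then 0 else h)"
        have Q: "0 < Q" "Q \<le> 2" using q h by (auto simp: Q_def)
        have xv: "x \<le> v" using r' L by simp
        have "\<bar>\<integral>w. indicator {..x} w * (R z (s, w) * p w v) \<partial>lborel\<bar>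
          \<le> (\<integral>w. (C * exp (- Q * u)) * (indicator {..x} w * (exp (- Q * w) * heat_kernel h (w - v))) \<partial>lborel)"
        proof (rule order_trans[OF integral_abs_bound], rule integral_mono_AE')
          show "integrable lborel (\<lambda>w. (C * exp (- Q * u)) * (indicator {..x} w * (exp (- Q * w) * heat_kernel h (w - v))))"
            by (intro integrable_mult_right heat_kernel_far_integral h xv)
          have "\<bar>indicator {..x} w * (R z (s, w) * p w v)\<bar> \<le> (C * exp (- Q * u)) * (indicator {..x} w * (exp (- Q * w) * heat_kernel h (w - v)))" for w
          proof -
            have "\<bar>R z (s, w)\<bar> \<le> C * exp (- Q * (u + w))" using row[OF r(1), of u w] by (simp add: z Q_def)
            hence "indicator {..x} w * (\<bar>R z (s, w)\<bar> * p w v) \<le> indicator {..x} w * (C * exp (- Q * (u + w)) * p w v)"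
              using h by (intro mult_left_mono mult_right_mono) (auto simp: p_def heat_kernel_nonneg)
            moreover have "exp (- Q * (u + w)) = exp (- Q * u) * exp (- Q * w)" by (simp add: mult_exp_exp algebra_simps)
            moreover have "\<bar>indicator {..x} w * (R z (s, w) * p w v)\<bar> = indicator {..x} w * (\<bar>R z (s, w)\<bar> * p w v)"
              using h by (simp add: abs_mult p_def heat_kernel_nonneg)
            ultimately show ?thesis by (simp only: p_def mult_ac)
          qed
          thus "AE w in lborel. \<bar>indicator {..x} w * (R z (s, w) * p w v)\<bar> \<le> (C * exp (- Q * u)) * (indicator {..x} w * (exp (- Q * w) * heat_kernel h (w - v)))" by simp
        qed (use C h in \<open>simp add: heat_kernel_nonneg\<close>)
        also have "\<dots> \<le> (C * exp (- Q * u)) * (2 * g v * exp (- Q * v + 2 * h * Q\<^sup>2))"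
          unfolding integral_mult_right_zero g_def using C by (intro mult_left_mono heat_kernel_far_integral h xv) auto
        also have "\<dots> \<le> (C * exp (- Q * u)) * (2 * g v * exp (- Q * v + 8))"
        proof -
          have "h * Q\<^sup>2 \<le> 1 * 2\<^sup>2" using h Q by (intro mult_mono power_mono) auto
          thus ?thesis using C by (intro mult_left_mono) (auto simp: g_def)
        qed
        also have "\<dots> \<le> \<rho> z * \<kappa> z'"
        proof (cases "r = s")
          case True
          have "C * exp (- Q * u) * (2 * g v * exp (- Q * v + 8)) = C * exp (- q * u) * (2 * g v * exp 8) * exp (- q * v)"
            unfolding exp_add using True by (simp add: Q_def)
          also have "\<dots> \<le> C * exp (- q * u) * (2 * g v * exp 8) * exp 1"
            using C by (intro mult_left_mono expq uv) (auto simp: g_def)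
          also have "\<dots> = \<rho> z * \<kappa> z'" using True r' st by (simp add: z z' \<rho>_def \<kappa>_def mult_exp_exp)
          finally show ?thesis .
        next
          case False
          have "C * exp (- Q * u) * (2 * g v * exp (- Q * v + 8)) = (C * 2 * g v * exp 8) * (exp (- q * u) * exp (- h * u) * (exp (- q * v) * exp (- h * v)))"
            using False by (simp add: Q_def mult_exp_exp algebra_simps)
          also have "\<dots> \<le> (C * 2 * g v * exp 8) * (exp 1 * exp L * (exp 1 * exp L))"
          proof (rule mult_left_mono)
            show "exp (- q * u) * exp (- h * u) * (exp (- q * v) * exp (- h * v)) \<le> exp 1 * exp L * (exp 1 * exp L)"
              by (intro mult_mono expq exph uv) auto
          qed (use C in \<open>simp add: g_def\<close>)
          also have "\<dots> = \<rho> z * \<kappa> z'" using False r' st by (simp add: z z' \<rho>_def \<kappa>_def mult_exp_exp)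
          finally show ?thesis .
        qed
        finally show ?thesis using False by (simp add: crossing_kernel_def z')
      qed
    qed
    define D1 where "D1 = C"
    define D2 where "D2 = 2 * exp 10 * C * exp (2 * L)"
    define m where "m = D1 * (4 * L) + 1"
    have m: "0 \<le> 2 * m" using C L by (simp add: m_def D1_def)
    define S where "S = exp (6 * (2 * m)\<^sup>2) + 1"
    have "\<P>(\<omega> in P. A s \<omega> \<le> x \<and> y < A t \<omega>) \<le> 8 * D2 * S * exp (- ((y - x)\<^sup>2 / (16 * h)))"
    proof (rule crossing_probability_gaussian[OF proc fdd h_def h L])
      show "0 \<le> D1" "0 \<le> D2" using C by (auto simp: D1_def D2_def)
      have "(\<lambda>w. \<tau> (fst (fst w)) (fst (snd w))) \<in> borel_measurable (time_space s t \<Otimes>\<^sub>M time_space s t)"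
        "(\<lambda>w. snd (fst w) + snd (snd w)) \<in> borel_measurable (time_space s t \<Otimes>\<^sub>M time_space s t)"
        unfolding \<tau>_def by (intro borel_measurable_times borel_measurable_diff borel_measurable_add borel_measurable_const
          measurable_compose[OF measurable_fst] measurable_compose[OF measurable_snd] time_space_measurable_fst time_space_measurable_snd)+
      thus "case_prod R \<in> borel_measurable (time_space s t \<Otimes>\<^sub>M time_space s t)"
        unfolding R_def airy_flow_def case_prod_unfold by measurable
      show "case_prod p \<in> borel_measurable (borel \<Otimes>\<^sub>M borel)" unfolding p_def by measurable
      show "oriented s t airy1_ext_kernel (r, u) (r', u') = R (r, u) (r', u') - (if r = s \<and> r' = t then p u u' else 0)"
        if "r \<in> {s, t}" "r' \<in> {s, t}" for r r' u u'
        using that st by (cases "s < t") (auto simp: oriented_def airy1_ext_kernel_def R_def p_def \<tau>_def airy_flow_def heat_kernel_def h_def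
          power2_commute[of u u'] sgn_if add.commute algebra_simps)
      show "\<bar>R (r, u) (r', u')\<bar> \<le> C * exp (- 2 * (u + u'))" if "r \<in> {s, t}" "r' \<in> {s, t}" for r r' u u'
        unfolding R_def fst_conv snd_conv by (rule C(2)) (use that \<tau> h in auto)
      show "\<bar>p u v\<bar> \<le> exp h / sqrt (4 * pi * h) * exp (u - v)" for u v
        using heat_kernel_le_exp[OF h(1), of "u - v"] heat_kernel_nonneg[OF h(1), of "u - v"] by (simp add: p_def)
      show "integrable lborel (\<lambda>w. R (r, u) (s, w) * p w v)" if "r \<in> {s, t}" for r u v
        unfolding R_def p_def fst_conv snd_conv by (rule airy_flow_heat[OF h(1)])
      show "(\<integral>w. R (r, u) (s, w) * p w v \<partial>lborel) = R (r, u) (t, v)" if "r \<in> {s, t}" for r u v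
      proof -
        have "\<tau> r s + h = \<tau> r t" using that \<tau> by auto
        thus ?thesis unfolding R_def p_def fst_conv snd_conv airy_flow_heat(2)[OF h(1)] by simp
      qed
      show "0 \<le> sqrt (real n ^ n)" for n by simp
      show "summable (\<lambda>n. sqrt (real n ^ n) * (2 * (D1 * (4 * L) + 1)) ^ n / fact n)"
        using hadamard_series(1)[OF m] by (simp add: m_def)
      show "(\<Sum>n. sqrt (real n ^ n) * (2 * (D1 * (4 * L) + 1)) ^ n / fact n) \<le> S"
        using hadamard_series(2)[OF m] by (simp add: m_def S_def)
      show "1 \<le> S" by (simp add: S_def)
    next
      fix n and z :: "nat \<Rightarrow> real \<times> real"
      assume z: "\<And>i. i < n \<Longrightarrow> fst (z i) = s \<and> x < snd (z i) \<or> fst (z i) = t \<and> y < snd (z i)"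
      have "\<bar>matrix_det n (\<lambda>i j. crossing_kernel R p s x (z i) (z j))\<bar> \<le> sqrt (real n ^ n) * (\<Prod>i<n. \<rho> (z i) * \<kappa> (z i))"
        by (rule det_bound_of_entries) (use z entry C in \<open>auto simp: \<rho>_def \<kappa>_def g_def\<close>)
      also have "(\<Prod>i<n. \<rho> (z i) * \<kappa> (z i)) = (\<Prod>i<n. if fst (z i) = s then D1 * exp (- (2 / L) * snd (z i)) else D2 * exp (- ((snd (z i) - x)\<^sup>2 / (8 * h))))"
        by (intro prod.cong refl) (simp add: \<rho>_def \<kappa>_def D1_def D2_def g_def q_def mult_exp_exp)
      finally show "\<bar>matrix_det n (\<lambda>i j. crossing_kernel R p s x (z i) (z j))\<bar>
        \<le> sqrt (real n ^ n) * (\<Prod>i<n. if fst (z i) = s then D1 * exp (- (2 / L) * snd (z i)) else D2 * exp (- ((snd (z i) - x)\<^sup>2 / (8 * h))))" .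
    qed
    also have "\<dots> \<le> (C' * exp (C' * L\<^sup>2)) * exp (- ((y - x)\<^sup>2 / (16 * h)))"
    proof (rule mult_right_mono)
      have LC: "1 \<le> C * L" using C(1) L mult_mono[of 1 C 1 L] by simp
      have "2 * m \<le> 10 * (C * L)" using LC by (simp add: m_def D1_def)
      hence "(2 * m)\<^sup>2 \<le> (10 * (C * L))\<^sup>2" using m by (intro power_mono) auto
      hence "S \<le> exp (600 * (C\<^sup>2 * L\<^sup>2)) + 1" by (simp add: S_def power_mult_distrib)
      also have "\<dots> \<le> 2 * exp (600 * (C\<^sup>2 * L\<^sup>2))" by simp
      finally have S: "S \<le> 2 * exp (600 * (C\<^sup>2 * L\<^sup>2))" .
      have "2 * L \<le> 2 * (C\<^sup>2 * L\<^sup>2)"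
      proof -
        have "L * 1 \<le> L\<^sup>2 * C\<^sup>2" using self_le_power[OF L(1), of 2] one_le_power[OF C(1), of 2] L by (intro mult_mono) auto
        thus ?thesis by (simp add: mult.commute)
      qed
      moreover have "C' * L\<^sup>2 = 32 * exp 10 * C * L\<^sup>2 + 602 * (C\<^sup>2 * L\<^sup>2)" by (simp add: C'_def algebra_simps)
      moreover have "0 \<le> 32 * exp 10 * C * L\<^sup>2" using C(1) by simp
      ultimately have "2 * L + 600 * (C\<^sup>2 * L\<^sup>2) \<le> C' * L\<^sup>2" by linarith
      hence e: "exp (2 * L) * exp (600 * (C\<^sup>2 * L\<^sup>2)) \<le> exp (C' * L\<^sup>2)" unfolding mult_exp_exp by simp
      have "8 * D2 * S \<le> 8 * D2 * (2 * exp (600 * (C\<^sup>2 * L\<^sup>2)))" using S C by (intro mult_left_mono) (auto simp: D2_def)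
      also have "\<dots> = 32 * exp 10 * C * (exp (2 * L) * exp (600 * (C\<^sup>2 * L\<^sup>2)))" by (simp add: D2_def)
      also have "\<dots> \<le> C' * exp (C' * L\<^sup>2)" using e C(1) by (intro mult_mono) (auto simp: C'_def)
      finally show "8 * D2 * S \<le> C' * exp (C' * L\<^sup>2)" .
    qed simp
    finally show ?thesis by (simp add: h_def)
  qed
  hence "gaussian_crossings P A C'" unfolding gaussian_crossings_def by (intro allI impI) (elim conjE)
  thus thesis by (rule that)
qed

section \<open>Crossings of the Airy\<open>\<^sub>2\<close> process\<close>

text \<open>The kernel of Airy\<open>\<^sub>2\<close> for \<open>t \<ge> t'\<close>, with \<open>c = t' - t\<close>.\<close>

definition airy_half_product :: "real \<Rightarrow> real \<Rightarrow> real \<Rightarrow> real" where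
  "airy_half_product c u v = (\<integral>l. indicator {0..} l * (exp (c * l) * (Ai (u + l) * Ai (v + l))) \<partial>lborel)"

lemma Ai_shift_bound:
  assumes "\<And>X. \<bar>Ai X\<bar> \<le> C * exp (- q * X)"
  shows "\<bar>Ai (u + l)\<bar> \<le> C * exp (- q * u) * exp (- q * l)"
proof -
  have "exp (- q * (u + l)) = exp (- q * u) * exp (- q * l)" by (simp add: mult_exp_exp algebra_simps)
  thus ?thesis using assms[of "u + l"] by (simp only: mult.assoc)
qed

lemma exp_half_line_integral:
  assumes "(c::real) > 0"
  shows "integrable lborel (\<lambda>l. indicator {0..} l * exp (- c * l))"
    and "(\<integral>l. indicator {0..} l * exp (- c * l) \<partial>lborel) = 1 / c"
  using exp_tail_integral[OF assms, of 0] by (auto simp: has_bochner_integral_iff)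

lemma airy_half_product_bound:
  assumes C: "C > 0" "\<And>X. \<bar>Ai X\<bar> \<le> C * exp (- 2 * X)" and c: "c \<le> 1"
  shows "integrable lborel (\<lambda>l. indicator {0..} l * (exp (c * l) * (Ai (u + l) * Ai (v + l))))"
    and "\<bar>airy_half_product c u v\<bar> \<le> C\<^sup>2 * exp (- 2 * (u + v))"
proof -
  define B where "B = C\<^sup>2 * exp (- 2 * (u + v))"
  have le: "\<bar>indicator {0..} l * (exp (c * l) * (Ai (u + l) * Ai (v + l)))\<bar> \<le> B * (indicator {0..} l * exp (- 3 * l))" for l :: real
  proof (cases "0 \<le> l")
    case True
    have "exp (c * l) \<le> exp (1 * l)" using mult_right_mono[OF c True] by simp
    hence "exp (c * l) * \<bar>Ai (u + l) * Ai (v + l)\<bar> \<le> exp (1 * l) * ((C * exp (- 2 * (u + l))) * (C * exp (- 2 * (v + l))))"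
      unfolding abs_mult using C(1) by (intro mult_mono C(2)) auto
    also have "\<dots> = B * exp (- 3 * l)"
    proof -
      have "exp (1 * l) * (exp (- 2 * (u + l)) * exp (- 2 * (v + l))) = exp (- 2 * (u + v)) * exp (- 3 * l)"
        unfolding mult_exp_exp by (rule arg_cong[where f = exp]) (simp add: algebra_simps)
      thus ?thesis unfolding B_def by (simp only: power2_eq_square mult_ac)
    qed
    finally show ?thesis using True by (simp add: abs_mult)
  qed simp
  have i: "integrable lborel (\<lambda>l. B * (indicator {0..} l * exp (- 3 * l)))"
    by (intro integrable_mult_right exp_half_line_integral) simp
  show "integrable lborel (\<lambda>l. indicator {0..} l * (exp (c * l) * (Ai (u + l) * Ai (v + l))))"
    by (rule Bochner_Integration.integrable_bound[OF i])
      (measurable, use le in \<open>auto simp: abs_mult B_def\<close>)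
  have "\<bar>airy_half_product c u v\<bar> \<le> (\<integral>l. B * (indicator {0..} l * exp (- 3 * l)) \<partial>lborel)"
    unfolding airy_half_product_def
    by (rule order_trans[OF integral_abs_bound], rule integral_mono_AE'[OF i]) (use le in \<open>auto simp: B_def\<close>)
  also have "\<dots> = B * (1 / 3)" unfolding integral_mult_right_zero using exp_half_line_integral(2)[of 3] by simp
  also have "\<dots> \<le> B" by (simp add: B_def)
  finally show "\<bar>airy_half_product c u v\<bar> \<le> C\<^sup>2 * exp (- 2 * (u + v))" by (simp add: B_def)
qed

text \<open>Fubini. Integrating over the line gives the flow property; integrating over a half-line shows that the
columns of the crossing kernel are inner products as well.\<close>

lemma airy_half_product_truncated:
  assumes h: "0 < h" and c: "c \<le> 0" and S: "S \<in> sets borel"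
  shows "integrable lborel (\<lambda>w. indicator S w * (airy_half_product c u w * tilted_heat_kernel h w v))"
    and "(\<integral>w. indicator S w * (airy_half_product c u w * tilted_heat_kernel h w v) \<partial>lborel)
      = (\<integral>l. (indicator {0..} l * (exp (c * l) * Ai (u + l))) * (\<integral>w. indicator S w * (Ai (w + l) * tilted_heat_kernel h w v) \<partial>lborel) \<partial>lborel)"
proof -
  obtain C where C: "C > 0" "\<And>r X. 0 \<le> r \<Longrightarrow> r \<le> 4 \<Longrightarrow> \<bar>Ai X\<bar> \<le> C * exp (- r * X)" by (rule Ai_bound) blast
  have [measurable]: "S \<in> sets borel" by (rule S)
  define f where "f = (\<lambda>w l. indicator S w * (indicator {0..} l * (exp (c * l) * (Ai (u + l) * Ai (w + l))) * tilted_heat_kernel h w v))"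
  define a where "a = (\<lambda>w. C * exp (- 2 * w) * tilted_heat_kernel h w v)"
  define b where "b = (\<lambda>l. C * exp (- 2 * u) * (indicator {0..} l * exp (- 4 * l)))"
  have p0: "0 \<le> tilted_heat_kernel h w v" for w using h by (simp add: tilted_heat_kernel_def heat_kernel_nonneg)
  have m: "case_prod f \<in> borel_measurable (lborel \<Otimes>\<^sub>M lborel)"
    unfolding f_def tilted_heat_kernel_def case_prod_unfold by measurable
  have ai: "integrable lborel a"
  proof -
    have "a w = (C * exp (- h * v / 2 + h ^ 3 / 12)) * (heat_kernel h (w - v) * exp ((- 2 - h / 2) * w))" for w
    proof -
      have "exp (- 2 * w) * exp (- h * (w + v) / 2 + h ^ 3 / 12) = exp (- h * v / 2 + h ^ 3 / 12) * exp ((- 2 - h / 2) * w)"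
        unfolding mult_exp_exp by (rule arg_cong[where f = exp]) (simp add: field_simps)
      thus ?thesis unfolding a_def tilted_heat_kernel_def by (simp only: mult_ac)
    qed
    hence eq: "a = (\<lambda>w. (C * exp (- h * v / 2 + h ^ 3 / 12)) * (heat_kernel h (w - v) * exp ((- 2 - h / 2) * w)))" by (rule ext)
    show ?thesis unfolding eq by (intro integrable_mult_right heat_kernel_exp_real h)
  qed
  have bi: "integrable lborel b" unfolding b_def by (intro integrable_mult_right exp_half_line_integral) simp
  have le: "norm (f w l) \<le> a w * b l" for w l
  proof (cases "0 \<le> l")
    case True
    have A: "\<bar>Ai (u' + l)\<bar> \<le> C * exp (- 2 * u') * exp (- 2 * l)" for u'
      by (rule Ai_shift_bound) (rule C(2), simp_all)
    have "norm (f w l) = (indicator S w * exp (c * l)) * (\<bar>Ai (u + l)\<bar> * \<bar>Ai (w + l)\<bar>) * tilted_heat_kernel h w v"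
      using True p0 by (simp add: f_def abs_mult)
    also have "\<dots> \<le> (1 * 1) * ((C * exp (- 2 * u) * exp (- 2 * l)) * (C * exp (- 2 * w) * exp (- 2 * l))) * tilted_heat_kernel h w v"
      using True p0 c C(1) by (intro mult_right_mono mult_mono A) (auto simp: mult_nonpos_nonneg indicator_def intro!: mult_nonneg_nonneg)
    also have "\<dots> = a w * b l"
    proof -
      have "exp (- 2 * l) * exp (- 2 * l) = exp (- 4 * l)" by (simp add: mult_exp_exp)
      thus ?thesis using True by (simp add: a_def b_def mult_ac)
    qed
    finally show ?thesis .
  qed (simp add: f_def b_def)
  note F = integrable_pair_dominated[of lborel lborel f, OF lborel.sigma_finite_measure_axioms lborel.sigma_finite_measure_axioms m ai bi le]
  have in1: "(\<integral>l. f w l \<partial>lborel) = indicator S w * (airy_half_product c u w * tilted_heat_kernel h w v)" for w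
    unfolding f_def airy_half_product_def by simp
  show "integrable lborel (\<lambda>w. indicator S w * (airy_half_product c u w * tilted_heat_kernel h w v))"
    using F(3) unfolding in1 .
  have in2: "(\<integral>w. f w l \<partial>lborel) = (indicator {0..} l * (exp (c * l) * Ai (u + l))) * (\<integral>w. indicator S w * (Ai (w + l) * tilted_heat_kernel h w v) \<partial>lborel)" for l
  proof -
    have "f w l = (indicator {0..} l * (exp (c * l) * Ai (u + l))) * (indicator S w * (Ai (w + l) * tilted_heat_kernel h w v))" for w
      by (simp add: f_def)
    thus ?thesis by (simp only: integral_mult_right_zero)
  qed
  show "(\<integral>w. indicator S w * (airy_half_product c u w * tilted_heat_kernel h w v) \<partial>lborel)
      = (\<integral>l. (indicator {0..} l * (exp (c * l) * Ai (u + l))) * (\<integral>w. indicator S w * (Ai (w + l) * tilted_heat_kernel h w v) \<partial>lborel) \<partial>lborel)"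
    using F(2) unfolding in1 in2 .
qed

lemma airy_half_product_semigroup:
  assumes h: "0 < h" and c: "c \<le> 0"
  shows "integrable lborel (\<lambda>w. airy_half_product c u w * tilted_heat_kernel h w v)"
    and "(\<integral>w. airy_half_product c u w * tilted_heat_kernel h w v \<partial>lborel) = airy_half_product (c + h) u v"
proof -
  note T = airy_half_product_truncated[OF h c, of UNIV u v, simplified]
  show "integrable lborel (\<lambda>w. airy_half_product c u w * tilted_heat_kernel h w v)" by (rule T(1))
  show "(\<integral>w. airy_half_product c u w * tilted_heat_kernel h w v \<partial>lborel) = airy_half_product (c + h) u v"
    unfolding T(2) Ai_tilted_heat(2)[OF h] unfolding airy_half_product_def
    by (rule Bochner_Integration.integral_cong) (auto simp: exp_add algebra_simps)
qed

text \<open>The spectral integral over the negative half-line is the integral over the line minus the one over the positive half-line.\<close>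

lemma airy2_kernel_split:
  assumes h: "0 < h" "h \<le> 1"
  shows "- (LBINT l:{..0}. exp (h * l) * Ai (u + l) * Ai (v + l)) = airy_half_product h u v - tilted_heat_kernel h u v"
proof -
  note P = Ai_product_integral[OF h, of u v]
  have i: "integrable lborel (\<lambda>l. indicator S l * (exp (h * l) * Ai (u + l) * Ai (v + l)))" if "S \<in> sets borel" for S
    using integrable_mult_indicator[OF _ P(1), of S] that by simp
  have "tilted_heat_kernel h u v = (\<integral>l. indicator {..0} l * (exp (h * l) * Ai (u + l) * Ai (v + l)) + indicator {0..} l * (exp (h * l) * Ai (u + l) * Ai (v + l)) \<partial>lborel)"
    unfolding P(2)[symmetric]
  proof (rule integral_cong_AE)
    show "AE l in lborel. exp (h * l) * Ai (u + l) * Ai (v + l) = indicator {..0} l * (exp (h * l) * Ai (u + l) * Ai (v + l)) + indicator {0..} l * (exp (h * l) * Ai (u + l) * Ai (v + l))"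
      using AE_lborel_singleton[of 0] by eventually_elim (auto simp: indicator_def)
  qed measurable
  also have "\<dots> = (LBINT l:{..0}. exp (h * l) * Ai (u + l) * Ai (v + l)) + airy_half_product h u v"
    using Bochner_Integration.integral_add[OF i i, of "{..0}" "{0..}"]
    by (simp add: set_lebesgue_integral_def airy_half_product_def mult.assoc)
  finally show ?thesis by simp
qed

text \<open>The crossing kernel at \<open>z\<close> and \<open>z'\<close> is the inner product of \<open>\<phi> z\<close> and \<open>\<psi> z'\<close> in \<open>L\<^sup>2\<close> of the positive spectral half-line. With the
rate \<open>q = 1 / L\<close>, the squared norms are of order \<open>L\<close> at time \<open>s\<close>, and \<open>\<psi>\<close> carries the Gaussian factor at time \<open>t\<close>.\<close>

lemma airy2_crossings:
  assumes "airy2_process P A"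
  obtains C where "gaussian_crossings P A C"
proof -
  have proc: "real_process P A" and fdd: "has_determinantal_fdd airy2_ext_kernel P A"
    using assms by (auto simp: airy2_process_def)
  obtain C where C: "C > 0" "\<And>r X. 0 \<le> r \<Longrightarrow> r \<le> 4 \<Longrightarrow> \<bar>Ai X\<bar> \<le> C * exp (- r * X)" by (rule Ai_bound) blast
  define C' where "C' = 16 * exp 9 * C\<^sup>2 * exp 2 + 4 * C\<^sup>2 + 3"
  have "\<P>(\<omega> in P. A s \<omega> \<le> x \<and> y < A t \<omega>) \<le> C' * exp (C' * L\<^sup>2) * exp (- ((y - x)\<^sup>2 / (16 * \<bar>t - s\<bar>)))"
    if st: "s \<noteq> t" "\<bar>t - s\<bar> \<le> 1" and L: "1 \<le> L" "- L \<le> x" "x < y" for s t L x y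
  proof -
    define h where "h = \<bar>t - s\<bar>"
    have h: "0 < h" "h \<le> 1" using st by (auto simp: h_def)
    define \<tau> where "\<tau> = (\<lambda>r r'. sgn (t - s) * (r' - r))"
    have \<tau>: "\<tau> s s = 0" "\<tau> t t = 0" "\<tau> s t = h" "\<tau> t s = - h"
      using st by (auto simp: \<tau>_def h_def sgn_if)
    define R where "R = (\<lambda>z z' :: real \<times> real. airy_half_product (\<tau> (fst z) (fst z')) (snd z) (snd z'))"
    define p where "p = tilted_heat_kernel h"
    have p0: "0 \<le> p w v" for w v using h by (simp add: p_def tilted_heat_kernel_def heat_kernel_nonneg)
    define q where "q = 1 / L"
    have q: "0 < q" "q \<le> 1" "q * L = 1" using L by (auto simp: q_def)
    define g where "g = (\<lambda>v. exp (- ((v - x)\<^sup>2 / (8 * h))))"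
    define \<phi> where "\<phi> = (\<lambda>z l. indicator {0..} l * (exp (\<tau> (fst z) s * l) * Ai (snd z + l)))"
    define \<psi> where "\<psi> = (\<lambda>z l. indicator {0..} l * (if fst z = s then Ai (snd z + l) else (\<integral>w. indicator {..x} w * (Ai (w + l) * p w (snd z)) \<partial>lborel)))"
    have exph: "exp (- h * u) \<le> exp L" and expq: "exp (- q * u) \<le> exp 1" if "- L \<le> u" for u
      using exp_window_le[OF _ _ that, of h L] exp_window_le[OF _ _ that, of q 1] h q L mult_right_mono[of h 1 L] by auto
    have [measurable]: "\<phi> z \<in> borel_measurable borel" "\<psi> z \<in> borel_measurable borel" for z
    proof -
      show "\<phi> z \<in> borel_measurable borel" unfolding \<phi>_def by measurable
      have "(\<lambda>(l, w). indicator {..x} w * (Ai (w + l) * p w (snd z))) \<in> borel_measurable (borel \<Otimes>\<^sub>M lborel)"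
        unfolding p_def tilted_heat_kernel_def case_prod_unfold by measurable
      from lborel.borel_measurable_lebesgue_integral[OF this]
      show "\<psi> z \<in> borel_measurable borel" unfolding \<psi>_def by measurable
    qed
    \<comment> \<open>norms of functions below an exponential on the half-line\<close>
    have dom: "square_integrable lborel f \<and> sqrt (l2_inner lborel f f) \<le> B * sqrt (1 / (2 * c))"
      if "f \<in> borel_measurable borel" "0 \<le> B" "0 < c" and le: "\<And>l. \<bar>f l\<bar> \<le> indicator {0..} l * (B * exp (- c * l))" for f :: "real \<Rightarrow> real" and B c
    proof -
      have e: "(indicator {0..} l * (B * exp (- c * l)))\<^sup>2 = B\<^sup>2 * (indicator {0..} l * exp (- (2 * c) * l))" for l :: real
        by (auto simp: indicator_def power2_eq_square mult_exp_exp)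
      have sq: "(f l)\<^sup>2 \<le> B\<^sup>2 * (indicator {0..} l * exp (- (2 * c) * l))" for l
        unfolding e[symmetric] using le[of l] by (metis abs_ge_zero power2_abs power_mono)
      have i: "integrable lborel (\<lambda>l. B\<^sup>2 * (indicator {0..} l * exp (- (2 * c) * l)))"
        using that(3) by (intro integrable_mult_right exp_half_line_integral) simp
      have i2: "integrable lborel (\<lambda>l. (f l)\<^sup>2)"
        by (rule Bochner_Integration.integrable_bound[OF i]) (use that(1) sq in \<open>auto intro!: order_trans[OF sq abs_ge_self]\<close>)
      have "l2_inner lborel f f \<le> (\<integral>l. B\<^sup>2 * (indicator {0..} l * exp (- (2 * c) * l)) \<partial>lborel)"
        unfolding l2_inner_def power2_eq_square[symmetric] by (rule integral_mono[OF i2 i sq])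
      also have "\<dots> = B\<^sup>2 * (1 / (2 * c))" unfolding integral_mult_right_zero using exp_half_line_integral(2)[of "2 * c"] that(3) by simp
      finally have "sqrt (l2_inner lborel f f) \<le> sqrt (B\<^sup>2 * (1 / (2 * c)))" by (rule real_sqrt_le_mono)
      also have "\<dots> = B * sqrt (1 / (2 * c))" using that(2) by (subst real_sqrt_mult) simp
      finally show ?thesis using i2 that(1) by (simp add: square_integrable_def)
    qed
    have \<phi>: "square_integrable lborel (\<phi> z) \<and> sqrt (l2_inner lborel (\<phi> z) (\<phi> z)) \<le> (C * exp (- q * snd z)) * sqrt (1 / (2 * q))"
      if "fst z \<in> {s, t}" for z
    proof (rule dom)
      fix l :: real
      show "\<bar>\<phi> z l\<bar> \<le> indicator {0..} l * (C * exp (- q * snd z) * exp (- q * l))"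
      proof (cases "0 \<le> l")
        case True
        have "exp (\<tau> (fst z) s * l) * \<bar>Ai (snd z + l)\<bar> \<le> 1 * (C * exp (- q * snd z) * exp (- q * l))"
        proof (rule mult_mono)
          show "exp (\<tau> (fst z) s * l) \<le> 1" using that \<tau> h True by auto
          show "\<bar>Ai (snd z + l)\<bar> \<le> C * exp (- q * snd z) * exp (- q * l)" by (rule Ai_shift_bound) (use C q in auto)
        qed auto
        thus ?thesis using True by (simp add: \<phi>_def abs_mult)
      qed (simp add: \<phi>_def)
    qed (use C q in auto)
    have \<psi>s: "square_integrable lborel (\<psi> (s, a)) \<and> sqrt (l2_inner lborel (\<psi> (s, a)) (\<psi> (s, a))) \<le> (C * exp (- q * a)) * sqrt (1 / (2 * q))" for a
    proof (rule dom)
      fix l :: real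
      have "\<bar>Ai (a + l)\<bar> \<le> C * exp (- q * a) * exp (- q * l)" by (rule Ai_shift_bound) (use C q in auto)
      thus "\<bar>\<psi> (s, a) l\<bar> \<le> indicator {0..} l * (C * exp (- q * a) * exp (- q * l))"
        by (simp add: \<psi>_def abs_mult mult_left_mono)
    qed (use C q in auto)
    have \<psi>t: "square_integrable lborel (\<psi> (t, v)) \<and> sqrt (l2_inner lborel (\<psi> (t, v)) (\<psi> (t, v))) \<le> (2 * C * exp 6 * exp (2 * L) * g v) * sqrt (1 / (2 * 1))"
      if v: "y < v" for v
    proof (rule dom)
      fix l :: real
      have Lv: "- L \<le> v" "x \<le> v" using v L by auto
      define Q where "Q = 1 + h / 2"
      have Q: "0 < Q" "Q \<le> 2" using h by (auto simp: Q_def)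
      define E where "E = C * exp (- l) * exp (- h * v / 2 + h ^ 3 / 12)"
      have E: "0 \<le> E" using C by (simp add: E_def)
      have "\<bar>\<integral>w. indicator {..x} w * (Ai (w + l) * p w v) \<partial>lborel\<bar> \<le> (\<integral>w. E * (indicator {..x} w * (exp (- Q * w) * heat_kernel h (w - v))) \<partial>lborel)"
      proof (rule order_trans[OF integral_abs_bound], rule integral_mono_AE')
        show "integrable lborel (\<lambda>w. E * (indicator {..x} w * (exp (- Q * w) * heat_kernel h (w - v))))"
          by (intro integrable_mult_right heat_kernel_far_integral h Lv)
        have "\<bar>indicator {..x} w * (Ai (w + l) * p w v)\<bar> \<le> E * (indicator {..x} w * (exp (- Q * w) * heat_kernel h (w - v)))" for w
        proof -
          have "\<bar>Ai (w + l)\<bar> \<le> C * exp (- 1 * w) * exp (- 1 * l)" by (rule Ai_shift_bound, rule C(2)) auto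
          hence "indicator {..x} w * (\<bar>Ai (w + l)\<bar> * p w v) \<le> indicator {..x} w * ((C * exp (- 1 * w) * exp (- 1 * l)) * p w v)"
            using p0 by (intro mult_left_mono mult_right_mono) auto
          moreover have "exp (- 1 * w) * exp (- h * (w + v) / 2 + h ^ 3 / 12) = exp (- h * v / 2 + h ^ 3 / 12) * exp (- Q * w)"
            unfolding mult_exp_exp Q_def by (rule arg_cong[where f = exp]) (simp add: field_simps)
          hence "(C * exp (- 1 * w) * exp (- 1 * l)) * p w v = E * (exp (- Q * w) * heat_kernel h (w - v))"
            unfolding p_def tilted_heat_kernel_def E_def by (simp add: mult_ac)
          moreover have "\<bar>indicator {..x} w * (Ai (w + l) * p w v)\<bar> = indicator {..x} w * (\<bar>Ai (w + l)\<bar> * p w v)"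
            using p0 by (simp add: abs_mult)
          ultimately show ?thesis by (simp only: mult.left_commute[of E])
        qed
        thus "AE w in lborel. \<bar>indicator {..x} w * (Ai (w + l) * p w v)\<bar> \<le> E * (indicator {..x} w * (exp (- Q * w) * heat_kernel h (w - v)))" by simp
      qed (use E h in \<open>simp add: heat_kernel_nonneg\<close>)
      also have "\<dots> \<le> E * (2 * g v * exp (- Q * v + 2 * h * Q\<^sup>2))"
        unfolding integral_mult_right_zero g_def by (intro mult_left_mono heat_kernel_far_integral h Lv E)
      also have "\<dots> \<le> (2 * C * exp 6 * exp (2 * L) * g v) * exp (- 1 * l)"
      proof -
        have "h * Q\<^sup>2 \<le> 1 * (3 / 2)\<^sup>2" using h Q by (intro mult_mono power_mono) (auto simp: Q_def)
        hence "2 * h * Q\<^sup>2 \<le> 9 / 2" by (simp add: power2_eq_square)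
        moreover have "h ^ 3 \<le> 1" using h by (intro power_le_one) auto
        moreover have "- h * v \<le> L" using exph[OF Lv(1)] by simp
        moreover have "- h * v / 2 + h ^ 3 / 12 + (- Q * v + 2 * h * Q\<^sup>2) = - h * v - v + h ^ 3 / 12 + 2 * h * Q\<^sup>2"
          by (simp add: Q_def field_simps)
        ultimately have "- h * v / 2 + h ^ 3 / 12 + (- Q * v + 2 * h * Q\<^sup>2) \<le> 6 + 2 * L" using Lv by linarith
        hence "exp (- h * v / 2 + h ^ 3 / 12) * exp (- Q * v + 2 * h * Q\<^sup>2) \<le> exp 6 * exp (2 * L)"
          unfolding mult_exp_exp by simp
        hence "(2 * C * g v * exp (- l)) * (exp (- h * v / 2 + h ^ 3 / 12) * exp (- Q * v + 2 * h * Q\<^sup>2)) \<le> (2 * C * g v * exp (- l)) * (exp 6 * exp (2 * L))"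
          using C by (intro mult_left_mono) (auto simp: g_def)
        thus ?thesis unfolding E_def by (simp add: mult_ac)
      qed
      finally show "\<bar>\<psi> (t, v) l\<bar> \<le> indicator {0..} l * ((2 * C * exp 6 * exp (2 * L) * g v) * exp (- 1 * l))"
        using st by (simp add: \<psi>_def abs_mult mult_left_mono)
    qed (use C in \<open>auto simp: g_def\<close>)
    have gram: "crossing_kernel R p s x z z' = l2_inner lborel (\<phi> z) (\<psi> z')" if "fst z \<in> {s, t}" for z z'
    proof (cases "fst z' = s")
      case True
      have "R z z' = l2_inner lborel (\<phi> z) (\<psi> z')"
        unfolding R_def airy_half_product_def l2_inner_def \<phi>_def \<psi>_def
        by (rule Bochner_Integration.integral_cong) (use True in \<open>auto simp: indicator_def\<close>)
      thus ?thesis using True by (simp add: crossing_kernel_def)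
    next
      case False
      have "\<tau> (fst z) s \<le> 0" using that \<tau> h by auto
      note T = airy_half_product_truncated(2)[OF h(1) this, of "{..x}" "snd z" "snd z'"]
      show ?thesis
        unfolding crossing_kernel_def l2_inner_def R_def p_def fst_conv snd_conv if_not_P[OF False]
        using T False by (simp add: \<phi>_def \<psi>_def p_def) (auto intro!: Bochner_Integration.integral_cong simp: indicator_def)
    qed
    define D1 where "D1 = C\<^sup>2 * (L / 2)"
    define D2 where "D2 = 2 * exp 7 * C\<^sup>2 * L * exp (2 * L)"
    define m where "m = D1 * (4 * L) + 1"
    define S where "S = exp (2 * m)"
    have m: "0 \<le> m" using L by (simp add: m_def D1_def)
    have exp_series: "(\<lambda>n. 1 * (2 * m) ^ n / fact n) sums S"
      using exp_converges[of "2 * m"] by (simp add: S_def scaleR_conv_of_real divide_inverse mult.commute)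
    have "\<P>(\<omega> in P. A s \<omega> \<le> x \<and> y < A t \<omega>) \<le> 8 * D2 * S * exp (- ((y - x)\<^sup>2 / (16 * h)))"
    proof (rule crossing_probability_gaussian[OF proc fdd h_def h L, where b = "\<lambda>_. 1"])
      show "0 \<le> D1" "0 \<le> D2" using C L by (auto simp: D1_def D2_def)
      have lb: "borel_measurable (X \<Otimes>\<^sub>M lborel) = borel_measurable (X \<Otimes>\<^sub>M borel)" for X :: "'x measure"
        by (intro measurable_cong_sets sets_pair_measure_cong) auto
      have [measurable]: "(\<lambda>w. \<tau> (fst (fst (fst w))) (fst (snd (fst w)))) \<in> borel_measurable ((time_space s t \<Otimes>\<^sub>M time_space s t) \<Otimes>\<^sub>M borel)"
        "(\<lambda>w. snd (fst (fst w))) \<in> borel_measurable ((time_space s t \<Otimes>\<^sub>M time_space s t) \<Otimes>\<^sub>M borel)"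
        "(\<lambda>w. snd (snd (fst w))) \<in> borel_measurable ((time_space s t \<Otimes>\<^sub>M time_space s t) \<Otimes>\<^sub>M borel)"
        unfolding \<tau>_def by (intro borel_measurable_times borel_measurable_diff borel_measurable_add borel_measurable_const
          measurable_compose[OF measurable_fst] measurable_compose[OF measurable_snd] time_space_measurable_fst time_space_measurable_snd)+
      have "(\<lambda>(w, l). indicator {0..} l * (exp (\<tau> (fst (fst w)) (fst (snd w)) * l) * (Ai (snd (fst w) + l) * Ai (snd (snd w) + l))))
        \<in> borel_measurable ((time_space s t \<Otimes>\<^sub>M time_space s t) \<Otimes>\<^sub>M lborel)"
        unfolding lb case_prod_unfold by measurable
      from lborel.borel_measurable_lebesgue_integral[OF this]
      show "case_prod R \<in> borel_measurable (time_space s t \<Otimes>\<^sub>M time_space s t)"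
        unfolding R_def airy_half_product_def case_prod_unfold .
      show "case_prod p \<in> borel_measurable (borel \<Otimes>\<^sub>M borel)" unfolding p_def tilted_heat_kernel_def case_prod_unfold by measurable
      show "oriented s t airy2_ext_kernel (r, u) (r', u') = R (r, u) (r', u') - (if r = s \<and> r' = t then p u u' else 0)"
        if r: "r \<in> {s, t}" "r' \<in> {s, t}" for r r' u u'
      proof (cases "r = s \<and> r' = t")
        case True
        note sp = airy2_kernel_split[OF h, of u u']
        show ?thesis
        proof (cases "s < t")
          case lt: True
          have "exp (- (l * (s - t))) * Ai (u + l) * Ai (u' + l) = exp (h * l) * Ai (u + l) * Ai (u' + l)" for l
            using lt by (simp add: h_def algebra_simps)
          hence "(LBINT l:{..0}. exp (- (l * (s - t))) * Ai (u + l) * Ai (u' + l)) = (LBINT l:{..0}. exp (h * l) * Ai (u + l) * Ai (u' + l))"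
            by (simp only:)
          thus ?thesis using sp True lt \<tau> by (simp add: oriented_def airy2_ext_kernel_def R_def p_def)
        next
          case False
          hence ts: "t < s" using st by simp
          have "exp (- (l * (t - s))) * Ai (u' + l) * Ai (u + l) = exp (h * l) * Ai (u + l) * Ai (u' + l)" for l
            using ts by (simp add: h_def algebra_simps)
          hence "(LBINT l:{..0}. exp (- (l * (t - s))) * Ai (u' + l) * Ai (u + l)) = (LBINT l:{..0}. exp (h * l) * Ai (u + l) * Ai (u' + l))"
            by (simp only:)
          thus ?thesis using sp True ts \<tau> by (simp add: oriented_def airy2_ext_kernel_def R_def p_def)
        qed
      next
        case False
        have "oriented s t airy2_ext_kernel (r, u) (r', u') = R (r, u) (r', u')"
          using False r st by (cases "s < t") (auto simp: oriented_def airy2_ext_kernel_def R_def \<tau>_def sgn_if airy_half_product_def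
            set_lebesgue_integral_def algebra_simps)
        thus ?thesis unfolding if_not_P[OF False] by simp
      qed
      show "\<bar>R (r, u) (r', u')\<bar> \<le> C\<^sup>2 * exp (- 2 * (u + u'))" if "r \<in> {s, t}" "r' \<in> {s, t}" for r r' u u'
        unfolding R_def fst_conv snd_conv by (rule airy_half_product_bound(2)) (use that \<tau> h C in auto)
      show "\<bar>p u v\<bar> \<le> (exp h / sqrt (4 * pi * h) * exp (L + 1)) * exp (u - v)" if "x < u" "y < v" for u v
      proof -
        have "- h * (u + v) / 2 + h ^ 3 / 12 \<le> L + 1"
        proof -
          have "- h * u \<le> L" "- h * v \<le> L" using exph[of u] exph[of v] that L by auto
          moreover have "h ^ 3 \<le> 1" using h by (intro power_le_one) auto
          moreover have "- h * (u + v) / 2 + h ^ 3 / 12 = (- h * u) / 2 + (- h * v) / 2 + h ^ 3 / 12" by (simp add: field_simps)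
          ultimately show ?thesis by (simp only:)
        qed
        hence "p u v \<le> (exp h / sqrt (4 * pi * h) * exp (u - v)) * exp (L + 1)"
          unfolding p_def tilted_heat_kernel_def using h by (intro mult_mono heat_kernel_le_exp) auto
        thus ?thesis using p0[of u v] by (simp add: mult_ac)
      qed
      show "integrable lborel (\<lambda>w. R (r, u) (s, w) * p w v)" if "r \<in> {s, t}" for r u v
        unfolding R_def p_def fst_conv snd_conv by (rule airy_half_product_semigroup[OF h(1)]) (use that \<tau> h in auto)
      show "(\<integral>w. R (r, u) (s, w) * p w v \<partial>lborel) = R (r, u) (t, v)" if "r \<in> {s, t}" for r u v
      proof -
        have "\<tau> r s + h = \<tau> r t" "\<tau> r s \<le> 0" using that \<tau> h by auto
        thus ?thesis unfolding R_def p_def fst_conv snd_conv by (simp add: airy_half_product_semigroup(2)[OF h(1)])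
      qed
      show "summable (\<lambda>n. 1 * (2 * (D1 * (4 * L) + 1)) ^ n / fact n)" "(\<Sum>n. 1 * (2 * (D1 * (4 * L) + 1)) ^ n / fact n) \<le> S"
        using exp_series by (auto simp: m_def sums_iff)
      show "1 \<le> S" using m by (simp add: S_def)
    next
      fix n and z :: "nat \<Rightarrow> real \<times> real"
      assume z: "\<And>i. i < n \<Longrightarrow> fst (z i) = s \<and> x < snd (z i) \<or> fst (z i) = t \<and> y < snd (z i)"
      have zt: "fst (z i) \<in> {s, t}" if "i < n" for i using z[OF that] by auto
      have \<psi>: "square_integrable lborel (\<psi> (z i))" if "i < n" for i
      proof (cases "z i")
        case (Pair r u)
        thus ?thesis using z[OF that] \<psi>s[of u] \<psi>t[of u] by auto
      qed
      have "Matrix.mat n n (\<lambda>(i, j). crossing_kernel R p s x (z i) (z j)) = Matrix.mat n n (\<lambda>(i, j). l2_inner lborel (\<phi> (z i)) (\<psi> (z j)))"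
        by (intro cong_mat) (auto intro!: gram zt)
      hence "\<bar>matrix_det n (\<lambda>i j. crossing_kernel R p s x (z i) (z j))\<bar> = \<bar>matrix_det n (\<lambda>i j. l2_inner lborel (\<phi> (z i)) (\<psi> (z j)))\<bar>" by simp
      also have "\<dots> \<le> (\<Prod>i<n. sqrt (l2_inner lborel (\<phi> (z i)) (\<phi> (z i))) * sqrt (l2_inner lborel (\<psi> (z i)) (\<psi> (z i))))"
        by (rule gram_det_bound) (use \<phi> zt \<psi> in auto)
      also have "\<dots> \<le> (\<Prod>i<n. if fst (z i) = s then D1 * exp (- (2 / L) * snd (z i)) else D2 * exp (- ((snd (z i) - x)\<^sup>2 / (8 * h))))"
      proof (rule prod_mono, intro conjI)
        fix i assume "i \<in> {..<n}"
        hence i: "i < n" by simp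
        show "0 \<le> sqrt (l2_inner lborel (\<phi> (z i)) (\<phi> (z i))) * sqrt (l2_inner lborel (\<psi> (z i)) (\<psi> (z i)))"
          by (simp add: l2_inner_self_nonneg)
        obtain r u where zi: "z i = (r, u)" by (cases "z i")
        have sq: "sqrt (1 / (2 * q)) * sqrt (1 / (2 * q)) = L / 2" using q L by (simp add: q_def)
        have sq1: "sqrt (1 / (2 * q)) \<le> L"
        proof (rule real_le_lsqrt)
          have "L * 1 \<le> L * L" using L by (intro mult_left_mono) auto
          thus "1 / (2 * q) \<le> L\<^sup>2" using L by (simp add: q_def power2_eq_square)
        qed (use L in auto)
        have \<phi>i: "sqrt (l2_inner lborel (\<phi> (z i)) (\<phi> (z i))) \<le> (C * exp (- q * u)) * sqrt (1 / (2 * q))"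
          using \<phi>[OF zt[OF i]] zi by simp
        show "sqrt (l2_inner lborel (\<phi> (z i)) (\<phi> (z i))) * sqrt (l2_inner lborel (\<psi> (z i)) (\<psi> (z i)))
          \<le> (if fst (z i) = s then D1 * exp (- (2 / L) * snd (z i)) else D2 * exp (- ((snd (z i) - x)\<^sup>2 / (8 * h))))"
        proof (cases "r = s")
          case True
          have "sqrt (l2_inner lborel (\<phi> (z i)) (\<phi> (z i))) * sqrt (l2_inner lborel (\<psi> (z i)) (\<psi> (z i)))
            \<le> ((C * exp (- q * u)) * sqrt (1 / (2 * q))) * ((C * exp (- q * u)) * sqrt (1 / (2 * q)))"
            using \<psi>s[of u] zi True C q by (intro mult_mono \<phi>i) (auto simp: l2_inner_self_nonneg)
          also have "\<dots> = C\<^sup>2 * (exp (- q * u) * exp (- q * u)) * (sqrt (1 / (2 * q)) * sqrt (1 / (2 * q)))"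
            by (simp only: power2_eq_square mult_ac)
          also have "\<dots> = D1 * exp (- (2 / L) * u)" unfolding sq mult_exp_exp by (simp add: D1_def q_def)
          finally show ?thesis using zi True by simp
        next
          case False
          hence rt: "r = t" "y < u" using z[OF i] zi by auto
          have "sqrt (l2_inner lborel (\<phi> (z i)) (\<phi> (z i))) * sqrt (l2_inner lborel (\<psi> (z i)) (\<psi> (z i)))
            \<le> ((C * exp 1) * L) * ((2 * C * exp 6 * exp (2 * L) * g u) * 1)"
          proof (rule mult_mono)
            have "(C * exp (- q * u)) * sqrt (1 / (2 * q)) \<le> (C * exp 1) * L"
              using C q sq1 rt L by (intro mult_mono mult_left_mono expq) auto
            thus "sqrt (l2_inner lborel (\<phi> (z i)) (\<phi> (z i))) \<le> (C * exp 1) * L" using \<phi>i by linarith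
            have "(2 * C * exp 6 * exp (2 * L) * g u) * sqrt (1 / (2 * 1)) \<le> (2 * C * exp 6 * exp (2 * L) * g u) * 1"
              using C by (intro mult_left_mono) (auto simp: g_def)
            thus "sqrt (l2_inner lborel (\<psi> (z i)) (\<psi> (z i))) \<le> (2 * C * exp 6 * exp (2 * L) * g u) * 1"
              using \<psi>t[OF rt(2)] zi rt(1) by simp
          qed (use C L in \<open>auto simp: l2_inner_self_nonneg\<close>)
          also have "\<dots> = D2 * g u"
          proof -
            have "exp 1 * exp 6 = exp (7::real)" by (simp add: mult_exp_exp)
            thus ?thesis unfolding D2_def by (simp add: power2_eq_square mult_ac)
          qed
          finally show ?thesis using zi False by (simp add: g_def)
        qed
      qed
      finally show "\<bar>matrix_det n (\<lambda>i j. crossing_kernel R p s x (z i) (z j))\<bar>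
        \<le> 1 * (\<Prod>i<n. if fst (z i) = s then D1 * exp (- (2 / L) * snd (z i)) else D2 * exp (- ((snd (z i) - x)\<^sup>2 / (8 * h))))" by simp
    qed simp_all
    also have "\<dots> \<le> (C' * exp (C' * L\<^sup>2)) * exp (- ((y - x)\<^sup>2 / (16 * h)))"
    proof (rule mult_right_mono)
      have LL: "L \<le> L\<^sup>2" using L self_le_power[of L 2] by simp
      have "L \<le> exp L" using exp_ge_add_one_self[of L] by linarith
      have "2 * m = 4 * C\<^sup>2 * L\<^sup>2 + 2" by (simp add: m_def D1_def power2_eq_square)
      moreover have "C' * L\<^sup>2 = (16 * exp 9 * C\<^sup>2 * exp 2) * L\<^sup>2 + 4 * C\<^sup>2 * L\<^sup>2 + 3 * L\<^sup>2" by (simp add: C'_def algebra_simps)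
      moreover have "0 \<le> (16 * exp 9 * C\<^sup>2 * exp 2) * L\<^sup>2" by simp
      ultimately have "L + 2 * L + 2 * m \<le> 2 + C' * L\<^sup>2" using LL by linarith
      hence "exp (L + 2 * L + 2 * m) \<le> exp (2 + C' * L\<^sup>2)" by simp
      hence e: "exp L * exp (2 * L) * S \<le> exp 2 * exp (C' * L\<^sup>2)" by (simp only: S_def exp_add)
      have "8 * D2 * S = 16 * exp 7 * C\<^sup>2 * (L * exp (2 * L) * S)" by (simp add: D2_def)
      also have "\<dots> \<le> 16 * exp 7 * C\<^sup>2 * (exp L * exp (2 * L) * S)"
        using \<open>L \<le> exp L\<close> by (intro mult_left_mono mult_right_mono) (auto simp: S_def)
      also have "\<dots> \<le> 16 * exp 7 * C\<^sup>2 * (exp 2 * exp (C' * L\<^sup>2))" by (intro mult_left_mono e) auto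
      also have "\<dots> = (16 * exp 7 * C\<^sup>2 * exp 2) * exp (C' * L\<^sup>2)" by simp
      also have "\<dots> \<le> C' * exp (C' * L\<^sup>2)"
      proof (rule mult_right_mono)
        have "16 * exp 7 * C\<^sup>2 * exp 2 \<le> 16 * exp 9 * C\<^sup>2 * exp (2::real)" by (intro mult_right_mono mult_left_mono) auto
        thus "16 * exp 7 * C\<^sup>2 * exp 2 \<le> C'" unfolding C'_def using zero_le_power2[of C] by linarith
      qed simp
      finally show "8 * D2 * S \<le> C' * exp (C' * L\<^sup>2)" .
    qed simp
    finally show ?thesis by (simp add: h_def)
  qed
  hence "gaussian_crossings P A C'" unfolding gaussian_crossings_def by (intro allI impI) (elim conjE)
  thus thesis by (rule that)
qed

section \<open>Hoelder continuous extension from dyadic points\<close>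

definition dyadic_floor :: "nat \<Rightarrow> real \<Rightarrow> real" where
  "dyadic_floor n t = real_of_int \<lfloor>2 ^ n * t\<rfloor> / 2 ^ n"

text \<open>Only increments of neighbouring dyadic points enter, from some level on that may depend on the bounded interval.\<close>

definition dyadic_Hoelder :: "real \<Rightarrow> (real \<Rightarrow> real) \<Rightarrow> bool" where
  "dyadic_Hoelder \<gamma> f \<longleftrightarrow> (\<forall>N::nat. \<exists>c p. \<forall>n\<ge>p. \<forall>k::int. real_of_int \<bar>k\<bar> \<le> N * 2 ^ n \<longrightarrow>
     \<bar>f (real_of_int (k + 1) / 2 ^ n) - f (real_of_int k / 2 ^ n)\<bar> \<le> c * (2 powr - \<gamma>) ^ n)"

lemma dyadic_floor_bounds: "dyadic_floor n t \<le> t" "t < dyadic_floor n t + 1 / 2 ^ n"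
proof -
  have "real_of_int \<lfloor>2 ^ n * t\<rfloor> \<le> 2 ^ n * t" "2 ^ n * t < real_of_int \<lfloor>2 ^ n * t\<rfloor> + 1" by linarith+
  thus "dyadic_floor n t \<le> t" "t < dyadic_floor n t + 1 / 2 ^ n" by (simp_all add: dyadic_floor_def field_simps)
qed

lemma locally_Hoelder_mono:
  assumes "locally_Hoelder \<gamma> f" "\<gamma>' \<le> \<gamma>"
  shows "locally_Hoelder \<gamma>' f"
  unfolding locally_Hoelder_def
proof (intro allI)
  fix a b :: real
  from assms(1) obtain C where C: "\<And>s t. s \<in> {a..b} \<Longrightarrow> t \<in> {a..b} \<Longrightarrow> \<bar>f t - f s\<bar> \<le> C * \<bar>t - s\<bar> powr \<gamma>"
    unfolding locally_Hoelder_def by blast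
  have "\<bar>f t - f s\<bar> \<le> (\<bar>C\<bar> * (b - a) powr (\<gamma> - \<gamma>')) * \<bar>t - s\<bar> powr \<gamma>'" if st: "s \<in> {a..b}" "t \<in> {a..b}" for s t
  proof (cases "s = t")
    case False
    have "\<bar>f t - f s\<bar> \<le> C * \<bar>t - s\<bar> powr \<gamma>" by (rule C[OF st])
    also have "\<dots> \<le> \<bar>C\<bar> * \<bar>t - s\<bar> powr \<gamma>" by (intro mult_right_mono) auto
    also have "\<bar>t - s\<bar> powr \<gamma> = \<bar>t - s\<bar> powr (\<gamma> - \<gamma>') * \<bar>t - s\<bar> powr \<gamma>'" by (simp add: powr_add[symmetric])
    also have "\<bar>C\<bar> * (\<bar>t - s\<bar> powr (\<gamma> - \<gamma>') * \<bar>t - s\<bar> powr \<gamma>') \<le> \<bar>C\<bar> * ((b - a) powr (\<gamma> - \<gamma>') * \<bar>t - s\<bar> powr \<gamma>')"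
      using st assms(2) by (intro mult_left_mono mult_right_mono powr_mono2) auto
    finally show ?thesis by (simp add: mult.assoc)
  qed simp
  thus "\<exists>C. \<forall>s\<in>{a..b}. \<forall>t\<in>{a..b}. \<bar>f t - f s\<bar> \<le> C * \<bar>t - s\<bar> powr \<gamma>'" by blast
qed

text \<open>From one level to the next, the dyadic point to the left of \<open>t\<close> moves by at most one step, so that the values form a Cauchy
sequence with geometric tails. Two points at distance about \<open>2\<^sup>-\<^sup>n\<close> are compared at the level \<open>n\<close>, where their left neighbours are a
bounded number of steps apart.\<close>

lemma dyadic_extension:
  assumes f: "dyadic_Hoelder \<gamma> f" and \<gamma>: "0 < \<gamma>"
  shows "convergent (\<lambda>n. f (dyadic_floor n t))"
    and "locally_Hoelder \<gamma> (\<lambda>t. lim (\<lambda>n. f (dyadic_floor n t)))"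
proof -
  define q where "q = (2::real) powr - \<gamma>"
  have q: "0 < q" "q < 1" using \<gamma> by (auto simp: q_def powr_less_one)
  define F where "F = (\<lambda>t. lim (\<lambda>n. f (dyadic_floor n t)))"
  \<comment> \<open>on each bounded window, passing to the next dyadic level moves the value by a geometrically small amount.\<close>
  define W where "W = (\<lambda>(N :: nat) c p. 0 \<le> c \<and> (\<forall>n\<ge>p. \<forall>k::int. real_of_int \<bar>k\<bar> \<le> real (Suc N) * 2 ^ n \<longrightarrow>
      \<bar>f (real_of_int (k + 1) / 2 ^ n) - f (real_of_int k / 2 ^ n)\<bar> \<le> c * q ^ n) \<and>
      (\<forall>t. \<bar>t\<bar> \<le> real N \<longrightarrow> (\<forall>n\<ge>p. \<bar>F t - f (dyadic_floor n t)\<bar> \<le> c / (1 - q) * q ^ n) \<and> convergent (\<lambda>n. f (dyadic_floor n t))))"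
  have window: "\<exists>c p. W N c p" for N
  proof -
    obtain c p where cp: "\<forall>n\<ge>p. \<forall>k::int. real_of_int \<bar>k\<bar> \<le> real (Suc N) * 2 ^ n \<longrightarrow>
      \<bar>f (real_of_int (k + 1) / 2 ^ n) - f (real_of_int k / 2 ^ n)\<bar> \<le> c * q ^ n"
      using f[unfolded dyadic_Hoelder_def, rule_format, of "Suc N"] unfolding q_def by blast
    have "0 \<le> c * q ^ p" using cp[rule_format, of p 0] by (rule order_trans[rotated]) auto
    hence c: "0 \<le> c" using zero_less_power[OF q(1), of p] by (simp add: zero_le_mult_iff)
    have T: "(\<forall>n\<ge>p. \<bar>F t - f (dyadic_floor n t)\<bar> \<le> c / (1 - q) * q ^ n) \<and> convergent (\<lambda>n. f (dyadic_floor n t))" if t: "\<bar>t\<bar> \<le> real N" for t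
    proof -
      have step: "\<bar>f (dyadic_floor (Suc n) t) - f (dyadic_floor n t)\<bar> \<le> c * q ^ Suc n" if n: "p \<le> n" for n
      proof -
        define k where "k = \<lfloor>2 ^ n * t\<rfloor>"
        have k2: "\<lfloor>2 ^ Suc n * t\<rfloor> = 2 * k \<or> \<lfloor>2 ^ Suc n * t\<rfloor> = 2 * k + 1"
        proof -
          have "2 ^ Suc n * t = 2 * (2 ^ n * t)" by simp
          moreover have "\<lfloor>2 * x\<rfloor> = 2 * \<lfloor>x\<rfloor> \<or> \<lfloor>2 * x\<rfloor> = 2 * \<lfloor>x\<rfloor> + 1" for x :: real by linarith
          ultimately show ?thesis unfolding k_def by metis
        qed
        have d: "dyadic_floor n t = real_of_int (2 * k) / 2 ^ Suc n" by (simp add: dyadic_floor_def k_def)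
        have "real_of_int \<bar>2 * k\<bar> \<le> real (Suc N) * 2 ^ Suc n"
        proof -
          have t1: "2 ^ n * t \<le> 2 ^ n * real N" "- (2 ^ n * real N) \<le> 2 ^ n * t"
            using t mult_left_mono[of t "real N" "2 ^ n"] mult_left_mono[of "- real N" t "2 ^ n"] by auto
          have "1 \<le> (2::real) ^ n" by simp
          hence "real_of_int \<bar>k\<bar> \<le> 2 ^ n * real N + 2 ^ n" using t1 unfolding k_def by linarith
          thus ?thesis by (simp add: algebra_simps)
        qed
        hence inc: "\<bar>f (real_of_int (2 * k + 1) / 2 ^ Suc n) - f (real_of_int (2 * k) / 2 ^ Suc n)\<bar> \<le> c * q ^ Suc n"
          using cp[rule_format, of "Suc n" "2 * k"] n by simp
        show ?thesis
          using k2
        proof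
          assume "\<lfloor>2 ^ Suc n * t\<rfloor> = 2 * k"
          hence "dyadic_floor (Suc n) t = dyadic_floor n t" unfolding d by (simp add: dyadic_floor_def)
          thus ?thesis using c q by simp
        next
          assume "\<lfloor>2 ^ Suc n * t\<rfloor> = 2 * k + 1"
          hence "dyadic_floor (Suc n) t = real_of_int (2 * k + 1) / 2 ^ Suc n" unfolding dyadic_floor_def by simp
          thus ?thesis using inc d by simp
        qed
      qed
      have sum: "\<bar>f (dyadic_floor (n + m) t) - f (dyadic_floor n t)\<bar> \<le> c / (1 - q) * (q ^ n - q ^ (n + m))" if n: "p \<le> n" for n m
      proof (induction m)
        case (Suc m)
        have "\<bar>f (dyadic_floor (n + Suc m) t) - f (dyadic_floor n t)\<bar> \<le> c * q ^ Suc (n + m) + c / (1 - q) * (q ^ n - q ^ (n + m))"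
          using Suc step[of "n + m"] n by simp
        also have "c * q ^ Suc (n + m) \<le> c * q ^ (n + m)" using c q by (intro mult_left_mono power_decreasing) auto
        also have "c * q ^ (n + m) + c / (1 - q) * (q ^ n - q ^ (n + m)) = c / (1 - q) * (q ^ n - q ^ (n + Suc m))"
          using q by (simp add: field_simps)
        finally show ?case by simp
      qed simp
      have tail: "\<bar>f (dyadic_floor m t) - f (dyadic_floor n t)\<bar> \<le> c / (1 - q) * q ^ n" if "p \<le> n" "n \<le> m" for n m
      proof -
        have "\<bar>f (dyadic_floor m t) - f (dyadic_floor n t)\<bar> \<le> c / (1 - q) * (q ^ n - q ^ m)" using sum[of n "m - n"] that by simp
        also have "\<dots> \<le> c / (1 - q) * q ^ n" using c q by (intro mult_left_mono) auto
        finally show ?thesis .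
      qed
      have conv: "convergent (\<lambda>n. f (dyadic_floor n t))"
      proof (rule Cauchy_convergent, rule metric_CauchyI)
        fix e :: real assume "0 < e"
        have "(\<lambda>n. c / (1 - q) * q ^ n) \<longlonglongrightarrow> c / (1 - q) * 0" using q by (intro tendsto_mult_left LIMSEQ_realpow_zero) auto
        hence "eventually (\<lambda>n. c / (1 - q) * q ^ n < e / 2) sequentially" using \<open>0 < e\<close> by (intro order_tendstoD(2)) auto
        then obtain n0 where n0: "\<And>n. n0 \<le> n \<Longrightarrow> c / (1 - q) * q ^ n < e / 2" unfolding eventually_sequentially by blast
        define n1 where "n1 = max n0 p"
        have "dist (f (dyadic_floor m t)) (f (dyadic_floor m' t)) < e" if "n1 \<le> m" "n1 \<le> m'" for m m'
        proof -
          have "\<bar>f (dyadic_floor m t) - f (dyadic_floor n1 t)\<bar> < e / 2" "\<bar>f (dyadic_floor m' t) - f (dyadic_floor n1 t)\<bar> < e / 2"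
            using le_less_trans[OF tail[of n1 m] n0[of n1]] le_less_trans[OF tail[of n1 m'] n0[of n1]] that
            unfolding n1_def by (simp_all only: max.bounded_iff max.cobounded1 max.cobounded2)
          thus ?thesis unfolding dist_real_def by linarith
        qed
        thus "\<exists>M. \<forall>m\<ge>M. \<forall>n\<ge>M. dist (f (dyadic_floor m t)) (f (dyadic_floor n t)) < e" by blast
      qed
      have "\<bar>F t - f (dyadic_floor n t)\<bar> \<le> c / (1 - q) * q ^ n" if n: "p \<le> n" for n
      proof (rule LIMSEQ_le_const2)
        show "(\<lambda>m. \<bar>f (dyadic_floor m t) - f (dyadic_floor n t)\<bar>) \<longlonglongrightarrow> \<bar>F t - f (dyadic_floor n t)\<bar>"
          unfolding F_def using conv by (intro tendsto_intros) (simp add: convergent_LIMSEQ_iff)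
        show "\<exists>N. \<forall>m\<ge>N. \<bar>f (dyadic_floor m t) - f (dyadic_floor n t)\<bar> \<le> c / (1 - q) * q ^ n" using tail[OF n] by blast
      qed
      thus ?thesis using conv by blast
    qed
    have "W N c p" unfolding W_def using c cp T by simp
    thus ?thesis by blast
  qed
  obtain N :: nat where "\<bar>t\<bar> \<le> real N" using real_arch_simple[of "\<bar>t\<bar>"] by blast
  moreover obtain c p where "W N c p" using window by blast
  ultimately show "convergent (\<lambda>n. f (dyadic_floor n t))" unfolding W_def by simp
  show "locally_Hoelder \<gamma> (\<lambda>t. lim (\<lambda>n. f (dyadic_floor n t)))"
    unfolding F_def[symmetric] locally_Hoelder_def
  proof (intro allI)
    fix a b :: real
    obtain N :: nat where N: "max \<bar>a\<bar> \<bar>b\<bar> \<le> real N" using real_arch_simple[of "max \<bar>a\<bar> \<bar>b\<bar>"] by blast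
    obtain c p where "W N c p" using window by blast
    hence c: "0 \<le> c"
      and cp: "\<And>n k. p \<le> n \<Longrightarrow> real_of_int \<bar>k\<bar> \<le> real (Suc N) * 2 ^ n \<Longrightarrow> \<bar>f (real_of_int (k + 1) / 2 ^ n) - f (real_of_int k / 2 ^ n)\<bar> \<le> c * q ^ n"
      and cF: "\<And>t n. \<bar>t\<bar> \<le> real N \<Longrightarrow> p \<le> n \<Longrightarrow> \<bar>F t - f (dyadic_floor n t)\<bar> \<le> c / (1 - q) * q ^ n"
      unfolding W_def by simp_all
    define R where "R = 2 ^ p * \<bar>b - a\<bar> + 1"
    define K where "K = (c / (1 - q) + R * c) / q"
    have K: "0 \<le> K" using c q by (auto simp: K_def R_def intro!: divide_nonneg_pos add_nonneg_nonneg mult_nonneg_nonneg)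
    have ordered: "\<bar>F t - F s\<bar> \<le> 2 * K * \<bar>t - s\<bar> powr \<gamma>" if st: "s < t" "a \<le> s" "t \<le> b" for s t
    proof -
      have stN: "\<bar>s\<bar> \<le> real N" "\<bar>t\<bar> \<le> real N" using st N by auto
      \<comment> \<open>the scale of the increment, but at least the coarsest admissible one\<close>
      have "\<exists>n\<ge>p. q ^ Suc n \<le> (t - s) powr \<gamma> \<and> 2 ^ n * (t - s) + 1 \<le> 2 * R"
      proof (cases "1 / 2 ^ p \<le> t - s")
        case True
        have "q ^ Suc p \<le> q ^ p" using q by (intro power_decreasing) auto
        also have "q ^ p = (1 / 2 ^ p) powr \<gamma>"
          by (simp add: q_def powr_minus powr_divide inverse_eq_divide power_divide powr_realpow[symmetric] powr_powr mult.commute)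
        also have "\<dots> \<le> (t - s) powr \<gamma>" using True \<gamma> by (intro powr_mono2) auto
        finally have "q ^ Suc p \<le> (t - s) powr \<gamma>" .
        moreover have "2 ^ p * (t - s) + 1 \<le> 2 * R"
        proof -
          have "2 ^ p * (t - s) \<le> 2 ^ p * \<bar>b - a\<bar>" using st by (intro mult_left_mono) auto
          hence "2 ^ p * (t - s) + 1 \<le> R" unfolding R_def by (rule add_right_mono)
          moreover have "0 \<le> R" by (simp add: R_def)
          ultimately show ?thesis by simp
        qed
        ultimately show ?thesis by blast
      next
        case False
        define n where "n = (LEAST n. 1 / 2 ^ Suc n \<le> t - s)"
        obtain n' where "(1 / 2) ^ n' < t - s" using real_arch_pow_inv[of "t - s" "1 / 2"] st by auto
        moreover have "(1 / 2 :: real) ^ Suc n' \<le> (1 / 2) ^ n'" by (intro power_decreasing) auto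
        ultimately have ex: "1 / 2 ^ Suc n' \<le> t - s" by (simp add: power_one_over)
        have n1: "1 / 2 ^ Suc n \<le> t - s" unfolding n_def using LeastI[of "\<lambda>n. 1 / 2 ^ Suc n \<le> t - s" n'] ex by simp
        have n2: "t - s < 1 / 2 ^ m" if "m \<le> n" "p \<le> m" for m
        proof (cases m)
          case 0
          thus ?thesis using False that by simp
        next
          case (Suc m')
          hence "m' < n" using that by simp
          thus ?thesis using not_less_Least[of m' "\<lambda>n. 1 / 2 ^ Suc n \<le> t - s"] Suc unfolding n_def by auto
        qed
        have np: "p \<le> n"
        proof (rule ccontr)
          assume "\<not> p \<le> n"
          hence "(2::real) ^ Suc n \<le> 2 ^ p" by (intro power_increasing) auto
          hence "1 / 2 ^ p \<le> (1::real) / 2 ^ Suc n" by (intro divide_left_mono) auto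
          thus False using n1 False by linarith
        qed
        have "q ^ Suc n = (1 / 2 ^ Suc n) powr \<gamma>"
          by (simp add: q_def powr_minus powr_divide inverse_eq_divide power_divide powr_realpow[symmetric] powr_powr mult.commute powr_mult powr_add del: power_Suc)
        also have "\<dots> \<le> (t - s) powr \<gamma>" using n1 \<gamma> by (intro powr_mono2) auto
        finally have "q ^ Suc n \<le> (t - s) powr \<gamma>" .
        moreover have "2 ^ n * (t - s) + 1 \<le> 2 * R"
        proof -
          have "2 ^ n * (t - s) \<le> 2 ^ n * (1 / 2 ^ n)" using n2[OF order_refl np] by (intro mult_left_mono) auto
          moreover have "1 \<le> R" by (simp add: R_def)
          ultimately show ?thesis by simp
        qed
        ultimately show ?thesis using np by blast
      qed
      then obtain n where n: "p \<le> n" "q ^ Suc n \<le> (t - s) powr \<gamma>" "2 ^ n * (t - s) + 1 \<le> 2 * R" by blast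
      define k where "k = \<lfloor>2 ^ n * s\<rfloor>"
      define d where "d = nat (\<lfloor>2 ^ n * t\<rfloor> - k)"
      have "k \<le> \<lfloor>2 ^ n * t\<rfloor>" unfolding k_def using st by (intro floor_mono) auto
      hence kd: "\<lfloor>2 ^ n * t\<rfloor> = k + int d" by (simp add: d_def)
      have d: "real d \<le> 2 * R"
      proof -
        have "2 ^ n * t - 2 ^ n * s + 1 \<le> 2 * R" using n(3) by (simp add: algebra_simps)
        moreover have "real d = real_of_int \<lfloor>2 ^ n * t\<rfloor> - real_of_int k" using kd by simp
        ultimately show ?thesis unfolding k_def by linarith
      qed
      have chain: "\<bar>f (real_of_int (k + int i) / 2 ^ n) - f (real_of_int k / 2 ^ n)\<bar> \<le> real i * (c * q ^ n)" if "i \<le> d" for i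
        using that
      proof (induction i)
        case (Suc i)
        have "real_of_int \<bar>k + int i\<bar> \<le> real (Suc N) * 2 ^ n"
        proof -
          have e: "2 ^ n * t \<le> 2 ^ n * real N" "- (2 ^ n * real N) \<le> 2 ^ n * s"
            using stN mult_left_mono[of t "real N" "2 ^ n"] mult_left_mono[of "- real N" s "2 ^ n"] by auto
          have "k + int i \<le> \<lfloor>2 ^ n * t\<rfloor>" "k \<le> k + int i" using Suc kd by auto
          moreover have "1 \<le> (2::real) ^ n" by simp
          ultimately have "real_of_int \<bar>k + int i\<bar> \<le> 2 ^ n * real N + 2 ^ n" using e unfolding k_def by linarith
          thus ?thesis by (simp add: algebra_simps)
        qed
        from cp[OF n(1) this] Suc show ?case by (simp add: algebra_simps)
      qed simp
      have "\<bar>f (dyadic_floor n t) - f (dyadic_floor n s)\<bar> \<le> real d * (c * q ^ n)"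
        using chain[of d] by (simp add: dyadic_floor_def kd k_def)
      also have "\<dots> \<le> (2 * R) * (c * q ^ n)" using d c q by (intro mult_right_mono) auto
      finally have "\<bar>F t - F s\<bar> \<le> 2 * (c / (1 - q) * q ^ n) + (2 * R) * (c * q ^ n)"
        using cF[OF stN(1) n(1)] cF[OF stN(2) n(1)] by linarith
      also have "\<dots> = 2 * (K * q) * q ^ n"
      proof -
        have "K * q = c / (1 - q) + R * c" using q by (simp add: K_def)
        thus ?thesis by (simp only:) (simp add: algebra_simps)
      qed
      also have "\<dots> = 2 * K * q ^ Suc n" by simp
      also have "\<dots> \<le> 2 * K * (t - s) powr \<gamma>" using n(2) K by (intro mult_left_mono) auto
      finally show ?thesis using st by simp
    qed
    have "\<bar>F t - F s\<bar> \<le> 2 * K * \<bar>t - s\<bar> powr \<gamma>" if "s \<in> {a..b}" "t \<in> {a..b}" for s t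
      using that ordered[of s t] ordered[of t s] by (cases s t rule: linorder_cases) (auto simp: abs_minus_commute)
    thus "\<exists>C. \<forall>s\<in>{a..b}. \<forall>t\<in>{a..b}. \<bar>F t - F s\<bar> \<le> C * \<bar>t - s\<bar> powr \<gamma>" by blast
  qed
qed

section \<open>Hoelder continuous versions\<close>

text \<open>An increment of more than \<open>2 * \<epsilon>\<close> crosses a gap of length \<open>\<epsilon>\<close> above one of the points of a grid with mesh \<open>\<epsilon>\<close>. Downward crossings
are upward ones with the times exchanged; they reach down to \<open>- 3 * L\<close>.\<close>

lemma increment_tail:
  assumes proc: "real_process P A" and G: "gaussian_crossings P A C"
    and st: "s \<noteq> t" "\<bar>t - s\<bar> \<le> 1" and L: "1 \<le> L" and \<epsilon>: "0 < \<epsilon>" "\<epsilon> \<le> L"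
  shows "\<P>(\<omega> in P. \<bar>A s \<omega>\<bar> \<le> L \<and> 2 * \<epsilon> < \<bar>A t \<omega> - A s \<omega>\<bar>)
    \<le> 12 * L / \<epsilon> * (C * exp (C * (3 * L)\<^sup>2) * exp (- (\<epsilon>\<^sup>2 / (16 * \<bar>t - s\<bar>))))"
proof -
  interpret P: prob_space P using proc by (simp add: real_process_def)
  have [measurable]: "A r \<in> borel_measurable P" for r using proc by (simp add: real_process_def)
  define b where "b = C * exp (C * (3 * L)\<^sup>2) * exp (- (\<epsilon>\<^sup>2 / (16 * \<bar>t - s\<bar>)))"
  define x where "x = (\<lambda>k::nat. - (3 * L) + real k * \<epsilon>)"
  define N where "N = nat \<lceil>4 * L / \<epsilon>\<rceil>"
  define U where "U = (\<lambda>k. {\<omega> \<in> space P. A s \<omega> \<le> x k \<and> x k + \<epsilon> < A t \<omega>})"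
  define V where "V = (\<lambda>k. {\<omega> \<in> space P. A t \<omega> \<le> x k \<and> x k + \<epsilon> < A s \<omega>})"
  have UV_sets: "U k \<in> sets P" "V k \<in> sets P" for k unfolding U_def V_def by measurable
  have x3: "- (3 * L) \<le> x k" for k using \<epsilon> by (simp add: x_def)
  have cross: "\<P>(\<omega> in P. A s' \<omega> \<le> x k \<and> x k + \<epsilon> < A t' \<omega>) \<le> b" if "s' \<noteq> t'" "\<bar>t' - s'\<bar> = \<bar>t - s\<bar>" for s' t' k
    using G[unfolded gaussian_crossings_def, rule_format, of s' t' "3 * L" "x k" "x k + \<epsilon>"] that st L \<epsilon> x3[of k]
    by (simp add: b_def)
  have UV: "measure P (U k \<union> V k) \<le> 2 * b" for k
  proof -
    have "measure P (U k \<union> V k) \<le> measure P (U k) + measure P (V k)"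
      using UV_sets by (intro measure_Un_le) auto
    moreover have "measure P (U k) \<le> b" unfolding U_def by (rule cross) (use st in auto)
    moreover have "measure P (V k) \<le> b" unfolding V_def by (rule cross) (use st in auto)
    ultimately show ?thesis by simp
  qed
  have grid: "\<exists>k\<le>N. c \<le> x k \<and> x k < c + \<epsilon>" if "- (3 * L) \<le> c" "c \<le> L" for c
  proof -
    define z where "z = (c + 3 * L) / \<epsilon>"
    have z: "0 \<le> z" "z \<le> 4 * L / \<epsilon>" unfolding z_def using that \<epsilon> by (auto intro!: divide_nonneg_pos divide_right_mono)
    define k where "k = nat \<lceil>z\<rceil>"
    have k: "real k = real_of_int \<lceil>z\<rceil>" using z by (simp add: k_def)
    have "k \<le> N" unfolding k_def N_def using z(2) by (intro nat_mono ceiling_mono)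
    moreover have "z \<le> real k" "real k < z + 1" unfolding k by linarith+
    hence "z * \<epsilon> \<le> real k * \<epsilon>" "real k * \<epsilon> < (z + 1) * \<epsilon>" using \<epsilon> by auto
    moreover have "z * \<epsilon> = c + 3 * L" using \<epsilon> by (simp add: z_def)
    ultimately show ?thesis by (intro exI[of _ k]) (simp add: x_def algebra_simps)
  qed
  have "{\<omega> \<in> space P. \<bar>A s \<omega>\<bar> \<le> L \<and> 2 * \<epsilon> < \<bar>A t \<omega> - A s \<omega>\<bar>} \<subseteq> (\<Union>k\<in>{..N}. U k \<union> V k)"
  proof
    fix \<omega> assume "\<omega> \<in> {\<omega> \<in> space P. \<bar>A s \<omega>\<bar> \<le> L \<and> 2 * \<epsilon> < \<bar>A t \<omega> - A s \<omega>\<bar>}"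
    hence \<omega>: "\<omega> \<in> space P" "\<bar>A s \<omega>\<bar> \<le> L" "2 * \<epsilon> < \<bar>A t \<omega> - A s \<omega>\<bar>" by auto
    show "\<omega> \<in> (\<Union>k\<in>{..N}. U k \<union> V k)"
    proof (cases "A s \<omega> \<le> A t \<omega>")
      case True
      have "- (3 * L) \<le> A s \<omega>" "A s \<omega> \<le> L" using \<omega>(2) L by linarith+
      from grid[OF this] obtain k where "k \<le> N" "A s \<omega> \<le> x k" "x k < A s \<omega> + \<epsilon>" by blast
      thus ?thesis using True \<omega> by (intro UN_I[of k]) (auto simp: U_def)
    next
      case False
      have "- (3 * L) \<le> A s \<omega> - 2 * \<epsilon>" "A s \<omega> - 2 * \<epsilon> \<le> L" using \<omega>(2) L \<epsilon> by linarith+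
      from grid[OF this] obtain k where "k \<le> N" "A s \<omega> - 2 * \<epsilon> \<le> x k" "x k < A s \<omega> - 2 * \<epsilon> + \<epsilon>" by blast
      thus ?thesis using False \<omega> by (intro UN_I[of k]) (auto simp: V_def)
    qed
  qed
  hence "\<P>(\<omega> in P. \<bar>A s \<omega>\<bar> \<le> L \<and> 2 * \<epsilon> < \<bar>A t \<omega> - A s \<omega>\<bar>) \<le> measure P (\<Union>k\<in>{..N}. U k \<union> V k)"
    using UV_sets by (intro P.finite_measure_mono) auto
  also have "\<dots> \<le> (\<Sum>k\<le>N. measure P (U k \<union> V k))" using UV_sets by (intro measure_UNION_le) auto
  also have "\<dots> \<le> (\<Sum>k\<le>N. 2 * b)" by (intro sum_mono UV)
  also have "\<dots> = (real N + 1) * (2 * b)" by simp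
  also have "\<dots> \<le> (6 * L / \<epsilon>) * (2 * b)"
  proof (rule mult_right_mono)
    have "0 \<le> 4 * L / \<epsilon>" using L \<epsilon> by simp
    hence "real N \<le> 4 * L / \<epsilon> + 1" unfolding N_def by linarith
    moreover have "1 \<le> L / \<epsilon>" using \<epsilon> by simp
    moreover have "4 * L / \<epsilon> = 4 * (L / \<epsilon>)" "6 * L / \<epsilon> = 6 * (L / \<epsilon>)" by simp_all
    ultimately show "real N + 1 \<le> 6 * L / \<epsilon>" by linarith
    show "0 \<le> 2 * b" using UV[of 0] measure_nonneg[of P "U 0 \<union> V 0"] by linarith
  qed
  also have "\<dots> = 12 * L / \<epsilon> * b" using \<epsilon> by (simp add: field_simps)
  finally show ?thesis by (simp add: b_def)
qed

lemma geometric_beats_linear: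
  fixes c r K :: real
  assumes "1 < r" "0 < c"
  shows "\<exists>p\<ge>1. \<forall>n\<ge>p. K + 3 * real n \<le> c * r ^ n"
proof -
  have n: "norm (1 / r) < 1" using assms by simp
  have "(\<lambda>n. K * (1 / r) ^ n + 3 * (real n * (1 / r) ^ n)) \<longlonglongrightarrow> K * 0 + 3 * 0"
    by (intro tendsto_add tendsto_mult_left LIMSEQ_power_zero powser_times_n_limit_0 n)
  hence "eventually (\<lambda>n. K * (1 / r) ^ n + 3 * (real n * (1 / r) ^ n) < c) sequentially"
    using assms by (intro order_tendstoD(2)) auto
  then obtain p where p: "\<And>n. p \<le> n \<Longrightarrow> K * (1 / r) ^ n + 3 * (real n * (1 / r) ^ n) < c" unfolding eventually_sequentially by blast
  have "K + 3 * real n \<le> c * r ^ n" if "p \<le> n" for n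
  proof -
    have "(K * (1 / r) ^ n + 3 * (real n * (1 / r) ^ n)) * r ^ n \<le> c * r ^ n" using p[OF that] assms by (intro mult_right_mono) auto
    moreover have "(K * (1 / r) ^ n + 3 * (real n * (1 / r) ^ n)) * r ^ n = K + 3 * real n"
      using assms by (simp add: power_one_over field_simps)
    ultimately show ?thesis by simp
  qed
  thus ?thesis by (intro exI[of _ "max p 1"]) auto
qed

text \<open>The level \<open>p\<close> is chosen before the cell \<open>j\<close> and before the bound \<open>L\<close>. This is possible because threshold and bound scale
alike: the exponent of the Gaussian factor at level \<open>n\<close> is \<open>L\<^sup>2\<close> times a number of order \<open>r\<^sup>n\<close> with \<open>r > 1\<close>, and beats
\<open>C * (6 * L)\<^sup>2\<close> for all \<open>L\<close> at once.\<close>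

lemma dyadic_cell_increments:
  assumes proc: "real_process P A" and G: "gaussian_crossings P A C" and C: "1 \<le> C" and \<gamma>: "0 < \<gamma>" "\<gamma> < 1 / 2"
  obtains p :: nat where "\<And>j::int. AE \<omega> in P. \<exists>c. \<forall>m. \<forall>k::int. j * 2 ^ m \<le> k \<and> k < (j + 1) * 2 ^ m \<longrightarrow>
      \<bar>A (real_of_int (k + 1) / 2 ^ (p + m)) \<omega> - A (real_of_int k / 2 ^ (p + m)) \<omega>\<bar> \<le> c * (2 powr - \<gamma>) ^ (p + m)"
proof -
  interpret P: prob_space P using proc by (simp add: real_process_def)
  have [measurable]: "A r \<in> borel_measurable P" for r using proc by (simp add: real_process_def)
  define q where "q = (2::real) powr - \<gamma>"
  have q: "0 < q" "q < 1" "1 / 2 < q"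
  proof -
    show "0 < q" "q < 1" using \<gamma> by (auto simp: q_def powr_less_one)
    have "(2::real) powr - 1 < 2 powr - \<gamma>" using \<gamma> by (intro powr_less_mono) auto
    thus "1 / 2 < q" by (simp add: q_def powr_minus_divide)
  qed
  \<comment> \<open>makes the sum of all thresholds \<open>2 * \<kappa> * L * q\<^sup>m\<close> equal to \<open>L\<close>\<close>
  define \<kappa> where "\<kappa> = (1 - q) / 2"
  have \<kappa>: "0 < \<kappa>" "\<kappa> < 1" using q by (auto simp: \<kappa>_def)
  define r where "r = q\<^sup>2 * 2"
  have r: "1 < r"
  proof -
    have "(2::real) powr (1 + - \<gamma> + - \<gamma>) = 2 powr 1 * 2 powr - \<gamma> * 2 powr - \<gamma>" by (simp only: powr_add)
    also have "\<dots> = r" by (simp add: r_def q_def power2_eq_square)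
    finally have "r = 2 powr (1 + - \<gamma> + - \<gamma>)" by simp
    thus ?thesis using \<gamma> by (simp add: gr_one_powr)
  qed
  obtain p where p: "1 \<le> p" "\<And>n. p \<le> n \<Longrightarrow> 36 * C + 3 * real n \<le> \<kappa>\<^sup>2 / 16 * r ^ n"
    using geometric_beats_linear[OF r, of "\<kappa>\<^sup>2 / 16" "36 * C"] \<kappa> by auto
  define pt where "pt = (\<lambda>(m::nat) (k::int). real_of_int k / 2 ^ (p + m))"
  define K where "K = 24 * C / \<kappa>"
  have K: "0 < K" using C \<kappa> by (simp add: K_def)
  have "AE \<omega> in P. \<exists>c. \<forall>m. \<forall>k::int. j * 2 ^ m \<le> k \<and> k < (j + 1) * 2 ^ m \<longrightarrow> \<bar>A (pt m (k + 1)) \<omega> - A (pt m k) \<omega>\<bar> \<le> c * q ^ (p + m)" for j :: int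
  proof -
    define cell where "cell = (\<lambda>m::nat. {j * 2 ^ m..<(j + 1) * 2 ^ m})"
    define Bad where "Bad = (\<lambda>(L::nat) m k. {\<omega> \<in> space P. \<bar>A (pt m k) \<omega>\<bar> \<le> 2 * real L \<and> 2 * (\<kappa> * real L * q ^ (p + m)) < \<bar>A (pt m (k + 1)) \<omega> - A (pt m k) \<omega>\<bar>})"
    define Start where "Start = (\<lambda>L::nat. {\<omega> \<in> space P. \<bar>A (pt 0 j) \<omega>\<bar> \<le> real L})"
    define Good where "Good = (\<lambda>L. Start L - (\<Union>m. \<Union>k\<in>cell m. Bad L m k))"
    have Bad_sets: "Bad L m k \<in> sets P" for L m k unfolding Bad_def by measurable
    have Bad_level_sets: "(\<Union>k\<in>cell m. Bad L m k) \<in> sets P" for L m using Bad_sets by (intro sets.finite_UN) (auto simp: cell_def)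
    have Start_sets: "Start L \<in> sets P" for L unfolding Start_def by measurable
    have Good_sets: "Good L \<in> sets P" for L unfolding Good_def using Bad_level_sets Start_sets by auto
    have increments: "\<bar>A (pt m (k + 1)) \<omega> - A (pt m k) \<omega>\<bar> \<le> (2 * \<kappa> * real L) * q ^ (p + m)"
      if \<omega>: "\<omega> \<in> Good L" and k: "k \<in> cell m" for \<omega> L m k
    proof -
      have good: "\<bar>A (pt m (k + 1)) \<omega> - A (pt m k) \<omega>\<bar> \<le> 2 * (\<kappa> * real L * q ^ (p + m))"
        if "k \<in> cell m" "\<bar>A (pt m k) \<omega>\<bar> \<le> 2 * real L" for m k
      proof (rule ccontr)
        assume "\<not> ?thesis"
        moreover have "\<omega> \<in> space P" using \<omega> by (simp add: Good_def Start_def)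
        ultimately have "\<omega> \<in> Bad L m k" using that(2) by (simp add: Bad_def not_le)
        moreover have "\<forall>m. \<forall>k\<in>cell m. \<omega> \<notin> Bad L m k" using \<omega> by (simp add: Good_def)
        ultimately show False using that(1) by simp
      qed
      \<comment> \<open>the values stay below \<open>2 * L\<close> because all the increments along a path of refinements add up to at most \<open>L\<close>\<close>
      have bounded: "\<bar>A (pt m k) \<omega>\<bar> \<le> real L * (2 - q ^ m)" if "k \<in> cell m" for m k
        using that
      proof (induction m arbitrary: k)
        case 0
        hence "k = j" by (simp add: cell_def)
        thus ?case using \<omega> by (simp add: Good_def Start_def)
      next
        case (Suc m)
        define k' where "k' = k div 2"
        have k': "k' \<in> cell m" using Suc.prems unfolding cell_def k'_def by auto
        have IH: "\<bar>A (pt (Suc m) (2 * k')) \<omega>\<bar> \<le> real L * (2 - q ^ m)"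
          using Suc.IH[OF k'] by (simp add: pt_def)
        have L2: "real L * (2 - q ^ i) \<le> 2 * real L" for i using q by (simp add: algebra_simps)
        have mono: "real L * (2 - q ^ m) \<le> real L * (2 - q ^ Suc m)"
          using q by (intro mult_left_mono diff_left_mono power_decreasing) auto
        consider "k = 2 * k'" | "k = 2 * k' + 1" unfolding k'_def by linarith
        thus ?case
        proof cases
          case 1
          thus ?thesis using IH mono by simp
        next
          case 2
          have "2 * k' \<in> cell (Suc m)" using k' by (simp add: cell_def)
          from good[OF this] IH L2[of m] have "\<bar>A (pt (Suc m) (2 * k' + 1)) \<omega> - A (pt (Suc m) (2 * k')) \<omega>\<bar> \<le> 2 * (\<kappa> * real L * q ^ (p + Suc m))"
            by linarith
          also have "\<dots> \<le> 2 * (\<kappa> * real L * q ^ m)" using \<kappa> q by (intro mult_left_mono power_decreasing) auto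
          also have "\<dots> = real L * (2 - q ^ Suc m) - real L * (2 - q ^ m)" by (simp add: \<kappa>_def field_simps)
          finally show ?thesis using IH 2 by simp
        qed
      qed
      have "real L * (2 - q ^ m) \<le> 2 * real L" using q by (simp add: algebra_simps)
      hence "\<bar>A (pt m k) \<omega>\<bar> \<le> 2 * real L" using bounded[OF k] by linarith
      from good[OF k this] show ?thesis by simp
    qed
    \<comment> \<open>at level \<open>n\<close> there are \<open>2\<^sup>m\<close> increments, and \<open>1 / q\<^sup>n \<le> 2\<^sup>n\<close>; both factors are absorbed by \<open>exp (- 2 * n)\<close>\<close>
    have level: "measure P (\<Union>k\<in>cell m. Bad L m k) \<le> K * exp (- real L) * (1 / 2) ^ m" if L: "1 \<le> L" for L m
    proof -
      define n where "n = p + m"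
      define l where "l = real L"
      have l: "1 \<le> l" using L by (simp add: l_def)
      have qn: "0 < q ^ n" "q ^ n \<le> 1" "1 / q ^ n \<le> 2 ^ n"
      proof -
        show "0 < q ^ n" "q ^ n \<le> 1" using q by (auto intro: power_le_one)
        have "(1 / 2) ^ n \<le> q ^ n" using q by (intro power_mono) auto
        thus "1 / q ^ n \<le> 2 ^ n" using q by (simp add: power_one_over field_simps)
      qed
      define \<epsilon> where "\<epsilon> = \<kappa> * l * q ^ n"
      have \<epsilon>: "0 < \<epsilon>" "\<epsilon> \<le> 2 * l"
      proof -
        show "0 < \<epsilon>" using \<kappa> l qn by (simp add: \<epsilon>_def)
        have "\<kappa> * l * q ^ n \<le> 1 * l * 1" using \<kappa> l qn by (intro mult_mono) auto
        thus "\<epsilon> \<le> 2 * l" using l by (simp add: \<epsilon>_def)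
      qed
      have Bad: "measure P (Bad L m k) \<le> K * 2 ^ n * exp (- 3 * real n * l\<^sup>2)" for k
      proof -
        have d: "pt m (k + 1) - pt m k = 1 / 2 ^ n" by (simp add: pt_def n_def diff_divide_distrib[symmetric])
        have "(1::real) / 2 ^ n \<le> 1" "(0::real) < 1 / 2 ^ n" by simp_all
        hence st: "pt m k \<noteq> pt m (k + 1)" "\<bar>pt m (k + 1) - pt m k\<bar> \<le> 1" using d by auto
        have "measure P (Bad L m k) \<le> 12 * (2 * l) / \<epsilon> * (C * exp (C * (3 * (2 * l))\<^sup>2) * exp (- (\<epsilon>\<^sup>2 / (16 * \<bar>pt m (k + 1) - pt m k\<bar>))))"
          unfolding Bad_def n_def[symmetric] l_def[symmetric] \<epsilon>_def[symmetric]
          by (rule increment_tail[OF proc G st _ \<epsilon>]) (use l in simp)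
        also have "\<dots> = (24 * l / \<epsilon>) * C * (exp (C * (3 * (2 * l))\<^sup>2) * exp (- (\<epsilon>\<^sup>2 / (16 * (1 / 2 ^ n)))))"
          unfolding d by simp
        also have "\<dots> \<le> (24 * l / \<epsilon>) * C * exp (- 3 * real n * l\<^sup>2)"
        proof (rule mult_left_mono)
          show "exp (C * (3 * (2 * l))\<^sup>2) * exp (- (\<epsilon>\<^sup>2 / (16 * (1 / 2 ^ n)))) \<le> exp (- 3 * real n * l\<^sup>2)"
          proof -
            have "\<epsilon>\<^sup>2 / (16 * (1 / 2 ^ n)) = (\<kappa>\<^sup>2 / 16 * r ^ n) * l\<^sup>2"
              by (simp add: \<epsilon>_def r_def power_mult_distrib power_mult[symmetric] mult.commute[of 2 n])
            moreover have "(36 * C + 3 * real n) * l\<^sup>2 \<le> (\<kappa>\<^sup>2 / 16 * r ^ n) * l\<^sup>2"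
              by (intro mult_right_mono p) (auto simp: n_def)
            moreover have "C * (3 * (2 * l))\<^sup>2 = 36 * C * l\<^sup>2" by (simp add: power2_eq_square)
            ultimately have "C * (3 * (2 * l))\<^sup>2 - \<epsilon>\<^sup>2 / (16 * (1 / 2 ^ n)) \<le> - 3 * real n * l\<^sup>2"
              by (simp add: algebra_simps)
            thus ?thesis unfolding mult_exp_exp by simp
          qed
        qed (use l \<epsilon> C in simp)
        also have "24 * l / \<epsilon> * C = K * (1 / q ^ n)" using l by (simp add: K_def \<epsilon>_def)
        also have "K * (1 / q ^ n) * exp (- 3 * real n * l\<^sup>2) \<le> K * 2 ^ n * exp (- 3 * real n * l\<^sup>2)"
          using K qn by (intro mult_right_mono mult_left_mono) auto
        finally show ?thesis .
      qed
      have "measure P (\<Union>k\<in>cell m. Bad L m k) \<le> (\<Sum>k\<in>cell m. measure P (Bad L m k))"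
        using Bad_sets by (intro measure_UNION_le) (auto simp: cell_def)
      also have "\<dots> \<le> (\<Sum>k\<in>cell m. K * 2 ^ n * exp (- 3 * real n * l\<^sup>2))" by (intro sum_mono Bad)
      also have "\<dots> = 2 ^ m * (K * 2 ^ n * exp (- 3 * real n * l\<^sup>2))"
        by (simp add: cell_def algebra_simps nat_power_eq)
      also have "\<dots> \<le> 2 ^ n * (K * 2 ^ n * exp (- 3 * real n * l\<^sup>2))"
        using K by (intro mult_right_mono power_increasing) (auto simp: n_def)
      also have "\<dots> = K * (2 ^ n * 2 ^ n * exp (- 3 * real n * l\<^sup>2))" by simp
      also have "\<dots> \<le> K * (exp (real n) * exp (real n) * exp (- 2 * real n - l - real m))"
      proof -
        have two: "2 ^ i \<le> exp (real i)" for i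
        proof -
          have "2 ^ i \<le> exp (1::real) ^ i" using exp_ge_add_one_self[of 1] by (intro power_mono) auto
          thus ?thesis by (simp add: exp_of_nat_mult[symmetric])
        qed
        have "l * 1 \<le> l * l" using l by (intro mult_left_mono) auto
        hence ll: "l \<le> l\<^sup>2" by (simp add: power2_eq_square)
        have "real n * 1 \<le> real n * l\<^sup>2" using ll l by (intro mult_left_mono) auto
        moreover have "(real m + 1) * l \<le> real n * l\<^sup>2" using ll l p(1) by (intro mult_mono) (auto simp: n_def)
        moreover have "real m * 1 \<le> real m * l" using l by (intro mult_left_mono) auto
        ultimately have "- 3 * real n * l\<^sup>2 \<le> - 2 * real n - l - real m" by (simp add: algebra_simps)
        thus ?thesis using K by (intro mult_left_mono mult_mono two) auto
      qed
      also have "\<dots> = K * (exp (- l) * exp (- real m))" unfolding mult_exp_exp by simp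
      also have "exp (- real m) \<le> (1 / 2) ^ m"
      proof -
        have "2 ^ m \<le> exp (1::real) ^ m" using exp_ge_add_one_self[of 1] by (intro power_mono) auto
        thus ?thesis by (simp add: exp_of_nat_mult[symmetric] exp_minus power_one_over field_simps)
      qed
      finally show ?thesis using K by (simp add: l_def mult_left_mono mult.assoc)
    qed
    have Good_prob: "measure P (Start L) - 2 * K * exp (- real L) \<le> measure P (\<Union>L. Good (Suc L))" if L: "1 \<le> L" for L
    proof -
      have geo: "summable (\<lambda>m. K * exp (- real L) * (1 / 2) ^ m)" "(\<Sum>m. K * exp (- real L) * (1 / 2) ^ m) = 2 * K * exp (- real L)"
        using suminf_geometric[of "1 / 2 :: real"] by (auto simp: suminf_mult)
      have sm: "summable (\<lambda>m. measure P (\<Union>k\<in>cell m. Bad L m k))"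
        by (rule summable_comparison_test[OF _ geo(1)]) (use level[OF L] in auto)
      have "measure P (\<Union>m. \<Union>k\<in>cell m. Bad L m k) \<le> (\<Sum>m. measure P (\<Union>k\<in>cell m. Bad L m k))"
        using Bad_level_sets by (intro P.finite_measure_subadditive_countably sm) auto
      also have "\<dots> \<le> 2 * K * exp (- real L)" unfolding geo(2)[symmetric] by (intro suminf_le sm geo level L)
      finally have bad: "measure P (\<Union>m. \<Union>k\<in>cell m. Bad L m k) \<le> 2 * K * exp (- real L)" .
      have "Start L \<subseteq> Good L \<union> (\<Union>m. \<Union>k\<in>cell m. Bad L m k)" by (auto simp: Good_def)
      hence "measure P (Start L) \<le> measure P (Good L \<union> (\<Union>m. \<Union>k\<in>cell m. Bad L m k))"
        using Good_sets Bad_level_sets by (intro P.finite_measure_mono) auto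
      also have "\<dots> \<le> measure P (Good L) + measure P (\<Union>m. \<Union>k\<in>cell m. Bad L m k)"
        using Good_sets Bad_level_sets by (intro measure_Un_le) auto
      finally have "measure P (Start L) - 2 * K * exp (- real L) \<le> measure P (Good L)" using bad by simp
      also have "\<dots> \<le> measure P (\<Union>L. Good (Suc L))"
      proof (rule P.finite_measure_mono)
        show "Good L \<subseteq> (\<Union>L. Good (Suc L))" using L by (cases L) auto
        show "(\<Union>L. Good (Suc L)) \<in> sets P" using Good_sets by auto
      qed
      finally show ?thesis .
    qed
    have "(\<lambda>L. measure P (Start L)) \<longlonglongrightarrow> measure P (\<Union>L. Start L)"
      using Start_sets by (intro P.finite_Lim_measure_incseq incseq_SucI) (auto simp: Start_def)
    moreover have "(\<Union>L. Start L) = space P" using real_arch_simple by (auto simp: Start_def)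
    ultimately have lim1: "(\<lambda>L. measure P (Start L)) \<longlonglongrightarrow> 1" by (simp add: P.prob_space)
    have "(\<lambda>L. 2 * K * exp (- real L)) \<longlonglongrightarrow> 0" by real_asymp
    from tendsto_diff[OF lim1 this] have "(\<lambda>L. measure P (Start L) - 2 * K * exp (- real L)) \<longlonglongrightarrow> 1" by simp
    hence "1 \<le> measure P (\<Union>L. Good (Suc L))" by (rule LIMSEQ_le_const2) (use Good_prob in blast)
    hence "measure P (\<Union>L. Good (Suc L)) = 1" using P.prob_le_1[of "\<Union>L. Good (Suc L)"] by linarith
    hence "AE \<omega> in P. \<omega> \<in> (\<Union>L. Good (Suc L))" by (rule P.AE_prob_1)
    thus ?thesis
    proof (rule AE_mp, intro AE_I2 impI)
      fix \<omega> assume "\<omega> \<in> (\<Union>L. Good (Suc L))"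
      then obtain L where "\<omega> \<in> Good (Suc L)" by blast
      from increments[OF this]
      show "\<exists>c. \<forall>m. \<forall>k::int. j * 2 ^ m \<le> k \<and> k < (j + 1) * 2 ^ m \<longrightarrow> \<bar>A (pt m (k + 1)) \<omega> - A (pt m k) \<omega>\<bar> \<le> c * q ^ (p + m)"
        by (intro exI[of _ "2 * \<kappa> * real (Suc L)"]) (auto simp: cell_def)
    qed
  qed
  thus thesis by (intro that[of p]) (simp add: pt_def q_def)
qed

lemma AE_dyadic_Hoelder:
  assumes proc: "real_process P A" and G: "gaussian_crossings P A C" "1 \<le> C" and \<gamma>: "0 < \<gamma>" "\<gamma> < 1 / 2"
  shows "AE \<omega> in P. dyadic_Hoelder \<gamma> (\<lambda>t. A t \<omega>)"
proof -
  obtain p :: nat where p: "\<And>j::int. AE \<omega> in P. \<exists>c. \<forall>m. \<forall>k::int. j * 2 ^ m \<le> k \<and> k < (j + 1) * 2 ^ m \<longrightarrow>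
      \<bar>A (real_of_int (k + 1) / 2 ^ (p + m)) \<omega> - A (real_of_int k / 2 ^ (p + m)) \<omega>\<bar> \<le> c * (2 powr - \<gamma>) ^ (p + m)"
    by (rule dyadic_cell_increments[OF proc G \<gamma>]) blast
  hence "AE \<omega> in P. \<forall>j::int. \<exists>c. \<forall>m. \<forall>k::int. j * 2 ^ m \<le> k \<and> k < (j + 1) * 2 ^ m \<longrightarrow>
      \<bar>A (real_of_int (k + 1) / 2 ^ (p + m)) \<omega> - A (real_of_int k / 2 ^ (p + m)) \<omega>\<bar> \<le> c * (2 powr - \<gamma>) ^ (p + m)"
    by (simp add: AE_all_countable)
  thus ?thesis
  proof (rule AE_mp, intro AE_I2 impI)
    fix \<omega> assume "\<forall>j::int. \<exists>c. \<forall>m. \<forall>k::int. j * 2 ^ m \<le> k \<and> k < (j + 1) * 2 ^ m \<longrightarrow>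
      \<bar>A (real_of_int (k + 1) / 2 ^ (p + m)) \<omega> - A (real_of_int k / 2 ^ (p + m)) \<omega>\<bar> \<le> c * (2 powr - \<gamma>) ^ (p + m)"
    from choice[OF this] obtain c where c: "\<And>j m k. j * 2 ^ m \<le> k \<Longrightarrow> k < (j + 1) * 2 ^ m \<Longrightarrow>
      \<bar>A (real_of_int (k + 1) / 2 ^ (p + m)) \<omega> - A (real_of_int k / 2 ^ (p + m)) \<omega>\<bar> \<le> c j * (2 powr - \<gamma>) ^ (p + m)" by auto
    show "dyadic_Hoelder \<gamma> (\<lambda>t. A t \<omega>)"
      unfolding dyadic_Hoelder_def
    proof
      fix N :: nat
      define J where "J = {- (int N * 2 ^ p)..int N * 2 ^ p}"
      have "\<bar>A (real_of_int (k + 1) / 2 ^ n) \<omega> - A (real_of_int k / 2 ^ n) \<omega>\<bar> \<le> (\<Sum>j\<in>J. \<bar>c j\<bar>) * (2 powr - \<gamma>) ^ n"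
        if n: "p \<le> n" and k: "real_of_int \<bar>k\<bar> \<le> real N * 2 ^ n" for n k
      proof -
        define m where "m = n - p"
        have nm: "n = p + m" using n by (simp add: m_def)
        define j where "j = k div 2 ^ m"
        have jk: "j * 2 ^ m \<le> k" "k < (j + 1) * 2 ^ m"
        proof -
          have "k = j * 2 ^ m + k mod 2 ^ m" unfolding j_def by (rule div_mult_mod_eq[symmetric])
          moreover have "0 \<le> k mod 2 ^ m" "k mod 2 ^ m < 2 ^ m" by simp_all
          moreover have "(j + 1) * 2 ^ m = j * 2 ^ m + 2 ^ m" by (simp add: distrib_right)
          ultimately show "j * 2 ^ m \<le> k" "k < (j + 1) * 2 ^ m" by linarith+
        qed
        have "real_of_int \<bar>k\<bar> \<le> real_of_int (int N * 2 ^ p * 2 ^ m)" using k by (simp add: nm power_add)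
        hence k': "\<bar>k\<bar> \<le> int N * 2 ^ p * 2 ^ m" by linarith
        have "j \<in> J"
        proof -
          have "j \<le> (int N * 2 ^ p * 2 ^ m) div 2 ^ m" unfolding j_def using k' by (intro zdiv_mono1) auto
          moreover have "(- (int N * 2 ^ p) * 2 ^ m) div 2 ^ m \<le> j" unfolding j_def using k' by (intro zdiv_mono1) auto
          moreover have "(- (int N * 2 ^ p) * 2 ^ m) div 2 ^ m = - (int N * 2 ^ p)" by (rule nonzero_mult_div_cancel_right) simp
          ultimately show ?thesis by (simp add: J_def)
        qed
        hence "c j \<le> (\<Sum>j\<in>J. \<bar>c j\<bar>)" using member_le_sum[of j J "\<lambda>j. \<bar>c j\<bar>"] by (simp add: J_def abs_le_iff)
        hence "c j * (2 powr - \<gamma>) ^ n \<le> (\<Sum>j\<in>J. \<bar>c j\<bar>) * (2 powr - \<gamma>) ^ n" by (intro mult_right_mono) auto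
        thus ?thesis using c[OF jk] unfolding nm by linarith
      qed
      thus "\<exists>c p. \<forall>n\<ge>p. \<forall>k::int. real_of_int \<bar>k\<bar> \<le> real N * 2 ^ n \<longrightarrow>
        \<bar>A (real_of_int (k + 1) / 2 ^ n) \<omega> - A (real_of_int k / 2 ^ n) \<omega>\<bar> \<le> c * (2 powr - \<gamma>) ^ n" by blast
    qed
  qed
qed

text \<open>For a fixed time, the increments to the left dyadic neighbours have summable tails, and Borel-Cantelli applies.\<close>

lemma AE_dyadic_limit:
  assumes proc: "real_process P A" and G: "gaussian_crossings P A C" "1 \<le> C"
  shows "AE \<omega> in P. (\<lambda>n. A (dyadic_floor n t) \<omega>) \<longlonglongrightarrow> A t \<omega>"
proof -
  interpret P: prob_space P using proc by (simp add: real_process_def)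
  have [measurable]: "A r \<in> borel_measurable P" for r using proc by (simp add: real_process_def)
  have "AE \<omega> in P. eventually (\<lambda>n. \<bar>A t \<omega>\<bar> \<le> real (Suc L) \<longrightarrow> \<bar>A (dyadic_floor n t) \<omega> - A t \<omega>\<bar> \<le> 2 * (1 / real (Suc i))) sequentially" for L i
  proof -
    define \<epsilon> where "\<epsilon> = 1 / real (Suc i)"
    define l where "l = real (Suc L)"
    have \<epsilon>: "0 < \<epsilon>" "\<epsilon> \<le> l" and l: "1 \<le> l"
    proof -
      show "0 < \<epsilon>" "1 \<le> l" by (auto simp: \<epsilon>_def l_def)
      have "\<epsilon> \<le> 1" by (simp add: \<epsilon>_def)
      thus "\<epsilon> \<le> l" by (simp add: l_def)
    qed
    define E where "E = (\<lambda>n. {\<omega> \<in> space P. \<bar>A t \<omega>\<bar> \<le> l \<and> 2 * \<epsilon> < \<bar>A (dyadic_floor n t) \<omega> - A t \<omega>\<bar>})"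
    define Q where "Q = 12 * l / \<epsilon> * (C * exp (C * (3 * l)\<^sup>2))"
    have Q: "0 \<le> Q" using l \<epsilon> G(2) by (simp add: Q_def)
    have E_le: "measure P (E n) \<le> Q * exp (- (\<epsilon>\<^sup>2 / 16)) ^ n" for n
    proof (cases "dyadic_floor n t = t")
      case True
      hence "E n = {}" using \<epsilon> by (auto simp: E_def)
      thus ?thesis using Q by simp
    next
      case False
      define d where "d = \<bar>dyadic_floor n t - t\<bar>"
      have d: "0 < d" "d \<le> 1 / 2 ^ n" using False dyadic_floor_bounds(1)[of n t] dyadic_floor_bounds(2)[of t n] by (auto simp: d_def)
      have "(1::real) / 2 ^ n \<le> 1" by simp
      hence d1: "d \<le> 1" using d by linarith
      have "measure P (E n) \<le> 12 * l / \<epsilon> * (C * exp (C * (3 * l)\<^sup>2) * exp (- (\<epsilon>\<^sup>2 / (16 * \<bar>dyadic_floor n t - t\<bar>))))"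
        unfolding E_def by (rule increment_tail[OF proc G(1) _ _ l \<epsilon>]) (use False d1 in \<open>auto simp: d_def\<close>)
      also have "\<dots> = Q * exp (- (\<epsilon>\<^sup>2 / (16 * d)))" by (simp add: Q_def d_def)
      also have "\<dots> \<le> Q * exp (- (\<epsilon>\<^sup>2 / 16 * real n))"
      proof -
        have "real n \<le> 2 ^ n" using of_nat_less_two_power[of n] by (simp add: less_imp_le)
        also have "\<dots> \<le> 1 / d" using d by (simp add: field_simps)
        finally have "\<epsilon>\<^sup>2 / 16 * real n \<le> \<epsilon>\<^sup>2 / 16 * (1 / d)" by (intro mult_left_mono) auto
        thus ?thesis using Q by (intro mult_left_mono) auto
      qed
      also have "exp (- (\<epsilon>\<^sup>2 / 16 * real n)) = exp (- (\<epsilon>\<^sup>2 / 16)) ^ n" by (simp add: exp_of_nat_mult[symmetric] mult.commute)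
      finally show ?thesis .
    qed
    have "summable (\<lambda>n. Q * exp (- (\<epsilon>\<^sup>2 / 16)) ^ n)" using \<epsilon> by (intro summable_mult summable_geometric) simp
    hence "summable (\<lambda>n. measure P (E n))" by (rule summable_comparison_test[rotated]) (use E_le in auto)
    moreover have "E n \<in> sets P" for n unfolding E_def by measurable
    ultimately have "AE \<omega> in P. eventually (\<lambda>n. \<omega> \<in> space P - E n) sequentially"
      by (intro borel_cantelli_AE1) (auto simp: P.emeasure_eq_measure)
    thus ?thesis
    proof (rule AE_mp, intro AE_I2 impI)
      fix \<omega> assume \<omega>: "\<omega> \<in> space P" and ev: "eventually (\<lambda>n. \<omega> \<in> space P - E n) sequentially"
      from ev show "eventually (\<lambda>n. \<bar>A t \<omega>\<bar> \<le> real (Suc L) \<longrightarrow> \<bar>A (dyadic_floor n t) \<omega> - A t \<omega>\<bar> \<le> 2 * (1 / real (Suc i))) sequentially"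
        by eventually_elim (auto simp: E_def \<epsilon>_def l_def)
    qed
  qed
  hence "AE \<omega> in P. \<forall>L i. eventually (\<lambda>n. \<bar>A t \<omega>\<bar> \<le> real (Suc L) \<longrightarrow> \<bar>A (dyadic_floor n t) \<omega> - A t \<omega>\<bar> \<le> 2 * (1 / real (Suc i))) sequentially"
    unfolding AE_all_countable by blast
  thus ?thesis
  proof (rule AE_mp, intro AE_I2 impI)
    fix \<omega> assume ev: "\<forall>L i. eventually (\<lambda>n. \<bar>A t \<omega>\<bar> \<le> real (Suc L) \<longrightarrow> \<bar>A (dyadic_floor n t) \<omega> - A t \<omega>\<bar> \<le> 2 * (1 / real (Suc i))) sequentially"
    show "(\<lambda>n. A (dyadic_floor n t) \<omega>) \<longlonglongrightarrow> A t \<omega>"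
    proof (rule tendstoI)
      fix e :: real assume "0 < e"
      hence "0 < e / 2" by simp
      then obtain i where i: "1 / real (Suc i) < e / 2" using reals_Archimedean[of "e / 2"] by (auto simp: inverse_eq_divide)
      obtain L where L: "\<bar>A t \<omega>\<bar> \<le> real L" using real_arch_simple[of "\<bar>A t \<omega>\<bar>"] by blast
      from ev[rule_format, of L i] show "eventually (\<lambda>n. dist (A (dyadic_floor n t) \<omega>) (A t \<omega>) < e) sequentially"
      proof eventually_elim
        case (elim n)
        have "\<bar>A t \<omega>\<bar> \<le> real (Suc L)" using L by simp
        hence "\<bar>A (dyadic_floor n t) \<omega> - A t \<omega>\<bar> \<le> 2 * (1 / real (Suc i))" using elim by blast
        thus ?case using i unfolding dist_real_def by linarith
      qed
    qed
  qed
qed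

text \<open>The exponents \<open>1 / 2 - 1 / (i + 3)\<close> form a countable family which is positive and exhausts the exponents below \<open>1 / 2\<close>. One
null set serves all of them; on it the version is set to zero.\<close>

lemma Hoelder_version:
  assumes proc: "real_process P A" and G: "gaussian_crossings P A C"
  shows "\<exists>B. is_version P A B \<and> (\<forall>\<omega>\<in>space P. \<forall>\<delta>>0. locally_Hoelder (1 / 2 - \<delta>) (\<lambda>t. B t \<omega>))"
proof -
  interpret P: prob_space P using proc by (simp add: real_process_def)
  have [measurable]: "A r \<in> borel_measurable P" for r using proc by (simp add: real_process_def)
  define C' where "C' = max C 1"
  have C': "1 \<le> C'" by (simp add: C'_def)
  have G': "gaussian_crossings P A C'"
    unfolding gaussian_crossings_def
  proof (intro allI impI)
    fix s t L x y :: real assume a: "s \<noteq> t \<and> \<bar>t - s\<bar> \<le> 1 \<and> 1 \<le> L \<and> - L \<le> x \<and> x < y"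
    have "\<P>(\<omega> in P. A s \<omega> \<le> x \<and> y < A t \<omega>) \<le> C * exp (C * L\<^sup>2) * exp (- ((y - x)\<^sup>2 / (16 * \<bar>t - s\<bar>)))"
      using G a unfolding gaussian_crossings_def by simp
    also have "\<dots> \<le> C' * exp (C' * L\<^sup>2) * exp (- ((y - x)\<^sup>2 / (16 * \<bar>t - s\<bar>)))"
      using C' by (intro mult_right_mono mult_mono) (auto simp: C'_def intro!: mult_right_mono)
    finally show "\<P>(\<omega> in P. A s \<omega> \<le> x \<and> y < A t \<omega>) \<le> C' * exp (C' * L\<^sup>2) * exp (- ((y - x)\<^sup>2 / (16 * \<bar>t - s\<bar>)))" .
  qed
  define \<gamma> where "\<gamma> = (\<lambda>i::nat. 1 / 2 - 1 / (real i + 3))"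
  have \<gamma>: "0 < \<gamma> i" "\<gamma> i < 1 / 2" for i by (auto simp: \<gamma>_def field_simps)
  have "AE \<omega> in P. \<forall>i. dyadic_Hoelder (\<gamma> i) (\<lambda>t. A t \<omega>)"
    by (simp add: AE_all_countable AE_dyadic_Hoelder[OF proc G' C' \<gamma>])
  then obtain N where N: "{\<omega> \<in> space P. \<not> (\<forall>i. dyadic_Hoelder (\<gamma> i) (\<lambda>t. A t \<omega>))} \<subseteq> N" "emeasure P N = 0" "N \<in> sets P"
    by (rule AE_E)
  define B where "B = (\<lambda>t \<omega>. if \<omega> \<in> N then 0 else lim (\<lambda>n. A (dyadic_floor n t) \<omega>))"
  have [measurable]: "N \<in> sets P" by (rule N(3))
  have B_meas: "B t \<in> borel_measurable P" for t unfolding B_def by measurable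
  have "AE \<omega> in P. B t \<omega> = A t \<omega>" for t
  proof -
    have "AE \<omega> in P. \<omega> \<notin> N" using N by (intro AE_not_in) (auto simp: null_sets_def)
    with AE_dyadic_limit[OF proc G' C', of t] show ?thesis by eventually_elim (auto simp: B_def limI)
  qed
  hence "is_version P A B" using proc B_meas by (simp add: is_version_def real_process_def)
  moreover have "locally_Hoelder (1 / 2 - \<delta>) (\<lambda>t. B t \<omega>)" if \<omega>: "\<omega> \<in> space P" and \<delta>: "0 < \<delta>" for \<omega> \<delta>
  proof (cases "\<omega> \<in> N")
    case True
    thus ?thesis by (auto simp: B_def locally_Hoelder_def intro!: exI[of _ 0])
  next
    case False
    obtain i where "1 / \<delta> \<le> real i" using real_arch_simple[of "1 / \<delta>"] by blast
    hence "1 / \<delta> \<le> real i + 3" by simp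
    hence "1 / (real i + 3) \<le> \<delta>" using \<delta> by (simp add: field_simps)
    hence le: "1 / 2 - \<delta> \<le> \<gamma> i" by (simp add: \<gamma>_def)
    have "dyadic_Hoelder (\<gamma> i) (\<lambda>t. A t \<omega>)" using N(1) False \<omega> by blast
    from dyadic_extension(2)[OF this \<gamma>(1)] have "locally_Hoelder (\<gamma> i) (\<lambda>t. B t \<omega>)" using False by (simp add: B_def)
    thus ?thesis using le by (rule locally_Hoelder_mono)
  qed
  ultimately show ?thesis by blast
qed

theorem theorem2:
  fixes M :: "'a measure" and A :: "real \<Rightarrow> 'a \<Rightarrow> real"
  shows
    "(airy1_process M A \<longrightarrow>
       (\<exists>B. is_version M A B \<and>
          (\<forall>\<omega>\<in>space M. \<forall>\<delta>>0. locally_Hoelder (1 / 2 - \<delta>) (\<lambda>t. B t \<omega>)))) \<and>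
     (airy2_process M A \<longrightarrow>
       (\<exists>B. is_version M A B \<and>
          (\<forall>\<omega>\<in>space M. \<forall>\<delta>>0. locally_Hoelder (1 / 2 - \<delta>) (\<lambda>t. B t \<omega>))))"
proof (intro conjI impI)
  assume "airy1_process M A"
  moreover from this obtain C where "gaussian_crossings M A C" by (rule airy1_crossings)
  ultimately show "\<exists>B. is_version M A B \<and> (\<forall>\<omega>\<in>space M. \<forall>\<delta>>0. locally_Hoelder (1 / 2 - \<delta>) (\<lambda>t. B t \<omega>))"
    by (intro Hoelder_version) (auto simp: airy1_process_def)
next
  assume "airy2_process M A"
  moreover from this obtain C where "gaussian_crossings M A C" by (rule airy2_crossings)
  ultimately show "\<exists>B. is_version M A B \<and> (\<forall>\<omega>\<in>space M. \<forall>\<delta>>0. locally_Hoelder (1 / 2 - \<delta>) (\<lambda>t. B t \<omega>))"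
    by (intro Hoelder_version) (auto simp: airy2_process_def)
qed

end
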